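(* Let $d\ge 2$ and let $\mathcal S$ be a finite set of segments in $\mathbb{R}^d$. Let $G=G(\mathcal S)$ be the disjointness graph of $\mathcal S$. Then $$\chi(G)\le(\omega(G))^4+(\omega(G))^3.$$ Moreover, there is a polynomial time algorithm that, given the segments of $\mathcal S$, finds a complete subgraph $K\subseteq G$ and a proper coloring of $G$ with at most $|V(K)|^4+|V(K)|^3$ colors.
   Context: The disjointness graph of a family of sets is the graph whose vertices are the members of the family, two vertices being adjacent if and only if the corresponding sets are disjoint. $\chi(G)$ denotes the chromatic number and $\omega(G)$ the clique number of a graph $G$. *)

theory Defs
  imports
    "HOL-Analysis.Abstract_Euclidean_Space"
    "HOL-Computational_Algebra.Polynomial"
    "Graph_Theory.Kuratowski"
begin

section \<open>Segments in Euclidean space\<close>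

text \<open>
  The dimension is quantified inside the statement, so points are elements of
  \<^term>\<open>topspace (Euclidean_space d)\<close>: functions \<^typ>\<open>nat \<Rightarrow> real\<close> that vanish from
  index \<open>d\<close> on. Segments are closed and nondegenerate.
\<close>

definition segment :: "(nat \<Rightarrow> real) \<times> (nat \<Rightarrow> real) \<Rightarrow> (nat \<Rightarrow> real) set" where
  "segment = (\<lambda>(a, b). {(\<lambda>j. (1 - u) * a j + u * b j) | u. 0 \<le> u \<and> u \<le> 1})"

definition endpoint_pairs :: "nat \<Rightarrow> ((nat \<Rightarrow> real) \<times> (nat \<Rightarrow> real)) set" where
  "endpoint_pairs d =
     {(a, b). a \<in> topspace (Euclidean_space d) \<and> b \<in> topspace (Euclidean_space d) \<and> a \<noteq> b}"

definition segments :: "nat \<Rightarrow> (nat \<Rightarrow> real) set set" where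
  "segments d = segment ` endpoint_pairs d"


section \<open>Graphs\<close>

text \<open>
  As in the Graph_Theory library, an undirected graph is a symmetric digraph. The condition
  \<open>s \<noteq> t\<close> only matters for the empty set, which would otherwise get a loop.
\<close>

definition disjointness_graph :: "'a set set \<Rightarrow> ('a set, 'a set \<times> 'a set) pre_digraph" where
  "disjointness_graph S =
     with_proj \<lparr> pverts = S, parcs = {(s, t). s \<in> S \<and> t \<in> S \<and> s \<noteq> t \<and> s \<inter> t = {}} \<rparr>"

text \<open>\<^term>\<open>complete_digraph k K\<close> says that \<open>K\<close> is a complete graph on \<open>k\<close> vertices.\<close>

definition clique_number :: "('a, 'b) pre_digraph \<Rightarrow> nat" where
  "clique_number G = Max {k. \<exists>K. subgraph K G \<and> complete_digraph k K}"

definition proper_coloring :: "('a, 'b) pre_digraph \<Rightarrow> ('a \<Rightarrow> nat) \<Rightarrow> bool" where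
  "proper_coloring G c \<longleftrightarrow> (\<forall>(u, v) \<in> arcs_ends G. c u \<noteq> c v)"

definition chromatic_number :: "('a, 'b) pre_digraph \<Rightarrow> nat" where
  "chromatic_number G = (LEAST k. \<exists>c. proper_coloring G c \<and> c ` verts G \<subseteq> {..<k})"


section \<open>Real random access machines\<close>

text \<open>
  Since the input consists of arbitrary real coordinates, algorithms are programs of a real RAM
  with unit costs, the standard model of computational geometry. Its memory consists of
  named arrays of natural numbers and of real numbers with indirect addressing; cell 0 of an array
  serves as a scalar variable. A program mentions only finitely many arrays, so named arrays
  are merely interleaved portions of the memory of a conventional RAM.

  The operations are kept weak enough for unit costs to be reasonable: natural numbers
  (the addresses) can only be added, subtracted (truncated at 0) and compared; real numbers admit
  the field operations and comparisons, but there is no rounding and no conversion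
  between the two sorts. The only real constants are integers, so that no information can be
  hidden in a constant.

  Every assignment and every evaluation of a test costs one step. As expressions have a
  size fixed by the program, charging for their individual operations would change
  running times by a constant factor only.
\<close>

type_synonym vname = string

record state =
  nats :: "vname \<Rightarrow> nat \<Rightarrow> nat"
  reals :: "vname \<Rightarrow> nat \<Rightarrow> real"

datatype nexp =
    NConst nat
  | NCell vname nexp
  | NPlus nexp nexp
  | NMinus nexp nexp

datatype rexp =
    RConst int
  | RCell vname nexp
  | RPlus rexp rexp
  | RMinus rexp rexp
  | RTimes rexp rexp
  | RDivide rexp rexp

datatype bexp =
    NLess nexp nexp
  | RLess rexp rexp
  | BNot bexp
  | BAnd bexp bexp

datatype com =
    Skip
  | NAssign vname nexp nexp
  | RAssign vname nexp rexp
  | Seq com com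
  | Cond bexp com com
  | While bexp com

primrec nval :: "nexp \<Rightarrow> state \<Rightarrow> nat" where
  "nval (NConst k) s = k"
| "nval (NCell x e) s = nats s x (nval e s)"
| "nval (NPlus e f) s = nval e s + nval f s"
| "nval (NMinus e f) s = nval e s - nval f s"

text \<open>Division by 0 yields 0, as usual in HOL; a program can avoid it by a test.\<close>

primrec rval :: "rexp \<Rightarrow> state \<Rightarrow> real" where
  "rval (RConst k) s = of_int k"
| "rval (RCell x e) s = reals s x (nval e s)"
| "rval (RPlus e f) s = rval e s + rval f s"
| "rval (RMinus e f) s = rval e s - rval f s"
| "rval (RTimes e f) s = rval e s * rval f s"
| "rval (RDivide e f) s = rval e s / rval f s"

primrec bval :: "bexp \<Rightarrow> state \<Rightarrow> bool" where
  "bval (NLess e f) s \<longleftrightarrow> nval e s < nval f s"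
| "bval (RLess e f) s \<longleftrightarrow> rval e s < rval f s"
| "bval (BNot b) s \<longleftrightarrow> \<not> bval b s"
| "bval (BAnd b c) s \<longleftrightarrow> bval b s \<and> bval c s"

definition nupdate :: "vname \<Rightarrow> nat \<Rightarrow> nat \<Rightarrow> state \<Rightarrow> state" where
  "nupdate x i v s = s\<lparr>nats := (nats s)(x := (nats s x)(i := v))\<rparr>"

definition rupdate :: "vname \<Rightarrow> nat \<Rightarrow> real \<Rightarrow> state \<Rightarrow> state" where
  "rupdate x i v s = s\<lparr>reals := (reals s)(x := (reals s x)(i := v))\<rparr>"

text \<open>
  \<open>exec c s t s'\<close>: started in state \<open>s\<close>, the program \<open>c\<close> terminates in state \<open>s'\<close> after
  exactly \<open>t\<close> steps.
\<close>

inductive exec :: "com \<Rightarrow> state \<Rightarrow> nat \<Rightarrow> state \<Rightarrow> bool" where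
  Skip: "exec Skip s 1 s"
| NAssign: "exec (NAssign x e f) s 1 (nupdate x (nval e s) (nval f s) s)"
| RAssign: "exec (RAssign x e f) s 1 (rupdate x (nval e s) (rval f s) s)"
| Seq: "exec c1 s1 t1 s2 \<Longrightarrow> exec c2 s2 t2 s3 \<Longrightarrow> exec (Seq c1 c2) s1 (t1 + t2) s3"
| CondTrue: "bval b s \<Longrightarrow> exec c1 s t s' \<Longrightarrow> exec (Cond b c1 c2) s (Suc t) s'"
| CondFalse: "\<not> bval b s \<Longrightarrow> exec c2 s t s' \<Longrightarrow> exec (Cond b c1 c2) s (Suc t) s'"
| WhileFalse: "\<not> bval b s \<Longrightarrow> exec (While b c) s 1 s"
| WhileTrue: "bval b s1 \<Longrightarrow> exec c s1 t1 s2 \<Longrightarrow> exec (While b c) s2 t2 s3 \<Longrightarrow>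
    exec (While b c) s1 (Suc (t1 + t2)) s3"


section \<open>Input and output of the algorithm\<close>

type_synonym segment_list = "((nat \<Rightarrow> real) \<times> (nat \<Rightarrow> real)) list"

text \<open>\<open>ps\<close> lists every segment of \<open>S\<close> exactly once, by a pair of endpoints in either order.\<close>

definition lists_segments :: "nat \<Rightarrow> (nat \<Rightarrow> real) set set \<Rightarrow> segment_list \<Rightarrow> bool" where
  "lists_segments d S ps \<longleftrightarrow>
     set ps \<subseteq> endpoint_pairs d \<and> distinct (map segment ps) \<and> set (map segment ps) = S"

text \<open>
  Arrays \<open>A\<close> and \<open>B\<close> hold the coordinates of the first and second endpoints: coordinate \<open>j\<close> of
  the \<open>i\<close>-th endpoint is in cell \<open>i * d + j\<close>. All memory not used by the input is 0.
\<close>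

definition input_state :: "nat \<Rightarrow> segment_list \<Rightarrow> state" where
  "input_state d ps = \<lparr>
     nats = (\<lambda>x k. if k = 0 \<and> x = ''n'' then length ps
                   else if k = 0 \<and> x = ''d'' then d else 0),
     reals = (\<lambda>x k. if k < length ps * d \<and> x = ''A'' then fst (ps ! (k div d)) (k mod d)
                    else if k < length ps * d \<and> x = ''B'' then snd (ps ! (k div d)) (k mod d)
                    else 0) \<rparr>"

text \<open>The number of real numbers in the input.\<close>

definition input_size :: "nat \<Rightarrow> segment_list \<Rightarrow> nat" where
  "input_size d ps = 2 * length ps * d"

text \<open>
  The program answers by marking the vertices of the complete subgraph with nonzero
  entries in array \<open>K\<close> and writing the colors to array \<open>C\<close>.
\<close>

definition output_clique ::
    "segment_list \<Rightarrow> state \<Rightarrow> ((nat \<Rightarrow> real) set, 'b) pre_digraph \<Rightarrow> bool" where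
  "output_clique ps s K \<longleftrightarrow>
     verts K = {segment (ps ! i) | i. i < length ps \<and> nats s ''K'' i \<noteq> 0}"

definition output_coloring :: "segment_list \<Rightarrow> state \<Rightarrow> ((nat \<Rightarrow> real) set \<Rightarrow> nat) \<Rightarrow> bool" where
  "output_coloring ps s c \<longleftrightarrow> (\<forall>i < length ps. c (segment (ps ! i)) = nats s ''C'' i)"

end

(* A clique C that cannot be enlarged by exchanging at most one member for two disjoint segments is met by
   every segment. Segments meeting exactly one member of C form a class per member. Two disjoint members of C
   spanning no common plane, met by t, leave only parameters on them: a maximal clique M among the
   segments meeting both has a member sharing the parameter of t on one of the two, and equal parameters force
   an intersection. All other segments lie in the plane of two members of C. In a plane either all segments of a
   class pass through the point where another clique member crosses the plane, or four partial orders, whose chains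
   are cliques, compare any two disjoint segments; the heights in these orders color the class. The longest
   chains of all planes together form a clique D, because segments touching the earlier part of D were
   colored before. The largest of C, D and the sets M pays for all colors, and every step is a bounded loop over
   indices, evaluated on inner products of the endpoints only. *)

theory Submission
  imports Defs "HOL-Analysis.Analysis"
begin

text \<open>The inequality for the chromatic number is read off from the output of the algorithm, so
  only the program is analysed. Let \<open>k\<close> be the size of the clique returned. The private
  classes and at most \<open>2 * k\<close> labels for each of at most k(k-1)/2 pairs from
  \<open>C\<close> amount to at most \<open>k ^ 3\<close>: a non-coplanar pair spends two labels on
  each element of its \<open>M\<close>, one for each side, and a coplanar pair spends one on each
  crossing member of \<open>C\<close> or \<open>D\<close>. The term \<open>k ^ 4\<close> counts
  quadruples of heights: the chains of different planes are disjoint parts of \<open>D\<close>, so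
  the fourth powers of their lengths sum to at most the fourth power of its size. The obstacle to a
  program is that the dimension is part of the input while expressions have a fixed size. The inner
  products of all endpoints are tabulated once; afterwards every geometric test is one expression in
  table entries, and its correctness is proved in an abstract inner product space. A sweep inside a
  plane would need a generic direction; the lexicographic order of two coordinates replaces it, and
  the shear that justifies this occurs in the proof only.\<close>

section \<open>Four partial orders on segments in the plane\<close>

definition lexle :: "('p \<Rightarrow> real) \<Rightarrow> ('p \<Rightarrow> real) \<Rightarrow> 'p \<Rightarrow> 'p \<Rightarrow> bool" where
  "lexle X Y e f \<longleftrightarrow> X e < X f \<or> (X e = X f \<and> Y e \<le> Y f)"

text \<open>Twice the signed area of the triangle \<open>a b z\<close>. Adding a multiple of
  \<open>Y\<close> to \<open>X\<close> does not change it, so tests built on it mean the same before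
  and after shearing.\<close>

definition orient :: "('p \<Rightarrow> real) \<Rightarrow> ('p \<Rightarrow> real) \<Rightarrow> 'p \<Rightarrow> 'p \<Rightarrow> 'p \<Rightarrow> real" where
  "orient X Y a b z = (X b - X a) * (Y z - Y a) - (Y b - Y a) * (X z - X a)"

definition above :: "('p \<Rightarrow> real) \<Rightarrow> ('p \<Rightarrow> real) \<Rightarrow> 'p \<Rightarrow> 'p \<Rightarrow> 'p \<Rightarrow> bool" where
  "above X Y a b z \<longleftrightarrow> (if lexle X Y b a then orient X Y a b z < 0 else 0 < orient X Y a b z)"

definition under :: "('p \<Rightarrow> real) \<Rightarrow> ('p \<Rightarrow> real) \<Rightarrow> 'p \<Rightarrow> 'p \<Rightarrow> 'p \<Rightarrow> bool" where
  "under X Y a b z \<longleftrightarrow> (if lexle X Y b a then 0 < orient X Y a b z else orient X Y a b z < 0)"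

definition between :: "('p \<Rightarrow> real) \<Rightarrow> ('p \<Rightarrow> real) \<Rightarrow> 'p \<Rightarrow> 'p \<Rightarrow> 'p \<Rightarrow> bool" where
  "between X Y a b z \<longleftrightarrow> (lexle X Y a z \<or> lexle X Y b z) \<and> (lexle X Y z a \<or> lexle X Y z b)"

text \<open>For disjoint segments a single witness suffices: the vertical order cannot change over
  the common part of the projections, and this common part begins over an endpoint of one of the
  two.\<close>

definition below :: "('p \<Rightarrow> real) \<Rightarrow> ('p \<Rightarrow> real) \<Rightarrow> 'p \<Rightarrow> 'p \<Rightarrow> 'p \<Rightarrow> 'p \<Rightarrow> bool" where
  "below X Y a b c d \<longleftrightarrow> (between X Y a b c \<and> above X Y a b c) \<or> (between X Y a b d \<and> above X Y a b d)
     \<or> (between X Y c d a \<and> under X Y c d a) \<or> (between X Y c d b \<and> under X Y c d b)"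

definition starts :: "('p \<Rightarrow> real) \<Rightarrow> ('p \<Rightarrow> real) \<Rightarrow> 'p \<Rightarrow> 'p \<Rightarrow> 'p \<Rightarrow> 'p \<Rightarrow> bool" where
  "starts X Y a b c d \<longleftrightarrow> (lexle X Y a c \<or> lexle X Y b c) \<and> (lexle X Y a d \<or> lexle X Y b d)"

definition ends :: "('p \<Rightarrow> real) \<Rightarrow> ('p \<Rightarrow> real) \<Rightarrow> 'p \<Rightarrow> 'p \<Rightarrow> 'p \<Rightarrow> 'p \<Rightarrow> bool" where
  "ends X Y a b c d \<longleftrightarrow> (lexle X Y a c \<or> lexle X Y a d) \<and> (lexle X Y b c \<or> lexle X Y b d)"

definition reaches :: "('p \<Rightarrow> real) \<Rightarrow> ('p \<Rightarrow> real) \<Rightarrow> 'p \<Rightarrow> 'p \<Rightarrow> 'p \<Rightarrow> 'p \<Rightarrow> bool" where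
  "reaches X Y a b c d \<longleftrightarrow> lexle X Y a c \<or> lexle X Y a d \<or> lexle X Y b c \<or> lexle X Y b d"

text \<open>The two bits of \<open>i\<close> choose the directions in which left and right ends move
  along a chain, while the vertical order is the same in all four relations. If the projections do
  not overlap, the vertical condition is void.\<close>

definition prec :: "('p \<Rightarrow> real) \<Rightarrow> ('p \<Rightarrow> real) \<Rightarrow> nat \<Rightarrow> 'p \<Rightarrow> 'p \<Rightarrow> 'p \<Rightarrow> 'p \<Rightarrow> bool" where
  "prec X Y i a b c d \<longleftrightarrow> (if i < 2 then starts X Y a b c d else starts X Y c d a b)
     \<and> (if even i then ends X Y a b c d else ends X Y c d a b)
     \<and> (reaches X Y a b c d \<and> reaches X Y c d a b \<longrightarrow> below X Y a b c d)"

definition pmeet :: "('p \<Rightarrow> real) \<Rightarrow> ('p \<Rightarrow> real) \<Rightarrow> 'p \<Rightarrow> 'p \<Rightarrow> 'p \<Rightarrow> 'p \<Rightarrow> bool" where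
  "pmeet X Y a b c d \<longleftrightarrow> (\<exists>u v. 0 \<le> u \<and> u \<le> 1 \<and> 0 \<le> v \<and> v \<le> 1 \<and>
     X c - X a = u * (X b - X a) - v * (X d - X c) \<and> Y c - Y a = u * (Y b - Y a) - v * (Y d - Y c))"

text \<open>Each strict inequality survives some positive multiple of \<open>Y\<close> and all
  smaller positive ones, so the minimum over the finitely many pairs works.\<close>

lemma shear_pairs:
  fixes X Y :: "'p \<Rightarrow> real"
  assumes "finite Q" "\<And>e f. (e, f) \<in> Q \<Longrightarrow> X e < X f"
  shows "\<exists>k>0. \<forall>(e, f) \<in> Q. X e + k * Y e < X f + k * Y f"
  using assms
proof (induction Q rule: finite_induct)
  case empty
  then show ?case by (intro exI[of _ 1]) auto
next
  case (insert q F)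
  then obtain k where k: "k > 0" "\<forall>(e, f) \<in> F. X e + k * Y e < X f + k * Y f" by auto
  obtain e f where q: "q = (e, f)" "X e < X f" using insert.prems by (cases q) auto
  \<comment> \<open>Half of the gap \<open>X f - X e\<close>, spread over the difference of the
    second coordinates; the summand 1 keeps the denominator positive.\<close>
  define m where "m = (X f - X e) / (2 * (1 + \<bar>Y e - Y f\<bar>))"
  define k' where "k' = min k m"
  have m0: "m > 0" unfolding m_def using q by (intro divide_pos_pos mult_pos_pos add_pos_nonneg) auto
  then have k'0: "k' > 0" using k by (simp add: k'_def)
  have mono: "X e' + k' * Y e' < X f' + k' * Y f'" if "X e' < X f'" "X e' + l * Y e' < X f' + l * Y f'" "k' \<le> l" for e' f' l
  proof (cases "Y e' \<le> Y f'")
    case True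
    then have "k' * Y e' \<le> k' * Y f'" using k'0 by simp
    then show ?thesis using that by linarith
  next
    case False
    then have "k' * (Y e' - Y f') \<le> l * (Y e' - Y f')" using that by (intro mult_right_mono) auto
    then show ?thesis using that by (simp add: algebra_simps)
  qed
  have "m * (Y e - Y f) < X f - X e"
  proof -
    have "m * (Y e - Y f) \<le> m * (1 + \<bar>Y e - Y f\<bar>)" using m0 by (intro mult_left_mono) auto
    also have "\<dots> = (X f - X e) / 2"
    proof -
      define w where "w = 1 + \<bar>Y e - Y f\<bar>"
      have "w \<noteq> 0" unfolding w_def by linarith
      then show ?thesis unfolding m_def w_def[symmetric] by simp
    qed
    finally show ?thesis using q by (simp add: field_simps)
  qed
  then have "X e + m * Y e < X f + m * Y f" by (simp add: algebra_simps)
  then have "X e + k' * Y e < X f + k' * Y f" using mono[of e f m] q by (simp add: k'_def)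
  moreover have "\<forall>(e, f) \<in> F. X e + k' * Y e < X f + k' * Y f"
  proof safe
    fix e' f' assume "(e', f') \<in> F"
    then show "X e' + k' * Y e' < X f' + k' * Y f'" using mono[of e' f' k] k insert.prems by (auto simp: k'_def)
  qed
  ultimately show ?case using k'0 q by auto
qed

text \<open>Different first coordinates stay in order because \<open>k\<close> is small, and ties
  are decided by \<open>Y\<close> because \<open>k\<close> is positive.\<close>

lemma lex_shear:
  fixes X Y :: "'p \<Rightarrow> real"
  assumes "finite A"
  obtains k where "\<And>e f. e \<in> A \<Longrightarrow> f \<in> A \<Longrightarrow> lexle X Y e f \<longleftrightarrow> X e + k * Y e \<le> X f + k * Y f"
proof -
  define Q where "Q = {(e, f). e \<in> A \<and> f \<in> A \<and> X e < X f}"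
  have "finite Q" using assms by (auto simp: Q_def intro: finite_subset[of _ "A \<times> A"])
  then have "\<exists>k>0. \<forall>(e, f) \<in> Q. X e + k * Y e < X f + k * Y f"
    by (rule shear_pairs) (auto simp: Q_def)
  then obtain k where k: "k > 0" "\<And>e f. e \<in> A \<Longrightarrow> f \<in> A \<Longrightarrow> X e < X f \<Longrightarrow> X e + k * Y e < X f + k * Y f"
    by (auto simp: Q_def)
  have "lexle X Y e f \<longleftrightarrow> X e + k * Y e \<le> X f + k * Y f" if "e \<in> A" "f \<in> A" for e f
    using k(1) k(2)[OF that] k(2)[OF that(2,1)] unfolding lexle_def
    by (cases "X e" "X f" rule: linorder_cases) auto
  then show ?thesis using that by blast
qed

text \<open>A shear makes no segment vertical and turns the lexicographic order of the finitely many endpoints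
  into the order of their first coordinates; the following locale describes the result.\<close>

locale sheared =
  fixes X Y :: "'p \<Rightarrow> real" and A :: "'p set" and f :: "'p \<Rightarrow> real" and k :: real
  assumes le: "e \<in> A \<Longrightarrow> e' \<in> A \<Longrightarrow> lexle X Y e e' \<longleftrightarrow> f e \<le> f e'"
    and f: "f e = X e + k * Y e"
begin

definition lo :: "'p \<Rightarrow> 'p \<Rightarrow> real" where "lo a b = min (f a) (f b)"
definition hi :: "'p \<Rightarrow> 'p \<Rightarrow> real" where "hi a b = max (f a) (f b)"
definition val :: "'p \<Rightarrow> 'p \<Rightarrow> real \<Rightarrow> real" where
  "val a b x = Y a + (x - f a) * ((Y b - Y a) / (f b - f a))"

lemma orient_f: "orient X Y a b z = (f b - f a) * (Y z - Y a) - (Y b - Y a) * (f z - f a)"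
  by (simp add: orient_def f algebra_simps)

text \<open>\<open>orient\<close> is the signed horizontal extent \<open>f b - f a\<close> times the
  height of \<open>z\<close> over the line, so its sign must be corrected by the direction of the
  segment.\<close>

lemma above_iff:
  assumes "a \<in> A" "b \<in> A" "f a \<noteq> f b"
  shows "above X Y a b z \<longleftrightarrow> val a b (f z) < Y z"
proof -
  have "(f b - f a) * (Y z - val a b (f z)) = orient X Y a b z"
    using assms by (simp add: orient_f val_def field_simps)
  then show ?thesis unfolding above_def using assms
    by (auto simp: le zero_less_mult_iff mult_less_0_iff dest!: sym[of _ "orient X Y a b z"])
qed

lemma under_iff:
  assumes "a \<in> A" "b \<in> A" "f a \<noteq> f b"
  shows "under X Y a b z \<longleftrightarrow> Y z < val a b (f z)"
proof -
  have "(f b - f a) * (Y z - val a b (f z)) = orient X Y a b z"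
    using assms by (simp add: orient_f val_def field_simps)
  then show ?thesis unfolding under_def using assms
    by (auto simp: le zero_less_mult_iff mult_less_0_iff dest!: sym[of _ "orient X Y a b z"])
qed

lemma val_endpoints:
  assumes "f a \<noteq> f b"
  shows "val a b (f a) = Y a" "val a b (f b) = Y b"
  using assms by (auto simp: val_def)

lemma between_iff: "a \<in> A \<Longrightarrow> b \<in> A \<Longrightarrow> z \<in> A \<Longrightarrow> between X Y a b z \<longleftrightarrow> lo a b \<le> f z \<and> f z \<le> hi a b"
  by (auto simp: between_def le lo_def hi_def)

lemma starts_iff: "{a, b, c, d} \<subseteq> A \<Longrightarrow> starts X Y a b c d \<longleftrightarrow> lo a b \<le> lo c d"
  by (auto simp: starts_def le lo_def)

lemma ends_iff: "{a, b, c, d} \<subseteq> A \<Longrightarrow> ends X Y a b c d \<longleftrightarrow> hi a b \<le> hi c d"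
  by (auto simp: ends_def le hi_def)

lemma reaches_iff: "{a, b, c, d} \<subseteq> A \<Longrightarrow> reaches X Y a b c d \<longleftrightarrow> lo a b \<le> hi c d"
  by (auto simp: reaches_def le hi_def lo_def)

text \<open>The shear is an invertible linear map and preserves intersections. On a non-vertical
  segment a point is determined by its abscissa, which replaces the two parameters by one
  number.\<close>

lemma pmeet_iff:
  assumes "f a \<noteq> f b" "f c \<noteq> f d"
  shows "pmeet X Y a b c d \<longleftrightarrow> (\<exists>x. lo a b \<le> x \<and> lo c d \<le> x \<and> x \<le> hi a b \<and> x \<le> hi c d \<and> val a b x = val c d x)"
proof
  have X: "X e = f e - k * Y e" for e by (simp add: f)
  have pt: "\<exists>u. 0 \<le> u \<and> u \<le> 1 \<and> x = f a + u * (f b - f a) \<and> val a b x = Y a + u * (Y b - Y a)"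
    if "lo a b \<le> x" "x \<le> hi a b" "f a \<noteq> f b" for a b x
    using that by (intro exI[of _ "(x - f a) / (f b - f a)"]) (auto simp: lo_def hi_def val_def divide_simps split: if_splits)
  {
    assume "pmeet X Y a b c d"
    then obtain u v where uv: "0 \<le> u" "u \<le> 1" "0 \<le> v" "v \<le> 1"
      and e: "X c - X a = u * (X b - X a) - v * (X d - X c)" "Y c - Y a = u * (Y b - Y a) - v * (Y d - Y c)"
      by (auto simp: pmeet_def)
    have bd: "lo a b \<le> f a + u * (f b - f a) \<and> f a + u * (f b - f a) \<le> hi a b" if "0 \<le> u" "u \<le> 1" for u a b
    proof (cases "f a \<le> f b")
      case True
      then have "0 \<le> u * (f b - f a)" "u * (f b - f a) \<le> f b - f a" using that by (auto simp: mult_left_le_one_le)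
      then show ?thesis using True by (auto simp: lo_def hi_def)
    next
      case False
      then have "0 \<le> u * (f a - f b)" "u * (f a - f b) \<le> f a - f b" using that by (auto simp: mult_left_le_one_le)
      then show ?thesis using False by (auto simp: lo_def hi_def algebra_simps)
    qed
    define x where "x = f a + u * (f b - f a)"
    have "f c - f a = u * (f b - f a) - v * (f d - f c)"
    proof -
      have "f c - f a = (X c - X a) + k * (Y c - Y a)" by (simp add: f algebra_simps)
      also have "\<dots> = u * (f b - f a) - v * (f d - f c)" unfolding e by (simp add: f algebra_simps)
      finally show ?thesis .
    qed
    then have x: "x = f c + v * (f d - f c)" by (simp add: x_def)
    have "val a b x = Y a + u * (Y b - Y a)" using assms by (simp add: val_def x_def)
    moreover have "val c d x = Y c + v * (Y d - Y c)" using assms by (simp add: val_def x)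
    ultimately have "val a b x = val c d x" using e(2) by simp
    then show "\<exists>x. lo a b \<le> x \<and> lo c d \<le> x \<and> x \<le> hi a b \<and> x \<le> hi c d \<and> val a b x = val c d x"
      using bd[of u a b] bd[of v c d] uv unfolding x_def[symmetric] x[symmetric] by blast
  next
    assume "\<exists>x. lo a b \<le> x \<and> lo c d \<le> x \<and> x \<le> hi a b \<and> x \<le> hi c d \<and> val a b x = val c d x"
    then obtain x u v where "0 \<le> u" "u \<le> 1" "x = f a + u * (f b - f a)" "val a b x = Y a + u * (Y b - Y a)"
      "0 \<le> v" "v \<le> 1" "x = f c + v * (f d - f c)" "val c d x = Y c + v * (Y d - Y c)" "val a b x = val c d x"
      using pt assms by metis
    then have uv: "0 \<le> u" "u \<le> 1" "0 \<le> v" "v \<le> 1" and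
      e: "f c - f a = u * (f b - f a) - v * (f d - f c)" "Y c - Y a = u * (Y b - Y a) - v * (Y d - Y c)" by auto
    have "X c - X a = (f c - f a) - k * (Y c - Y a)" by (simp add: X algebra_simps)
    also have "\<dots> = u * (X b - X a) - v * (X d - X c)" unfolding e by (simp add: X algebra_simps)
    finally show "pmeet X Y a b c d" using uv e unfolding pmeet_def by blast
  }
qed

lemma val_affine: "val a b ((1 - s) * x + s * y) = (1 - s) * val a b x + s * val a b y"
proof -
  obtain m where m: "\<And>x. val a b x = Y a + (x - f a) * m" unfolding val_def by blast
  show ?thesis unfolding m by (simp add: algebra_simps)
qed

text \<open>The difference of two affine functions that changes sign on the common interval vanishes
  somewhere in between, and this zero would be a common point.\<close>

lemma less_on_overlap:
  assumes nm: "\<not> pmeet X Y a b c d" and ne: "f a \<noteq> f b" "f c \<noteq> f d"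
    and x: "lo a b \<le> x" "lo c d \<le> x" "x \<le> hi a b" "x \<le> hi c d" "val a b x < val c d x"
    and y: "lo a b \<le> y" "lo c d \<le> y" "y \<le> hi a b" "y \<le> hi c d"
  shows "val a b y < val c d y"
proof (rule ccontr)
  assume *: "\<not> ?thesis"
  define p q where "p = val c d x - val a b x" and "q = val a b y - val c d y"
  have pq: "p > 0" "q \<ge> 0" using x * by (auto simp: p_def q_def)
  \<comment> \<open>The position of the zero of the affine difference, which is \<open>p\<close> at
    \<open>x\<close> and \<open>- q\<close> at \<open>y\<close>.\<close>
  define s where "s = p / (p + q)"
  have s: "0 \<le> s" "s \<le> 1" "s * (p + q) = p" using pq by (auto simp: s_def)
  let ?z = "(1 - s) * x + s * y"
  have "val c d ?z - val a b ?z = (1 - s) * p - s * q" unfolding val_affine by (simp add: p_def q_def algebra_simps)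
  also have "\<dots> = 0" using s(3) by (simp add: algebra_simps)
  finally have "val a b ?z = val c d ?z" by simp
  moreover have "l \<le> ?z" if "l \<le> x" "l \<le> y" for l
    using convex_bound_le[of "-x" "-l" "-y" "1 - s" s] that s by simp
  moreover have "?z \<le> l" if "x \<le> l" "y \<le> l" for l
    using convex_bound_le[of x l y "1 - s" s] that s by simp
  ultimately show False using nm x y unfolding pmeet_iff[OF ne] by blast
qed

text \<open>The common part of the projections starts at the larger of the two left ends, where one
  of the endpoint tests applies; \<open>less_on_overlap\<close> carries the outcome of one test to
  the whole common part.\<close>

lemma below_iff:
  assumes "{a, b, c, d} \<subseteq> A" and nm: "\<not> pmeet X Y a b c d" and ne: "f a \<noteq> f b" "f c \<noteq> f d"
  shows "(reaches X Y a b c d \<and> reaches X Y c d a b \<longrightarrow> below X Y a b c d) \<longleftrightarrow>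
    (\<forall>y. lo a b \<le> y \<and> lo c d \<le> y \<and> y \<le> hi a b \<and> y \<le> hi c d \<longrightarrow> val a b y < val c d y)" (is "?L \<longleftrightarrow> ?R")
proof -
  have A: "a \<in> A" "b \<in> A" "c \<in> A" "d \<in> A" using assms by auto
  have r: "reaches X Y a b c d \<longleftrightarrow> lo a b \<le> hi c d" "reaches X Y c d a b \<longleftrightarrow> lo c d \<le> hi a b"
    using A by (auto simp: reaches_iff)
  have lohi: "lo e f' \<le> hi e f'" for e f' by (auto simp: lo_def hi_def)
  have ends: "lo a b \<le> f a" "f a \<le> hi a b" "lo a b \<le> f b" "f b \<le> hi a b" for a b by (auto simp: lo_def hi_def)
  show ?thesis
  proof
    assume L: ?L
    show ?R
    proof (intro allI impI)
      fix y assume y: "lo a b \<le> y \<and> lo c d \<le> y \<and> y \<le> hi a b \<and> y \<le> hi c d"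
      then have "below X Y a b c d" using L r by auto
      then obtain x where "lo a b \<le> x" "lo c d \<le> x" "x \<le> hi a b" "x \<le> hi c d" "val a b x < val c d x"
      proof -
        have "lo a b \<le> f c \<and> f c \<le> hi a b \<and> val a b (f c) < Y c \<or> lo a b \<le> f d \<and> f d \<le> hi a b \<and> val a b (f d) < Y d
          \<or> lo c d \<le> f a \<and> f a \<le> hi c d \<and> Y a < val c d (f a) \<or> lo c d \<le> f b \<and> f b \<le> hi c d \<and> Y b < val c d (f b)"
          using \<open>below X Y a b c d\<close> A ne unfolding below_def by (simp add: between_iff above_iff under_iff)
        then show thesis
          using that[of "f a"] that[of "f b"] that[of "f c"] that[of "f d"] ends val_endpoints[OF ne(1)] val_endpoints[OF ne(2)]
          by auto
      qed
      then show "val a b y < val c d y" using less_on_overlap[OF nm ne] y by blast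
    qed
  next
    assume R: ?R
    show ?L
    proof
      assume "reaches X Y a b c d \<and> reaches X Y c d a b"
      then have ov: "lo a b \<le> hi c d" "lo c d \<le> hi a b" using r by auto
      have "lo a b = f a \<or> lo a b = f b" "lo c d = f c \<or> lo c d = f d" by (auto simp: lo_def)
      then consider "lo c d \<le> lo a b" "lo a b = f a" | "lo c d \<le> lo a b" "lo a b = f b"
        | "lo a b \<le> lo c d" "lo c d = f c" | "lo a b \<le> lo c d" "lo c d = f d" by linarith
      then show "below X Y a b c d"
      proof cases
        case 1 then show ?thesis using R[rule_format, of "f a"] ov ends A ne unfolding below_def
          by (simp add: between_iff under_iff val_endpoints)
      next
        case 2 then show ?thesis using R[rule_format, of "f b"] ov ends A ne unfolding below_def
          by (simp add: between_iff under_iff val_endpoints)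
      next
        case 3 then show ?thesis using R[rule_format, of "f c"] ov ends A ne unfolding below_def
          by (simp add: between_iff above_iff val_endpoints)
      next
        case 4 then show ?thesis using R[rule_format, of "f d"] ov ends A ne unfolding below_def
          by (simp add: between_iff above_iff val_endpoints)
      qed
    qed
  qed
qed

lemma prec_iff:
  assumes "{a, b, c, d} \<subseteq> A" "\<not> pmeet X Y a b c d" "f a \<noteq> f b" "f c \<noteq> f d"
  shows "prec X Y i a b c d \<longleftrightarrow> (if i < 2 then lo a b \<le> lo c d else lo c d \<le> lo a b)
     \<and> (if even i then hi a b \<le> hi c d else hi c d \<le> hi a b)
     \<and> (\<forall>y. lo a b \<le> y \<and> lo c d \<le> y \<and> y \<le> hi a b \<and> y \<le> hi c d \<longrightarrow> val a b y < val c d y)"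
  using assms unfolding prec_def below_iff[OF assms] by (simp add: starts_iff ends_iff)

end

lemma shearedE:
  fixes X Y :: "'p \<Rightarrow> real"
  assumes "finite A"
  obtains f k where "sheared X Y A f k"
proof -
  obtain k where "\<And>e f. e \<in> A \<Longrightarrow> f \<in> A \<Longrightarrow> lexle X Y e f \<longleftrightarrow> X e + k * Y e \<le> X f + k * Y f"
    using lex_shear[OF assms] by metis
  then have "sheared X Y A (\<lambda>e. X e + k * Y e) k" by unfold_locales auto
  then show ?thesis using that by blast
qed

lemma (in sheared) f_neq:
  assumes "a \<in> A" "b \<in> A" "(X a, Y a) \<noteq> (X b, Y b)"
  shows "f a \<noteq> f b"
  using le[OF assms(1,2)] le[OF assms(2,1)] assms(3) by (auto simp: lexle_def)

text \<open>Both ends move monotonically along the chain, so the projection of the middle segment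
  contains the common part of the outer two, and the vertical inequalities compose there.
  Disjointness of the outer segments follows from the same inequalities.\<close>

lemma prec_trans:
  fixes X Y :: "'p \<Rightarrow> real"
  assumes ne: "(X a, Y a) \<noteq> (X b, Y b)" "(X c, Y c) \<noteq> (X d, Y d)" "(X e, Y e) \<noteq> (X e', Y e')"
    and nm: "\<not> pmeet X Y a b c d" "\<not> pmeet X Y c d e e'"
    and p: "prec X Y i a b c d" "prec X Y i c d e e'"
  shows "\<not> pmeet X Y a b e e'" "prec X Y i a b e e'"
proof -
  obtain f k where "sheared X Y {a, b, c, d, e, e'} f k" by (metis shearedE finite.emptyI finite_insert)
  then interpret sheared X Y "{a, b, c, d, e, e'}" f k .
  have fne: "f a \<noteq> f b" "f c \<noteq> f d" "f e \<noteq> f e'"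
    using f_neq[OF _ _ ne(1)] f_neq[OF _ _ ne(2)] f_neq[OF _ _ ne(3)] by auto
  have 1: "prec X Y i a b c d \<longleftrightarrow> (if i < 2 then lo a b \<le> lo c d else lo c d \<le> lo a b)
     \<and> (if even i then hi a b \<le> hi c d else hi c d \<le> hi a b)
     \<and> (\<forall>y. lo a b \<le> y \<and> lo c d \<le> y \<and> y \<le> hi a b \<and> y \<le> hi c d \<longrightarrow> val a b y < val c d y)"
    using nm fne by (intro prec_iff) auto
  have 2: "prec X Y i c d e e' \<longleftrightarrow> (if i < 2 then lo c d \<le> lo e e' else lo e e' \<le> lo c d)
     \<and> (if even i then hi c d \<le> hi e e' else hi e e' \<le> hi c d)
     \<and> (\<forall>y. lo c d \<le> y \<and> lo e e' \<le> y \<and> y \<le> hi c d \<and> y \<le> hi e e' \<longrightarrow> val c d y < val e e' y)"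
    using nm fne by (intro prec_iff) auto
  have lt: "val a b y < val e e' y" if "lo a b \<le> y" "lo e e' \<le> y" "y \<le> hi a b" "y \<le> hi e e'" for y
  proof -
    have "lo c d \<le> y" "y \<le> hi c d" using p[unfolded 1 2] that by (auto split: if_splits)
    then show ?thesis using p[unfolded 1 2] that by (meson less_trans)
  qed
  show nm': "\<not> pmeet X Y a b e e'" using lt unfolding pmeet_iff[OF fne(1,3)] by force
  have "prec X Y i a b e e' \<longleftrightarrow> (if i < 2 then lo a b \<le> lo e e' else lo e e' \<le> lo a b)
     \<and> (if even i then hi a b \<le> hi e e' else hi e e' \<le> hi a b)
     \<and> (\<forall>y. lo a b \<le> y \<and> lo e e' \<le> y \<and> y \<le> hi a b \<and> y \<le> hi e e' \<longrightarrow> val a b y < val e e' y)"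
    using nm' fne by (intro prec_iff) auto
  then show "prec X Y i a b e e'" using lt p[unfolded 1 2] by (auto split: if_splits)
qed

lemma pmeet_sym: "pmeet X Y a b c d \<Longrightarrow> pmeet X Y c d a b"
proof -
  assume "pmeet X Y a b c d"
  then obtain u v where "0 \<le> u" "u \<le> 1" "0 \<le> v" "v \<le> 1"
     "X c - X a = u * (X b - X a) - v * (X d - X c)" "Y c - Y a = u * (Y b - Y a) - v * (Y d - Y c)"
    unfolding pmeet_def by blast
  then show ?thesis unfolding pmeet_def by (intro exI[of _ v] exI[of _ u]) auto
qed

text \<open>Disjoint segments have a fixed vertical order over the common part of their projections
  (either one, if that part is empty). With the lower segment first, the relative position of the
  ends selects \<open>i\<close>.\<close>

lemma prec_total:
  fixes X Y :: "'p \<Rightarrow> real"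
  assumes ne: "(X a, Y a) \<noteq> (X b, Y b)" "(X c, Y c) \<noteq> (X d, Y d)" and nm: "\<not> pmeet X Y a b c d"
  shows "\<exists>i<4. prec X Y i a b c d \<or> prec X Y i c d a b"
proof -
  obtain f k where "sheared X Y {a, b, c, d} f k" by (metis shearedE finite.emptyI finite_insert)
  then interpret sheared X Y "{a, b, c, d}" f k .
  have fne: "f a \<noteq> f b" "f c \<noteq> f d" using f_neq[OF _ _ ne(1)] f_neq[OF _ _ ne(2)] by auto
  have nm': "\<not> pmeet X Y c d a b" using nm pmeet_sym[of X Y c d a b] by blast
  have 1: "prec X Y i a b c d \<longleftrightarrow> (if i < 2 then lo a b \<le> lo c d else lo c d \<le> lo a b)
     \<and> (if even i then hi a b \<le> hi c d else hi c d \<le> hi a b)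
     \<and> (\<forall>y. lo a b \<le> y \<and> lo c d \<le> y \<and> y \<le> hi a b \<and> y \<le> hi c d \<longrightarrow> val a b y < val c d y)" for i
    using nm fne by (intro prec_iff) auto
  have 2: "prec X Y i c d a b \<longleftrightarrow> (if i < 2 then lo c d \<le> lo a b else lo a b \<le> lo c d)
     \<and> (if even i then hi c d \<le> hi a b else hi a b \<le> hi c d)
     \<and> (\<forall>y. lo c d \<le> y \<and> lo a b \<le> y \<and> y \<le> hi c d \<and> y \<le> hi a b \<longrightarrow> val c d y < val a b y)" for i
    using nm' fne by (intro prec_iff) auto
  have alt: "(\<forall>y. lo a b \<le> y \<and> lo c d \<le> y \<and> y \<le> hi a b \<and> y \<le> hi c d \<longrightarrow> val a b y < val c d y)
     \<or> (\<forall>y. lo c d \<le> y \<and> lo a b \<le> y \<and> y \<le> hi c d \<and> y \<le> hi a b \<longrightarrow> val c d y < val a b y)"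
    using less_on_overlap[OF nm' fne(2,1)] nm unfolding pmeet_iff[OF fne] by (metis linorder_neqE_linordered_idom)
  consider "lo a b \<le> lo c d" "hi a b \<le> hi c d" | "lo a b \<le> lo c d" "hi c d \<le> hi a b"
    | "lo c d \<le> lo a b" "hi a b \<le> hi c d" | "lo c d \<le> lo a b" "hi c d \<le> hi a b" by linarith
  then have i: "prec X Y 0 a b c d \<or> prec X Y 1 a b c d \<or> prec X Y 2 a b c d \<or> prec X Y 3 a b c d
     \<or> prec X Y 0 c d a b \<or> prec X Y 1 c d a b \<or> prec X Y 2 c d a b \<or> prec X Y 3 c d a b"
    unfolding 1 2 by cases (use alt in \<open>simp_all, blast+\<close>)
  then obtain i where "i \<in> {0, 1, 2, 3}" "prec X Y i a b c d \<or> prec X Y i c d a b" by blast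
  then show ?thesis by (intro exI[of _ i]) auto
qed

section \<open>Incidence of segments through inner products\<close>

text \<open>When \<open>g\<close> is the table of inner products of points, this is the inner
  product of the vectors from \<open>a\<close> to \<open>b\<close> and from \<open>c\<close> to
  \<open>d\<close>. \<open>g\<close> stays abstract because the program sees nothing but the
  table.\<close>

definition iq :: "('p \<Rightarrow> 'p \<Rightarrow> real) \<Rightarrow> 'p \<Rightarrow> 'p \<Rightarrow> 'p \<Rightarrow> 'p \<Rightarrow> real" where
  "iq g a b c d = g b d - g b c - g a d + g a c"

text \<open>Gram determinant of the two directions; for proper segments it vanishes exactly if they
  are parallel.\<close>

definition disc :: "('p \<Rightarrow> 'p \<Rightarrow> real) \<Rightarrow> 'p \<Rightarrow> 'p \<Rightarrow> 'p \<Rightarrow> 'p \<Rightarrow> real" where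
  "disc g a b c d = iq g a b a b * iq g c d c d - iq g a b c d * iq g a b c d"

text \<open>Cramer's rule for \<open>c - a = u * (b - a) - v * (d - c)\<close> after taking inner
  products with both directions; \<open>par1\<close> is the value of \<open>u\<close> and
  \<open>par2\<close> that of \<open>v\<close>.\<close>

definition par1 :: "('p \<Rightarrow> 'p \<Rightarrow> real) \<Rightarrow> 'p \<Rightarrow> 'p \<Rightarrow> 'p \<Rightarrow> 'p \<Rightarrow> real" where
  "par1 g a b c d = (iq g a c a b * iq g c d c d - iq g a c c d * iq g a b c d) / disc g a b c d"

definition par2 :: "('p \<Rightarrow> 'p \<Rightarrow> real) \<Rightarrow> 'p \<Rightarrow> 'p \<Rightarrow> 'p \<Rightarrow> 'p \<Rightarrow> real" where
  "par2 g a b c d = (iq g a c a b * iq g a b c d - iq g a c c d * iq g a b a b) / disc g a b c d"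

text \<open>Squared distance of the points with parameters \<open>u\<close> and \<open>v\<close> on
  the two lines, expanded. It decides whether a solution of the projected system solves the vector
  equation itself.\<close>

definition gap :: "('p \<Rightarrow> 'p \<Rightarrow> real) \<Rightarrow> 'p \<Rightarrow> 'p \<Rightarrow> 'p \<Rightarrow> 'p \<Rightarrow> real \<Rightarrow> real \<Rightarrow> real" where
  "gap g a b c d u v = iq g a c a c + u * u * iq g a b a b + v * v * iq g c d c d
     - 2 * u * iq g a c a b + 2 * v * iq g a c c d - 2 * u * v * iq g a b c d"

text \<open>For parallel segments the equality case of Cauchy-Schwarz tests collinearity. Projected
  to the common direction, the first segment becomes the interval from 0 to
  \<open>iq g a b a b\<close> and the second runs between \<open>iq g a c a b\<close> and
  \<open>iq g a c a b + iq g a b c d\<close>; the last two conditions say that neither end of the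
  first separates them.\<close>

definition meet :: "('p \<Rightarrow> 'p \<Rightarrow> real) \<Rightarrow> 'p \<Rightarrow> 'p \<Rightarrow> 'p \<Rightarrow> 'p \<Rightarrow> bool" where
  "meet g a b c d \<longleftrightarrow>
    (if disc g a b c d \<noteq> 0
     then 0 \<le> par1 g a b c d \<and> par1 g a b c d \<le> 1 \<and> 0 \<le> par2 g a b c d \<and> par2 g a b c d \<le> 1
       \<and> gap g a b c d (par1 g a b c d) (par2 g a b c d) = 0
     else iq g a c a c * iq g a b a b = iq g a c a b * iq g a c a b
       \<and> \<not> (iq g a b a b < iq g a c a b \<and> iq g a b a b < iq g a c a b + iq g a b c d)
       \<and> \<not> (iq g a c a b < 0 \<and> iq g a c a b + iq g a b c d < 0))"

definition gram2 :: "('p \<Rightarrow> 'p \<Rightarrow> real) \<Rightarrow> 'p \<Rightarrow> 'p \<Rightarrow> 'p \<Rightarrow> real" where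
  "gram2 g z a b = iq g z a z a * iq g z b z b - iq g z a z b * iq g z a z b"

text \<open>Gram determinant of the vectors from \<open>z\<close> to \<open>a\<close>,
  \<open>b\<close> and \<open>c\<close>, expanded along the first row; it vanishes exactly if they
  are linearly dependent.\<close>

definition gram3 :: "('p \<Rightarrow> 'p \<Rightarrow> real) \<Rightarrow> 'p \<Rightarrow> 'p \<Rightarrow> 'p \<Rightarrow> 'p \<Rightarrow> real" where
  "gram3 g z a b c =
     iq g z a z a * (iq g z b z b * iq g z c z c - iq g z b z c * iq g z b z c)
   - iq g z a z b * (iq g z a z b * iq g z c z c - iq g z b z c * iq g z a z c)
   + iq g z a z c * (iq g z a z b * iq g z b z c - iq g z b z b * iq g z a z c)"

lemma iq_inner:
  fixes P :: "'p \<Rightarrow> 'a::real_inner"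
  shows "iq (\<lambda>e f. P e \<bullet> P f) a b c d = (P b - P a) \<bullet> (P d - P c)"
  by (simp add: iq_def inner_diff_left inner_diff_right inner_commute algebra_simps)

lemma gram_pos:
  fixes p q :: "'a::real_inner"
  shows "(p \<bullet> p) * (q \<bullet> q) - (p \<bullet> q) * (p \<bullet> q) \<ge> 0"
  using Cauchy_Schwarz_ineq[of p q] by (simp add: power2_eq_square)

text \<open>The squared length of \<open>q\<close> minus its projection to \<open>p\<close> is the
  Gram determinant divided by the squared length of \<open>p\<close>.\<close>

lemma parallel_coeff:
  fixes p q :: "'a::real_inner"
  assumes "p \<noteq> 0" and "(p \<bullet> p) * (q \<bullet> q) = (p \<bullet> q) * (p \<bullet> q)"
  shows "q = ((p \<bullet> q) / (p \<bullet> p)) *\<^sub>R p"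
proof -
  let ?c = "(p \<bullet> q) / (p \<bullet> p)"
  have pp: "p \<bullet> p \<noteq> 0" using assms by simp
  have "(q - ?c *\<^sub>R p) \<bullet> (q - ?c *\<^sub>R p) = q \<bullet> q - 2 * ?c * (p \<bullet> q) + ?c * ?c * (p \<bullet> p)"
    by (simp add: inner_diff_left inner_diff_right inner_commute algebra_simps)
  also have "\<dots> = ((p \<bullet> p) * (q \<bullet> q) - (p \<bullet> q) * (p \<bullet> q)) / (p \<bullet> p)"
    using pp by (simp add: field_simps)
  also have "\<dots> = 0" using assms(2) by simp
  finally show ?thesis by simp
qed

lemma dependent_gram2:
  fixes p q :: "'a::real_inner"
  shows "(p \<bullet> p) * ((c *\<^sub>R p) \<bullet> (c *\<^sub>R p)) - (p \<bullet> (c *\<^sub>R p)) * (p \<bullet> (c *\<^sub>R p)) = 0"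
  by simp

text \<open>Inner products with \<open>p\<close> and \<open>q\<close> give a homogeneous linear
  system whose determinant is the Gram determinant.\<close>

lemma independent_zero:
  fixes p q :: "'a::real_inner"
  assumes "(p \<bullet> p) * (q \<bullet> q) - (p \<bullet> q) * (p \<bullet> q) \<noteq> 0" and "s *\<^sub>R p + t *\<^sub>R q = 0"
  shows "s = 0" "t = 0"
proof -
  have 1: "s * (p \<bullet> p) + t * (p \<bullet> q) = 0"
    using arg_cong[OF assms(2), of "\<lambda>x. x \<bullet> p"] by (simp add: inner_add_left inner_commute[of q p])
  have 2: "s * (p \<bullet> q) + t * (q \<bullet> q) = 0"
    using arg_cong[OF assms(2), of "\<lambda>x. x \<bullet> q"] by (simp add: inner_add_left)
  have "s * ((p \<bullet> p) * (q \<bullet> q) - (p \<bullet> q) * (p \<bullet> q)) =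
     (s * (p \<bullet> p) + t * (p \<bullet> q)) * (q \<bullet> q) - (s * (p \<bullet> q) + t * (q \<bullet> q)) * (p \<bullet> q)"
    by (simp add: algebra_simps)
  then show "s = 0" using 1 2 assms(1) by simp
  have "t * ((p \<bullet> p) * (q \<bullet> q) - (p \<bullet> q) * (p \<bullet> q)) =
     (s * (p \<bullet> q) + t * (q \<bullet> q)) * (p \<bullet> p) - (s * (p \<bullet> p) + t * (p \<bullet> q)) * (p \<bullet> q)"
    by (simp add: algebra_simps)
  then show "t = 0" using 1 2 assms(1) by simp
qed

text \<open>The Gram determinant of three vectors is that of the first two times the squared
  distance of the third from their span. \<open>?z\<close> is the component of \<open>v\<close>
  orthogonal to the span, with coefficients from Cramer's rule.\<close>

lemma span2_iff:
  fixes p w v :: "'a::real_inner"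
  assumes D: "(p \<bullet> p) * (w \<bullet> w) - (p \<bullet> w) * (p \<bullet> w) \<noteq> 0"
  shows "(p \<bullet> p) * ((w \<bullet> w) * (v \<bullet> v) - (w \<bullet> v) * (w \<bullet> v))
       - (p \<bullet> w) * ((p \<bullet> w) * (v \<bullet> v) - (w \<bullet> v) * (p \<bullet> v))
       + (p \<bullet> v) * ((p \<bullet> w) * (w \<bullet> v) - (w \<bullet> w) * (p \<bullet> v)) = 0
     \<longleftrightarrow> (\<exists>s t. v = s *\<^sub>R p + t *\<^sub>R w)" (is "?G = 0 \<longleftrightarrow> _")
proof
  let ?D = "(p \<bullet> p) * (w \<bullet> w) - (p \<bullet> w) * (p \<bullet> w)"
  define s where "s = ((p \<bullet> v) * (w \<bullet> w) - (w \<bullet> v) * (p \<bullet> w)) / ?D"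
  define t where "t = ((w \<bullet> v) * (p \<bullet> p) - (p \<bullet> v) * (p \<bullet> w)) / ?D"
  assume G: "?G = 0"
  have s: "s * ?D = (p \<bullet> v) * (w \<bullet> w) - (w \<bullet> v) * (p \<bullet> w)" using D by (simp add: s_def)
  have t: "t * ?D = (w \<bullet> v) * (p \<bullet> p) - (p \<bullet> v) * (p \<bullet> w)" using D by (simp add: t_def)
  let ?z = "v - s *\<^sub>R p - t *\<^sub>R w"
  have "?D * (s * (p \<bullet> p) + t * (p \<bullet> w) - p \<bullet> v) = 
     (s * ?D) * (p \<bullet> p) + (t * ?D) * (p \<bullet> w) - ?D * (p \<bullet> v)" by (simp add: algebra_simps)
  also have "\<dots> = 0" unfolding s t by (simp add: algebra_simps)
  finally have zp: "?z \<bullet> p = 0" using D 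
    by (simp add: inner_diff_left inner_commute[of w p] inner_commute[of v p])
  have "?D * (s * (p \<bullet> w) + t * (w \<bullet> w) - w \<bullet> v) = 
     (s * ?D) * (p \<bullet> w) + (t * ?D) * (w \<bullet> w) - ?D * (w \<bullet> v)" by (simp add: algebra_simps)
  also have "\<dots> = 0" unfolding s t by (simp add: algebra_simps)
  finally have zw: "?z \<bullet> w = 0" using D 
    by (simp add: inner_diff_left inner_commute[of v w])
  have zz: "?z \<bullet> ?z = ?z \<bullet> v" using zp zw by (simp add: inner_diff_right)
  have "?D * (?z \<bullet> v) = ?D * (v \<bullet> v) - (s * ?D) * (p \<bullet> v) - (t * ?D) * (w \<bullet> v)"
    by (simp add: inner_diff_left algebra_simps)
  also have "\<dots> = ?G" unfolding s t by (simp add: algebra_simps)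
  finally have "?z \<bullet> v = 0" using D G by simp
  then have "?z = 0" using zz by simp
  then show "\<exists>s t. v = s *\<^sub>R p + t *\<^sub>R w" by (metis diff_diff_eq eq_iff_diff_eq_0)
next
  assume "\<exists>s t. v = s *\<^sub>R p + t *\<^sub>R w"
  then obtain s t where v: "v = s *\<^sub>R p + t *\<^sub>R w" by blast
  have pv: "p \<bullet> v = s * (p \<bullet> p) + t * (p \<bullet> w)" by (simp add: v inner_add_right)
  have wv: "w \<bullet> v = s * (p \<bullet> w) + t * (w \<bullet> w)" by (simp add: v inner_add_right inner_commute)
  have vv: "v \<bullet> v = s * (s * (p \<bullet> p) + t * (p \<bullet> w)) + t * (s * (p \<bullet> w) + t * (w \<bullet> w))"
    unfolding pv[symmetric] wv[symmetric] by (subst v) (simp only: inner_add_left inner_scaleR_left)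
  show "?G = 0" unfolding pv wv vv by (simp add: algebra_simps)
qed

lemma closed_segment_meet_iff:
  fixes a b c d :: "'a::real_vector"
  shows "closed_segment a b \<inter> closed_segment c d \<noteq> {} \<longleftrightarrow>
    (\<exists>u v. 0 \<le> u \<and> u \<le> 1 \<and> 0 \<le> v \<and> v \<le> 1 \<and> c - a = u *\<^sub>R (b - a) - v *\<^sub>R (d - c))" (is "?L \<longleftrightarrow> ?R")
proof -
  have "?L \<longleftrightarrow> (\<exists>u v. 0 \<le> u \<and> u \<le> 1 \<and> 0 \<le> v \<and> v \<le> 1 \<and> (1 - u) *\<^sub>R a + u *\<^sub>R b = (1 - v) *\<^sub>R c + v *\<^sub>R d)"
    unfolding closed_segment_def by blast
  also have "\<dots> \<longleftrightarrow> ?R"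
    by (intro ex_cong1 conj_cong refl) (auto simp: algebra_simps)
  finally show ?thesis .
qed

lemma cramer2:
  fixes p q r :: "'a::real_inner"
  assumes r: "r = u *\<^sub>R p - v *\<^sub>R q" and D: "(p \<bullet> p) * (q \<bullet> q) - (p \<bullet> q) * (p \<bullet> q) \<noteq> 0"
  shows "u = ((r \<bullet> p) * (q \<bullet> q) - (r \<bullet> q) * (p \<bullet> q)) / ((p \<bullet> p) * (q \<bullet> q) - (p \<bullet> q) * (p \<bullet> q))"
    and "v = ((r \<bullet> p) * (p \<bullet> q) - (r \<bullet> q) * (p \<bullet> p)) / ((p \<bullet> p) * (q \<bullet> q) - (p \<bullet> q) * (p \<bullet> q))"
proof -
  have rp: "r \<bullet> p = u * (p \<bullet> p) - v * (p \<bullet> q)" by (simp add: r inner_diff_left inner_commute[of q p])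
  have rq: "r \<bullet> q = u * (p \<bullet> q) - v * (q \<bullet> q)" by (simp add: r inner_diff_left)
  show "u = ((r \<bullet> p) * (q \<bullet> q) - (r \<bullet> q) * (p \<bullet> q)) / ((p \<bullet> p) * (q \<bullet> q) - (p \<bullet> q) * (p \<bullet> q))"
    unfolding rp rq using D by (subst eq_divide_eq) (simp add: algebra_simps)
  show "v = ((r \<bullet> p) * (p \<bullet> q) - (r \<bullet> q) * (p \<bullet> p)) / ((p \<bullet> p) * (q \<bullet> q) - (p \<bullet> q) * (p \<bullet> q))"
    unfolding rp rq using D by (subst eq_divide_eq) (simp add: algebra_simps)
qed

text \<open>The interval \<open>[0, s]\<close> and the one between \<open>m\<close> and
  \<open>m + k\<close> are disjoint only if an end of the first separates them. The condition is
  stated without knowing the sign of \<open>k\<close>.\<close>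

lemma intervals_meet_iff:
  fixes s m k :: real
  assumes "s > 0"
  shows "(\<exists>u v. 0 \<le> u \<and> u \<le> 1 \<and> 0 \<le> v \<and> v \<le> 1 \<and> m = u * s - v * k)
     \<longleftrightarrow> \<not> (s < m \<and> s < m + k) \<and> \<not> (m < 0 \<and> m + k < 0)" (is "?L \<longleftrightarrow> ?R")
proof
  assume ?L
  then obtain u v where uv: "0 \<le> u" "u \<le> 1" "0 \<le> v" "v \<le> 1" "m = u * s - v * k" by blast
  have 1: "0 \<le> u * s" "u * s \<le> s" using uv assms by (auto simp: mult_left_le_one_le)
  have 2: "m + v * k = u * s" using uv by simp
  show ?R
  proof (cases "k \<ge> 0")
    case True
    then have "0 \<le> v * k" "v * k \<le> k" using uv by (auto simp: mult_left_le_one_le)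
    then show ?thesis using 1 2 True by linarith
  next
    case False
    then have "v * k \<le> 0" "k \<le> v * k" using uv mult_right_mono_neg[of v 1 k] 
      by (auto simp: mult_nonneg_nonpos)
    then show ?thesis using 1 2 False by linarith
  qed
next
  assume R: ?R
  consider "0 \<le> m" "m \<le> s" | "0 \<le> m + k" "m + k \<le> s" | "m < 0" "m + k > s" | "m > s" "m + k < 0"
    using R by linarith
  then show ?L
  proof cases
    case 1 then show ?thesis using assms by (intro exI[of _ "m / s"] exI[of _ 0]) auto
  next
    case 2 then show ?thesis using assms by (intro exI[of _ "(m + k) / s"] exI[of _ 1]) auto
  next
    \<comment> \<open>From here on 0 lies inside the second interval, so \<open>u = 0\<close>, and
      this determines \<open>v\<close>.\<close>
    case 3 then have "k > 0" using assms by linarith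
    with 3 assms show ?thesis by (intro exI[of _ 0] exI[of _ "- m / k"]) (auto simp: field_simps)
  next
    case 4 then have "k < 0" using assms by linarith
    with 4 assms show ?thesis by (intro exI[of _ 0] exI[of _ "- m / k"]) (auto simp: field_simps)
  qed
qed

text \<open>For independent directions Cramer's rule leaves one candidate pair of parameters, and
  only this pair needs testing. For parallel directions nothing is lost by projecting to the line,
  once collinearity is known.\<close>

lemma meet_iff:
  fixes P :: "'p \<Rightarrow> 'a::real_inner"
  assumes "P a \<noteq> P b"
  shows "meet (\<lambda>e f. P e \<bullet> P f) a b c d \<longleftrightarrow> closed_segment (P a) (P b) \<inter> closed_segment (P c) (P d) \<noteq> {}"
proof -
  let ?g = "\<lambda>e f. P e \<bullet> P f"
  define p where "p = P b - P a"
  define q where "q = P d - P c"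
  define r where "r = P c - P a"
  have p0: "p \<noteq> 0" using assms by (simp add: p_def)
  then have pp: "p \<bullet> p > 0" by simp
  have I: "iq ?g a b a b = p \<bullet> p" "iq ?g c d c d = q \<bullet> q" "iq ?g a b c d = p \<bullet> q" "iq ?g a c a b = r \<bullet> p"
    "iq ?g a c c d = r \<bullet> q" "iq ?g a c a c = r \<bullet> r" by (simp_all add: iq_inner p_def q_def r_def)
  define D where "D = (p \<bullet> p) * (q \<bullet> q) - (p \<bullet> q) * (p \<bullet> q)"
  have D: "disc ?g a b c d = D" by (simp add: disc_def I D_def)
  have R: "closed_segment (P a) (P b) \<inter> closed_segment (P c) (P d) \<noteq> {} \<longleftrightarrow>
    (\<exists>u v. 0 \<le> u \<and> u \<le> 1 \<and> 0 \<le> v \<and> v \<le> 1 \<and> r = u *\<^sub>R p - v *\<^sub>R q)"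
    by (simp add: closed_segment_meet_iff p_def q_def r_def)
  have gap: "gap ?g a b c d u v = 0 \<longleftrightarrow> r = u *\<^sub>R p - v *\<^sub>R q" for u v
  proof -
    have "gap ?g a b c d u v = (r - u *\<^sub>R p + v *\<^sub>R q) \<bullet> (r - u *\<^sub>R p + v *\<^sub>R q)"
      by (simp add: gap_def I inner_diff_left inner_diff_right inner_add_left inner_add_right
          inner_commute[of p r] inner_commute[of q r] inner_commute[of q p] algebra_simps)
    then have "gap ?g a b c d u v = 0 \<longleftrightarrow> r - u *\<^sub>R p + v *\<^sub>R q = 0" by simp
    then show ?thesis by (simp add: algebra_simps add_eq_0_iff2 eq_diff_eq)
  qed
  show ?thesis
  proof (cases "D = 0")
    case False
    have "r = u *\<^sub>R p - v *\<^sub>R q \<Longrightarrow> u = par1 ?g a b c d \<and> v = par2 ?g a b c d" for u v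
      using cramer2[of r u p v q] False by (simp add: D_def par1_def par2_def I disc_def)
    then show ?thesis unfolding R meet_def D using False by (auto simp: gap)
  next
    case True
    define k where "k = (p \<bullet> q) / (p \<bullet> p)"
    have q: "q = k *\<^sub>R p" unfolding k_def
      by (rule parallel_coeff) (use p0 True in \<open>auto simp: D_def\<close>)
    define m where "m = (r \<bullet> p) / (p \<bullet> p)"
    have "(\<exists>u v. 0 \<le> u \<and> u \<le> 1 \<and> 0 \<le> v \<and> v \<le> 1 \<and> r = u *\<^sub>R p - v *\<^sub>R q) \<longleftrightarrow>
      (r \<bullet> r) * (p \<bullet> p) = (r \<bullet> p) * (r \<bullet> p) \<and> (\<exists>u v. 0 \<le> u \<and> u \<le> 1 \<and> 0 \<le> v \<and> v \<le> 1 \<and> r \<bullet> p = u * (p \<bullet> p) - v * (p \<bullet> q))"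
      (is "?A \<longleftrightarrow> ?B \<and> ?C")
    proof
      assume ?A
      then obtain u v where uv: "0 \<le> u" "u \<le> 1" "0 \<le> v" "v \<le> 1" "r = u *\<^sub>R p - v *\<^sub>R q" by blast
      have "r = (u - v * k) *\<^sub>R p" using uv q by (simp add: algebra_simps)
      then have ?B by simp
      moreover have "r \<bullet> p = u * (p \<bullet> p) - v * (p \<bullet> q)" using uv by (simp add: inner_diff_left inner_commute[of q p])
      ultimately show "?B \<and> ?C" using uv by blast
    next
      assume BC: "?B \<and> ?C"
      then obtain u v where uv: "0 \<le> u" "u \<le> 1" "0 \<le> v" "v \<le> 1" "r \<bullet> p = u * (p \<bullet> p) - v * (p \<bullet> q)" by blast
      have r: "r = ((p \<bullet> r) / (p \<bullet> p)) *\<^sub>R p" 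
        by (rule parallel_coeff) (use p0 BC in \<open>auto simp: inner_commute mult.commute\<close>)
      have "(p \<bullet> r) / (p \<bullet> p) = u - v * k" using uv(5) pp by (simp add: k_def inner_commute field_simps)
      with r have "r = (u - v * k) *\<^sub>R p" by simp
      then have "r = u *\<^sub>R p - v *\<^sub>R q" using q by (simp add: algebra_simps)
      then show ?A using uv by blast
    qed
    then show ?thesis unfolding R meet_def D 
      using True intervals_meet_iff[OF pp, of "r \<bullet> p" "p \<bullet> q"] by (simp add: I)
  qed
qed


section \<open>Lines and planes spanned by segments\<close>

text \<open>Points are named by pairs: \<open>False\<close> or \<open>True\<close> for the first or
  second endpoint, and the index of the segment.\<close>

definition touches :: "(bool \<times> nat \<Rightarrow> bool \<times> nat \<Rightarrow> real) \<Rightarrow> nat \<Rightarrow> nat \<Rightarrow> bool" where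
  "touches g i j = meet g (False, i) (True, i) (False, j) (True, j)"

definition param :: "(bool \<times> nat \<Rightarrow> bool \<times> nat \<Rightarrow> real) \<Rightarrow> nat \<Rightarrow> nat \<Rightarrow> real" where
  "param g i j = par1 g (False, i) (True, i) (False, j) (True, j)"

text \<open>An endpoint of \<open>y\<close> off the line of \<open>x\<close>, if there is one. If
  both lie on that line the default does no harm, because \<open>plane_contains\<close> tests the
  determinant again.\<close>

definition tip :: "(bool \<times> nat \<Rightarrow> bool \<times> nat \<Rightarrow> real) \<Rightarrow> nat \<Rightarrow> nat \<Rightarrow> bool \<times> nat" where
  "tip g x y = (if gram2 g (False, x) (True, x) (False, y) \<noteq> 0 then (False, y) else (True, y))"

definition inplane :: "(bool \<times> nat \<Rightarrow> bool \<times> nat \<Rightarrow> real) \<Rightarrow> nat \<Rightarrow> nat \<Rightarrow> bool \<times> nat \<Rightarrow> bool" where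
  "inplane g x y z \<longleftrightarrow> gram3 g (False, x) (True, x) (tip g x y) z = 0"

text \<open>The relation fails for every \<open>t\<close> unless \<open>x\<close> and
  \<open>y\<close> are coplanar and not collinear; so \<open>plane_contains g x y x\<close>
  expresses that the pair spans a plane.\<close>

definition plane_contains :: "(bool \<times> nat \<Rightarrow> bool \<times> nat \<Rightarrow> real) \<Rightarrow> nat \<Rightarrow> nat \<Rightarrow> nat \<Rightarrow> bool" where
  "plane_contains g x y t \<longleftrightarrow> gram2 g (False, x) (True, x) (tip g x y) \<noteq> 0
     \<and> inplane g x y (False, y) \<and> inplane g x y (True, y) \<and> inplane g x y (False, t) \<and> inplane g x y (True, t)"

text \<open>Inner products with the two spanning vectors serve as coordinates, so no basis has to be
  orthogonalised. They are injective on the plane: a vector of the span with both coordinates 0 is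
  orthogonal to itself.\<close>

definition cx :: "(bool \<times> nat \<Rightarrow> bool \<times> nat \<Rightarrow> real) \<Rightarrow> nat \<Rightarrow> nat \<Rightarrow> bool \<times> nat \<Rightarrow> real" where
  "cx g x y z = iq g (False, x) z (False, x) (True, x)"

definition cy :: "(bool \<times> nat \<Rightarrow> bool \<times> nat \<Rightarrow> real) \<Rightarrow> nat \<Rightarrow> nat \<Rightarrow> bool \<times> nat \<Rightarrow> real" where
  "cy g x y z = iq g (False, x) z (False, x) (tip g x y)"

definition plane_order :: "(bool \<times> nat \<Rightarrow> bool \<times> nat \<Rightarrow> real) \<Rightarrow> nat \<Rightarrow> nat \<Rightarrow> nat \<Rightarrow> nat \<Rightarrow> nat \<Rightarrow> bool" where
  "plane_order g i x y t u \<longleftrightarrow> \<not> touches g t u \<and> prec (cx g x y) (cy g x y) i (False, t) (True, t) (False, u) (True, u)"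

text \<open>Every index carries a proper segment, also beyond the input, so that the geometric
  lemmas are free of range conditions.\<close>

locale seg_geometry =
  fixes P :: "bool \<times> nat \<Rightarrow> 'a::real_inner"
  assumes nondeg: "P (False, i) \<noteq> P (True, i)"
begin

definition G :: "bool \<times> nat \<Rightarrow> bool \<times> nat \<Rightarrow> real" where "G = (\<lambda>e f. P e \<bullet> P f)"

definition sg :: "nat \<Rightarrow> 'a set" where "sg i = closed_segment (P (False, i)) (P (True, i))"

definition dir :: "nat \<Rightarrow> 'a" where "dir i = P (True, i) - P (False, i)"

definition pl :: "nat \<Rightarrow> nat \<Rightarrow> 'a set" where
  "pl x y = {z. \<exists>s t. z = P (False, x) + s *\<^sub>R dir x + t *\<^sub>R (P (tip G x y) - P (False, x))}"

lemma dir_nonzero: "dir i \<noteq> 0"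
  using nondeg[of i] by (simp add: dir_def)

lemma touches_iff: "touches G i j \<longleftrightarrow> sg i \<inter> sg j \<noteq> {}"
  unfolding touches_def G_def sg_def by (rule meet_iff) (rule nondeg)

lemma touches_refl: "touches G i i"
  by (simp add: touches_iff sg_def)

lemma touches_sym: "touches G i j \<Longrightarrow> touches G j i"
  by (auto simp: touches_iff)

lemma gram2_G: "gram2 G (False, x) (True, x) z =
    (dir x \<bullet> dir x) * ((P z - P (False, x)) \<bullet> (P z - P (False, x)))
    - (dir x \<bullet> (P z - P (False, x))) * (dir x \<bullet> (P z - P (False, x)))"
  unfolding gram2_def G_def iq_inner dir_def ..

lemma gram2_zero: "gram2 G (False, x) (True, x) z = 0 \<Longrightarrow> \<exists>s. P z = P (False, x) + s *\<^sub>R dir x"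
  using parallel_coeff[of "dir x" "P z - P (False, x)"] dir_nonzero[of x] unfolding gram2_G
  by (metis add.commute diff_add_cancel eq_iff_diff_eq_0)

lemma inplane_iff:
  assumes "gram2 G (False, x) (True, x) (tip G x y) \<noteq> 0"
  shows "inplane G x y z \<longleftrightarrow> P z \<in> pl x y"
proof -
  have "inplane G x y z \<longleftrightarrow> (\<exists>s t. P z - P (False, x) = s *\<^sub>R dir x + t *\<^sub>R (P (tip G x y) - P (False, x)))"
    using span2_iff[of "dir x" "P (tip G x y) - P (False, x)" "P z - P (False, x)"] assms
    unfolding inplane_def gram2_G by (simp add: gram3_def G_def iq_inner flip: dir_def)
  also have "\<dots> \<longleftrightarrow> P z \<in> pl x y" unfolding pl_def
    by (simp add: diff_eq_eq add_ac)
  finally show ?thesis .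
qed

lemma pl_affine: 
  assumes "u \<in> pl x y" "v \<in> pl x y"
  shows "u + k *\<^sub>R (v - u) \<in> pl x y"
proof -
  let ?w = "P (tip G x y) - P (False, x)"
  obtain s t s' t' where u: "u = P (False, x) + s *\<^sub>R dir x + t *\<^sub>R ?w"
    and v: "v = P (False, x) + s' *\<^sub>R dir x + t' *\<^sub>R ?w"
    using assms unfolding pl_def by blast
  have "u + k *\<^sub>R (v - u) = P (False, x) + (s + k * (s' - s)) *\<^sub>R dir x + (t + k * (t' - t)) *\<^sub>R ?w"
    unfolding u v by (simp add: algebra_simps)
  then show ?thesis unfolding pl_def by blast
qed

lemma sgE:
  assumes "z \<in> sg i"
  obtains u where "0 \<le> u" "u \<le> 1" "z = P (False, i) + u *\<^sub>R dir i"
  using assms unfolding sg_def closed_segment_def dir_def by (auto simp: algebra_simps)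

lemma sgI: "0 \<le> u \<Longrightarrow> u \<le> 1 \<Longrightarrow> P (False, i) + u *\<^sub>R dir i \<in> sg i"
  unfolding sg_def closed_segment_def dir_def by (auto simp: algebra_simps intro!: exI[of _ u])

lemma sg_subset_pl:
  assumes "P (False, i) \<in> pl x y" "P (True, i) \<in> pl x y"
  shows "sg i \<subseteq> pl x y"
  using pl_affine[OF assms] by (auto elim!: sgE simp: dir_def)

lemma two_points:
  assumes "u \<in> sg i" "v \<in> sg i" "u \<noteq> v" "w \<in> sg i"
  shows "\<exists>k. w = u + k *\<^sub>R (v - u)"
proof -
  obtain k l m where u: "u = P (False, i) + k *\<^sub>R dir i" and v: "v = P (False, i) + l *\<^sub>R dir i"
    and w: "w = P (False, i) + m *\<^sub>R dir i"
    using assms by (metis sgE)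
  have kl: "l - k \<noteq> 0" using u v assms(3) by auto
  have "w = u + ((m - k) / (l - k)) *\<^sub>R (v - u)"
  proof -
    have "v - u = (l - k) *\<^sub>R dir i" by (simp add: u v scaleR_diff_left)
    then have "((m - k) / (l - k)) *\<^sub>R (v - u) = (m - k) *\<^sub>R dir i" using kl by simp
    then show ?thesis by (simp add: u w algebra_simps)
  qed
  then show ?thesis ..
qed

lemma endpoints_in_sg: "P (False, i) \<in> sg i" "P (True, i) \<in> sg i"
  unfolding sg_def by simp_all

lemma sg_subset_pl':
  assumes "u \<in> sg i" "v \<in> sg i" "u \<noteq> v" "u \<in> pl x y" "v \<in> pl x y"
  shows "sg i \<subseteq> pl x y"
  using two_points[OF assms(1-3)] pl_affine[OF assms(4,5)] by blast

lemma pl_base: "P (False, x) \<in> pl x y" "P (True, x) \<in> pl x y" "P (tip G x y) \<in> pl x y"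
proof -
  have "P (True, x) = P (False, x) + 1 *\<^sub>R dir x + 0 *\<^sub>R (P (tip G x y) - P (False, x))"
    by (simp add: dir_def)
  then show "P (True, x) \<in> pl x y" unfolding pl_def by blast
  have "P (False, x) = P (False, x) + 0 *\<^sub>R dir x + 0 *\<^sub>R (P (tip G x y) - P (False, x))" by simp
  then show "P (False, x) \<in> pl x y" unfolding pl_def by blast
  have "P (tip G x y) = P (False, x) + 0 *\<^sub>R dir x + 1 *\<^sub>R (P (tip G x y) - P (False, x))" by simp
  then show "P (tip G x y) \<in> pl x y" unfolding pl_def by blast
qed

lemma plane_contains_iff:
  "plane_contains G x y t \<longleftrightarrow> gram2 G (False, x) (True, x) (tip G x y) \<noteq> 0 \<and> sg x \<subseteq> pl x y \<and> sg y \<subseteq> pl x y \<and> sg t \<subseteq> pl x y"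
proof (cases "gram2 G (False, x) (True, x) (tip G x y) = 0")
  case True
  then show ?thesis by (simp add: plane_contains_def)
next
  case False
  have "sg i \<subseteq> pl x y \<longleftrightarrow> P (False, i) \<in> pl x y \<and> P (True, i) \<in> pl x y" for i
    using sg_subset_pl endpoints_in_sg by blast
  then show ?thesis unfolding plane_contains_def by (simp add: False inplane_iff pl_base)
qed

text \<open>A segment not contained in the plane has at most one point in it, so \<open>t\<close>
  and \<open>u\<close> both pass through that point of \<open>z\<close>.\<close>

lemma coplanar_touch:
  assumes "plane_contains G x y t" "plane_contains G x y u" "\<not> plane_contains G x y z" "touches G t z" "touches G u z"
  shows "touches G t u"
proof -
  obtain v w where "v \<in> sg t" "v \<in> sg z" "w \<in> sg u" "w \<in> sg z"
    using assms(4,5) by (auto simp: touches_iff)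
  moreover have "v = w"
    using sg_subset_pl'[of v z w x y] calculation assms(1-3) unfolding plane_contains_iff by blast
  ultimately show ?thesis by (auto simp: touches_iff)
qed

text \<open>\<open>t\<close> meets the disjoint segments \<open>x\<close> and \<open>y\<close> in
  two different points of their plane, hence lies in it.\<close>

lemma coplanar_both:
  assumes "\<not> touches G x y" "plane_contains G x y x" "touches G t x" "touches G t y"
  shows "plane_contains G x y t"
proof -
  obtain v w where "v \<in> sg t" "v \<in> sg x" "w \<in> sg t" "w \<in> sg y"
    using assms(3,4) by (auto simp: touches_iff)
  then show ?thesis
    using sg_subset_pl'[of v t w x y] assms(1,2) unfolding plane_contains_iff touches_iff by blast
qed

lemma pl_subset:
  assumes "P (False, x) \<in> pl x' y'" "P (True, x) \<in> pl x' y'" "P (tip G x y) \<in> pl x' y'"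
  shows "pl x y \<subseteq> pl x' y'"
proof
  fix z assume "z \<in> pl x y"
  then obtain s t where z: "z = P (False, x) + s *\<^sub>R dir x + t *\<^sub>R (P (tip G x y) - P (False, x))"
    unfolding pl_def by blast
  \<comment> \<open>With doubled coefficients \<open>z\<close> is the midpoint of two points, each
    an affine combination of two given ones, so \<open>pl_affine\<close> applies three
    times.\<close>
  let ?u = "P (False, x) + (2 * s) *\<^sub>R (P (True, x) - P (False, x))"
  let ?v = "P (False, x) + (2 * t) *\<^sub>R (P (tip G x y) - P (False, x))"
  have "?u + (1/2) *\<^sub>R (?v - ?u) \<in> pl x' y'"
    by (intro pl_affine assms)
  also have "?u + (1/2) *\<^sub>R (?v - ?u) = z"
  proof -
    have "(1/2) *\<^sub>R (?v - ?u) = t *\<^sub>R (P (tip G x y) - P (False, x)) - s *\<^sub>R dir x"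
      by (simp add: scaleR_diff_right dir_def)
    moreover have "(2 * s) *\<^sub>R (P (True, x) - P (False, x)) = s *\<^sub>R dir x + s *\<^sub>R dir x"
      by (simp add: dir_def flip: scaleR_add_left)
    ultimately show ?thesis unfolding z by simp
  qed
  finally show "z \<in> pl x' y'" .
qed

text \<open>Three affinely independent points determine a plane. \<open>D\<close> is the determinant
  of the change between the spanning vectors; if it vanished, independence of \<open>p\<close> and
  \<open>w\<close> would force the coefficients and thereby \<open>p\<close> to be 0.\<close>

lemma pl_eq:
  assumes g: "gram2 G (False, x) (True, x) (tip G x y) \<noteq> 0"
    and sub: "P (False, x) \<in> pl x' y'" "P (True, x) \<in> pl x' y'" "P (tip G x y) \<in> pl x' y'"
  shows "pl x y = pl x' y'"
proof
  show "pl x y \<subseteq> pl x' y'" using sub by (rule pl_subset)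
  let ?o = "P (False, x)" and ?o' = "P (False, x')"
  define p w p' w' where "p = dir x" and "w = P (tip G x y) - ?o" and "p' = dir x'" and "w' = P (tip G x' y') - ?o'"
  obtain a b where o: "?o = ?o' + a *\<^sub>R p' + b *\<^sub>R w'" using sub(1) unfolding pl_def p'_def w'_def by blast
  obtain c d where q: "P (True, x) = ?o' + c *\<^sub>R p' + d *\<^sub>R w'" using sub(2) unfolding pl_def p'_def w'_def by blast
  obtain e f where r: "P (tip G x y) = ?o' + e *\<^sub>R p' + f *\<^sub>R w'" using sub(3) unfolding pl_def p'_def w'_def by blast
  have p: "p = (c - a) *\<^sub>R p' + (d - b) *\<^sub>R w'" by (simp add: p_def dir_def q o algebra_simps)
  have w: "w = (e - a) *\<^sub>R p' + (f - b) *\<^sub>R w'" by (simp add: w_def r o algebra_simps)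
  define D where "D = (c - a) * (f - b) - (d - b) * (e - a)"
  have 1: "(f - b) *\<^sub>R p + (- (d - b)) *\<^sub>R w = D *\<^sub>R p'" unfolding p w D_def by (simp add: algebra_simps)
  have 2: "(- (e - a)) *\<^sub>R p + (c - a) *\<^sub>R w = D *\<^sub>R w'" unfolding p w D_def by (simp add: algebra_simps)
  have ind: "(p \<bullet> p) * (w \<bullet> w) - (p \<bullet> w) * (p \<bullet> w) \<noteq> 0"
    using g unfolding gram2_G p_def w_def .
  have D: "D \<noteq> 0"
  proof
    assume "D = 0"
    then have "d - b = 0" "c - a = 0" using independent_zero[OF ind 1[unfolded \<open>D = 0\<close> scaleR_zero_left]]
       independent_zero[OF ind 2[unfolded \<open>D = 0\<close> scaleR_zero_left]] by auto
    then have "p = 0" using p by simp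
    then show False using dir_nonzero p_def by auto
  qed
  have p': "p' = ((f - b) / D) *\<^sub>R p + (- (d - b) / D) *\<^sub>R w"
    using arg_cong[OF 1, of "\<lambda>z. (1 / D) *\<^sub>R z"] D by (simp add: scaleR_add_right)
  have w': "w' = (- (e - a) / D) *\<^sub>R p + ((c - a) / D) *\<^sub>R w"
    using arg_cong[OF 2, of "\<lambda>z. (1 / D) *\<^sub>R z"] D by (simp add: scaleR_add_right)
  have mem: "?o + s *\<^sub>R p' + t *\<^sub>R w' \<in> pl x y" for s t
  proof -
    have "?o + s *\<^sub>R p' + t *\<^sub>R w' = ?o + (s * ((f - b) / D) + t * (- (e - a) / D)) *\<^sub>R p 
        + (s * (- (d - b) / D) + t * ((c - a) / D)) *\<^sub>R w"
      by (subst p', subst w') (simp only: scaleR_add_right scaleR_add_left scaleR_scaleR add_ac)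
    then show ?thesis unfolding pl_def p_def w_def by blast
  qed
  show "pl x' y' \<subseteq> pl x y"
  proof
    fix z assume "z \<in> pl x' y'"
    then obtain s t where "z = ?o' + s *\<^sub>R p' + t *\<^sub>R w'" unfolding pl_def p'_def w'_def by blast
    then have "z = ?o + (s - a) *\<^sub>R p' + (t - b) *\<^sub>R w'" by (simp add: o algebra_simps)
    then show "z \<in> pl x y" using mem by simp
  qed
qed

text \<open>Both planes contain \<open>x\<close> and the tip of \<open>y\<close>, which are in
  general position.\<close>

lemma coplanar_unique:
  assumes "plane_contains G x y x" "plane_contains G x' y' x" "plane_contains G x' y' y"
  shows "plane_contains G x y z \<longleftrightarrow> plane_contains G x' y' z"
proof -
  have "P (tip G x y) \<in> sg y" using endpoints_in_sg[of y] by (auto simp: tip_def)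
  then have "pl x y = pl x' y'" using assms endpoints_in_sg[of x] by (intro pl_eq) (auto simp: plane_contains_iff)
  then show ?thesis using assms by (auto simp: plane_contains_iff)
qed

text \<open>Without a common plane, either the whole of \<open>y\<close> lies on the line of
  \<open>x\<close>, or the two directions and a connecting vector are independent. Parallel or
  crossing lines fall under neither case, since they span a plane.\<close>

lemma not_coplanar_cases:
  assumes "\<not> plane_contains G x y x"
  obtains (line) k l where "P (False, y) = P (False, x) + k *\<^sub>R dir x" "P (True, y) = P (False, x) + l *\<^sub>R dir x"
  | (skew) "\<And>c d e. c *\<^sub>R dir x + d *\<^sub>R dir y + e *\<^sub>R (P (False, y) - P (False, x)) = 0 \<Longrightarrow> c = 0 \<and> d = 0 \<and> e = 0"
proof (cases "gram2 G (False, x) (True, x) (tip G x y) = 0")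
  case True
  then have "gram2 G (False, x) (True, x) (False, y) = 0" "gram2 G (False, x) (True, x) (True, y) = 0"
    by (auto simp: tip_def split: if_splits)
  then show ?thesis using line gram2_zero by metis
next
  case False
  \<comment> \<open>If the first endpoint of \<open>y\<close> lay on the line of \<open>x\<close>,
    the plane through the second one would contain all of \<open>y\<close>; hence the tip is the
    first endpoint.\<close>
  have tip: "gram2 G (False, x) (True, x) (False, y) \<noteq> 0"
  proof
    assume *: "gram2 G (False, x) (True, x) (False, y) = 0"
    obtain s where "P (False, y) = P (False, x) + s *\<^sub>R (P (True, x) - P (False, x))" 
      using gram2_zero[OF *] by (auto simp: dir_def)
    then have "P (False, y) \<in> pl x y" using pl_affine[OF pl_base(1,2)] by simp
    moreover have "P (True, y) \<in> pl x y" using pl_base(3)[of x y] * by (simp add: tip_def)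
    ultimately show False using assms False sg_subset_pl pl_base unfolding plane_contains_iff by blast
  qed
  then have tipeq: "tip G x y = (False, y)" by (simp add: tip_def)
  define r where "r = P (False, y) - P (False, x)"
  have ind: "(dir x \<bullet> dir x) * (r \<bullet> r) - (dir x \<bullet> r) * (dir x \<bullet> r) \<noteq> 0" using tip unfolding gram2_G r_def .
  show ?thesis
  proof (rule skew)
    fix c d e assume "c *\<^sub>R dir x + d *\<^sub>R dir y + e *\<^sub>R (P (False, y) - P (False, x)) = 0"
    then have eq: "c *\<^sub>R dir x + d *\<^sub>R dir y + e *\<^sub>R r = 0" by (simp add: r_def)
    have d: "d = 0"
    proof (rule ccontr)
      assume "d \<noteq> 0"
      have "d *\<^sub>R dir y = - (c *\<^sub>R dir x + e *\<^sub>R r)" 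
        by (rule eq_neg_iff_add_eq_0[THEN iffD2]) (use eq in \<open>simp only: add_ac\<close>)
      have "dir y = (1 / d) *\<^sub>R (d *\<^sub>R dir y)" using \<open>d \<noteq> 0\<close> by simp
      also have "\<dots> = (- c / d) *\<^sub>R dir x + (- e / d) *\<^sub>R r"
        unfolding \<open>d *\<^sub>R dir y = _\<close> by (simp add: scaleR_diff_right)
      finally have "dir y = (- c / d) *\<^sub>R dir x + (- e / d) *\<^sub>R r" .
      then have "P (True, y) = P (False, x) + (- c / d) *\<^sub>R dir x + (1 - e / d) *\<^sub>R r"
        by (simp add: dir_def[of y] r_def algebra_simps)
      then have "P (True, y) \<in> pl x y" unfolding pl_def tipeq r_def by blast
      moreover have "P (False, y) \<in> pl x y" using pl_base(3)[of x y] tipeq by simp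
      ultimately show False using assms False sg_subset_pl pl_base unfolding plane_contains_iff by blast
    qed
    then have "c *\<^sub>R dir x + e *\<^sub>R r = 0" using eq by simp
    then show "c = 0 \<and> d = 0 \<and> e = 0" using independent_zero[OF ind] d by auto
  qed
qed


lemma touch_paramsE:
  assumes "touches G t x"
  obtains u v where "0 \<le> u" "u \<le> 1" "0 \<le> v" "v \<le> 1"
    "P (False, t) + v *\<^sub>R dir t = P (False, x) + u *\<^sub>R dir x" "P (False, x) + u *\<^sub>R dir x \<in> sg t"
proof -
  obtain z where z: "z \<in> sg t" "z \<in> sg x" using assms by (auto simp: touches_iff)
  then show ?thesis using that by (metis sgE)
qed

lemma param_eq:
  assumes "P (False, t) + v *\<^sub>R dir t = P (False, x) + u *\<^sub>R dir x" "disc G (False, x) (True, x) (False, t) (True, t) \<noteq> 0"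
  shows "param G x t = u"
proof -
  have "P (False, t) - P (False, x) = u *\<^sub>R dir x - v *\<^sub>R dir t"
    using assms(1) by (simp add: algebra_simps)
  then have "u = par1 G (False, x) (True, x) (False, t) (True, t)"
    using cramer2(1)[of "P (False, t) - P (False, x)" u "dir x" v "dir t"] assms(2)
    unfolding par1_def disc_def G_def iq_inner by (simp add: dir_def)
  then show ?thesis by (simp add: param_def)
qed

lemma disc_zero:
  assumes "disc G (False, x) (True, x) (False, t) (True, t) = 0"
  obtains c where "dir t = c *\<^sub>R dir x" "c \<noteq> 0"
proof -
  define c where "c = (dir x \<bullet> dir t) / (dir x \<bullet> dir x)"
  have "dir t = c *\<^sub>R dir x" unfolding c_def
    by (rule parallel_coeff) (use assms dir_nonzero in \<open>auto simp: disc_def G_def iq_inner dir_def\<close>)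
  then show ?thesis using that dir_nonzero[of t] by force
qed

lemma disc_parallel:
  assumes "dir t = c *\<^sub>R dir x"
  shows "disc G (False, x) (True, x) (False, t) (True, t) = 0"
  unfolding disc_def G_def iq_inner dir_def[symmetric] assms by simp

text \<open>Division by 0 yields 0, so all segments parallel to \<open>x\<close> share one
  parameter. The collinear case relies on this default.\<close>

lemma param_parallel:
  assumes "dir t = c *\<^sub>R dir x"
  shows "param G x t = 0"
  unfolding param_def par1_def disc_parallel[OF assms] by simp

definition skew :: "nat \<Rightarrow> nat \<Rightarrow> bool" where
  "skew x y \<longleftrightarrow> (\<forall>c d e. c *\<^sub>R dir x + d *\<^sub>R dir y + e *\<^sub>R (P (False, y) - P (False, x)) = 0 \<longrightarrow> c = 0 \<and> d = 0 \<and> e = 0)"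

text \<open>A transversal of two skew lines is parallel to neither of them, since otherwise the
  connecting vector would be a combination of the two directions. So its parameters are genuine
  positions.\<close>

lemma skew_transversal:
  assumes "skew x y" "touches G t x" "touches G t y"
  shows "P (False, x) + param G x t *\<^sub>R dir x \<in> sg t" "P (False, y) + param G y t *\<^sub>R dir y \<in> sg t"
proof -
  obtain u v where u: "P (False, t) + v *\<^sub>R dir t = P (False, x) + u *\<^sub>R dir x" "P (False, x) + u *\<^sub>R dir x \<in> sg t"
    using touch_paramsE[OF assms(2)] by metis
  obtain u' v' where u': "P (False, t) + v' *\<^sub>R dir t = P (False, y) + u' *\<^sub>R dir y" "P (False, y) + u' *\<^sub>R dir y \<in> sg t"
    using touch_paramsE[OF assms(3)] by metis
  have e: "P (False, y) - P (False, x) = u *\<^sub>R dir x - u' *\<^sub>R dir y + (v' - v) *\<^sub>R dir t"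
    using arg_cong2[OF u(1) u'(1), of "(-)"] by (simp add: algebra_simps)
  have "disc G (False, x) (True, x) (False, t) (True, t) \<noteq> 0"
  proof
    assume "disc G (False, x) (True, x) (False, t) (True, t) = 0"
    then obtain c where c: "dir t = c *\<^sub>R dir x" by (metis disc_zero)
    have "(- u - (v' - v) * c) *\<^sub>R dir x + u' *\<^sub>R dir y + 1 *\<^sub>R (P (False, y) - P (False, x)) = 0"
      unfolding e c by (simp add: algebra_simps)
    then show False using assms(1) unfolding skew_def by (metis zero_neq_one)
  qed
  then show "P (False, x) + param G x t *\<^sub>R dir x \<in> sg t" using param_eq[OF u(1)] u(2) by simp
  have "disc G (False, y) (True, y) (False, t) (True, t) \<noteq> 0"
  proof
    assume "disc G (False, y) (True, y) (False, t) (True, t) = 0"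
    then obtain c where c: "dir t = c *\<^sub>R dir y" by (metis disc_zero)
    have "(- u) *\<^sub>R dir x + (u' - (v' - v) * c) *\<^sub>R dir y + 1 *\<^sub>R (P (False, y) - P (False, x)) = 0"
      unfolding e c by (simp add: algebra_simps)
    then show False using assms(1) unfolding skew_def by (metis zero_neq_one)
  qed
  then show "P (False, y) + param G y t *\<^sub>R dir y \<in> sg t" using param_eq[OF u'(1)] u'(2) by simp
qed

text \<open>A common point of two transversals has unique coefficients with respect to the three
  independent vectors. Comparing them gives \<open>k = l\<close>, then
  \<open>(1 - k) * (X - X') = 0\<close> and \<open>k * (Y - Y') = 0\<close>, so one of the two
  parameters agrees.\<close>

lemma skew_touch:
  assumes "skew x y" "\<not> touches G x y" "touches G t x" "touches G t y" "touches G u x" "touches G u y" "touches G t u"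
  shows "param G x t = param G x u \<or> param G y t = param G y u"
proof (rule ccontr)
  assume neg: "\<not> ?thesis"
  define X X' Y Y' where "X = param G x t" and "X' = param G x u" and "Y = param G y t" and "Y' = param G y u"
  have neq: "X \<noteq> X'" "Y \<noteq> Y'" using neg by (auto simp: X_def X'_def Y_def Y'_def)
  let ?a = "P (False, x)" and ?b = "P (False, y)"
  have mem: "?a + X *\<^sub>R dir x \<in> sg t" "?b + Y *\<^sub>R dir y \<in> sg t" "?a + X' *\<^sub>R dir x \<in> sg u" "?b + Y' *\<^sub>R dir y \<in> sg u"
    using skew_transversal assms unfolding X_def X'_def Y_def Y'_def by blast+
  have sk: "c *\<^sub>R dir x + d *\<^sub>R dir y + e *\<^sub>R (?b - ?a) = 0 \<Longrightarrow> c = 0 \<and> d = 0 \<and> e = 0" for c d e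
    using assms(1) by (auto simp: skew_def)
  have dist: "?a + s *\<^sub>R dir x \<noteq> ?b + s' *\<^sub>R dir y" for s s'
  proof
    assume "?a + s *\<^sub>R dir x = ?b + s' *\<^sub>R dir y"
    then have "(- s) *\<^sub>R dir x + s' *\<^sub>R dir y + 1 *\<^sub>R (?b - ?a) = 0" by (simp add: algebra_simps)
    then show False using sk by (metis zero_neq_one)
  qed
  obtain z where z: "z \<in> sg t" "z \<in> sg u" using assms(7) by (auto simp: touches_iff)
  obtain k where k: "z = ?a + X *\<^sub>R dir x + k *\<^sub>R (?b + Y *\<^sub>R dir y - (?a + X *\<^sub>R dir x))"
    using two_points[OF mem(1,2) dist z(1)] by blast
  obtain l where l: "z = ?a + X' *\<^sub>R dir x + l *\<^sub>R (?b + Y' *\<^sub>R dir y - (?a + X' *\<^sub>R dir x))"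
    using two_points[OF mem(3,4) dist z(2)] by blast
  have "((1 - k) * X - (1 - l) * X') *\<^sub>R dir x + (k * Y - l * Y') *\<^sub>R dir y + (k - l) *\<^sub>R (?b - ?a) = 0"
    using trans[OF k[symmetric] l] by (simp add: algebra_simps)
  then have "(1 - k) * X - (1 - l) * X' = 0 \<and> k * Y - l * Y' = 0 \<and> k - l = 0" by (rule sk)
  then have "(1 - k) * (X - X') = 0" "k * (Y - Y') = 0" by (auto simp: algebra_simps)
  then show False using neq by auto
qed

text \<open>If \<open>x\<close> and \<open>y\<close> are collinear, every transversal contains two
  points of their line and is parallel to it, so all parameters take the default value 0.\<close>

lemma noncoplanar_touch:
  assumes "\<not> touches G x y" "\<not> plane_contains G x y x" "touches G t x" "touches G t y" "touches G u x" "touches G u y" "touches G t u"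
  shows "param G x t = param G x u \<or> param G y t = param G y u"
  using assms(2)
proof (cases rule: not_coplanar_cases)
  case skew
  then have "skew x y" by (auto simp: skew_def)
  then show ?thesis using skew_touch assms by blast
next
  case (line k l)
  have "param G x s = 0" if s: "touches G s x" "touches G s y" for s
  proof -
    obtain m v where m: "P (False, s) + v *\<^sub>R dir s = P (False, x) + m *\<^sub>R dir x" "P (False, x) + m *\<^sub>R dir x \<in> sg x"
      using touch_paramsE[OF s(1)] sgI by metis
    obtain m' v' where m': "P (False, s) + v' *\<^sub>R dir s = P (False, y) + m' *\<^sub>R dir y" "P (False, y) + m' *\<^sub>R dir y \<in> sg y"
      using touch_paramsE[OF s(2)] sgI by metis
    have "P (False, y) + m' *\<^sub>R dir y = P (False, x) + (k + m' * (l - k)) *\<^sub>R dir x"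
      by (simp add: dir_def[of y] line algebra_simps)
    with m'(1) have ev: "P (False, s) + v' *\<^sub>R dir s = P (False, x) + (k + m' * (l - k)) *\<^sub>R dir x" by simp
    have "(v' - v) *\<^sub>R dir s = (P (False, s) + v' *\<^sub>R dir s) - (P (False, s) + v *\<^sub>R dir s)"
      by (simp add: scaleR_diff_left)
    also have "\<dots> = (k + m' * (l - k) - m) *\<^sub>R dir x" unfolding ev m(1) by (simp only: scaleR_diff_left add_diff_cancel_left)
    finally have e: "(v' - v) *\<^sub>R dir s = (k + m' * (l - k) - m) *\<^sub>R dir x" .
    \<comment> \<open>The points of contact differ because \<open>x\<close> and \<open>y\<close> are
      disjoint.\<close>
    have "v' - v \<noteq> 0" using m m' assms(1) by (auto simp: touches_iff)
    then have "dir s = ((k + m' * (l - k) - m) / (v' - v)) *\<^sub>R dir x"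
      using arg_cong[OF e, of "\<lambda>z. (1 / (v' - v)) *\<^sub>R z"] by simp
    then show ?thesis by (rule param_parallel)
  qed
  then show ?thesis using assms by simp
qed

text \<open>A segment meeting two disjoint collinear segments covers the gap between them; the end
  of \<open>x\<close> facing \<open>y\<close> is therefore common to all of them.\<close>

lemma collinear_gap:
  assumes line: "P (False, y) = P (False, x) + k *\<^sub>R dir x" "P (True, y) = P (False, x) + l *\<^sub>R dir x"
    and d: "\<not> touches G x y"
  obtains z where "\<And>t. touches G t x \<Longrightarrow> touches G t y \<Longrightarrow> z \<in> sg t"
proof -
  \<comment> \<open>Measured along \<open>x\<close>, the segment \<open>x\<close> is the interval
    from 0 to 1 and \<open>y\<close> runs between \<open>k\<close> and \<open>l\<close>.\<close>
  have "1 < k \<and> 1 < l \<or> k < 0 \<and> l < 0"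
  proof (rule ccontr)
    assume "\<not> ?thesis"
    then obtain u v where uv: "0 \<le> u" "u \<le> 1" "0 \<le> v" "v \<le> 1" "k = u * 1 - v * (l - k)"
      using intervals_meet_iff[of 1 k "l - k"] by auto
    have "P (False, y) + v *\<^sub>R dir y = P (False, x) + (k + v * (l - k)) *\<^sub>R dir x"
      by (simp add: dir_def[of y] line algebra_simps)
    also have "k + v * (l - k) = u" using uv by simp
    finally show False using sgI[of v y] sgI[of u x] uv d by (auto simp: touches_iff)
  qed
  moreover have "P (False, x) + e *\<^sub>R dir x \<in> sg t" if t: "touches G t x" "touches G t y"
    and e: "e = 1 \<and> 1 < k \<and> 1 < l \<or> e = 0 \<and> k < 0 \<and> l < 0" for e t
  proof -
    obtain m where m: "0 \<le> m" "m \<le> 1" "P (False, x) + m *\<^sub>R dir x \<in> sg t" 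
      using touch_paramsE[OF t(1)] by metis
    obtain m' where m': "0 \<le> m'" "m' \<le> 1" "P (False, y) + m' *\<^sub>R dir y \<in> sg t" 
      using touch_paramsE[OF t(2)] by metis
    \<comment> \<open>The position along \<open>x\<close> of the point where \<open>t\<close>
      touches \<open>y\<close>; it lies strictly beyond the end \<open>e\<close> of
      \<open>x\<close>.\<close>
    define n where "n = k + m' * (l - k)"
    have n: "P (False, y) + m' *\<^sub>R dir y = P (False, x) + n *\<^sub>R dir x"
      by (simp add: n_def dir_def[of y] line algebra_simps)
    have "n = (1 - m') * k + m' * l" by (simp add: n_def algebra_simps)
    then have "1 < k \<Longrightarrow> 1 < l \<Longrightarrow> 1 < n" "k < 0 \<Longrightarrow> l < 0 \<Longrightarrow> n < 0"
      using m' convex_bound_lt[of "-k" "-1" "-l" "1 - m'" m'] convex_bound_lt[of k 0 l "1 - m'" m'] by auto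
    then have en: "(m \<le> e \<and> e < n) \<or> (n < e \<and> e \<le> m)" using e m by auto
    define c where "c = (e - m) / (n - m)"
    have c: "0 \<le> c" "c \<le> 1" using en by (auto simp: c_def divide_simps)
    have cc: "c * (n - m) = e - m" using en by (auto simp: c_def)
    have "(1 - c) *\<^sub>R (P (False, x) + m *\<^sub>R dir x) + c *\<^sub>R (P (False, x) + n *\<^sub>R dir x) = 
       P (False, x) + (m + c * (n - m)) *\<^sub>R dir x" by (simp add: algebra_simps)
    also have "\<dots> = P (False, x) + e *\<^sub>R dir x" unfolding cc by simp
    finally have E: "P (False, x) + e *\<^sub>R dir x = (1 - c) *\<^sub>R (P (False, x) + m *\<^sub>R dir x) + c *\<^sub>R (P (False, x) + n *\<^sub>R dir x)" ..
    show ?thesis unfolding E using m(3) m'(3)[unfolded n] c unfolding sg_def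
      by (intro convexD_alt[OF convex_closed_segment]) 
  qed
  ultimately show ?thesis using that by metis
qed

text \<open>For skew segments an equal parameter is a common point; for collinear ones the gap point
  is common to all transversals, whatever the parameters.\<close>

lemma noncoplanar_param:
  assumes "\<not> touches G x y" "\<not> plane_contains G x y x" "touches G t x" "touches G t y" "touches G u x" "touches G u y"
    and "param G x t = param G x u \<or> param G y t = param G y u"
  shows "touches G t u"
  using assms(2)
proof (cases rule: not_coplanar_cases)
  case skew
  then have "skew x y" by (auto simp: skew_def)
  then show ?thesis using skew_transversal[of x y] assms by (metis touches_iff disjoint_iff)
next
  case (line k l)
  then show ?thesis using collinear_gap[OF line assms(1)] assms unfolding touches_iff by (metis disjoint_iff)
qed


lemma coordinates_inj:
  assumes g: "gram2 G (False, x) (True, x) (tip G x y) \<noteq> 0"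
    and z: "z = s *\<^sub>R dir x + t *\<^sub>R (P (tip G x y) - P (False, x))" "z \<bullet> dir x = 0" "z \<bullet> (P (tip G x y) - P (False, x)) = 0"
  shows "z = 0"
proof -
  have "z \<bullet> z = s * (z \<bullet> dir x) + t * (z \<bullet> (P (tip G x y) - P (False, x)))"
    by (subst (2) z(1)) (simp add: inner_add_right)
  then show ?thesis using z by simp
qed

lemma cx_diff: "cx G x y e - cx G x y f = (P e - P f) \<bullet> dir x"
  by (simp add: cx_def G_def iq_inner dir_def algebra_simps)

lemma cy_diff: "cy G x y e - cy G x y f = (P e - P f) \<bullet> (P (tip G x y) - P (False, x))"
  by (simp add: cy_def G_def iq_inner algebra_simps)

lemma pl_diffE:
  assumes "u \<in> pl x y" "v \<in> pl x y"
  obtains s t where "u - v = s *\<^sub>R dir x + t *\<^sub>R (P (tip G x y) - P (False, x))"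
proof -
  obtain s t s' t' where uv: "u = P (False, x) + s *\<^sub>R dir x + t *\<^sub>R (P (tip G x y) - P (False, x))"
    "v = P (False, x) + s' *\<^sub>R dir x + t' *\<^sub>R (P (tip G x y) - P (False, x))"
    using assms unfolding pl_def by blast
  have "u - v = (s - s') *\<^sub>R dir x + (t - t') *\<^sub>R (P (tip G x y) - P (False, x))"
    unfolding uv by (simp add: algebra_simps)
  then show ?thesis using that by blast
qed

lemma coordinates_neq:
  assumes "plane_contains G x y t"
  shows "(cx G x y (False, t), cy G x y (False, t)) \<noteq> (cx G x y (True, t), cy G x y (True, t))"
proof
  assume "(cx G x y (False, t), cy G x y (False, t)) = (cx G x y (True, t), cy G x y (True, t))"
  then have z: "(P (True, t) - P (False, t)) \<bullet> dir x = 0" 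
    "(P (True, t) - P (False, t)) \<bullet> (P (tip G x y) - P (False, x)) = 0"
    using cx_diff[of x y "(True, t)" "(False, t)"] cy_diff[of x y "(True, t)" "(False, t)"] by simp_all
  obtain s r where "P (True, t) - P (False, t) = s *\<^sub>R dir x + r *\<^sub>R (P (tip G x y) - P (False, x))"
    using pl_diffE assms endpoints_in_sg[of t] unfolding plane_contains_iff by blast
  then have "P (True, t) - P (False, t) = 0" using coordinates_inj assms z unfolding plane_contains_iff by blast
  then show False using nondeg[of t] by simp
qed

text \<open>All vectors in the equation are parallel to the plane, where the two inner products are
  injective; so the equation may be tested coordinate by coordinate.\<close>

lemma touches_pmeet:
  assumes "plane_contains G x y t" "plane_contains G x y u"
  shows "touches G t u \<longleftrightarrow> pmeet (cx G x y) (cy G x y) (False, t) (True, t) (False, u) (True, u)"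
proof -
  let ?X = "cx G x y" and ?Y = "cy G x y"
  let ?a = "P (False, t)" and ?b = "P (True, t)" and ?c = "P (False, u)" and ?d = "P (True, u)"
  have "?c - ?a = k *\<^sub>R (?b - ?a) - l *\<^sub>R (?d - ?c) \<longleftrightarrow>
     ?X (False, u) - ?X (False, t) = k * (?X (True, t) - ?X (False, t)) - l * (?X (True, u) - ?X (False, u)) \<and>
     ?Y (False, u) - ?Y (False, t) = k * (?Y (True, t) - ?Y (False, t)) - l * (?Y (True, u) - ?Y (False, u))" (is "?L \<longleftrightarrow> ?R") for k l
  proof
    assume L: ?L
    have lin: "(k *\<^sub>R u - l *\<^sub>R v) \<bullet> w = k * (u \<bullet> w) - l * (v \<bullet> w)" for u v w :: 'a by (simp add: inner_diff_left)
    show ?R unfolding cx_diff cy_diff L lin by simp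
  next
    assume R: ?R
    have mem: "?a \<in> pl x y" "?b \<in> pl x y" "?c \<in> pl x y" "?d \<in> pl x y"
      using assms endpoints_in_sg[of t] endpoints_in_sg[of u] unfolding plane_contains_iff by auto
    let ?w = "P (tip G x y) - P (False, x)"
    obtain s1 t1 where 1: "?c - ?a = s1 *\<^sub>R dir x + t1 *\<^sub>R ?w" using mem(3,1) by (rule pl_diffE)
    obtain s2 t2 where 2: "?b - ?a = s2 *\<^sub>R dir x + t2 *\<^sub>R ?w" using mem(2,1) by (rule pl_diffE)
    obtain s3 t3 where 3: "?d - ?c = s3 *\<^sub>R dir x + t3 *\<^sub>R ?w" using mem(4,3) by (rule pl_diffE)
    let ?z = "(?c - ?a) - k *\<^sub>R (?b - ?a) + l *\<^sub>R (?d - ?c)"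
    have "?z = 0"
    proof (rule coordinates_inj)
      show "gram2 G (False, x) (True, x) (tip G x y) \<noteq> 0" using assms by (simp add: plane_contains_iff)
      show "?z = (s1 - k * s2 + l * s3) *\<^sub>R dir x + (t1 - k * t2 + l * t3) *\<^sub>R ?w"
        unfolding 1 2 3 by (simp add: algebra_simps)
      have lin: "(r - k *\<^sub>R u + l *\<^sub>R v) \<bullet> w = r \<bullet> w - k * (u \<bullet> w) + l * (v \<bullet> w)" for r u v w :: 'a
        by (simp add: inner_diff_left inner_add_left)
      show "?z \<bullet> dir x = 0" "?z \<bullet> ?w = 0" using R unfolding cx_diff cy_diff lin by simp_all
    qed
    then show ?L by (simp add: algebra_simps)
  qed
  then show ?thesis unfolding touches_iff sg_def closed_segment_meet_iff pmeet_def by blast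
qed

lemma plane_order_trans:
  assumes "plane_contains G x y t" "plane_contains G x y u" "plane_contains G x y v" "plane_order G i x y t u" "plane_order G i x y u v"
  shows "plane_order G i x y t v"
  using prec_trans[OF coordinates_neq[OF assms(1)] coordinates_neq[OF assms(2)] coordinates_neq[OF assms(3)]] assms(4,5)
  unfolding plane_order_def touches_pmeet[OF assms(1,2)] touches_pmeet[OF assms(2,3)] touches_pmeet[OF assms(1,3)] by blast

lemma plane_order_total:
  assumes "plane_contains G x y t" "plane_contains G x y u" "\<not> touches G t u"
  shows "\<exists>i<4. plane_order G i x y t u \<or> plane_order G i x y u t"
  using prec_total[OF coordinates_neq[OF assms(1)] coordinates_neq[OF assms(2)]] assms(3) touches_sym[of u t]
  unfolding plane_order_def touches_pmeet[OF assms(1,2), symmetric] by blast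

end

section \<open>Counting labels from abstract incidence data\<close>

lemma sum_power4_le:
  fixes f :: "'a \<Rightarrow> nat"
  assumes "finite A"
  shows "(\<Sum>x\<in>A. f x ^ 4) \<le> (\<Sum>x\<in>A. f x) ^ 4"
  using assms
proof (induction A rule: finite_induct)
  case (insert x F)
  have "a ^ 4 + b ^ 4 \<le> (a + b) ^ 4" for a b :: nat
    by (simp add: power4_eq_xxxx algebra_simps)
  then have "f x ^ 4 + sum f F ^ 4 \<le> (f x + sum f F) ^ 4" .
  moreover have "f x ^ 4 + (\<Sum>y\<in>F. f y ^ 4) \<le> f x ^ 4 + sum f F ^ 4" using insert.IH by simp
  ultimately show ?case using insert.hyps by simp
qed simp

lemma card_increasing_pairs:
  fixes C :: "nat set"
  assumes "finite C"
  shows "2 * card {(x, y). x \<in> C \<and> y \<in> C \<and> x < y} = card C * (card C - 1)"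
proof -
  let ?L = "{(x, y). x \<in> C \<and> y \<in> C \<and> x < y}"
  have fin: "finite ?L" by (rule finite_subset[of _ "C \<times> C"]) (use assms in auto)
  have split: "C \<times> C = ?L \<union> prod.swap ` ?L \<union> (\<lambda>x. (x, x)) ` C"
    by (auto simp: image_iff)
  have count: "card (?L \<union> prod.swap ` ?L \<union> (\<lambda>x. (x, x)) ` C) = card ?L + card ?L + card C"
  proof -
    have "card (?L \<union> prod.swap ` ?L \<union> (\<lambda>x. (x, x)) ` C) = card (?L \<union> prod.swap ` ?L) + card ((\<lambda>x. (x, x)) ` C)"
      by (rule card_Un_disjoint) (use fin assms in auto)
    moreover have "card (?L \<union> prod.swap ` ?L) = card ?L + card (prod.swap ` ?L)"
      by (rule card_Un_disjoint) (use fin in auto)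
    ultimately show ?thesis by (simp add: card_image inj_on_def)
  qed
  have "card C * card C = 2 * card ?L + card C"
    using count[folded split] by (simp add: card_cartesian_product)
  then show ?thesis by (simp add: diff_mult_distrib2)
qed

text \<open>All that the counting needs from geometry. \<open>pc x y\<close> is the plane of the
  pair and \<open>pc x y x\<close> says that there is one; \<open>par x t\<close> is the parameter
  of \<open>t\<close> on \<open>x\<close>, meaningful for non-coplanar pairs that \<open>t\<close>
  meets.\<close>

locale seg_structure =
  fixes tc :: "nat \<Rightarrow> nat \<Rightarrow> bool"
    and pc :: "nat \<Rightarrow> nat \<Rightarrow> nat \<Rightarrow> bool"
    and par :: "nat \<Rightarrow> nat \<Rightarrow> real"
    and ord :: "nat \<Rightarrow> nat \<Rightarrow> nat \<Rightarrow> nat \<Rightarrow> nat \<Rightarrow> bool"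
  assumes tc_refl: "tc t t"
    and tc_sym: "tc t u \<Longrightarrow> tc u t"
    and pc_base: "pc x y t \<Longrightarrow> pc x y x \<and> pc x y y"
    and pc_point: "pc x y t \<Longrightarrow> pc x y u \<Longrightarrow> \<not> pc x y z \<Longrightarrow> tc t z \<Longrightarrow> tc u z \<Longrightarrow> tc t u"
    and pc_unique: "pc x y x \<Longrightarrow> pc x' y' x \<Longrightarrow> pc x' y' y \<Longrightarrow> pc x y z \<longleftrightarrow> pc x' y' z"
    and pc_both: "\<not> tc x y \<Longrightarrow> pc x y x \<Longrightarrow> tc t x \<Longrightarrow> tc t y \<Longrightarrow> pc x y t"
    and par_touch: "\<not> tc x y \<Longrightarrow> \<not> pc x y x \<Longrightarrow> tc t x \<Longrightarrow> tc t y \<Longrightarrow> tc u x \<Longrightarrow> tc u y \<Longrightarrow>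
      tc t u \<Longrightarrow> par x t = par x u \<or> par y t = par y u"
    and touch_par: "\<not> tc x y \<Longrightarrow> \<not> pc x y x \<Longrightarrow> tc t x \<Longrightarrow> tc t y \<Longrightarrow> tc u x \<Longrightarrow> tc u y \<Longrightarrow>
      par x t = par x u \<or> par y t = par y u \<Longrightarrow> tc t u"
    and ord_tc: "ord i x y t u \<Longrightarrow> \<not> tc t u"
    and ord_trans: "pc x y t \<Longrightarrow> pc x y u \<Longrightarrow> pc x y v \<Longrightarrow> ord i x y t u \<Longrightarrow> ord i x y u v \<Longrightarrow> ord i x y t v"
    and ord_total: "pc x y t \<Longrightarrow> pc x y u \<Longrightarrow> \<not> tc t u \<Longrightarrow> \<exists>i<4. ord i x y t u \<or> ord i x y u t"
begin

definition indep :: "nat set \<Rightarrow> bool" where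
  "indep A \<longleftrightarrow> (\<forall>t\<in>A. \<forall>u\<in>A. t \<noteq> u \<longrightarrow> \<not> tc t u)"

text \<open>For disjoint \<open>t\<close> and \<open>u\<close> at least two members must be in the
  way: otherwise both could enter the clique for the loss of at most one.\<close>

definition optimal :: "nat \<Rightarrow> nat set \<Rightarrow> bool" where
  "optimal n C \<longleftrightarrow> C \<subseteq> {..<n} \<and> indep C \<and> (\<forall>t<n. \<exists>s\<in>C. tc s t) \<and>
     (\<forall>t<n. \<forall>u<n. t \<noteq> u \<and> \<not> tc t u \<longrightarrow>
        (\<exists>s\<in>C. \<exists>s'\<in>C. s \<noteq> s' \<and> (tc s t \<or> tc s u) \<and> (tc s' t \<or> tc s' u)))"

text \<open>The third clause makes the plane of \<open>t\<close> unique. If it fails, a member met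
  by \<open>t\<close> leaves a plane containing \<open>t\<close>, and the crossing point settles the
  color of \<open>t\<close>.\<close>

definition residual :: "nat set \<Rightarrow> nat \<Rightarrow> bool" where
  "residual C t \<longleftrightarrow> (\<exists>s\<in>C. \<exists>s'\<in>C. s < s' \<and> tc s t \<and> tc s' t) \<and>
     (\<forall>s\<in>C. \<forall>s'\<in>C. s < s' \<and> tc s t \<and> tc s' t \<longrightarrow> pc s s' s) \<and>
     (\<forall>x\<in>C. \<forall>y\<in>C. \<forall>s\<in>C. x < y \<and> pc x y t \<and> tc s t \<longrightarrow> pc x y s)"

text \<open>Two members met by \<open>t\<close> lie in every plane of a pair from \<open>C\<close>
  that contains \<open>t\<close>, and they determine their plane.\<close>

lemma residual_plane:
  assumes "indep C" "residual C t" "x \<in> C" "y \<in> C" "x < y" "pc x y t" "x' \<in> C" "y' \<in> C" "x' < y'" "pc x' y' t"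
  shows "pc x y z \<longleftrightarrow> pc x' y' z"
proof -
  obtain s s' where s: "s \<in> C" "s' \<in> C" "s < s'" "tc s t" "tc s' t" and pl: "pc s s' s"
    using assms(2) unfolding residual_def by blast
  have "pc s s' z \<longleftrightarrow> pc x y z" "pc s s' z \<longleftrightarrow> pc x' y' z"
    using assms s by (auto intro!: pc_unique[OF pl] simp: residual_def)
  then show ?thesis by simp
qed

lemma residual_exists:
  assumes "indep C" "residual C t"
  shows "\<exists>x\<in>C. \<exists>y\<in>C. x < y \<and> pc x y t"
proof -
  obtain s s' where s: "s \<in> C" "s' \<in> C" "s < s'" "tc s t" "tc s' t" and pl: "pc s s' s"
    using assms(2) unfolding residual_def by blast
  have "\<not> tc s s'" using assms(1) s by (auto simp: indep_def)
  then have "pc s s' t" using pl s tc_sym by (blast intro: pc_both)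
  then show ?thesis using s by blast
qed

end

text \<open>The kinds are: 1 private to one member, 2 non-coplanar pair, 3 and 4 crossing point with
  a member of \<open>C\<close> or of \<open>D\<close>, 5 heights within a plane. In kind 2 the entry
  \<open>h 0\<close> records on which member of the pair the parameter is shared. Entries without
  meaning for a kind are fixed to 0, so that they do not multiply the count.\<close>

locale labelling = seg_structure +
  fixes n :: nat and C M D K :: "nat set" and kind lx ly lz :: "nat \<Rightarrow> nat" and h :: "nat \<Rightarrow> nat \<Rightarrow> nat"
  assumes C: "optimal n C"
    and M: "M \<subseteq> {..<n}" "\<And>m m'. m \<in> M \<Longrightarrow> m' \<in> M \<Longrightarrow> m \<noteq> m' \<Longrightarrow> lx m = lx m' \<Longrightarrow> ly m = ly m' \<Longrightarrow> \<not> tc m m'"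
    and D: "D \<subseteq> {..<n}" "indep D"
    and K: "card C \<le> card K" "card D \<le> card K" "\<And>x y. card {m \<in> M. lx m = x \<and> ly m = y} \<le> card K"
    and kinds: "\<And>t. t < n \<Longrightarrow> kind t \<in> {1, 2, 3, 4, 5}"
    and kind1: "\<And>t. t < n \<Longrightarrow> kind t = 1 \<Longrightarrow> lx t \<in> C \<and> (\<forall>s\<in>C. tc s t \<longrightarrow> s = lx t)
      \<and> ly t = 0 \<and> lz t = 0 \<and> (\<forall>i<4. h i t = 0)"
    and kind2: "\<And>t. t < n \<Longrightarrow> kind t = 2 \<Longrightarrow> lx t \<in> C \<and> ly t \<in> C \<and> lx t < ly t \<and> \<not> pc (lx t) (ly t) (lx t)
      \<and> tc (lx t) t \<and> tc (ly t) t \<and> lz t \<in> M \<and> lx (lz t) = lx t \<and> ly (lz t) = ly t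
      \<and> (h 0 t = 0 \<and> par (lx t) (lz t) = par (lx t) t \<or> h 0 t = 1 \<and> par (ly t) (lz t) = par (ly t) t)
      \<and> h 1 t = 0 \<and> h 2 t = 0 \<and> h 3 t = 0"
    and kind3: "\<And>t. t < n \<Longrightarrow> kind t = 3 \<Longrightarrow> lx t \<in> C \<and> ly t \<in> C \<and> lx t < ly t \<and> pc (lx t) (ly t) t
      \<and> lz t \<in> C \<and> tc (lz t) t \<and> \<not> pc (lx t) (ly t) (lz t) \<and> (\<forall>i<4. h i t = 0)"
    and kind4: "\<And>t. t < n \<Longrightarrow> kind t = 4 \<Longrightarrow> lx t \<in> C \<and> ly t \<in> C \<and> lx t < ly t \<and> pc (lx t) (ly t) t
      \<and> lz t \<in> D \<and> tc (lz t) t \<and> \<not> pc (lx t) (ly t) (lz t) \<and> (\<forall>i<4. h i t = 0)"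
    and kind5: "\<And>t. t < n \<Longrightarrow> kind t = 5 \<Longrightarrow> lx t \<in> C \<and> ly t \<in> C \<and> lx t < ly t \<and> pc (lx t) (ly t) t
      \<and> lz t = 0 \<and> (\<forall>i<4. h i t < card {d \<in> D. lx d = lx t \<and> ly d = ly t})"
    and heights: "\<And>i t u. t < n \<Longrightarrow> u < n \<Longrightarrow> kind t = 5 \<Longrightarrow> kind u = 5 \<Longrightarrow> lx t = lx u \<Longrightarrow> ly t = ly u \<Longrightarrow>
      i < 4 \<Longrightarrow> ord i (lx t) (ly t) t u \<Longrightarrow> h i t < h i u"
begin

definition label :: "nat \<Rightarrow> nat list" where
  "label t = [kind t, lx t, ly t, lz t, h 0 t, h 1 t, h 2 t, h 3 t]"

lemma label_proper:
  assumes "t < n" "u < n" "t \<noteq> u" "\<not> tc t u"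
  shows "label t \<noteq> label u"
proof
  assume "label t = label u"
  then have e: "kind u = kind t" "lx u = lx t" "ly u = ly t" "lz u = lz t" "h 0 u = h 0 t" "h 1 u = h 1 t" "h 2 u = h 2 t" "h 3 u = h 3 t"
    by (auto simp: label_def)
  have nt: "\<not> tc (lx t) (ly t)" if "lx t \<in> C" "ly t \<in> C" "lx t < ly t"
  proof -
    have "indep C" using C by (simp add: optimal_def)
    then show ?thesis using that by (auto simp: indep_def)
  qed
  consider "kind t = 1" | "kind t = 2" | "kind t = 3" | "kind t = 4" | "kind t = 5" using kinds[OF assms(1)] by auto
  then show False
  proof cases
    case 1
    \<comment> \<open>Two disjoint segments meeting only the same member would be an improving
      exchange.\<close>
    obtain s s' where "s \<in> C" "s' \<in> C" "s \<noteq> s'" "tc s t \<or> tc s u" "tc s' t \<or> tc s' u"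
      using C assms(3,4) assms(1,2) unfolding optimal_def by meson
    moreover have "\<forall>s\<in>C. tc s t \<longrightarrow> s = lx t" using kind1[OF assms(1) 1] by blast
    moreover have "\<forall>s\<in>C. tc s u \<longrightarrow> s = lx t" using kind1[OF assms(2)] 1 e(1,2) by metis
    ultimately show False by blast
  next
    case 2
    have u2: "kind u = 2" using e 2 by simp
    note t' = kind2[OF assms(1) 2] and u' = kind2[OF assms(2) u2, unfolded e]
    have "tc t u"
    proof (rule touch_par[of "lx t" "ly t"])
      show "\<not> tc (lx t) (ly t)" using t' nt by blast
      show "\<not> pc (lx t) (ly t) (lx t)" using t' by blast
      show "tc t (lx t)" "tc t (ly t)" "tc u (lx t)" "tc u (ly t)" using t' u' tc_sym by blast+
      \<comment> \<open>Both parameters equal that of the common element \<open>lz t\<close> of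
        \<open>M\<close>, on the side given by \<open>h 0\<close>.\<close>
      show "par (lx t) t = par (lx t) u \<or> par (ly t) t = par (ly t) u" using t' u' by (metis zero_neq_one)
    qed
    then show False using assms by simp
  next
    case 3
    have u': "kind u = 3" using e 3 by simp
    have "tc t u"
      by (rule pc_point[of "lx t" "ly t" t u "lz t"])
        (use kind3[OF assms(1) 3] kind3[OF assms(2) u', unfolded e] tc_sym in blast)+
    then show False using assms by simp
  next
    case 4
    have u': "kind u = 4" using e 4 by simp
    have "tc t u"
      by (rule pc_point[of "lx t" "ly t" t u "lz t"])
        (use kind4[OF assms(1) 4] kind4[OF assms(2) u', unfolded e] tc_sym in blast)+
    then show False using assms by simp
  next
    case 5
    obtain i where i: "i < 4" "ord i (lx t) (ly t) t u \<or> ord i (lx t) (ly t) u t"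
      using ord_total[of "lx t" "ly t" t u] kind5[OF assms(1) 5] kind5[OF assms(2), unfolded e] 5 assms by blast
    then have "h i t \<noteq> h i u" 
      using heights[of t u i, unfolded e] heights[of u t i, unfolded e] assms 5 by auto
    moreover have "i \<in> {0, 1, 2, 3}" using i by auto
    ultimately show False using e by auto
  qed
qed

lemma card_labels: "card (label ` {..<n}) \<le> card K ^ 4 + card K ^ 3"
proof -
  define k where "k = card K"
  define P where "P = {(x, y). x \<in> C \<and> y \<in> C \<and> x < y}"
  define Q where "Q = {(x, y) \<in> P. pc x y x}"
  define w where "w = (\<lambda>(x, y). card {d \<in> D. lx d = x \<and> ly d = y})"
  have finC: "finite C" using C finite_subset[of C "{..<n}"] by (auto simp: optimal_def)
  have finD: "finite D" using D finite_subset by blast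
  have finM: "finite M" using M finite_subset by blast
  have finP: "finite P" unfolding P_def by (rule finite_subset[of _ "C \<times> C"]) (use finC in auto)
  have QP: "Q \<subseteq> P" by (auto simp: Q_def)
  have finQ: "finite Q" using QP finP finite_subset by blast
  define A1 where "A1 = ((\<lambda>s. [1, s, 0, 0, 0, 0, 0, 0]) ` C)"
  define A2 where "A2 = (\<Union>(x, y)\<in>P - Q. (\<lambda>(m, e). [2, x, y, m, e, 0, 0, 0]) ` ({m \<in> M. lx m = x \<and> ly m = y} \<times> {0, 1}))"
  define A3 where "A3 = ((\<lambda>((x, y), s). [3, x, y, s, 0, 0, 0, 0]) ` (Q \<times> C))"
  define A4 where "A4 = ((\<lambda>((x, y), s). [4, x, y, s, 0, 0, 0, 0]) ` (Q \<times> D))"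
  define A5 where "A5 = (\<Union>q\<in>Q. (\<lambda>(a, b, c, d). [5, fst q, snd q, 0, a, b, c, d]) ` ({..<w q} \<times> {..<w q} \<times> {..<w q} \<times> {..<w q}))"
  have "label t \<in> A1 \<union> A2 \<union> A3 \<union> A4 \<union> A5" if t: "t < n" for t
  proof -
    have Qx: "(lx t, ly t) \<in> Q" if "lx t \<in> C" "ly t \<in> C" "lx t < ly t" "pc (lx t) (ly t) t"
      using that pc_base by (auto simp: Q_def P_def)
    consider "kind t = 1" | "kind t = 2" | "kind t = 3" | "kind t = 4" | "kind t = 5" using kinds[OF t] by auto
    then show ?thesis
    proof cases
      case 1 then have "label t \<in> A1" unfolding A1_def using kind1[OF t 1] by (auto simp: label_def)
      then show ?thesis by blast
    next
      case 2
      have "(lx t, ly t) \<in> P - Q" using kind2[OF t 2] by (auto simp: P_def Q_def)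
      moreover have "label t \<in> (\<lambda>(m, e). [2, lx t, ly t, m, e, 0, 0, 0]) ` ({m \<in> M. lx m = lx t \<and> ly m = ly t} \<times> {0, 1})"
        by (rule image_eqI[of _ _ "(lz t, h 0 t)"]) (use kind2[OF t 2] 2 in \<open>auto simp: label_def\<close>)
      ultimately have "label t \<in> A2" unfolding A2_def by blast
      then show ?thesis by blast
    next
      case 3
      have "label t \<in> A3" unfolding A3_def
        by (rule image_eqI[of _ _ "((lx t, ly t), lz t)"]) (use kind3[OF t 3] 3 Qx in \<open>auto simp: label_def\<close>)
      then show ?thesis by blast
    next
      case 4
      have "label t \<in> A4" unfolding A4_def
        by (rule image_eqI[of _ _ "((lx t, ly t), lz t)"]) (use kind4[OF t 4] 4 Qx in \<open>auto simp: label_def\<close>)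
      then show ?thesis by blast
    next
      case 5
      have "(lx t, ly t) \<in> Q" using kind5[OF t 5] Qx by auto
      moreover have "label t \<in> (\<lambda>(a, b, c, d). [5, fst (lx t, ly t), snd (lx t, ly t), 0, a, b, c, d]) `
          ({..<w (lx t, ly t)} \<times> {..<w (lx t, ly t)} \<times> {..<w (lx t, ly t)} \<times> {..<w (lx t, ly t)})"
        by (rule image_eqI[of _ _ "(h 0 t, h 1 t, h 2 t, h 3 t)"]) (use kind5[OF t 5] 5 in \<open>auto simp: label_def w_def\<close>)
      ultimately have "label t \<in> A5" unfolding A5_def by blast
      then show ?thesis by blast
    qed
  qed
  then have "label ` {..<n} \<subseteq> A1 \<union> A2 \<union> A3 \<union> A4 \<union> A5" by blast
  moreover have "finite (A1 \<union> A2 \<union> A3 \<union> A4 \<union> A5)"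
    unfolding A1_def A2_def A3_def A4_def A5_def using finC finD finM finP finQ by auto
  ultimately have "card (label ` {..<n}) \<le> card (A1 \<union> A2 \<union> A3 \<union> A4 \<union> A5)" by (rule card_mono[rotated])
  also have "\<dots> \<le> card A1 + card A2 + card A3 + card A4 + card A5"
    by (meson card_Un_le order_trans add_right_mono)
  also have "\<dots> \<le> k + card (P - Q) * (2 * k) + card Q * k + card Q * k + k ^ 4"
  proof (intro add_mono)
    show "card A1 \<le> k" unfolding A1_def k_def by (rule order.trans[OF card_image_le[OF finC] K(1)])
    have "card A2 \<le> (\<Sum>(x, y)\<in>P - Q. card ((\<lambda>(m, e). [2, x, y, m, e, 0, 0, 0]) ` ({m \<in> M. lx m = x \<and> ly m = y} \<times> {0, 1::nat})))"
      unfolding A2_def case_prod_beta by (rule card_UN_le) (use finP in auto)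
    also have "\<dots> \<le> (\<Sum>(x, y)\<in>P - Q. 2 * k)"
    proof (rule sum_mono, clarify)
      fix x y
      have "card ((\<lambda>(m, e). [2, x, y, m, e, 0, 0, 0]) ` ({m \<in> M. lx m = x \<and> ly m = y} \<times> {0, 1::nat}))
         \<le> card ({m \<in> M. lx m = x \<and> ly m = y} \<times> {0, 1::nat})" by (rule card_image_le) (use finM in auto)
      also have "\<dots> \<le> 2 * k" using K(3)[of x y] by (simp add: card_cartesian_product k_def)
      finally show "card ((\<lambda>(m, e). [2, x, y, m, e, 0, 0, 0]) ` ({m \<in> M. lx m = x \<and> ly m = y} \<times> {0, 1::nat})) \<le> 2 * k" .
    qed
    finally show "card A2 \<le> card (P - Q) * (2 * k)" by (simp add: case_prod_beta)
    have "card A3 \<le> card (Q \<times> C)" unfolding A3_def by (rule card_image_le) (use finQ finC in auto)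
    then show "card A3 \<le> card Q * k" using K(1) by (simp add: card_cartesian_product k_def) (meson mult_le_mono2 order_trans)
    have "card A4 \<le> card (Q \<times> D)" unfolding A4_def by (rule card_image_le) (use finQ finD in auto)
    then show "card A4 \<le> card Q * k" using K(2) by (simp add: card_cartesian_product k_def) (meson mult_le_mono2 order_trans)
    have "card A5 \<le> (\<Sum>q\<in>Q. card ((\<lambda>(a, b, c, d). [5, fst q, snd q, 0, a, b, c, d]) ` ({..<w q} \<times> {..<w q} \<times> {..<w q} \<times> {..<w q})))"
      unfolding A5_def by (rule card_UN_le[OF finQ])
    also have "\<dots> \<le> (\<Sum>q\<in>Q. w q ^ 4)"
    proof (rule sum_mono)
      fix q
      have "card ((\<lambda>(a, b, c, d). [5, fst q, snd q, 0, a, b, c, d]) ` ({..<w q} \<times> {..<w q} \<times> {..<w q} \<times> {..<w q}))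
        \<le> card ({..<w q} \<times> {..<w q} \<times> {..<w q} \<times> {..<w q})" by (rule card_image_le) auto
      then show "card ((\<lambda>(a, b, c, d). [5, fst q, snd q, 0, a, b, c, d]) ` ({..<w q} \<times> {..<w q} \<times> {..<w q} \<times> {..<w q})) \<le> w q ^ 4"
        by (simp add: card_cartesian_product power4_eq_xxxx mult.assoc)
    qed
    also have "\<dots> \<le> (\<Sum>q\<in>Q. w q) ^ 4" by (rule sum_power4_le[OF finQ])
    also have "\<dots> \<le> k ^ 4"
    proof (rule power_mono)
      \<comment> \<open>Members of \<open>D\<close> with different pairs are different, so the
        \<open>w q\<close> add up to at most \<open>card D\<close>.\<close>
      have "(\<Sum>q\<in>Q. w q) = card (\<Union>q\<in>Q. {d \<in> D. lx d = fst q \<and> ly d = snd q})"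
        unfolding w_def case_prod_beta by (rule card_UN_disjoint[symmetric]) (use finQ finD in \<open>auto simp: prod_eq_iff\<close>)
      also have "\<dots> \<le> card D" by (rule card_mono[OF finD]) auto
      finally show "(\<Sum>q\<in>Q. w q) \<le> k" using K(2) k_def by linarith
    qed simp
    finally show "card A5 \<le> k ^ 4" .
  qed
  \<comment> \<open>Coplanar and non-coplanar pairs cost the same: \<open>k + k\<close> crossing
    labels for the former, two sides times \<open>k\<close> for the latter.\<close>
  also have "\<dots> = k + (2 * card P) * k + k ^ 4"
  proof -
    have "card P = card (P - Q) + card Q" using QP finP finQ by (simp add: card_Diff_subset card_mono)
    then show ?thesis by (simp add: algebra_simps)
  qed
  also have "\<dots> \<le> k ^ 4 + k ^ 3"
  proof -
    have "2 * card P = card C * (card C - 1)" unfolding P_def by (rule card_increasing_pairs[OF finC])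
    also have "\<dots> \<le> k * (k - 1)" using K(1) k_def by (intro mult_le_mono) auto
    finally have "k + (2 * card P) * k \<le> k + k * (k - 1) * k" by (simp add: mult_le_mono1)
    also have "\<dots> \<le> k ^ 3"
    \<comment> \<open>The subtraction in \<open>k - 1\<close> is truncated, hence the separate case
      \<open>k = 0\<close>.\<close>
    proof (cases k)
      case (Suc j)
      then show ?thesis by (simp add: power3_eq_cube algebra_simps)
    qed simp
    finally show ?thesis by simp
  qed
  finally show ?thesis unfolding k_def .
qed

end

section \<open>A language of bounded loops and its compilation to the machine\<close>

text \<open>Quantifiers range over the indices below \<open>n\<close> and loops have bounds read on
  entry. Every program terminates, so it denotes a function on states, and a polynomial step bound
  can be read off from its syntax.\<close>

datatype fm = Atom bexp | Neg fm | Conj fm fm | Ex vname fm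

datatype prog =
    NSet vname nexp nexp
  | RSet vname nexp rexp
  | Sq prog prog
  | Guard fm prog
  | For vname vname prog

primrec fval :: "fm \<Rightarrow> state \<Rightarrow> bool" where
  "fval (Atom b) s \<longleftrightarrow> bval b s"
| "fval (Neg f) s \<longleftrightarrow> \<not> fval f s"
| "fval (Conj f g) s \<longleftrightarrow> fval f s \<and> fval g s"
| "fval (Ex z f) s \<longleftrightarrow> (\<exists>i < nats s ''n'' 0. fval f (nupdate z 0 i s))"

primrec sem :: "prog \<Rightarrow> state \<Rightarrow> state" where
  "sem (NSet x e f) s = nupdate x (nval e s) (nval f s) s"
| "sem (RSet x e f) s = rupdate x (nval e s) (rval f s) s"
| "sem (Sq p q) s = sem q (sem p s)"
| "sem (Guard f p) s = (if fval f s then sem p s else s)"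
| "sem (For x b p) s = fold (\<lambda>i s. sem p (nupdate x 0 i s)) [0..<nats s b 0] s"

primrec nnames :: "nexp \<Rightarrow> vname set" where
  "nnames (NConst k) = {}"
| "nnames (NCell x e) = insert x (nnames e)"
| "nnames (NPlus e f) = nnames e \<union> nnames f"
| "nnames (NMinus e f) = nnames e \<union> nnames f"

primrec rnames :: "rexp \<Rightarrow> vname set" where
  "rnames (RConst k) = {}"
| "rnames (RCell x e) = nnames e"
| "rnames (RPlus e f) = rnames e \<union> rnames f"
| "rnames (RMinus e f) = rnames e \<union> rnames f"
| "rnames (RTimes e f) = rnames e \<union> rnames f"
| "rnames (RDivide e f) = rnames e \<union> rnames f"

primrec bnames :: "bexp \<Rightarrow> vname set" where
  "bnames (NLess e f) = nnames e \<union> nnames f"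
| "bnames (RLess e f) = rnames e \<union> rnames f"
| "bnames (BNot b) = bnames b"
| "bnames (BAnd b c) = bnames b \<union> bnames c"

text \<open>The array \<open>''#''\<close> is reserved for the loop counters and truth values of the compiled program.\<close>

abbreviation hid :: vname where "hid \<equiv> ''#''"

text \<open>Protecting \<open>n\<close> and \<open>d\<close>, here and in \<open>wfp\<close>, keeps
  the bounds of all loops constant during a run; the cost polynomials depend on that.\<close>

primrec wff :: "fm \<Rightarrow> bool" where
  "wff (Atom b) \<longleftrightarrow> hid \<notin> bnames b"
| "wff (Neg f) \<longleftrightarrow> wff f"
| "wff (Conj f g) \<longleftrightarrow> wff f \<and> wff g"
| "wff (Ex z f) \<longleftrightarrow> z \<notin> {hid, ''n'', ''d''} \<and> wff f"

primrec wfp :: "prog \<Rightarrow> bool" where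
  "wfp (NSet x e f) \<longleftrightarrow> x \<notin> {hid, ''n'', ''d''} \<and> hid \<notin> nnames e \<union> nnames f"
| "wfp (RSet x e f) \<longleftrightarrow> hid \<notin> nnames e \<union> rnames f"
| "wfp (Sq p q) \<longleftrightarrow> wfp p \<and> wfp q"
| "wfp (Guard f p) \<longleftrightarrow> wff f \<and> wfp p"
| "wfp (For x b p) \<longleftrightarrow> x \<notin> {hid, ''n'', ''d''} \<and> b \<in> {''n'', ''d''} \<and> wfp p"

primrec writes :: "prog \<Rightarrow> vname set" where
  "writes (NSet x e f) = {x}"
| "writes (RSet x e f) = {}"
| "writes (Sq p q) = writes p \<union> writes q"
| "writes (Guard f p) = writes p"
| "writes (For x b p) = insert x (writes p)"

primrec rwrites :: "prog \<Rightarrow> vname set" where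
  "rwrites (NSet x e f) = {}"
| "rwrites (RSet x e f) = {x}"
| "rwrites (Sq p q) = rwrites p \<union> rwrites q"
| "rwrites (Guard f p) = rwrites p"
| "rwrites (For x b p) = rwrites p"

abbreviation hcell :: "nat \<Rightarrow> nexp" where "hcell k \<equiv> NCell hid (NConst k)"
abbreviation hset :: "nat \<Rightarrow> nexp \<Rightarrow> com" where "hset k e \<equiv> NAssign hid (NConst k) e"

text \<open>Cell \<open>k\<close> of the reserved array receives the truth value, and the cells
  below \<open>k\<close> survive. A quantifier saves the old value of \<open>z\<close> in cell
  \<open>k + 1\<close>, counts in \<open>k + 2\<close> and evaluates its body at
  \<open>k + 3\<close>; restoring \<open>z\<close> makes formulas free of side effects.\<close>

primrec compile_fm :: "fm \<Rightarrow> nat \<Rightarrow> com" where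
  "compile_fm (Atom b) k = Cond b (hset k (NConst 1)) (hset k (NConst 0))"
| "compile_fm (Neg f) k = Seq (compile_fm f k) (hset k (NMinus (NConst 1) (hcell k)))"
| "compile_fm (Conj f g) k = Seq (compile_fm f k) (Seq (compile_fm g (Suc k))
     (Cond (BAnd (NLess (NConst 0) (hcell k)) (NLess (NConst 0) (hcell (Suc k))))
       (hset k (NConst 1)) (hset k (NConst 0))))"
| "compile_fm (Ex z f) k = Seq (hset k (NConst 0)) (Seq (hset (k + 1) (NCell z (NConst 0))) (Seq (hset (k + 2) (NConst 0))
     (Seq (While (NLess (hcell (k + 2)) (NCell ''n'' (NConst 0)))
       (Seq (NAssign z (NConst 0) (hcell (k + 2))) (Seq (compile_fm f (k + 3))
         (Seq (Cond (NLess (NConst 0) (hcell (k + 3))) (hset k (NConst 1)) Skip)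
           (hset (k + 2) (NPlus (hcell (k + 2)) (NConst 1)))))))
       (NAssign z (NConst 0) (hcell (k + 1))))))"

primrec compile :: "prog \<Rightarrow> nat \<Rightarrow> com" where
  "compile (NSet x e f) k = NAssign x e f"
| "compile (RSet x e f) k = RAssign x e f"
| "compile (Sq p q) k = Seq (compile p k) (compile q k)"
| "compile (Guard f p) k = Seq (compile_fm f k) (Cond (NLess (NConst 0) (hcell k)) (compile p k) Skip)"
| "compile (For x b p) k = Seq (hset k (NConst 0)) (While (NLess (hcell k) (NCell b (NConst 0)))
     (Seq (NAssign x (NConst 0) (hcell k)) (Seq (compile p (Suc k)) (hset k (NPlus (hcell k) (NConst 1))))))"

text \<open>A step bound as a polynomial in any common bound of \<open>n\<close> and
  \<open>d\<close>; the factor \<open>[:0, 1:]\<close> stands for the number of rounds of a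
  loop.\<close>

primrec costf :: "fm \<Rightarrow> nat poly" where
  "costf (Atom b) = [:2:]"
| "costf (Neg f) = costf f + [:1:]"
| "costf (Conj f g) = costf f + costf g + [:2:]"
| "costf (Ex z f) = [:0, 1:] * (costf f + [:5:]) + [:5:]"

primrec cost :: "prog \<Rightarrow> nat poly" where
  "cost (NSet x e f) = [:1:]"
| "cost (RSet x e f) = [:1:]"
| "cost (Sq p q) = cost p + cost q"
| "cost (Guard f p) = costf f + cost p + [:2:]"
| "cost (For x b p) = [:0, 1:] * (cost p + [:3:]) + [:2:]"

text \<open>Equality up to the reserved array, which is the sense in which compiled code realises
  \<open>sem\<close>.\<close>

definition eqv :: "state \<Rightarrow> state \<Rightarrow> bool" where
  "eqv s s' \<longleftrightarrow> (\<forall>x. x \<noteq> hid \<longrightarrow> nats s x = nats s' x) \<and> reals s = reals s'"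

lemma eqv_refl [simp]: "eqv s s"
  by (simp add: eqv_def)

lemma eqv_trans: "eqv s s' \<Longrightarrow> eqv s' s'' \<Longrightarrow> eqv s s''"
  by (simp add: eqv_def)

lemma eqv_sym: "eqv s s' \<Longrightarrow> eqv s' s"
  by (simp add: eqv_def)

lemma nats_nupdate [simp]: "nats (nupdate x i v s) y = (if y = x then (nats s x)(i := v) else nats s y)"
  by (simp add: nupdate_def)

lemma reals_nupdate [simp]: "reals (nupdate x i v s) = reals s"
  by (simp add: nupdate_def)

lemma nats_rupdate [simp]: "nats (rupdate x i v s) = nats s"
  by (simp add: rupdate_def)

lemma reals_rupdate [simp]: "reals (rupdate x i v s) y = (if y = x then (reals s x)(i := v) else reals s y)"
  by (simp add: rupdate_def)

lemma nval_eqv: "eqv s s' \<Longrightarrow> hid \<notin> nnames e \<Longrightarrow> nval e s = nval e s'"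
  by (induction e) (auto simp: eqv_def)

lemma rval_eqv: "eqv s s' \<Longrightarrow> hid \<notin> rnames e \<Longrightarrow> rval e s = rval e s'"
  by (induction e) (auto simp: nval_eqv, simp add: eqv_def)

lemma bval_eqv: "eqv s s' \<Longrightarrow> hid \<notin> bnames b \<Longrightarrow> bval b s = bval b s'"
  by (induction b) (auto simp: nval_eqv rval_eqv)

lemma eqv_nupdate: "eqv s s' \<Longrightarrow> eqv (nupdate x i v s) (nupdate x i v s')"
  by (auto simp: eqv_def)

lemma eqv_rupdate: "eqv s s' \<Longrightarrow> eqv (rupdate x i v s) (rupdate x i v s')"
  by (auto simp: eqv_def)

lemma eqv_hid: "eqv (nupdate hid i v s) s"
  by (auto simp: eqv_def)

lemma fval_eqv: "eqv s s' \<Longrightarrow> wff f \<Longrightarrow> fval f s = fval f s'"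
proof (induction f arbitrary: s s')
  case (Ex z f)
  have "nats s ''n'' 0 = nats s' ''n'' 0" using Ex.prems by (auto simp: eqv_def)
  moreover have "fval f (nupdate z 0 i s) = fval f (nupdate z 0 i s')" for i
    by (rule Ex.IH) (use Ex.prems in \<open>auto intro: eqv_nupdate\<close>)
  ultimately show ?case by simp
qed (auto simp: bval_eqv)

lemma sem_eqv: "eqv s s' \<Longrightarrow> wfp p \<Longrightarrow> eqv (sem p s) (sem p s')"
proof (induction p arbitrary: s s')
  case (NSet x e f)
  then show ?case using nval_eqv[OF NSet(1)] eqv_nupdate by auto
next
  case (RSet x e f)
  then show ?case using nval_eqv[OF RSet(1)] rval_eqv[OF RSet(1)] eqv_rupdate by auto
next
  case (Guard f p)
  then show ?case using fval_eqv[OF Guard(2)] by auto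
next
  case (For x b p)
  have b: "nats s b 0 = nats s' b 0" using For.prems by (auto simp: eqv_def)
  have "eqv (fold (\<lambda>i s. sem p (nupdate x 0 i s)) xs s) (fold (\<lambda>i s. sem p (nupdate x 0 i s)) xs s')" for xs
    using For.prems(1)
  proof (induction xs arbitrary: s s')
    case (Cons i xs)
    have "eqv (sem p (nupdate x 0 i s)) (sem p (nupdate x 0 i s'))"
      by (rule For.IH) (use Cons.prems For.prems eqv_nupdate in auto)
    then show ?case using Cons.IH by simp
  qed simp
  then show ?case using b by simp
qed auto

lemma nats_sem: "x \<notin> writes p \<Longrightarrow> nats (sem p s) x = nats s x"
proof (induction p arbitrary: s)
  case (For y b p)
  have "nats (fold (\<lambda>i s. sem p (nupdate y 0 i s)) xs s) x = nats s x" for xs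
    using For by (induction xs arbitrary: s) auto
  then show ?case by simp
qed auto

lemma reals_sem: "x \<notin> rwrites p \<Longrightarrow> reals (sem p s) x = reals s x"
proof (induction p arbitrary: s)
  case (For y b p)
  have "reals (fold (\<lambda>i s. sem p (nupdate y 0 i s)) xs s) x = reals s x" for xs
    using For by (induction xs arbitrary: s) auto
  then show ?case by simp
qed auto

lemma wfp_writes: "wfp p \<Longrightarrow> x \<in> {hid, ''n'', ''d''} \<Longrightarrow> x \<notin> writes p"
  by (induction p) auto

text \<open>For loops of exactly \<open>m\<close> rounds. The induction is on the number of rounds
  that remain, and each round pays one step for the test.\<close>

lemma exec_while:
  assumes step: "\<And>i s. i < m \<Longrightarrow> P i s \<Longrightarrow> bval b s \<and> (\<exists>t s'. exec c s t s' \<and> P (Suc i) s' \<and> t \<le> T)"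
    and stop: "\<And>s. P m s \<Longrightarrow> \<not> bval b s"
    and "P 0 s"
  shows "\<exists>t s'. exec (While b c) s t s' \<and> P m s' \<and> t \<le> m * (T + 1) + 1"
proof -
  have "\<exists>t s'. exec (While b c) s t s' \<and> P m s' \<and> t \<le> j * (T + 1) + 1" if "j \<le> m" "P (m - j) s" for j s
    using that
  proof (induction j arbitrary: s)
    case 0
    then show ?case using stop exec.WhileFalse by (metis diff_zero le_add2 mult_0 add_0)
  next
    case (Suc j)
    have "m - Suc j < m" using Suc.prems by auto
    then obtain t s' where 1: "bval b s" "exec c s t s'" "P (Suc (m - Suc j)) s'" "t \<le> T"
      using step Suc.prems by blast
    moreover have "Suc (m - Suc j) = m - j" using Suc.prems by auto
    ultimately obtain t' s'' where 2: "exec (While b c) s' t' s''" "P m s''" "t' \<le> j * (T + 1) + 1"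
      using Suc.IH[of s'] Suc.prems by auto
    have "exec (While b c) s (Suc (t + t')) s''" using 1 2 exec.WhileTrue by blast
    then show ?case using 1 2 by (intro exI[of _ "Suc (t + t')"] exI[of _ s'']) auto
  qed
  from this[of m s] show ?thesis using assms(3) by simp
qed

definition keeps :: "nat \<Rightarrow> state \<Rightarrow> state \<Rightarrow> bool" where
  "keeps k s s' \<longleftrightarrow> (\<forall>j<k. nats s' hid j = nats s hid j)"

lemma exec_compile_fm:
  assumes "wff f" "nats s ''n'' 0 \<le> N"
  shows "\<exists>t s'. exec (compile_fm f k) s t s' \<and> eqv s' s \<and> keeps k s s'
    \<and> nats s' hid k = (if fval f s then 1 else 0) \<and> t \<le> poly (costf f) N"
  using assms
proof (induction f arbitrary: k s)
  case (Atom b)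
  show ?case
  proof (cases "bval b s")
    case True
    have "exec (compile_fm (Atom b) k) s (Suc 1) (nupdate hid k 1 s)"
      using exec.CondTrue[OF True exec.NAssign[of hid "NConst k" "NConst 1" s]] by simp
    then show ?thesis using True
      by (intro exI[of _ "Suc 1"] exI[of _ "nupdate hid k 1 s"]) (auto simp: eqv_hid keeps_def)
  next
    case False
    have "exec (compile_fm (Atom b) k) s (Suc 1) (nupdate hid k 0 s)"
      using exec.CondFalse[OF False exec.NAssign[of hid "NConst k" "NConst 0" s]] by simp
    then show ?thesis using False
      by (intro exI[of _ "Suc 1"] exI[of _ "nupdate hid k 0 s"]) (auto simp: eqv_hid keeps_def)
  qed
next
  case (Neg f)
  then obtain t s' where s': "exec (compile_fm f k) s t s'" "eqv s' s" "keeps k s s'"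
    "nats s' hid k = (if fval f s then 1 else 0)" "t \<le> poly (costf f) N" by fastforce
  have "exec (compile_fm (Neg f) k) s (t + 1) (nupdate hid k (1 - nats s' hid k) s')"
    using exec.Seq[OF s'(1) exec.NAssign[of hid "NConst k" "NMinus (NConst 1) (hcell k)" s']] by simp
  then show ?case using s' 
    by (intro exI[of _ "t + 1"] exI[of _ "nupdate hid k (1 - nats s' hid k) s'"])
      (auto simp: keeps_def intro: eqv_trans[OF eqv_hid])
next
  case (Conj f g)
  then obtain t s' where s': "exec (compile_fm f k) s t s'" "eqv s' s" "keeps k s s'"
    "nats s' hid k = (if fval f s then 1 else 0)" "t \<le> poly (costf f) N" by fastforce
  have "nats s' ''n'' 0 \<le> N" using s' Conj.prems by (auto simp: eqv_def)
  then obtain t' s'' where s'': "exec (compile_fm g (Suc k)) s' t' s''" "eqv s'' s'" "keeps (Suc k) s' s''"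
    "nats s'' hid (Suc k) = (if fval g s' then 1 else 0)" "t' \<le> poly (costf g) N" using Conj by fastforce
  have k: "nats s'' hid k = (if fval f s then 1 else 0)" using s'(4) s''(3) by (auto simp: keeps_def)
  have g: "fval g s' = fval g s" using fval_eqv s' Conj.prems by auto
  let ?b = "BAnd (NLess (NConst 0) (hcell k)) (NLess (NConst 0) (hcell (Suc k)))"
  have b: "bval ?b s'' \<longleftrightarrow> fval (Conj f g) s" using k s''(4) g by simp
  have "exec (Cond ?b (hset k (NConst 1)) (hset k (NConst 0))) s'' (Suc 1) (nupdate hid k (if fval (Conj f g) s then 1 else 0) s'')"
    using exec.CondTrue[of ?b s'' "hset k (NConst 1)" 1 "nupdate hid k 1 s''" "hset k (NConst 0)"]
      exec.CondFalse[of ?b s'' "hset k (NConst 0)" 1 "nupdate hid k 0 s''" "hset k (NConst 1)"] b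
      exec.NAssign[of hid "NConst k" "NConst 0" s''] exec.NAssign[of hid "NConst k" "NConst 1" s''] 
    by (cases "fval (Conj f g) s") auto
  then have "exec (compile_fm (Conj f g) k) s (t + (t' + Suc 1)) (nupdate hid k (if fval (Conj f g) s then 1 else 0) s'')"
    unfolding compile_fm.simps by (rule exec.Seq[OF s'(1) exec.Seq[OF s''(1)]])
  then show ?case using s' s''
    by (intro exI[of _ "t + (t' + Suc 1)"] exI[of _ "nupdate hid k (if fval (Conj f g) s then 1 else 0) s''"])
      (auto simp: keeps_def intro!: eqv_trans[OF eqv_hid] eqv_trans[OF s''(2)])
next
  case (Ex z f)
  let ?n = "nats s ''n'' 0"
  have z: "z \<noteq> hid" "z \<noteq> ''n''" "wff f" using Ex.prems by auto
  define s1 where "s1 = nupdate hid (k + 2) 0 (nupdate hid (k + 1) (nats s z 0) (nupdate hid k 0 s))"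
  have s1: "exec (hset k (NConst 0)) s 1 (nupdate hid k 0 s)"
    "exec (hset (k + 1) (NCell z (NConst 0))) (nupdate hid k 0 s) 1 (nupdate hid (k + 1) (nats s z 0) (nupdate hid k 0 s))"
    "exec (hset (k + 2) (NConst 0)) (nupdate hid (k + 1) (nats s z 0) (nupdate hid k 0 s)) 1 s1"
    using exec.NAssign[of hid "NConst k" "NConst 0" s] exec.NAssign[of hid "NConst (k + 1)" "NCell z (NConst 0)" "nupdate hid k 0 s"]
      exec.NAssign[of hid "NConst (k + 2)" "NConst 0" "nupdate hid (k + 1) (nats s z 0) (nupdate hid k 0 s)"] z
    unfolding s1_def by simp_all
  \<comment> \<open>During the loop \<open>z\<close> may hold any value \<open>v\<close>; the saved
    copy in cell \<open>k + 1\<close> is what counts.\<close>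
  define P where "P i s' \<longleftrightarrow> (\<exists>v. eqv s' (nupdate z 0 v s)) \<and> keeps k s s' \<and> nats s' hid (k + 1) = nats s z 0
    \<and> nats s' hid (k + 2) = i \<and> nats s' hid k = (if \<exists>j<i. fval f (nupdate z 0 j s) then 1 else 0)" for i s'
  let ?b = "NLess (hcell (k + 2)) (NCell ''n'' (NConst 0))"
  let ?c = "Seq (NAssign z (NConst 0) (hcell (k + 2))) (Seq (compile_fm f (k + 3))
         (Seq (Cond (NLess (NConst 0) (hcell (k + 3))) (hset k (NConst 1)) Skip)
           (hset (k + 2) (NPlus (hcell (k + 2)) (NConst 1)))))"
  have bP: "bval ?b s' \<longleftrightarrow> i < ?n" if "P i s'" for i s'
    using that z unfolding P_def eqv_def by auto
  \<comment> \<open>Besides the body of the quantifier a round takes four steps: one sets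
    \<open>z\<close>, two go to the conditional, one advances the counter.\<close>
  have "\<exists>t s'. exec (While ?b ?c) s1 t s' \<and> P ?n s' \<and> t \<le> ?n * ((poly (costf f) N + 4) + 1) + 1"
  proof (rule exec_while)
    have "eqv s1 (nupdate z 0 (nats s z 0) s)" using z by (auto simp: s1_def eqv_def)
    then show "P 0 s1" using z by (auto simp: P_def s1_def keeps_def)
    show "\<not> bval ?b s'" if "P ?n s'" for s' using bP[OF that] by simp
    fix i s' assume i: "i < ?n" and P: "P i s'"
    define s2 where "s2 = nupdate z 0 i s'"
    have s2: "exec (NAssign z (NConst 0) (hcell (k + 2))) s' 1 s2"
      using exec.NAssign[of z "NConst 0" "hcell (k + 2)" s'] P by (simp add: P_def s2_def)
    have e2: "eqv s2 (nupdate z 0 i s)" using P z unfolding P_def s2_def eqv_def by auto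
    have "nats s2 ''n'' 0 \<le> N" using e2 Ex.prems z unfolding eqv_def by auto
    then obtain t3 s3 where s3: "exec (compile_fm f (k + 3)) s2 t3 s3" "eqv s3 s2" "keeps (k + 3) s2 s3"
      "nats s3 hid (k + 3) = (if fval f s2 then 1 else 0)" "t3 \<le> poly (costf f) N" using Ex.IH z by fastforce
    have f: "fval f s2 = fval f (nupdate z 0 i s)" using fval_eqv e2 z by blast
    define s4 where "s4 = (if fval f s2 then nupdate hid k 1 s3 else s3)"
    have s4: "exec (Cond (NLess (NConst 0) (hcell (k + 3))) (hset k (NConst 1)) Skip) s3 (Suc 1) s4"
    proof (cases "fval f s2")
      case True
      then show ?thesis using s3(4) exec.NAssign[of hid "NConst k" "NConst 1" s3] by (auto simp: s4_def intro!: exec.CondTrue)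
    next
      case False
      then show ?thesis using s3(4) exec.Skip by (auto simp: s4_def intro!: exec.CondFalse)
    qed
    define s5 where "s5 = nupdate hid (k + 2) (nats s4 hid (k + 2) + 1) s4"
    have s5: "exec (hset (k + 2) (NPlus (hcell (k + 2)) (NConst 1))) s4 1 s5"
      using exec.NAssign[of hid "NConst (k + 2)" "NPlus (hcell (k + 2)) (NConst 1)" s4] by (simp add: s5_def)
    have h3: "nats s3 hid j = nats s' hid j" if "j < k + 3" for j
      using s3(3) that z by (auto simp: keeps_def s2_def)
    have "exec ?c s' (1 + (t3 + (Suc 1 + 1))) s5"
      by (intro exec.Seq[OF s2] exec.Seq[OF s3(1)] exec.Seq[OF s4] s5)
    moreover have "P (Suc i) s5"
    proof -
      have "eqv s5 (nupdate z 0 i s)"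
        using s3(2) e2 unfolding s5_def s4_def by (auto simp: eqv_def)
      moreover have "nats s5 hid j = nats s' hid j" if "j < k + 2" "j \<noteq> k" for j
        using that h3 by (auto simp: s5_def s4_def)
      moreover have "nats s5 hid (k + 2) = Suc i" using h3[of "k + 2"] P by (auto simp: s5_def s4_def P_def)
      moreover have "nats s5 hid k = (if \<exists>j<Suc i. fval f (nupdate z 0 j s) then 1 else 0)"
        using h3[of k] P f by (auto simp: s5_def s4_def P_def less_Suc_eq)
      ultimately show ?thesis using P unfolding P_def keeps_def by (intro conjI exI[of _ i]) auto
    qed
    ultimately show "bval ?b s' \<and> (\<exists>t s''. exec ?c s' t s'' \<and> P (Suc i) s'' \<and> t \<le> poly (costf f) N + 4)"
      using bP[OF P] i s3(5) by (intro conjI exI[of _ "1 + (t3 + (Suc 1 + 1))"] exI[of _ s5]) auto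
  qed
  then obtain t6 s6 where s6: "exec (While ?b ?c) s1 t6 s6" "P ?n s6" "t6 \<le> ?n * ((poly (costf f) N + 4) + 1) + 1" by blast
  define s7 where "s7 = nupdate z 0 (nats s z 0) s6"
  have s7: "exec (NAssign z (NConst 0) (hcell (k + 1))) s6 1 s7"
    using exec.NAssign[of z "NConst 0" "hcell (k + 1)" s6] s6(2) by (simp add: P_def s7_def)
  have "exec (compile_fm (Ex z f) k) s (1 + (1 + (1 + (t6 + 1)))) s7"
    unfolding compile_fm.simps by (intro exec.Seq[OF s1(1)] exec.Seq[OF s1(2)] exec.Seq[OF s1(3)] exec.Seq[OF s6(1)] s7)
  moreover have "eqv s7 s" using s6(2) by (auto simp: P_def s7_def eqv_def)
  moreover have "keeps k s s7" using s6(2) z by (auto simp: P_def s7_def keeps_def)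
  moreover have "nats s7 hid k = (if fval (Ex z f) s then 1 else 0)" using s6(2) z by (simp add: P_def s7_def)
  moreover have "1 + (1 + (1 + (t6 + 1))) \<le> poly (costf (Ex z f)) N"
  proof -
    have "?n * (poly (costf f) N + 5) \<le> N * (poly (costf f) N + 5)" using Ex.prems by (intro mult_le_mono1) auto
    then show ?thesis using s6(3) by (simp add: algebra_simps)
  qed
  ultimately show ?case by blast
qed

lemma exec_compile:
  assumes "wfp p" "nats s ''n'' 0 \<le> N" "nats s ''d'' 0 \<le> N"
  shows "\<exists>t s'. exec (compile p k) s t s' \<and> eqv s' (sem p s) \<and> keeps k s s' \<and> t \<le> poly (cost p) N"
  using assms
proof (induction p arbitrary: k s)
  case (NSet x e f)
  then show ?case using exec.NAssign[of x e f s] 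
    by (intro exI[of _ 1] exI[of _ "nupdate x (nval e s) (nval f s) s"]) (auto simp: keeps_def)
next
  case (RSet x e f)
  then show ?case using exec.RAssign[of x e f s] 
    by (intro exI[of _ 1] exI[of _ "rupdate x (nval e s) (rval f s) s"]) (auto simp: keeps_def)
next
  case (Sq p q)
  then obtain t s' where s': "exec (compile p k) s t s'" "eqv s' (sem p s)" "keeps k s s'" "t \<le> poly (cost p) N" by fastforce
  have "nats s' ''n'' 0 \<le> N" "nats s' ''d'' 0 \<le> N" 
    using s'(2) Sq.prems wfp_writes[of p "''n''"] wfp_writes[of p "''d''"] by (auto simp: eqv_def nats_sem)
  then obtain t' s'' where s'': "exec (compile q k) s' t' s''" "eqv s'' (sem q s')" "keeps k s' s''" "t' \<le> poly (cost q) N"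
    using Sq by fastforce
  have "eqv s'' (sem (Sq p q) s)" using eqv_trans[OF s''(2) sem_eqv[OF s'(2)]] Sq.prems by simp
  moreover have "exec (compile (Sq p q) k) s (t + t') s''" using exec.Seq s' s'' by simp
  moreover have "keeps k s s''" using s' s'' by (auto simp: keeps_def)
  moreover have "t + t' \<le> poly (cost (Sq p q)) N" using s' s'' by simp
  ultimately show ?case by blast
next
  case (Guard f p)
  obtain t s' where s': "exec (compile_fm f k) s t s'" "eqv s' s" "keeps k s s'"
    "nats s' hid k = (if fval f s then 1 else 0)" "t \<le> poly (costf f) N" using exec_compile_fm[of f s N k] Guard.prems by auto
  show ?case
  proof (cases "fval f s")
    case True
    have "nats s' ''n'' 0 \<le> N" "nats s' ''d'' 0 \<le> N" using s'(2) Guard.prems by (auto simp: eqv_def)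
    then obtain t' s'' where s'': "exec (compile p k) s' t' s''" "eqv s'' (sem p s')" "keeps k s' s''" "t' \<le> poly (cost p) N"
      using Guard by fastforce
    have c: "exec (Cond (NLess (NConst 0) (hcell k)) (compile p k) Skip) s' (Suc t') s''"
      by (rule exec.CondTrue) (use s' True s''(1) in auto)
    have "exec (compile (Guard f p) k) s (t + Suc t') s''"
      using exec.Seq[OF s'(1) c] by simp
    moreover have "eqv s'' (sem (Guard f p) s)" using eqv_trans[OF s''(2) sem_eqv[OF s'(2)]] Guard.prems True by simp
    moreover have "keeps k s s''" using s' s'' by (auto simp: keeps_def)
    moreover have "t + Suc t' \<le> poly (cost (Guard f p)) N" using s' s'' by simp
    ultimately show ?thesis by blast
  next
    case False
    have c: "exec (Cond (NLess (NConst 0) (hcell k)) (compile p k) Skip) s' (Suc 1) s'"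
      by (rule exec.CondFalse) (use s' False exec.Skip in auto)
    have "exec (compile (Guard f p) k) s (t + Suc 1) s'"
      using exec.Seq[OF s'(1) c] by simp
    moreover have "eqv s' (sem (Guard f p) s)" using s' False by simp
    moreover have "t + Suc 1 \<le> poly (cost (Guard f p)) N" using s' by simp
    ultimately show ?thesis using s'(3) by blast
  qed
next
  case (For x b p)
  let ?m = "nats s b 0"
  let ?F = "\<lambda>i. fold (\<lambda>i s. sem p (nupdate x 0 i s)) [0..<i] s"
  have x: "x \<notin> {hid, ''n'', ''d''}" "b \<in> {''n'', ''d''}" "wfp p" using For.prems by auto
  have mN: "?m \<le> N" using x For.prems by auto
  have Fb: "nats (?F i) y = nats s y" if "y \<in> {''n'', ''d''}" for i y
    using that x wfp_writes[OF x(3), of y] by (induction i) (auto simp: nats_sem)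
  define s1 where "s1 = nupdate hid k 0 s"
  have s1: "exec (hset k (NConst 0)) s 1 s1" using exec.NAssign[of hid "NConst k" "NConst 0" s] by (simp add: s1_def)
  define P where "P i s' \<longleftrightarrow> eqv s' (?F i) \<and> keeps k s s' \<and> nats s' hid k = i" for i s'
  let ?b = "NLess (hcell k) (NCell b (NConst 0))"
  let ?c = "Seq (NAssign x (NConst 0) (hcell k)) (Seq (compile p (Suc k)) (hset k (NPlus (hcell k) (NConst 1))))"
  have bP: "bval ?b s' \<longleftrightarrow> i < ?m" if "P i s'" for i s'
    using that x(2) Fb[of b] unfolding P_def eqv_def by auto
  have "\<exists>t s'. exec (While ?b ?c) s1 t s' \<and> P ?m s' \<and> t \<le> ?m * ((poly (cost p) N + 2) + 1) + 1"
  proof (rule exec_while)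
    show "P 0 s1" by (auto simp: P_def s1_def eqv_def keeps_def)
    show "\<not> bval ?b s'" if "P ?m s'" for s' using bP[OF that] by simp
    fix i s' assume i: "i < ?m" and P: "P i s'"
    define s2 where "s2 = nupdate x 0 i s'"
    have s2: "exec (NAssign x (NConst 0) (hcell k)) s' 1 s2"
      using exec.NAssign[of x "NConst 0" "hcell k" s'] P by (simp add: P_def s2_def)
    have e2: "eqv s2 (nupdate x 0 i (?F i))" using P unfolding P_def s2_def by (auto intro: eqv_nupdate)
    have "nats s2 ''n'' 0 \<le> N" "nats s2 ''d'' 0 \<le> N" using e2 For.prems x(1) Fb unfolding eqv_def by auto
    then obtain t3 s3 where s3: "exec (compile p (Suc k)) s2 t3 s3" "eqv s3 (sem p s2)" "keeps (Suc k) s2 s3" "t3 \<le> poly (cost p) N"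
      using For.IH x by fastforce
    define s4 where "s4 = nupdate hid k (nats s3 hid k + 1) s3"
    have s4: "exec (hset k (NPlus (hcell k) (NConst 1))) s3 1 s4"
      using exec.NAssign[of hid "NConst k" "NPlus (hcell k) (NConst 1)" s3] by (simp add: s4_def)
    have "exec ?c s' (1 + (t3 + 1)) s4" by (intro exec.Seq[OF s2] exec.Seq[OF s3(1)] s4)
    moreover have "P (Suc i) s4"
    proof -
      have "eqv s4 (sem p s2)" using eqv_trans[OF eqv_hid s3(2)] by (simp add: s4_def)
      then have "eqv s4 (?F (Suc i))" using eqv_trans[OF _ sem_eqv[OF e2 x(3)]] by simp
      moreover have "keeps k s s4" "nats s4 hid k = Suc i" using s3(3) P x by (auto simp: s4_def P_def keeps_def s2_def)
      ultimately show ?thesis by (simp add: P_def)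
    qed
    ultimately show "bval ?b s' \<and> (\<exists>t s''. exec ?c s' t s'' \<and> P (Suc i) s'' \<and> t \<le> poly (cost p) N + 2)"
      using bP[OF P] i s3(4) by (intro conjI exI[of _ "1 + (t3 + 1)"] exI[of _ s4]) auto
  qed
  then obtain t s' where s': "exec (While ?b ?c) s1 t s'" "P ?m s'" "t \<le> ?m * ((poly (cost p) N + 2) + 1) + 1" by blast
  have "exec (compile (For x b p) k) s (1 + t) s'" unfolding compile.simps by (rule exec.Seq[OF s1 s'(1)])
  moreover have "1 + t \<le> poly (cost (For x b p)) N"
  proof -
    have "?m * (poly (cost p) N + 3) \<le> N * (poly (cost p) N + 3)" using mN by (rule mult_le_mono1)
    then show ?thesis using s'(3) by (simp add: algebra_simps)
  qed
  moreover have "eqv s' (sem (For x b p) s)" "keeps k s s'" using s'(2) by (auto simp: P_def)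
  ultimately show ?case by blast
qed

text \<open>The step may assume that arrays outside the syntactic write sets are as on entry, which
  keeps such facts out of the individual invariants.\<close>

lemma sem_For:
  assumes "I 0 s" and "\<And>i s'. i < nats s b 0 \<Longrightarrow> I i s' \<Longrightarrow> (\<forall>y. y \<notin> insert x (writes p) \<longrightarrow> nats s' y = nats s y) \<Longrightarrow>
     (\<forall>y. y \<notin> rwrites p \<longrightarrow> reals s' y = reals s y) \<Longrightarrow> I (Suc i) (sem p (nupdate x 0 i s'))"
  shows "I (nats s b 0) (sem (For x b p) s)"
proof -
  let ?F = "\<lambda>i. fold (\<lambda>i s. sem p (nupdate x 0 i s)) [0..<i] s"
  have "i \<le> nats s b 0 \<Longrightarrow> I i (?F i) \<and> (\<forall>y. y \<notin> insert x (writes p) \<longrightarrow> nats (?F i) y = nats s y)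
     \<and> (\<forall>y. y \<notin> rwrites p \<longrightarrow> reals (?F i) y = reals s y)" for i
    by (induction i) (use assms in \<open>auto simp: nats_sem reals_sem\<close>)
  then show ?thesis by simp
qed

section \<open>Geometric tests as machine expressions\<close>

type_synonym pt = "bool \<times> vname"

definition gname :: "bool \<Rightarrow> bool \<Rightarrow> vname" where
  "gname b c = (if b then (if c then ''GTT'' else ''GTF'') else (if c then ''GFT'' else ''GFF''))"

abbreviation Var :: "vname \<Rightarrow> nexp" where "Var x \<equiv> NCell x (NConst 0)"
abbreviation At :: "vname \<Rightarrow> vname \<Rightarrow> nexp" where "At a x \<equiv> NCell a (Var x)"

text \<open>Addresses cannot be multiplied, so the array \<open>row\<close> supplies the multiples
  of \<open>n\<close>. There is one table for each choice of first or second endpoints.\<close>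

definition gE :: "pt \<Rightarrow> pt \<Rightarrow> rexp" where
  "gE a b = RCell (gname (fst a) (fst b)) (NPlus (At ''row'' (snd a)) (Var (snd b)))"

definition gram :: "state \<Rightarrow> bool \<times> nat \<Rightarrow> bool \<times> nat \<Rightarrow> real" where
  "gram s a b = reals s (gname (fst a) (fst b)) (nats s ''row'' (snd a) + snd b)"

definition pos :: "state \<Rightarrow> pt \<Rightarrow> bool \<times> nat" where "pos s a = (fst a, nats s (snd a) 0)"

definition BOr :: "bexp \<Rightarrow> bexp \<Rightarrow> bexp" where "BOr b c = BNot (BAnd (BNot b) (BNot c))"
definition BIf :: "bexp \<Rightarrow> bexp \<Rightarrow> bexp \<Rightarrow> bexp" where "BIf a b c = BOr (BAnd a b) (BAnd (BNot a) c)"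
definition REq :: "rexp \<Rightarrow> rexp \<Rightarrow> bexp" where "REq e f = BAnd (BNot (RLess e f)) (BNot (RLess f e))"
definition NEq :: "nexp \<Rightarrow> nexp \<Rightarrow> bexp" where "NEq e f = BAnd (BNot (NLess e f)) (BNot (NLess f e))"

lemma bval_derived [simp]:
  "bval (BOr b c) s \<longleftrightarrow> bval b s \<or> bval c s"
  "bval (BIf a b c) s \<longleftrightarrow> (if bval a s then bval b s else bval c s)"
  "bval (REq e f) s \<longleftrightarrow> rval e s = rval f s"
  "bval (NEq k l) s \<longleftrightarrow> nval k s = nval l s"
  by (auto simp: BOr_def BIf_def REq_def NEq_def)

lemma bnames_derived [simp]:
  "bnames (BOr b c) = bnames b \<union> bnames c"
  "bnames (BIf a b c) = bnames a \<union> bnames b \<union> bnames c"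
  "bnames (REq e f) = rnames e \<union> rnames f"
  "bnames (NEq k l) = nnames k \<union> nnames l"
  by (auto simp: BOr_def BIf_def REq_def NEq_def)

definition iqE :: "pt \<Rightarrow> pt \<Rightarrow> pt \<Rightarrow> pt \<Rightarrow> rexp" where
  "iqE a b c d = RPlus (RMinus (RMinus (gE b d) (gE b c)) (gE a d)) (gE a c)"

definition discE :: "pt \<Rightarrow> pt \<Rightarrow> pt \<Rightarrow> pt \<Rightarrow> rexp" where
  "discE a b c d = RMinus (RTimes (iqE a b a b) (iqE c d c d)) (RTimes (iqE a b c d) (iqE a b c d))"

definition par1E :: "pt \<Rightarrow> pt \<Rightarrow> pt \<Rightarrow> pt \<Rightarrow> rexp" where
  "par1E a b c d = RDivide (RMinus (RTimes (iqE a c a b) (iqE c d c d)) (RTimes (iqE a c c d) (iqE a b c d))) (discE a b c d)"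

definition par2E :: "pt \<Rightarrow> pt \<Rightarrow> pt \<Rightarrow> pt \<Rightarrow> rexp" where
  "par2E a b c d = RDivide (RMinus (RTimes (iqE a c a b) (iqE a b c d)) (RTimes (iqE a c c d) (iqE a b a b))) (discE a b c d)"

definition gapE :: "pt \<Rightarrow> pt \<Rightarrow> pt \<Rightarrow> pt \<Rightarrow> rexp \<Rightarrow> rexp \<Rightarrow> rexp" where
  "gapE a b c d u v = RMinus (RPlus (RMinus (RPlus (RPlus (iqE a c a c) (RTimes (RTimes u u) (iqE a b a b)))
     (RTimes (RTimes v v) (iqE c d c d))) (RTimes (RTimes (RConst 2) u) (iqE a c a b)))
     (RTimes (RTimes (RConst 2) v) (iqE a c c d))) (RTimes (RTimes (RTimes (RConst 2) u) v) (iqE a b c d))"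

definition meetB :: "pt \<Rightarrow> pt \<Rightarrow> pt \<Rightarrow> pt \<Rightarrow> bexp" where
  "meetB a b c d = BIf (BNot (REq (discE a b c d) (RConst 0)))
     (BAnd (BNot (RLess (par1E a b c d) (RConst 0))) (BAnd (BNot (RLess (RConst 1) (par1E a b c d)))
       (BAnd (BNot (RLess (par2E a b c d) (RConst 0))) (BAnd (BNot (RLess (RConst 1) (par2E a b c d)))
         (REq (gapE a b c d (par1E a b c d) (par2E a b c d)) (RConst 0))))))
     (BAnd (REq (RTimes (iqE a c a c) (iqE a b a b)) (RTimes (iqE a c a b) (iqE a c a b)))
       (BAnd (BNot (BAnd (RLess (iqE a b a b) (iqE a c a b)) (RLess (iqE a b a b) (RPlus (iqE a c a b) (iqE a b c d)))))
         (BNot (BAnd (RLess (iqE a c a b) (RConst 0)) (RLess (RPlus (iqE a c a b) (iqE a b c d)) (RConst 0))))))"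

definition gram2E :: "pt \<Rightarrow> pt \<Rightarrow> pt \<Rightarrow> rexp" where
  "gram2E z a b = RMinus (RTimes (iqE z a z a) (iqE z b z b)) (RTimes (iqE z a z b) (iqE z a z b))"

definition gram3E :: "pt \<Rightarrow> pt \<Rightarrow> pt \<Rightarrow> pt \<Rightarrow> rexp" where
  "gram3E z a b c = RPlus (RMinus
     (RTimes (iqE z a z a) (RMinus (RTimes (iqE z b z b) (iqE z c z c)) (RTimes (iqE z b z c) (iqE z b z c))))
     (RTimes (iqE z a z b) (RMinus (RTimes (iqE z a z b) (iqE z c z c)) (RTimes (iqE z b z c) (iqE z a z c)))))
     (RTimes (iqE z a z c) (RMinus (RTimes (iqE z a z b) (iqE z b z c)) (RTimes (iqE z b z b) (iqE z a z c))))"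

definition touchB :: "vname \<Rightarrow> vname \<Rightarrow> bexp" where
  "touchB x y = meetB (False, x) (True, x) (False, y) (True, y)"

definition paramE :: "vname \<Rightarrow> vname \<Rightarrow> rexp" where
  "paramE x y = par1E (False, x) (True, x) (False, y) (True, y)"

definition ontoB :: "vname \<Rightarrow> pt \<Rightarrow> pt \<Rightarrow> bexp" where
  "ontoB x e z = REq (gram3E (False, x) (True, x) e z) (RConst 0)"

definition noncollinearB :: "vname \<Rightarrow> pt \<Rightarrow> bexp" where
  "noncollinearB x e = BNot (REq (gram2E (False, x) (True, x) e) (RConst 0))"

text \<open>Real expressions have no case distinction. The choice of the tip is therefore made by a
  \<open>BIf\<close> outside, and the chosen endpoint is passed as \<open>e\<close>.\<close>

definition planeB' :: "vname \<Rightarrow> vname \<Rightarrow> pt \<Rightarrow> vname \<Rightarrow> bexp" where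
  "planeB' x y e t = BAnd (noncollinearB x e) (BAnd (ontoB x e (False, y)) (BAnd (ontoB x e (True, y))
     (BAnd (ontoB x e (False, t)) (ontoB x e (True, t)))))"

definition planeB :: "vname \<Rightarrow> vname \<Rightarrow> vname \<Rightarrow> bexp" where
  "planeB x y t = BIf (noncollinearB x (False, y)) (planeB' x y (False, y) t) (planeB' x y (True, y) t)"

definition lexleB :: "(pt \<Rightarrow> rexp) \<Rightarrow> (pt \<Rightarrow> rexp) \<Rightarrow> pt \<Rightarrow> pt \<Rightarrow> bexp" where
  "lexleB X Y e f = BOr (RLess (X e) (X f)) (BAnd (REq (X e) (X f)) (BNot (RLess (Y f) (Y e))))"

definition orientE :: "(pt \<Rightarrow> rexp) \<Rightarrow> (pt \<Rightarrow> rexp) \<Rightarrow> pt \<Rightarrow> pt \<Rightarrow> pt \<Rightarrow> rexp" where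
  "orientE X Y a b z = RMinus (RTimes (RMinus (X b) (X a)) (RMinus (Y z) (Y a))) (RTimes (RMinus (Y b) (Y a)) (RMinus (X z) (X a)))"

definition aboveB :: "(pt \<Rightarrow> rexp) \<Rightarrow> (pt \<Rightarrow> rexp) \<Rightarrow> pt \<Rightarrow> pt \<Rightarrow> pt \<Rightarrow> bexp" where
  "aboveB X Y a b z = BIf (lexleB X Y b a) (RLess (orientE X Y a b z) (RConst 0)) (RLess (RConst 0) (orientE X Y a b z))"

definition underB :: "(pt \<Rightarrow> rexp) \<Rightarrow> (pt \<Rightarrow> rexp) \<Rightarrow> pt \<Rightarrow> pt \<Rightarrow> pt \<Rightarrow> bexp" where
  "underB X Y a b z = BIf (lexleB X Y b a) (RLess (RConst 0) (orientE X Y a b z)) (RLess (orientE X Y a b z) (RConst 0))"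

definition betweenB :: "(pt \<Rightarrow> rexp) \<Rightarrow> (pt \<Rightarrow> rexp) \<Rightarrow> pt \<Rightarrow> pt \<Rightarrow> pt \<Rightarrow> bexp" where
  "betweenB X Y a b z = BAnd (BOr (lexleB X Y a z) (lexleB X Y b z)) (BOr (lexleB X Y z a) (lexleB X Y z b))"

definition belowB :: "(pt \<Rightarrow> rexp) \<Rightarrow> (pt \<Rightarrow> rexp) \<Rightarrow> pt \<Rightarrow> pt \<Rightarrow> pt \<Rightarrow> pt \<Rightarrow> bexp" where
  "belowB X Y a b c d = BOr (BAnd (betweenB X Y a b c) (aboveB X Y a b c)) (BOr (BAnd (betweenB X Y a b d) (aboveB X Y a b d))
     (BOr (BAnd (betweenB X Y c d a) (underB X Y c d a)) (BAnd (betweenB X Y c d b) (underB X Y c d b))))"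

definition startsB :: "(pt \<Rightarrow> rexp) \<Rightarrow> (pt \<Rightarrow> rexp) \<Rightarrow> pt \<Rightarrow> pt \<Rightarrow> pt \<Rightarrow> pt \<Rightarrow> bexp" where
  "startsB X Y a b c d = BAnd (BOr (lexleB X Y a c) (lexleB X Y b c)) (BOr (lexleB X Y a d) (lexleB X Y b d))"

definition endsB :: "(pt \<Rightarrow> rexp) \<Rightarrow> (pt \<Rightarrow> rexp) \<Rightarrow> pt \<Rightarrow> pt \<Rightarrow> pt \<Rightarrow> pt \<Rightarrow> bexp" where
  "endsB X Y a b c d = BAnd (BOr (lexleB X Y a c) (lexleB X Y a d)) (BOr (lexleB X Y b c) (lexleB X Y b d))"

definition reachesB :: "(pt \<Rightarrow> rexp) \<Rightarrow> (pt \<Rightarrow> rexp) \<Rightarrow> pt \<Rightarrow> pt \<Rightarrow> pt \<Rightarrow> pt \<Rightarrow> bexp" where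
  "reachesB X Y a b c d = BOr (lexleB X Y a c) (BOr (lexleB X Y a d) (BOr (lexleB X Y b c) (lexleB X Y b d)))"

definition precB :: "(pt \<Rightarrow> rexp) \<Rightarrow> (pt \<Rightarrow> rexp) \<Rightarrow> nat \<Rightarrow> pt \<Rightarrow> pt \<Rightarrow> pt \<Rightarrow> pt \<Rightarrow> bexp" where
  "precB X Y i a b c d = BAnd (if i < 2 then startsB X Y a b c d else startsB X Y c d a b)
     (BAnd (if even i then endsB X Y a b c d else endsB X Y c d a b)
       (BOr (BNot (BAnd (reachesB X Y a b c d) (reachesB X Y c d a b))) (belowB X Y a b c d)))"

definition orderB' :: "nat \<Rightarrow> vname \<Rightarrow> pt \<Rightarrow> vname \<Rightarrow> vname \<Rightarrow> bexp" where
  "orderB' i x e t u = precB (\<lambda>z. iqE (False, x) z (False, x) (True, x)) (\<lambda>z. iqE (False, x) z (False, x) e)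
     i (False, t) (True, t) (False, u) (True, u)"

definition orderB :: "nat \<Rightarrow> vname \<Rightarrow> vname \<Rightarrow> vname \<Rightarrow> vname \<Rightarrow> bexp" where
  "orderB i x y t u = BAnd (BNot (touchB t u))
     (BIf (noncollinearB x (False, y)) (orderB' i x (False, y) t u) (orderB' i x (True, y) t u))"

lemma rval_iqE: "rval (iqE a b c d) s = iq (gram s) (pos s a) (pos s b) (pos s c) (pos s d)"
  by (simp add: iqE_def iq_def gE_def gram_def pos_def)

lemma rval_discE: "rval (discE a b c d) s = disc (gram s) (pos s a) (pos s b) (pos s c) (pos s d)"
  by (simp add: discE_def disc_def rval_iqE)

lemma rval_par1E: "rval (par1E a b c d) s = par1 (gram s) (pos s a) (pos s b) (pos s c) (pos s d)"
  by (simp add: par1E_def par1_def rval_iqE rval_discE)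

lemma rval_par2E: "rval (par2E a b c d) s = par2 (gram s) (pos s a) (pos s b) (pos s c) (pos s d)"
  by (simp add: par2E_def par2_def rval_iqE rval_discE)

lemma rval_gapE: "rval (gapE a b c d u v) s = gap (gram s) (pos s a) (pos s b) (pos s c) (pos s d) (rval u s) (rval v s)"
  by (simp add: gapE_def gap_def rval_iqE)

lemma bval_touchB: "bval (touchB x y) s \<longleftrightarrow> touches (gram s) (nats s x 0) (nats s y 0)"
  unfolding touchB_def touches_def meetB_def meet_def
  by (simp add: rval_iqE rval_discE rval_par1E rval_par2E rval_gapE pos_def not_less)

lemma rval_paramE: "rval (paramE x y) s = param (gram s) (nats s x 0) (nats s y 0)"
  by (simp add: paramE_def param_def rval_par1E pos_def)

lemma rval_gram2E: "rval (gram2E a b c) s = gram2 (gram s) (pos s a) (pos s b) (pos s c)"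
  by (simp add: gram2E_def gram2_def rval_iqE)

lemma bval_noncollinearB: "bval (noncollinearB x e) s \<longleftrightarrow> gram2 (gram s) (False, nats s x 0) (True, nats s x 0) (pos s e) \<noteq> 0"
  by (auto simp: noncollinearB_def rval_gram2E pos_def)

lemma bval_ontoB: "bval (ontoB x e z) s \<longleftrightarrow> gram3 (gram s) (False, nats s x 0) (True, nats s x 0) (pos s e) (pos s z) = 0"
proof -
  have "rval (gram3E (False, x) (True, x) e z) s = gram3 (gram s) (False, nats s x 0) (True, nats s x 0) (pos s e) (pos s z)"
    by (simp add: gram3E_def gram3_def rval_iqE pos_def)
  then show ?thesis by (auto simp: ontoB_def)
qed

lemma bval_planeB: "bval (planeB x y t) s \<longleftrightarrow> plane_contains (gram s) (nats s x 0) (nats s y 0) (nats s t 0)"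
  by (simp add: planeB_def planeB'_def bval_noncollinearB bval_ontoB plane_contains_def inplane_def tip_def pos_def)

lemma bval_precB:
  assumes X: "\<And>e. rval (X e) s = X' (pos s e)" and Y: "\<And>e. rval (Y e) s = Y' (pos s e)"
  shows "bval (precB X Y i a b c d) s \<longleftrightarrow> prec X' Y' i (pos s a) (pos s b) (pos s c) (pos s d)"
proof -
  have le: "bval (lexleB X Y e f) s \<longleftrightarrow> lexle X' Y' (pos s e) (pos s f)" for e f
    by (auto simp: lexleB_def lexle_def X Y)
  have o: "rval (orientE X Y e f z) s = orient X' Y' (pos s e) (pos s f) (pos s z)" for e f z
    by (simp add: orientE_def orient_def X Y)
  have "bval (startsB X Y a b c d) s \<longleftrightarrow> starts X' Y' (pos s a) (pos s b) (pos s c) (pos s d)"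
    "bval (endsB X Y a b c d) s \<longleftrightarrow> ends X' Y' (pos s a) (pos s b) (pos s c) (pos s d)"
    "bval (reachesB X Y a b c d) s \<longleftrightarrow> reaches X' Y' (pos s a) (pos s b) (pos s c) (pos s d)" for a b c d
    by (simp_all add: startsB_def starts_def endsB_def ends_def reachesB_def reaches_def le)
  moreover have "bval (belowB X Y a b c d) s \<longleftrightarrow> below X' Y' (pos s a) (pos s b) (pos s c) (pos s d)"
    unfolding belowB_def below_def betweenB_def between_def aboveB_def above_def underB_def under_def
    by (simp add: le o)
  ultimately show ?thesis unfolding precB_def prec_def by auto
qed

lemma bval_orderB: "bval (orderB i x y t u) s \<longleftrightarrow>
   plane_order (gram s) i (nats s x 0) (nats s y 0) (nats s t 0) (nats s u 0)"
proof -
  have "bval (orderB' i x e t u) s \<longleftrightarrow> prec (\<lambda>z. iq (gram s) (False, nats s x 0) z (False, nats s x 0) (True, nats s x 0))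
     (\<lambda>z. iq (gram s) (False, nats s x 0) z (False, nats s x 0) (pos s e)) i
     (pos s (False, t)) (pos s (True, t)) (pos s (False, u)) (pos s (True, u))" for e
    unfolding orderB'_def by (rule bval_precB) (simp_all add: rval_iqE pos_def)
  then show ?thesis
    by (simp add: orderB_def plane_order_def bval_touchB bval_noncollinearB cx_def cy_def[abs_def] cx_def[abs_def] tip_def pos_def)
qed

lemma hid_iqE [simp]: "hid \<notin> rnames (iqE a b c d) \<longleftrightarrow> hid \<notin> {snd a, snd b, snd c, snd d}"
  by (auto simp: iqE_def gE_def)

lemma hid_touchB [simp]: "hid \<notin> bnames (touchB x y) \<longleftrightarrow> hid \<noteq> x \<and> hid \<noteq> y"
  by (auto simp: touchB_def meetB_def discE_def par1E_def par2E_def gapE_def)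

lemma hid_paramE [simp]: "hid \<notin> rnames (paramE x y) \<longleftrightarrow> hid \<noteq> x \<and> hid \<noteq> y"
  by (auto simp: paramE_def discE_def par1E_def)

lemma hid_planeB [simp]: "hid \<notin> bnames (planeB x y t) \<longleftrightarrow> hid \<noteq> x \<and> hid \<noteq> y \<and> hid \<noteq> t"
  by (auto simp: planeB_def planeB'_def noncollinearB_def ontoB_def gram2E_def gram3E_def)

lemma hid_orderB [simp]: "hid \<noteq> x \<Longrightarrow> hid \<noteq> y \<Longrightarrow> hid \<noteq> t \<Longrightarrow> hid \<noteq> u \<Longrightarrow> hid \<notin> bnames (orderB i x y t u)"
proof -
  assume h: "hid \<noteq> x" "hid \<noteq> y" "hid \<noteq> t" "hid \<noteq> u"
  let ?X = "\<lambda>z. iqE (False, x) z (False, x) (True, x)"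
  have l: "hid \<notin> bnames (lexleB ?X (\<lambda>z. iqE (False, x) z (False, x) e) z z')" 
    and o: "hid \<notin> rnames (orientE ?X (\<lambda>z. iqE (False, x) z (False, x) e) z z' z'')"
    if "snd e \<noteq> hid" "snd z \<noteq> hid" "snd z' \<noteq> hid" "snd z'' \<noteq> hid" for e z z' z''
    using that h by (auto simp: lexleB_def orientE_def)
  have "hid \<notin> bnames (orderB' i x e t u)" if "snd e \<noteq> hid" for e
    using h that unfolding orderB'_def precB_def startsB_def endsB_def reachesB_def belowB_def betweenB_def aboveB_def underB_def
    by (simp add: l o)
  then show ?thesis using h by (simp add: orderB_def noncollinearB_def gram2E_def)
qed

text \<open>The table holds true inner products for indices below \<open>n\<close> only; the
  congruence lemmas show that the predicates look nowhere else.\<close>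

definition agree :: "nat \<Rightarrow> (bool \<times> nat \<Rightarrow> bool \<times> nat \<Rightarrow> real) \<Rightarrow> (bool \<times> nat \<Rightarrow> bool \<times> nat \<Rightarrow> real) \<Rightarrow> bool" where
  "agree n g g' \<longleftrightarrow> (\<forall>a b. snd a < n \<longrightarrow> snd b < n \<longrightarrow> g a b = g' a b)"

lemma iq_cong: "agree n g g' \<Longrightarrow> snd a < n \<Longrightarrow> snd b < n \<Longrightarrow> snd c < n \<Longrightarrow> snd d < n \<Longrightarrow> iq g a b c d = iq g' a b c d"
  unfolding iq_def agree_def by presburger

lemma touches_cong: "agree n g g' \<Longrightarrow> i < n \<Longrightarrow> j < n \<Longrightarrow> touches g i j = touches g' i j"
  by (simp add: touches_def meet_def disc_def par1_def par2_def gap_def iq_cong[of n g g'])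

lemma param_cong: "agree n g g' \<Longrightarrow> i < n \<Longrightarrow> j < n \<Longrightarrow> param g i j = param g' i j"
  by (simp add: param_def disc_def par1_def iq_cong[of n g g'])

lemma tip_cong: "agree n g g' \<Longrightarrow> i < n \<Longrightarrow> j < n \<Longrightarrow> tip g i j = tip g' i j"
  by (simp add: tip_def gram2_def iq_cong[of n g g'])

lemma snd_tip: "snd (tip g i j) = j"
  by (simp add: tip_def)

lemma plane_contains_cong: "agree n g g' \<Longrightarrow> i < n \<Longrightarrow> j < n \<Longrightarrow> k < n \<Longrightarrow> plane_contains g i j k = plane_contains g' i j k"
  by (simp add: plane_contains_def inplane_def tip_cong[of n g g'] gram2_def gram3_def iq_cong[of n g g'] snd_tip)

lemma prec_cong: "(\<And>z. z \<in> {a, b, c, d} \<Longrightarrow> X z = X' z \<and> Y z = Y' z) \<Longrightarrow> prec X Y i a b c d = prec X' Y' i a b c d"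
  unfolding prec_def starts_def ends_def reaches_def below_def between_def above_def under_def orient_def lexle_def
  by simp

lemma plane_order_cong:
  assumes "agree n g g'" "x < n" "y < n" "t < n" "u < n"
  shows "plane_order g i x y t u = plane_order g' i x y t u"
proof -
  have "prec (cx g x y) (cy g x y) i (False, t) (True, t) (False, u) (True, u) =
    prec (cx g' x y) (cy g' x y) i (False, t) (True, t) (False, u) (True, u)"
    by (rule prec_cong) (use assms in \<open>auto simp: cx_def cy_def tip_cong[of n g g'] iq_cong[of n g g'] snd_tip\<close>)
  then show ?thesis using touches_cong[OF assms(1,4,5)] by (simp add: plane_order_def)
qed

section \<open>Frames, marked index sets and nested loops\<close>

definition frame :: "vname set \<Rightarrow> state \<Rightarrow> state \<Rightarrow> bool" where
  "frame W s s' \<longleftrightarrow> (\<forall>y. y \<notin> W \<longrightarrow> nats s' y = nats s y) \<and> reals s' = reals s"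

lemma frame_refl [simp]: "frame W s s"
  by (simp add: frame_def)

lemma frame_trans: "frame W s s' \<Longrightarrow> frame W' s' s'' \<Longrightarrow> W \<subseteq> V \<Longrightarrow> W' \<subseteq> V \<Longrightarrow> frame V s s''"
  unfolding frame_def by (metis subsetD)

lemma frame_sem: "rwrites p = {} \<Longrightarrow> writes p \<subseteq> W \<Longrightarrow> frame W s (sem p s)"
  unfolding frame_def using nats_sem reals_sem by (metis ext empty_iff subsetD)

lemma frame_nupdate: "x \<in> W \<Longrightarrow> frame W s (nupdate x i v s)"
  by (auto simp: frame_def)

definition mark :: "nat \<Rightarrow> vname \<Rightarrow> state \<Rightarrow> nat set" where
  "mark n a s = {i. i < n \<and> nats s a i \<noteq> 0}"

lemma mark_nupdate: "mark n a (nupdate b i v s) = (if b = a then (if v \<noteq> 0 \<and> i < n then insert i (mark n a s) else if v = 0 then mark n a s - {i} else mark n a s) else mark n a s)"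
  by (auto simp: mark_def split: if_splits)

lemma mark_subset: "mark n a s \<subseteq> {..<n}"
  by (auto simp: mark_def)

lemma finite_mark [simp]: "finite (mark n a s)"
  by (rule finite_subset[OF mark_subset]) simp

primrec nest :: "vname list \<Rightarrow> prog \<Rightarrow> prog" where
  "nest [] p = p"
| "nest (x # xs) p = For x ''n'' (nest xs p)"

lemma writes_nest [simp]: "writes (nest xs p) = set xs \<union> writes p"
  by (induction xs) auto

lemma rwrites_nest [simp]: "rwrites (nest xs p) = rwrites p"
  by (induction xs) auto

lemma wfp_nest [simp]: "wfp (nest xs p) \<longleftrightarrow> set xs \<inter> {hid, ''n'', ''d''} = {} \<and> wfp p"
  by (induction xs) auto

lemma frame_eq: "frame W s s' \<Longrightarrow> y \<notin> W \<Longrightarrow> nats s' y = nats s y"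
  by (simp add: frame_def)

text \<open>The invariant speaks of the set of index tuples visited so far instead of the positions
  of the counters, so one shape serves every depth and ends with the set of all tuples.\<close>

lemma nest_rule:
  assumes "nats s ''n'' 0 = n" "rwrites p = {}" "''n'' \<notin> set xs \<union> writes p" "distinct xs" "set xs \<inter> writes p = {}"
    and "I {} s"
    and "\<And>Q s' x v. x \<in> set xs \<Longrightarrow> I Q s' \<Longrightarrow> I Q (nupdate x 0 v s')"
    and "\<And>Q vs s'. length vs = length xs \<Longrightarrow> set vs \<subseteq> {..<n} \<Longrightarrow> vs \<notin> Q \<Longrightarrow> I Q s' \<Longrightarrow>
      frame (set xs \<union> writes p) s s' \<Longrightarrow> map (\<lambda>x. nats s' x 0) xs = vs \<Longrightarrow> I (insert vs Q) (sem p s')"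
  shows "I {vs. length vs = length xs \<and> set vs \<subseteq> {..<n}} (sem (nest xs p) s)"
  using assms
proof (induction xs arbitrary: I s)
  case Nil
  have "I (insert [] {}) (sem p s)" using Nil(6) Nil(8)[of "[]" "{}" s] by simp
  moreover have "insert [] {} = {vs. length vs = length [] \<and> set vs \<subseteq> {..<n}}" by auto
  ultimately show ?case by simp
next
  case (Cons x xs)
  let ?V = "{vs. length vs = length xs \<and> set vs \<subseteq> {..<n}}"
  let ?U = "set (x # xs) \<union> writes p"
  define J where "J i s' \<longleftrightarrow> I {v # vs | v vs. v < i \<and> vs \<in> ?V} s'" for i s'
  have "J (nats s ''n'' 0) (sem (For x ''n'' (nest xs p)) s)"
  proof (rule sem_For)
    show "J 0 s" using Cons.prems(6) by (simp add: J_def)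
    fix i s' assume i: "i < nats s ''n'' 0" and J: "J i s'"
      and fr: "\<forall>y. y \<notin> insert x (writes (nest xs p)) \<longrightarrow> nats s' y = nats s y"
        "\<forall>y. y \<notin> rwrites (nest xs p) \<longrightarrow> reals s' y = reals s y"
    have fr': "frame ?U s s'" using fr Cons.prems(2) by (auto simp: frame_def)
    define s1 where "s1 = nupdate x 0 i s'"
    have fr1: "frame ?U s s1" using fr' by (auto simp: frame_def s1_def)
    \<comment> \<open>The invariant for the inner loops remembers the outer index \<open>i\<close>
      and adds the tuples of the finished outer rounds.\<close>
    define I' where "I' Q s'' \<longleftrightarrow> nats s'' x 0 = i \<and> I ({v # vs | v vs. v < i \<and> vs \<in> ?V} \<union> (#) i ` Q) s''" for Q s''
    have "I' ?V (sem (nest xs p) s1)"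
    proof (rule Cons.IH)
      show "nats s1 ''n'' 0 = n" using fr1 Cons.prems(1,3) by (simp add: frame_def)
      show "rwrites p = {}" "''n'' \<notin> set xs \<union> writes p" "distinct xs" "set xs \<inter> writes p = {}"
        using Cons.prems by auto
      show "I' {} s1" using J Cons.prems(7)[of x] by (simp add: I'_def J_def s1_def)
      show "I' Q (nupdate y 0 v s'')" if "y \<in> set xs" "I' Q s''" for Q s'' y v
        using that Cons.prems(4,7) by (auto simp: I'_def)
      fix Q vs s''
      assume vs: "length vs = length xs" "set vs \<subseteq> {..<n}" "vs \<notin> Q" "I' Q s''"
        and fr2: "frame (set xs \<union> writes p) s1 s''" and m: "map (\<lambda>x. nats s'' x 0) xs = vs"
      let ?R = "{v # vs | v vs. v < i \<and> vs \<in> ?V} \<union> (#) i ` Q"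
      have "I (insert (i # vs) ?R) (sem p s'')"
      proof (rule Cons.prems(8))
        show "length (i # vs) = length (x # xs)" "set (i # vs) \<subseteq> {..<n}" using vs i Cons.prems(1) by auto
        show "i # vs \<notin> ?R" using vs by auto
        show "I ?R s''" using vs by (simp add: I'_def)
        show "frame ?U s s''" using frame_trans[OF fr1 fr2, of ?U] by auto
        show "map (\<lambda>x. nats s'' x 0) (x # xs) = i # vs" using vs m by (simp add: I'_def)
      qed
      moreover have "insert (i # vs) ?R = {v # vs | v vs. v < i \<and> vs \<in> ?V} \<union> (#) i ` insert vs Q" by auto
      moreover have "nats (sem p s'') x 0 = i" using vs(4) nats_sem[of x p s''] Cons.prems(5) by (auto simp: I'_def)
      ultimately show "I' (insert vs Q) (sem p s'')" by (simp add: I'_def)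
    qed
    then have "I ({v # vs | v vs. v < i \<and> vs \<in> ?V} \<union> (#) i ` ?V) (sem (nest xs p) s1)" by (simp add: I'_def)
    moreover have "{v # vs | v vs. v < i \<and> vs \<in> ?V} \<union> (#) i ` ?V = {v # vs | v vs. v < Suc i \<and> vs \<in> ?V}"
      by (auto simp: less_Suc_eq)
    ultimately show "J (Suc i) (sem (nest xs p) (nupdate x 0 i s'))" by (simp add: J_def s1_def)
  qed
  moreover have "{v # vs | v vs. v < n \<and> vs \<in> ?V} = {vs. length vs = length (x # xs) \<and> set vs \<subseteq> {..<n}}"
    by (auto simp: length_Suc_conv)
  ultimately show ?case using Cons.prems(1) by (simp add: J_def)
qed

lemma nest1:
  assumes "nats s ''n'' 0 = n" "rwrites p = {}" "''n'' \<notin> insert x (writes p)" "x \<notin> writes p"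
    and "I {} s" "\<And>Q s' v. I Q s' \<Longrightarrow> I Q (nupdate x 0 v s')"
    and "\<And>Q a s'. a < n \<Longrightarrow> a \<notin> Q \<Longrightarrow> I Q s' \<Longrightarrow> frame (insert x (writes p)) s s' \<Longrightarrow> nats s' x 0 = a \<Longrightarrow> I (insert a Q) (sem p s')"
  shows "I {..<n} (sem (nest [x] p) s)"
proof -
  have "I {a. [a] \<in> {vs. length vs = length [x] \<and> set vs \<subseteq> {..<n}}} (sem (nest [x] p) s)"
  proof (rule nest_rule[where I = "\<lambda>Q. I {a. [a] \<in> Q}" and xs = "[x]"])
    fix Q vs s' assume "length vs = length [x]" "set vs \<subseteq> {..<n}" "vs \<notin> Q" "I {a. [a] \<in> Q} s'"
      "frame (set [x] \<union> writes p) s s'" "map (\<lambda>x. nats s' x 0) [x] = vs"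
    moreover have "{a. [a] \<in> insert [b] Q} = insert b {a. [a] \<in> Q}" for b by auto
    ultimately show "I {a. [a] \<in> insert vs Q} (sem p s')" using assms(7) by auto
  qed (use assms in auto)
  moreover have "{a. [a] \<in> {vs. length vs = length [x] \<and> set vs \<subseteq> {..<n}}} = {..<n}" by auto
  ultimately show ?thesis by simp
qed

lemma nest2:
  assumes "nats s ''n'' 0 = n" "rwrites p = {}" "''n'' \<notin> {x, y} \<union> writes p" "{x, y} \<inter> writes p = {}" "x \<noteq> y"
    and "I {} s" "\<And>Q s' z v. z \<in> {x, y} \<Longrightarrow> I Q s' \<Longrightarrow> I Q (nupdate z 0 v s')"
    and "\<And>Q a b s'. a < n \<Longrightarrow> b < n \<Longrightarrow> (a, b) \<notin> Q \<Longrightarrow> I Q s' \<Longrightarrow> frame ({x, y} \<union> writes p) s s' \<Longrightarrow>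
      nats s' x 0 = a \<Longrightarrow> nats s' y 0 = b \<Longrightarrow> I (insert (a, b) Q) (sem p s')"
  shows "I ({..<n} \<times> {..<n}) (sem (nest [x, y] p) s)"
proof -
  have "I {(a, b). [a, b] \<in> {vs. length vs = length [x, y] \<and> set vs \<subseteq> {..<n}}} (sem (nest [x, y] p) s)"
  proof (rule nest_rule[where I = "\<lambda>Q. I {(a, b). [a, b] \<in> Q}" and xs = "[x, y]"])
    fix Q vs s' assume "length vs = length [x, y]" "set vs \<subseteq> {..<n}" "vs \<notin> Q" "I {(a, b). [a, b] \<in> Q} s'"
      "frame (set [x, y] \<union> writes p) s s'" "map (\<lambda>x. nats s' x 0) [x, y] = vs"
    moreover have "{(a, b). [a, b] \<in> insert [c, d] Q} = insert (c, d) {(a, b). [a, b] \<in> Q}" for c d by auto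
    ultimately show "I {(a, b). [a, b] \<in> insert vs Q} (sem p s')" using assms(8) by auto
  qed (use assms in auto)
  moreover have "{(a, b). [a, b] \<in> {vs. length vs = length [x, y] \<and> set vs \<subseteq> {..<n}}} = {..<n} \<times> {..<n}" by auto
  ultimately show ?thesis by simp
qed

definition eqF :: "nexp \<Rightarrow> nexp \<Rightarrow> fm" where "eqF e f = Atom (NEq e f)"
definition ltF :: "nexp \<Rightarrow> nexp \<Rightarrow> fm" where "ltF e f = Atom (NLess e f)"
definition inF :: "vname \<Rightarrow> vname \<Rightarrow> fm" where "inF a x = Atom (NLess (NConst 0) (At a x))"
definition Disj :: "fm \<Rightarrow> fm \<Rightarrow> fm" where "Disj f g = Neg (Conj (Neg f) (Neg g))"
definition Imp :: "fm \<Rightarrow> fm \<Rightarrow> fm" where "Imp f g = Neg (Conj f (Neg g))"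
definition All :: "vname \<Rightarrow> fm \<Rightarrow> fm" where "All z f = Neg (Ex z (Neg f))"
definition tcF :: "vname \<Rightarrow> vname \<Rightarrow> fm" where "tcF x y = Atom (touchB x y)"
definition pcF :: "vname \<Rightarrow> vname \<Rightarrow> vname \<Rightarrow> fm" where "pcF x y t = Atom (planeB x y t)"
definition parF :: "vname \<Rightarrow> vname \<Rightarrow> vname \<Rightarrow> fm" where "parF x t u = Atom (REq (paramE x t) (paramE x u))"
definition ordF :: "nat \<Rightarrow> vname \<Rightarrow> vname \<Rightarrow> vname \<Rightarrow> vname \<Rightarrow> fm" where "ordF i x y t u = Atom (orderB i x y t u)"

lemma fval_derived [simp]:
  "fval (eqF e f) s \<longleftrightarrow> nval e s = nval f s"
  "fval (ltF e f) s \<longleftrightarrow> nval e s < nval f s"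
  "fval (inF a x) s \<longleftrightarrow> nats s a (nats s x 0) \<noteq> 0"
  "fval (Disj g h) s \<longleftrightarrow> fval g s \<or> fval h s"
  "fval (Imp g h) s \<longleftrightarrow> (fval g s \<longrightarrow> fval h s)"
  "fval (All z g) s \<longleftrightarrow> (\<forall>i < nats s ''n'' 0. fval g (nupdate z 0 i s))"
  by (auto simp: eqF_def ltF_def inF_def Disj_def Imp_def All_def)

lemma wff_derived [simp]:
  "wff (eqF e f) \<longleftrightarrow> hid \<notin> nnames e \<union> nnames f"
  "wff (ltF e f) \<longleftrightarrow> hid \<notin> nnames e \<union> nnames f"
  "wff (inF a x) \<longleftrightarrow> hid \<noteq> a \<and> hid \<noteq> x"
  "wff (Disj g h) \<longleftrightarrow> wff g \<and> wff h"
  "wff (Imp g h) \<longleftrightarrow> wff g \<and> wff h"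
  "wff (All z g) \<longleftrightarrow> z \<notin> {hid, ''n'', ''d''} \<and> wff g"
  "wff (tcF x y) \<longleftrightarrow> hid \<noteq> x \<and> hid \<noteq> y"
  "wff (pcF x y t) \<longleftrightarrow> hid \<noteq> x \<and> hid \<noteq> y \<and> hid \<noteq> t"
  "wff (parF x t u) \<longleftrightarrow> hid \<noteq> x \<and> hid \<noteq> t \<and> hid \<noteq> u"
  "hid \<noteq> x \<Longrightarrow> hid \<noteq> y \<Longrightarrow> hid \<noteq> t \<Longrightarrow> hid \<noteq> u \<Longrightarrow> wff (ordF i x y t u)"
  by (auto simp: eqF_def ltF_def inF_def Disj_def Imp_def All_def tcF_def pcF_def parF_def ordF_def)

locale segments_input = seg_geometry P for P :: "bool \<times> nat \<Rightarrow> 'a::real_inner" +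
  fixes n :: nat
begin

sublocale seg_structure "touches G" "plane_contains G" "param G" "plane_order G"
proof
  show "plane_contains G x y t \<Longrightarrow> plane_contains G x y x \<and> plane_contains G x y y" for x y t
    by (simp add: plane_contains_iff)
  show "plane_order G i x y t u \<Longrightarrow> \<not> touches G t u" for i x y t u by (simp add: plane_order_def)
qed (fact touches_refl touches_sym coplanar_touch coplanar_unique coplanar_both noncoplanar_touch
  noncoplanar_param plane_order_trans plane_order_total)+

abbreviation "tc \<equiv> touches G"
abbreviation "pc \<equiv> plane_contains G"
abbreviation "po \<equiv> plane_order G"

definition env :: "state \<Rightarrow> bool" where
  "env s \<longleftrightarrow> nats s ''n'' 0 = n \<and> agree n (gram s) G"

lemma env_n: "env s \<Longrightarrow> nats s ''n'' 0 = n"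
  by (simp add: env_def)

lemma gram_nupdate: "x \<noteq> ''row'' \<Longrightarrow> gram (nupdate x i v s) = gram s"
  by (simp add: gram_def fun_eq_iff)

lemma env_nupdate [simp]: "x \<notin> {''n'', ''row''} \<Longrightarrow> env (nupdate x i v s) = env s"
  by (auto simp: env_def gram_nupdate)

lemma env_frame: "env s \<Longrightarrow> frame W s s' \<Longrightarrow> {''n'', ''row''} \<inter> W = {} \<Longrightarrow> env s'"
proof -
  assume e: "env s" "frame W s s'" "{''n'', ''row''} \<inter> W = {}"
  then have "nats s' ''n'' = nats s ''n''" "nats s' ''row'' = nats s ''row''" "reals s' = reals s"
    by (auto simp: frame_def)
  then show "env s'" using e(1) by (simp add: env_def gram_def[abs_def])
qed

lemma fval_geometry [simp]:
  "env s \<Longrightarrow> nats s x 0 < n \<Longrightarrow> nats s y 0 < n \<Longrightarrow> fval (tcF x y) s \<longleftrightarrow> tc (nats s x 0) (nats s y 0)"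
  "env s \<Longrightarrow> nats s x 0 < n \<Longrightarrow> nats s y 0 < n \<Longrightarrow> nats s t 0 < n \<Longrightarrow>
     fval (pcF x y t) s \<longleftrightarrow> pc (nats s x 0) (nats s y 0) (nats s t 0)"
  "env s \<Longrightarrow> nats s x 0 < n \<Longrightarrow> nats s t 0 < n \<Longrightarrow> nats s u 0 < n \<Longrightarrow>
     fval (parF x t u) s \<longleftrightarrow> param G (nats s x 0) (nats s t 0) = param G (nats s x 0) (nats s u 0)"
  "env s \<Longrightarrow> nats s x 0 < n \<Longrightarrow> nats s y 0 < n \<Longrightarrow> nats s t 0 < n \<Longrightarrow> nats s u 0 < n \<Longrightarrow>
     fval (ordF i x y t u) s \<longleftrightarrow> po i (nats s x 0) (nats s y 0) (nats s t 0) (nats s u 0)"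
  unfolding env_def tcF_def pcF_def parF_def ordF_def
  by (simp_all add: bval_touchB bval_planeB bval_orderB rval_paramE touches_cong[of n "gram s" G]
      plane_contains_cong[of n "gram s" G] param_cong[of n "gram s" G] plane_order_cong[of n "gram s" G])

end

section \<open>Local search for an exchange-optimal clique\<close>

definition improveF :: fm where
  "improveF = Conj (Disj (eqF (Var ''t'') (Var ''u'')) (Neg (tcF ''t'' ''u'')))
     (Disj (Neg (Ex ''s'' (Conj (inF ''c'' ''s'') (Disj (tcF ''s'' ''t'') (tcF ''s'' ''u'')))))
        (Conj (Neg (eqF (Var ''t'') (Var ''u'')))
          (Neg (Ex ''s'' (Ex ''v'' (Conj (Conj (inF ''c'' ''s'') (inF ''c'' ''v''))
            (Conj (Neg (eqF (Var ''s'') (Var ''v''))) (Conj (Disj (tcF ''s'' ''t'') (tcF ''s'' ''u''))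
               (Disj (tcF ''v'' ''t'') (tcF ''v'' ''u''))))))))))"

definition exchange :: prog where
  "exchange = Sq (nest [''s''] (Guard (Conj (inF ''c'' ''s'') (Disj (tcF ''s'' ''t'') (tcF ''s'' ''u''))) (NSet ''c'' (Var ''s'') (NConst 0))))
     (Sq (NSet ''c'' (Var ''t'') (NConst 1)) (NSet ''c'' (Var ''u'') (NConst 1)))"

lemma writes_exchange [simp]: "writes exchange = {''s'', ''c''}" "rwrites exchange = {}"
  by (auto simp: exchange_def)

text \<open>A sweep over all pairs either certifies optimality or enlarges the clique. A clique has
  at most \<open>n\<close> members, so \<open>n\<close> sweeps are enough.\<close>

definition clique_prog :: prog where
  "clique_prog = For ''r'' ''n'' (nest [''t'', ''u''] (Guard improveF exchange))"

definition lab :: "state \<Rightarrow> nat \<Rightarrow> nat list" where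
  "lab s t = [nats s ''kd'' t, nats s ''lx'' t, nats s ''ly'' t, nats s ''lz'' t,
     nats s ''h0'' t, nats s ''h1'' t, nats s ''h2'' t, nats s ''h3'' t]"

definition label_names :: "vname set" where
  "label_names = {''kd'', ''lx'', ''ly'', ''lz'', ''h0'', ''h1'', ''h2'', ''h3''}"

abbreviation zeros :: "nat list" where "zeros \<equiv> [0, 0, 0, 0, 0, 0, 0, 0]"

definition set_label :: "nat \<Rightarrow> nexp \<Rightarrow> nexp \<Rightarrow> nexp \<Rightarrow> prog" where
  "set_label k x y z = Sq (NSet ''kd'' (Var ''t'') (NConst k)) (Sq (NSet ''lx'' (Var ''t'') x)
     (Sq (NSet ''ly'' (Var ''t'') y) (NSet ''lz'' (Var ''t'') z)))"

text \<open>The guard on \<open>kd\<close> makes the first witness final: later tuples and later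
  searches leave the label alone.\<close>

definition search :: "vname list \<Rightarrow> fm \<Rightarrow> nat \<Rightarrow> nexp \<Rightarrow> nexp \<Rightarrow> nexp \<Rightarrow> prog" where
  "search xs f k x y z = nest (''t'' # xs) (Guard (Conj (eqF (At ''kd'' ''t'') (NConst 0)) f) (set_label k x y z))"

lemma lab_frame: "frame W s s' \<Longrightarrow> label_names \<inter> W = {} \<Longrightarrow> lab s' t = lab s t"
  by (auto simp: frame_def lab_def label_names_def)

text \<open>\<open>F\<close>, \<open>X\<close>, \<open>Y\<close> and \<open>Z\<close> are the
  mathematical counterparts of the test and of the stored values, as functions of the witness tuple.
  The stored values have to be stable under changes of the label arrays, because the entries of a
  label are assigned one after another.\<close>

lemma search_correct:
  assumes n: "nats s ''n'' 0 = n"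
    and xs: "distinct (''t'' # xs)" "set xs \<inter> insert ''n'' label_names = {}"
    and zero: "\<And>t. t < n \<Longrightarrow> nats s ''kd'' t = 0 \<Longrightarrow> lab s t = zeros"
    and k: "k \<noteq> 0"
    and f: "\<And>s' t vs. t < n \<Longrightarrow> length vs = length xs \<Longrightarrow> set vs \<subseteq> {..<n} \<Longrightarrow> frame (set (''t'' # xs) \<union> label_names) s s' \<Longrightarrow>
       nats s' ''t'' 0 = t \<Longrightarrow> map (\<lambda>x. nats s' x 0) xs = vs \<Longrightarrow>
       fval f s' = F t vs \<and> (\<forall>s''. frame label_names s' s'' \<longrightarrow> nval x s'' = X vs \<and> nval y s'' = Y vs \<and> nval z s'' = Z vs)"
    and t: "t < n"
  shows "nats s ''kd'' t \<noteq> 0 \<Longrightarrow> lab (sem (search xs f k x y z) s) t = lab s t"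
    and "nats s ''kd'' t = 0 \<Longrightarrow>
      (\<exists>vs. length vs = length xs \<and> set vs \<subseteq> {..<n} \<and> F t vs \<and>
         lab (sem (search xs f k x y z) s) t = [k, X vs, Y vs, Z vs, 0, 0, 0, 0]) \<or>
      (\<forall>vs. length vs = length xs \<and> set vs \<subseteq> {..<n} \<longrightarrow> \<not> F t vs) \<and> lab (sem (search xs f k x y z) s) t = zeros"
proof -
  let ?V = "\<lambda>vs. length vs = length xs \<and> set vs \<subseteq> {..<n}"
  \<comment> \<open>Only segments unlabelled on entry change: such a segment either carries a label
    with a valid witness, or every tuple visited for it has failed.\<close>
  define I where "I Q s' \<longleftrightarrow> (\<forall>t<n. (nats s ''kd'' t \<noteq> 0 \<longrightarrow> lab s' t = lab s t) \<and> (nats s ''kd'' t = 0 \<longrightarrow>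
      (\<exists>vs. ?V vs \<and> F t vs \<and> lab s' t = [k, X vs, Y vs, Z vs, 0, 0, 0, 0]) \<or>
      (\<forall>vs. t # vs \<in> Q \<and> ?V vs \<longrightarrow> \<not> F t vs) \<and> lab s' t = zeros))" for Q s'
  let ?p = "Guard (Conj (eqF (At ''kd'' ''t'') (NConst 0)) f) (set_label k x y z)"
  have w: "writes ?p = {''kd'', ''lx'', ''ly'', ''lz''}" by (auto simp: set_label_def)
  have "I {vs. length vs = length (''t'' # xs) \<and> set vs \<subseteq> {..<n}} (sem (nest (''t'' # xs) ?p) s)"
  proof (rule nest_rule)
    show "nats s ''n'' 0 = n" by fact
    show "rwrites ?p = {}" by (simp add: set_label_def)
    show "''n'' \<notin> set (''t'' # xs) \<union> writes ?p" using xs unfolding w by auto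
    show "distinct (''t'' # xs)" by fact
    show "set (''t'' # xs) \<inter> writes ?p = {}" using xs unfolding w by (auto simp: label_names_def)
    show "I {} s" using zero by (auto simp: I_def)
    show "I Q (nupdate x 0 v s')" if "x \<in> set (''t'' # xs)" "I Q s'" for Q s' x v
    proof -
      have "x \<notin> label_names" using that(1) xs by (auto simp: label_names_def)
      then have "lab (nupdate x 0 v s') = lab s'" by (auto simp: lab_def label_names_def fun_eq_iff)
      then show ?thesis using that(2) by (simp add: I_def)
    qed
    fix Q vs' s'
    assume vs': "length vs' = length (''t'' # xs)" "set vs' \<subseteq> {..<n}" "vs' \<notin> Q" and I: "I Q s'"
      and fr: "frame (set (''t'' # xs) \<union> writes ?p) s s'" and m: "map (\<lambda>x. nats s' x 0) (''t'' # xs) = vs'"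
    obtain a vs where v: "vs' = a # vs" using vs' by (cases vs') auto
    have a: "a < n" "length vs = length xs" "set vs \<subseteq> {..<n}" "nats s' ''t'' 0 = a" "map (\<lambda>x. nats s' x 0) xs = vs"
      using vs' m v by auto
    have "frame (set (''t'' # xs) \<union> label_names) s s'" using fr unfolding frame_def w label_names_def by auto
    from f[OF a(1-3) this a(4,5)] have F: "fval f s' = F a vs"
      and XYZ: "\<And>s''. frame label_names s' s'' \<Longrightarrow> nval x s'' = X vs \<and> nval y s'' = Y vs \<and> nval z s'' = Z vs" by blast+
    show "I (insert vs' Q) (sem ?p s')"
    proof (cases "nats s' ''kd'' a = 0 \<and> F a vs")
      case True
      have "frame label_names s' (nupdate ''kd'' a k s')"
        "frame label_names s' (nupdate ''lx'' a (X vs) (nupdate ''kd'' a k s'))"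
        "frame label_names s' (nupdate ''ly'' a (Y vs) (nupdate ''lx'' a (X vs) (nupdate ''kd'' a k s')))"
        by (auto simp: frame_def label_names_def)
      then have sem: "sem ?p s' = nupdate ''lz'' a (Z vs) (nupdate ''ly'' a (Y vs) (nupdate ''lx'' a (X vs) (nupdate ''kd'' a k s')))"
        using True F a XYZ by (simp add: set_label_def)
      have z: "lab s' a = zeros" "nats s ''kd'' a = 0"
      proof -
        have "nats s ''kd'' a = 0" using I a True k by (auto simp: I_def lab_def)
        then show "nats s ''kd'' a = 0" "lab s' a = zeros" using I a True k by (auto simp: I_def lab_def)
      qed
      have la: "lab (sem ?p s') a = [k, X vs, Y vs, Z vs, 0, 0, 0, 0]" unfolding sem using z by (simp add: lab_def)
      have lb: "lab (sem ?p s') b = lab s' b" if "b \<noteq> a" for b unfolding sem using that by (simp add: lab_def)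
      show ?thesis unfolding I_def
      proof (intro allI impI)
        fix b assume b: "b < n"
        show "(nats s ''kd'' b \<noteq> 0 \<longrightarrow> lab (sem ?p s') b = lab s b) \<and> (nats s ''kd'' b = 0 \<longrightarrow>
            (\<exists>vs. ?V vs \<and> F b vs \<and> lab (sem ?p s') b = [k, X vs, Y vs, Z vs, 0, 0, 0, 0]) \<or>
            (\<forall>vs. b # vs \<in> insert vs' Q \<and> ?V vs \<longrightarrow> \<not> F b vs) \<and> lab (sem ?p s') b = zeros)"
        proof (cases "b = a")
          case True
          then show ?thesis using la z(2) \<open>nats s' ''kd'' a = 0 \<and> F a vs\<close> a(2,3) by (simp only: simp_thms) blast
        next
          case False
          then show ?thesis using I[unfolded I_def, rule_format, OF b] unfolding lb[OF False] v by simp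
        qed
      qed
    next
      case False
      then have sem: "sem ?p s' = s'" using F a by auto
      show ?thesis unfolding I_def sem
      proof (intro allI impI)
        fix b assume b: "b < n"
        show "(nats s ''kd'' b \<noteq> 0 \<longrightarrow> lab s' b = lab s b) \<and> (nats s ''kd'' b = 0 \<longrightarrow>
            (\<exists>vs. ?V vs \<and> F b vs \<and> lab s' b = [k, X vs, Y vs, Z vs, 0, 0, 0, 0]) \<or>
            (\<forall>vs. b # vs \<in> insert vs' Q \<and> ?V vs \<longrightarrow> \<not> F b vs) \<and> lab s' b = zeros)"
        proof (cases "b = a \<and> lab s' b = zeros")
          case True
          then have "\<not> F a vs" using False by (auto simp: lab_def)
          then show ?thesis using I[unfolded I_def, rule_format, OF b] True unfolding v by auto
        next
          case False
          then show ?thesis using I[unfolded I_def, rule_format, OF b] unfolding v by auto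
        qed
      qed
    qed
  qed
  then have post: "I {vs. length vs = length (''t'' # xs) \<and> set vs \<subseteq> {..<n}} (sem (search xs f k x y z) s)"
    by (simp add: search_def)
  show "nats s ''kd'' t \<noteq> 0 \<Longrightarrow> lab (sem (search xs f k x y z) s) t = lab s t"
    using post t by (simp add: I_def)
  assume "nats s ''kd'' t = 0"
  then show "(\<exists>vs. length vs = length xs \<and> set vs \<subseteq> {..<n} \<and> F t vs \<and>
         lab (sem (search xs f k x y z) s) t = [k, X vs, Y vs, Z vs, 0, 0, 0, 0]) \<or>
      (\<forall>vs. length vs = length xs \<and> set vs \<subseteq> {..<n} \<longrightarrow> \<not> F t vs) \<and> lab (sem (search xs f k x y z) s) t = zeros"
    using post[unfolded I_def, rule_format, OF t] t by auto
qed

context segments_input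
begin

definition improvable :: "nat set \<Rightarrow> nat \<Rightarrow> nat \<Rightarrow> bool" where
  "improvable C t u \<longleftrightarrow> (t = u \<or> \<not> tc t u) \<and> ((\<forall>s\<in>C. \<not> (tc s t \<or> tc s u)) \<or>
     t \<noteq> u \<and> (\<forall>s\<in>C. \<forall>v\<in>C. s \<noteq> v \<longrightarrow> \<not> ((tc s t \<or> tc s u) \<and> (tc v t \<or> tc v u))))"

text \<open>If a member is in the way, improvability allows only one such member and demands
  \<open>t \<noteq> u\<close>; otherwise at least one segment is gained for none.\<close>

lemma exchange_indep:
  assumes C: "C \<subseteq> {..<n}" "indep C" and i: "improvable C t u" "t < n" "u < n"
  shows "indep (C - {s \<in> C. tc s t \<or> tc s u} \<union> {t, u})" (is "indep ?C'")
    and "card C < card (C - {s \<in> C. tc s t \<or> tc s u} \<union> {t, u})"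
proof -
  let ?N = "{s \<in> C. tc s t \<or> tc s u}"
  have fin: "finite C" using C finite_subset by blast
  show "indep ?C'" using C i tc_sym unfolding indep_def improvable_def by auto
  have tN: "{t, u} \<inter> (C - ?N) = {}" using tc_refl by auto
  have "card ?N < card {t, u}"
  proof (cases "?N = {}")
    case True then show ?thesis by (metis card.empty card_gt_0_iff finite.emptyI finite_insert insert_not_empty)
  next
    case False
    then obtain s where s: "s \<in> ?N" by blast
    have "t \<noteq> u" "?N = {s}" using i(1) s unfolding improvable_def by auto
    then show ?thesis by simp
  qed
  moreover have "card ?C' = card (C - ?N) + card {t, u}"
    by (rule card_Un_disjoint) (use fin tN in auto)
  moreover have "card (C - ?N) = card C - card ?N" by (rule card_Diff_subset) (use fin in auto)
  moreover have "card ?N \<le> card C" by (rule card_mono) (use fin in auto)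
  ultimately show "card C < card ?C'" by linarith
qed

lemma fval_improveF:
  assumes "env s" "nats s ''t'' 0 = t" "nats s ''u'' 0 = u" "t < n" "u < n"
  shows "fval improveF s \<longleftrightarrow> improvable (mark n ''c'' s) t u"
proof -
  have c: "fval (Disj (tcF ''s'' ''t'') (tcF ''s'' ''u'')) (nupdate ''s'' 0 i s) \<longleftrightarrow> tc i t \<or> tc i u" if "i < n" for i
    using assms that by simp
  have c2: "fval (Conj (Conj (inF ''c'' ''s'') (inF ''c'' ''v''))
            (Conj (Neg (eqF (Var ''s'') (Var ''v''))) (Conj (Disj (tcF ''s'' ''t'') (tcF ''s'' ''u''))
               (Disj (tcF ''v'' ''t'') (tcF ''v'' ''u''))))) (nupdate ''v'' 0 j (nupdate ''s'' 0 i s))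
     \<longleftrightarrow> nats s ''c'' i \<noteq> 0 \<and> nats s ''c'' j \<noteq> 0 \<and> i \<noteq> j \<and> (tc i t \<or> tc i u) \<and> (tc j t \<or> tc j u)"
    if "i < n" "j < n" for i j using assms that by simp
  have "fval improveF s \<longleftrightarrow> (t = u \<or> \<not> tc t u) \<and> (\<not> (\<exists>i<n. nats s ''c'' i \<noteq> 0 \<and> (tc i t \<or> tc i u)) \<or>
     t \<noteq> u \<and> \<not> (\<exists>i<n. \<exists>j<n. nats s ''c'' i \<noteq> 0 \<and> nats s ''c'' j \<noteq> 0 \<and> i \<noteq> j \<and> (tc i t \<or> tc i u) \<and> (tc j t \<or> tc j u)))"
    using assms c c2 unfolding improveF_def by (simp add: env_n cong: conj_cong)
  then show ?thesis unfolding improvable_def mark_def by blast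
qed

lemma sem_exchange:
  assumes "env s" "nats s ''t'' 0 = t" "nats s ''u'' 0 = u" "t < n" "u < n"
  shows "mark n ''c'' (sem exchange s) = mark n ''c'' s - {v \<in> mark n ''c'' s. tc v t \<or> tc v u} \<union> {t, u}"
proof -
  let ?p = "Guard (Conj (inF ''c'' ''s'') (Disj (tcF ''s'' ''t'') (tcF ''s'' ''u''))) (NSet ''c'' (Var ''s'') (NConst 0))"
  define I where "I Q s' \<longleftrightarrow> mark n ''c'' s' = mark n ''c'' s - {v \<in> mark n ''c'' s. v \<in> Q \<and> (tc v t \<or> tc v u)}" for Q s'
  have I: "I {..<n} (sem (nest [''s''] ?p) s)"
  proof (rule nest1)
    show "nats s ''n'' 0 = n" using assms env_n by blast
    show "I {} s" by (simp add: I_def)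
    show "I Q s' \<Longrightarrow> I Q (nupdate ''s'' 0 v s')" for Q s' v by (simp add: I_def mark_nupdate)
    fix Q a s' assume a: "a < n" "a \<notin> Q" "I Q s'" and fr: "frame (insert ''s'' (writes ?p)) s s'" and "nats s' ''s'' 0 = a"
    moreover have "env s'" using env_frame[OF assms(1) fr] by simp
    moreover have "nats s' ''t'' 0 = t" "nats s' ''u'' 0 = u" using fr assms by (auto simp: frame_def)
    ultimately have se: "sem ?p s' = (if a \<in> mark n ''c'' s' \<and> (tc a t \<or> tc a u) then nupdate ''c'' a 0 s' else s')"
      using assms by (simp add: mark_def)
    have "mark n ''c'' (sem ?p s') = (if a \<in> mark n ''c'' s' \<and> (tc a t \<or> tc a u) then mark n ''c'' s' - {a} else mark n ''c'' s')"
      unfolding se by (cases "a \<in> mark n ''c'' s' \<and> (tc a t \<or> tc a u)") (simp_all only: if_True if_False, simp add: mark_nupdate)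
    then show "I (insert a Q) (sem ?p s')" using a(3) unfolding I_def by (simp only:) (auto split: if_splits)
  qed auto
  define s1 where "s1 = sem (nest [''s''] ?p) s"
  have "frame {''s'', ''c''} s s1" unfolding s1_def by (rule frame_sem) auto
  then have "nats s1 ''t'' 0 = t" "nats s1 ''u'' 0 = u" using assms by (auto simp: frame_def)
  then have "sem exchange s = nupdate ''c'' u 1 (nupdate ''c'' t 1 s1)"
    by (simp add: exchange_def s1_def)
  moreover have "mark n ''c'' s1 = mark n ''c'' s - {v \<in> mark n ''c'' s. tc v t \<or> tc v u}"
    using I mark_subset unfolding I_def s1_def by blast
  ultimately show ?thesis using assms(4,5) by (simp add: mark_nupdate insert_commute)
qed

text \<open>Until the first exchange the pairs visited are known not to improve the clique;
  afterwards only the cardinality is compared with that on entry. The last conjunct records that the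
  initial clique was not optimal, so an optimal clique is never changed by later sweeps.\<close>

lemma sweep_correct:
  assumes e: "env s" and C0: "indep (mark n ''c'' s)"
  shows "let s' = sem (nest [''t'', ''u''] (Guard improveF exchange)) s in
    (mark n ''c'' s' = mark n ''c'' s \<and> (\<forall>a<n. \<forall>b<n. \<not> improvable (mark n ''c'' s) a b)) \<or>
    (indep (mark n ''c'' s') \<and> card (mark n ''c'' s) < card (mark n ''c'' s') \<and> (\<exists>a<n. \<exists>b<n. improvable (mark n ''c'' s) a b))"
proof -
  let ?p = "Guard improveF exchange" and ?C = "mark n ''c'' s"
  define I where "I Q s' \<longleftrightarrow> (mark n ''c'' s' = ?C \<and> (\<forall>a<n. \<forall>b<n. (a, b) \<in> Q \<longrightarrow> \<not> improvable ?C a b)) \<or>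
    (indep (mark n ''c'' s') \<and> card ?C < card (mark n ''c'' s') \<and> (\<exists>a<n. \<exists>b<n. improvable ?C a b))" for Q s'
  have w: "writes ?p = {''s'', ''c''}" by (auto simp: exchange_def)
  have "I ({..<n} \<times> {..<n}) (sem (nest [''t'', ''u''] ?p) s)"
  proof (rule nest2)
    show "nats s ''n'' 0 = n" using e env_n by blast
    show "rwrites ?p = {}" by (simp add: exchange_def)
    show "I {} s" by (simp add: I_def)
    show "I Q (nupdate z 0 v s')" if "z \<in> {''t'', ''u''}" "I Q s'" for Q s' z v
      using that by (auto simp: I_def mark_nupdate)
    fix Q a b s' assume ab: "a < n" "b < n" "(a, b) \<notin> Q" and I: "I Q s'"
      and fr: "frame ({''t'', ''u''} \<union> writes ?p) s s'" and v: "nats s' ''t'' 0 = a" "nats s' ''u'' 0 = b"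
    have e': "env s'" using env_frame[OF e fr] unfolding w by simp
    show "I (insert (a, b) Q) (sem ?p s')"
    proof (cases "improvable (mark n ''c'' s') a b")
      case True
      then have m: "mark n ''c'' (sem ?p s') = mark n ''c'' s' - {v \<in> mark n ''c'' s'. tc v a \<or> tc v b} \<union> {a, b}"
        using sem_exchange[OF e' v ab(1,2)] fval_improveF[OF e' v ab(1,2)] by simp
      have "indep (mark n ''c'' s')" using I C0 by (auto simp: I_def)
      then have 1: "indep (mark n ''c'' (sem ?p s'))" "card (mark n ''c'' s') < card (mark n ''c'' (sem ?p s'))"
        unfolding m using exchange_indep[OF mark_subset _ True ab(1,2)] by auto
      have "card ?C \<le> card (mark n ''c'' s')" using I unfolding I_def by (elim disjE conjE) simp_all
      then have 2: "card ?C < card (mark n ''c'' (sem ?p s'))" using 1(2) by linarith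
      have "\<exists>a<n. \<exists>b<n. improvable ?C a b" using I True ab(1,2) unfolding I_def by metis
      then show ?thesis using 1(1) 2 unfolding I_def by blast
    next
      case False
      then have "sem ?p s' = s'" using fval_improveF[OF e' v ab(1,2)] by simp
      then show ?thesis using I False by (auto simp: I_def)
    qed
  qed (simp_all only: w, auto)
  then show ?thesis by (auto simp: I_def Let_def)
qed

lemma optimalI:
  assumes "indep C" "C \<subseteq> {..<n}" "\<forall>a<n. \<forall>b<n. \<not> improvable C a b"
  shows "optimal n C"
  unfolding optimal_def
proof (intro conjI allI impI)
  fix t assume "t < n"
  then have "\<not> improvable C t t" using assms(3) by blast
  then show "\<exists>s\<in>C. tc s t" by (auto simp: improvable_def)
next
  fix t u assume "t < n" "u < n" and d: "t \<noteq> u \<and> \<not> tc t u"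
  then have "\<not> improvable C t u" using assms(3) by blast
  then show "\<exists>s\<in>C. \<exists>s'\<in>C. s \<noteq> s' \<and> (tc s t \<or> tc s u) \<and> (tc s' t \<or> tc s' u)"
    using d unfolding improvable_def by blast
qed (fact assms)+

lemma clique_prog_correct:
  assumes e: "env s" and z: "mark n ''c'' s = {}"
  shows "optimal n (mark n ''c'' (sem clique_prog s))"
proof -
  let ?p = "nest [''t'', ''u''] (Guard improveF exchange)"
  define I where "I i s' \<longleftrightarrow> indep (mark n ''c'' s') \<and>
     (i \<le> card (mark n ''c'' s') \<or> (\<forall>a<n. \<forall>b<n. \<not> improvable (mark n ''c'' s') a b))" for i s'
  have w: "writes ?p = {''s'', ''t'', ''u'', ''c''}" "rwrites ?p = {}" by (auto simp: exchange_def)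
  have "I (nats s ''n'' 0) (sem clique_prog s)" unfolding clique_prog_def
  proof (rule sem_For)
    show "I 0 s" using z by (simp add: I_def indep_def)
    fix i s' assume I: "I i s'" and fr: "\<forall>y. y \<notin> insert ''r'' (writes ?p) \<longrightarrow> nats s' y = nats s y"
      "\<forall>y. y \<notin> rwrites ?p \<longrightarrow> reals s' y = reals s y"
    have "frame (insert ''r'' (writes ?p)) s s'" using fr w(2) by (auto simp: frame_def)
    then have "env s'" by (rule env_frame[OF e]) simp
    then have e1: "env (nupdate ''r'' 0 i s')" by simp
    have m: "mark n ''c'' (nupdate ''r'' 0 i s') = mark n ''c'' s'" by (simp add: mark_nupdate)
    define s2 where "s2 = sem ?p (nupdate ''r'' 0 i s')"
    have i: "indep (mark n ''c'' s')" "i \<le> card (mark n ''c'' s') \<or> (\<forall>a<n. \<forall>b<n. \<not> improvable (mark n ''c'' s') a b)"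
      using I by (simp_all add: I_def)
    consider "mark n ''c'' s2 = mark n ''c'' s'" "\<forall>a<n. \<forall>b<n. \<not> improvable (mark n ''c'' s') a b"
      | "indep (mark n ''c'' s2)" "card (mark n ''c'' s') < card (mark n ''c'' s2)" "\<exists>a<n. \<exists>b<n. improvable (mark n ''c'' s') a b"
      using sweep_correct[OF e1] i(1) unfolding m Let_def s2_def[symmetric] by blast
    then have "I (Suc i) s2"
    proof cases
      case 1
      then show ?thesis using i(1) unfolding I_def by simp
    next
      case 2
      then have "i \<le> card (mark n ''c'' s')" using i(2) by blast
      then show ?thesis using 2(1,2) unfolding I_def by simp
    qed
    then show "I (Suc i) (sem ?p (nupdate ''r'' 0 i s'))" by (simp only: s2_def)
  qed
  then have I: "indep (mark n ''c'' (sem clique_prog s))" "n \<le> card (mark n ''c'' (sem clique_prog s)) \<or>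
     (\<forall>a<n. \<forall>b<n. \<not> improvable (mark n ''c'' (sem clique_prog s)) a b)" using env_n[OF e] by (auto simp: I_def)
  have "\<forall>a<n. \<forall>b<n. \<not> improvable (mark n ''c'' (sem clique_prog s)) a b"
  proof (cases "n \<le> card (mark n ''c'' (sem clique_prog s))")
    case True
    then have "mark n ''c'' (sem clique_prog s) = {..<n}" by (intro card_seteq mark_subset) auto
    \<comment> \<open>With all indices in the clique, \<open>a\<close> and \<open>b\<close>
      themselves are members in the way.\<close>
    moreover have "\<not> improvable {..<n} a b" if "a < n" "b < n" for a b
      using that tc_refl[of a] tc_refl[of b] unfolding improvable_def by blast
    ultimately show ?thesis by simp
  next
    case False
    then show ?thesis using I by blast
  qed
  then show ?thesis using I mark_subset by (intro optimalI)
qed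

end

section \<open>Labels outside the planes: private, non-coplanar and crossing\<close>

definition private_prog :: prog where
  "private_prog = search [''s''] (Conj (Conj (inF ''c'' ''s'') (tcF ''s'' ''t''))
     (All ''v'' (Imp (Conj (inF ''c'' ''v'') (tcF ''v'' ''t'')) (eqF (Var ''v'') (Var ''s'')))))
     1 (Var ''s'') (NConst 0) (NConst 0)"

definition nonplanar_prog :: prog where
  "nonplanar_prog = search [''x'', ''y''] (Conj (Conj (Conj (inF ''c'' ''x'') (inF ''c'' ''y'')) (ltF (Var ''x'') (Var ''y'')))
     (Conj (Conj (tcF ''x'' ''t'') (tcF ''y'' ''t'')) (Neg (pcF ''x'' ''y'' ''x''))))
     2 (Var ''x'') (Var ''y'') (NConst 0)"

definition same_pairF :: fm where
  "same_pairF = Conj (eqF (At ''lx'' ''v'') (At ''lx'' ''t'')) (eqF (At ''ly'' ''v'') (At ''ly'' ''t''))"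

text \<open>Greedy choice of a maximal clique among the segments of each non-coplanar pair. One
  array serves all pairs, because membership is always tested together with
  \<open>same_pairF\<close>.\<close>

definition matching_prog :: prog where
  "matching_prog = nest [''t''] (Guard (Conj (eqF (At ''kd'' ''t'') (NConst 2))
     (Neg (Ex ''v'' (Conj (Conj (inF ''m'' ''v'') (tcF ''v'' ''t'')) same_pairF)))) (NSet ''m'' (Var ''t'') (NConst 1)))"

text \<open>A later hit may overwrite an earlier one, since every hit yields a valid label.
  \<open>x\<close> and \<open>y\<close> are scratch copies of the pair, because \<open>parF\<close>
  takes names of variables.\<close>

definition side_prog :: prog where
  "side_prog = nest [''t'', ''v''] (Guard (Conj (Conj (eqF (At ''kd'' ''t'') (NConst 2)) (inF ''m'' ''v'')) same_pairF)
     (Sq (NSet ''x'' (NConst 0) (At ''lx'' ''t'')) (Sq (NSet ''y'' (NConst 0) (At ''ly'' ''t''))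
       (Sq (Guard (parF ''x'' ''v'' ''t'') (Sq (NSet ''lz'' (Var ''t'') (Var ''v'')) (NSet ''h0'' (Var ''t'') (NConst 0))))
         (Guard (parF ''y'' ''v'' ''t'') (Sq (NSet ''lz'' (Var ''t'') (Var ''v'')) (NSet ''h0'' (Var ''t'') (NConst 1))))))))"

definition point_prog :: prog where
  "point_prog = search [''x'', ''y'', ''s''] (Conj (Conj (Conj (inF ''c'' ''x'') (inF ''c'' ''y'')) (ltF (Var ''x'') (Var ''y'')))
     (Conj (Conj (pcF ''x'' ''y'' ''t'') (inF ''c'' ''s'')) (Conj (tcF ''s'' ''t'') (Neg (pcF ''x'' ''y'' ''s'')))))
     3 (Var ''x'') (Var ''y'') (Var ''s'')"

definition early_prog :: prog where
  "early_prog = Sq private_prog (Sq nonplanar_prog (Sq matching_prog (Sq side_prog point_prog)))"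

lemma mark_frame: "frame W s s' \<Longrightarrow> a \<notin> W \<Longrightarrow> mark n a s' = mark n a s"
  by (simp add: mark_def frame_def)

lemma writes_set_label [simp]: "writes (set_label k x y z) = {''kd'', ''lx'', ''ly'', ''lz''}" "rwrites (set_label k x y z) = {}"
  by (auto simp: set_label_def)

lemma writes_search [simp]: "writes (search xs f k x y z) = insert ''t'' (set xs) \<union> {''kd'', ''lx'', ''ly'', ''lz''}"
   "rwrites (search xs f k x y z) = {}"
  by (auto simp: search_def)

lemma frame_search: "frame (insert ''t'' (set xs) \<union> label_names) s (sem (search xs f k x y z) s)"
  by (rule frame_sem) (auto simp: label_names_def)

lemma nats_var_frame: "frame label_names s s' \<Longrightarrow> x \<notin> label_names \<Longrightarrow> nval (Var x) s' = nats s x 0"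
  by (simp add: frame_def)

context segments_input
begin

lemma fval_inF: "nats s x 0 < n \<Longrightarrow> fval (inF a x) s \<longleftrightarrow> nats s x 0 \<in> mark n a s"
  by (simp add: mark_def)

definition ok1 :: "nat set \<Rightarrow> nat \<Rightarrow> nat list \<Rightarrow> bool" where
  "ok1 C t l \<longleftrightarrow> (\<exists>x\<in>C. l = [1, x, 0, 0, 0, 0, 0, 0] \<and> (\<forall>s\<in>C. tc s t \<longrightarrow> s = x))"

definition nonplanar_pair :: "nat set \<Rightarrow> nat \<Rightarrow> nat \<Rightarrow> nat \<Rightarrow> bool" where
  "nonplanar_pair C t x y \<longleftrightarrow> x \<in> C \<and> y \<in> C \<and> x < y \<and> tc x t \<and> tc y t \<and> \<not> pc x y x"

definition ok2 :: "nat set \<Rightarrow> nat set \<Rightarrow> (nat \<Rightarrow> nat list) \<Rightarrow> nat \<Rightarrow> bool" where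
  "ok2 C M L t \<longleftrightarrow> (\<exists>x y z e. L t = [2, x, y, z, e, 0, 0, 0] \<and> nonplanar_pair C t x y \<and> z \<in> M \<and> L z ! 1 = x \<and> L z ! 2 = y
     \<and> (e = 0 \<and> param G x z = param G x t \<or> e = 1 \<and> param G y z = param G y t))"

definition ok3 :: "nat set \<Rightarrow> nat \<Rightarrow> nat list \<Rightarrow> bool" where
  "ok3 C t l \<longleftrightarrow> (\<exists>x y s. l = [3, x, y, s, 0, 0, 0, 0] \<and> x \<in> C \<and> y \<in> C \<and> x < y \<and> pc x y t \<and> s \<in> C \<and> tc s t \<and> \<not> pc x y s)"

lemma private_correct:
  assumes e: "env s" and C: "optimal n (mark n ''c'' s)" and z: "\<And>t. t < n \<Longrightarrow> lab s t = zeros" and t: "t < n"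
  shows "ok1 (mark n ''c'' s) t (lab (sem private_prog s) t) \<or>
    lab (sem private_prog s) t = zeros \<and> (\<exists>x\<in>mark n ''c'' s. \<exists>y\<in>mark n ''c'' s. x < y \<and> tc x t \<and> tc y t)"
proof -
  let ?C = "mark n ''c'' s"
  define F where "F t vs \<longleftrightarrow> hd vs \<in> ?C \<and> tc (hd vs) t \<and> (\<forall>v\<in>?C. tc v t \<longrightarrow> v = hd vs)" for t vs
  have kd: "nats s ''kd'' t = 0" using z[OF t] by (simp add: lab_def)
  have "(\<exists>vs. length vs = length [''s''] \<and> set vs \<subseteq> {..<n} \<and> F t vs \<and>
         lab (sem private_prog s) t = [1, hd vs, 0, 0, 0, 0, 0, 0]) \<or>
      (\<forall>vs. length vs = length [''s''] \<and> set vs \<subseteq> {..<n} \<longrightarrow> \<not> F t vs) \<and> lab (sem private_prog s) t = zeros"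
    unfolding private_prog_def
  proof (rule search_correct(2)[OF env_n[OF e]])
    fix s' t vs
    assume a: "t < n" "length vs = length [''s'']" "set vs \<subseteq> {..<n}" "nats s' ''t'' 0 = t" "map (\<lambda>x. nats s' x 0) [''s''] = vs"
      and fr: "frame (set [''t'', ''s''] \<union> label_names) s s'"
    have e': "env s'" by (rule env_frame[OF e fr]) (auto simp: label_names_def)
    have c: "mark n ''c'' s' = ?C" by (rule mark_frame[OF fr]) (auto simp: label_names_def)
    obtain x where x: "vs = [x]" "x < n" "nats s' ''s'' 0 = x" using a by auto
    have 1: "fval (Conj (inF ''c'' ''s'') (tcF ''s'' ''t'')) s' \<longleftrightarrow> x \<in> ?C \<and> tc x t"
      using x a e' by (simp add: fval_inF c del: fval_derived(3))
    have 2: "fval (Imp (Conj (inF ''c'' ''v'') (tcF ''v'' ''t'')) (eqF (Var ''v'') (Var ''s''))) (nupdate ''v'' 0 i s')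
      \<longleftrightarrow> (i \<in> ?C \<and> tc i t \<longrightarrow> i = x)" if "i < n" for i
      using x a e' that by (simp add: fval_inF c mark_nupdate del: fval_derived(3))
    have "fval (Conj (Conj (inF ''c'' ''s'') (tcF ''s'' ''t''))
     (All ''v'' (Imp (Conj (inF ''c'' ''v'') (tcF ''v'' ''t'')) (eqF (Var ''v'') (Var ''s''))))) s' \<longleftrightarrow> F t vs"
      unfolding fval.simps(3) 1[unfolded fval.simps(3)] fval_derived(6) env_n[OF e'] using 2 x mark_subset[of n "''c''" s]
      unfolding F_def by auto
    moreover have "\<forall>s''. frame label_names s' s'' \<longrightarrow> nval (Var ''s'') s'' = hd vs"
      using x by (auto simp: frame_def label_names_def)
    ultimately show "fval (Conj (Conj (inF ''c'' ''s'') (tcF ''s'' ''t''))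
     (All ''v'' (Imp (Conj (inF ''c'' ''v'') (tcF ''v'' ''t'')) (eqF (Var ''v'') (Var ''s''))))) s' = F t vs \<and>
      (\<forall>s''. frame label_names s' s'' \<longrightarrow> nval (Var ''s'') s'' = hd vs \<and> nval (NConst 0) s'' = 0 \<and> nval (NConst 0) s'' = 0)"
      by simp
  qed (use z t kd in \<open>auto simp: label_names_def\<close>)
  then show ?thesis
  proof
    assume "\<exists>vs. length vs = length [''s''] \<and> set vs \<subseteq> {..<n} \<and> F t vs \<and> lab (sem private_prog s) t = [1, hd vs, 0, 0, 0, 0, 0, 0]"
    then show ?thesis unfolding ok1_def F_def by blast
  next
    assume *: "(\<forall>vs. length vs = length [''s''] \<and> set vs \<subseteq> {..<n} \<longrightarrow> \<not> F t vs) \<and> lab (sem private_prog s) t = zeros"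
    obtain x where x: "x \<in> ?C" "tc x t" using C t unfolding optimal_def by blast
    have "x < n" using x(1) by (simp add: mark_def)
    then have "\<not> F t [x]" using * by simp
    then obtain y where "y \<in> ?C" "tc y t" "y \<noteq> x" using x by (auto simp: F_def)
    then show ?thesis using x * by (metis linorder_neqE_nat)
  qed
qed

lemma nonplanar_correct:
  assumes e: "env s" and z: "\<And>t. t < n \<Longrightarrow> nats s ''kd'' t = 0 \<Longrightarrow> lab s t = zeros" and t: "t < n"
  shows "nats s ''kd'' t \<noteq> 0 \<Longrightarrow> lab (sem nonplanar_prog s) t = lab s t"
    and "nats s ''kd'' t = 0 \<Longrightarrow> (\<exists>x y. nonplanar_pair (mark n ''c'' s) t x y \<and> lab (sem nonplanar_prog s) t = [2, x, y, 0, 0, 0, 0, 0])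
      \<or> (\<forall>x y. \<not> nonplanar_pair (mark n ''c'' s) t x y) \<and> lab (sem nonplanar_prog s) t = zeros"
proof -
  let ?C = "mark n ''c'' s"
  let ?f = "Conj (Conj (Conj (inF ''c'' ''x'') (inF ''c'' ''y'')) (ltF (Var ''x'') (Var ''y'')))
     (Conj (Conj (tcF ''x'' ''t'') (tcF ''y'' ''t'')) (Neg (pcF ''x'' ''y'' ''x'')))"
  define F where "F t vs \<longleftrightarrow> nonplanar_pair ?C t (vs ! 0) (vs ! 1)" for t vs
  have eval: "fval ?f s' = F t vs \<and> (\<forall>s''. frame label_names s' s'' \<longrightarrow>
      nval (Var ''x'') s'' = vs ! 0 \<and> nval (Var ''y'') s'' = vs ! 1 \<and> nval (NConst 0) s'' = 0)"
    if a: "t < n" "length vs = length [''x'', ''y'']" "set vs \<subseteq> {..<n}" "nats s' ''t'' 0 = t" "map (\<lambda>x. nats s' x 0) [''x'', ''y''] = vs"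
      and fr: "frame (set [''t'', ''x'', ''y''] \<union> label_names) s s'" for s' t vs
  proof -
    have e': "env s'" by (rule env_frame[OF e fr]) (auto simp: label_names_def)
    have c: "mark n ''c'' s' = ?C" by (rule mark_frame[OF fr]) (auto simp: label_names_def)
    obtain x y where x: "vs = [x, y]" "x < n" "y < n" "nats s' ''x'' 0 = x" "nats s' ''y'' 0 = y" using a by auto
    have "fval ?f s' \<longleftrightarrow> nonplanar_pair ?C t x y"
      using x a e' by (auto simp add: nonplanar_pair_def fval_inF c simp del: fval_derived(3))
    moreover have "\<forall>s''. frame label_names s' s'' \<longrightarrow> nval (Var ''x'') s'' = x \<and> nval (Var ''y'') s'' = y"
      using x by (auto simp: frame_def label_names_def)
    ultimately show ?thesis using x by (simp add: F_def)
  qed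
  note sc = search_correct[where xs = "[''x'', ''y'']" and k = 2 and f = ?f and F = F and x = "Var ''x''" and y = "Var ''y''"
      and z = "NConst 0" and X = "\<lambda>vs. vs ! 0" and Y = "\<lambda>vs. vs ! 1" and Z = "\<lambda>_. 0", OF env_n[OF e] _ _ z _ eval t]
  show "lab (sem nonplanar_prog s) t = lab s t" if "nats s ''kd'' t \<noteq> 0"
    unfolding nonplanar_prog_def by (rule sc(1)) (auto simp: label_names_def that)
  assume kd: "nats s ''kd'' t = 0"
  have "(\<exists>vs. length vs = length [''x'', ''y''] \<and> set vs \<subseteq> {..<n} \<and> F t vs \<and>
         lab (sem nonplanar_prog s) t = [2, vs ! 0, vs ! 1, 0, 0, 0, 0, 0]) \<or>
      (\<forall>vs. length vs = length [''x'', ''y''] \<and> set vs \<subseteq> {..<n} \<longrightarrow> \<not> F t vs) \<and> lab (sem nonplanar_prog s) t = zeros"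
    unfolding nonplanar_prog_def by (rule sc(2)) (auto simp: label_names_def kd)
  then show "(\<exists>x y. nonplanar_pair ?C t x y \<and> lab (sem nonplanar_prog s) t = [2, x, y, 0, 0, 0, 0, 0])
      \<or> (\<forall>x y. \<not> nonplanar_pair ?C t x y) \<and> lab (sem nonplanar_prog s) t = zeros"
  proof
    assume *: "(\<forall>vs. length vs = length [''x'', ''y''] \<and> set vs \<subseteq> {..<n} \<longrightarrow> \<not> F t vs) \<and> lab (sem nonplanar_prog s) t = zeros"
    have "\<not> nonplanar_pair ?C t x y" for x y
    proof
      assume p: "nonplanar_pair ?C t x y"
      then have "x < n" "y < n" by (auto simp: nonplanar_pair_def mark_def)
      then have "\<not> F t [x, y]" using * by simp
      then show False using p by (simp add: F_def)
    qed
    then show ?thesis using * by blast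
  qed (auto simp: F_def)
qed

lemma point_correct:
  assumes e: "env s" and z: "\<And>t. t < n \<Longrightarrow> nats s ''kd'' t = 0 \<Longrightarrow> lab s t = zeros" and t: "t < n"
  shows "nats s ''kd'' t \<noteq> 0 \<Longrightarrow> lab (sem point_prog s) t = lab s t"
    and "nats s ''kd'' t = 0 \<Longrightarrow> ok3 (mark n ''c'' s) t (lab (sem point_prog s) t) \<or>
      (\<forall>x\<in>mark n ''c'' s. \<forall>y\<in>mark n ''c'' s. \<forall>r\<in>mark n ''c'' s. x < y \<and> pc x y t \<and> tc r t \<longrightarrow> pc x y r) \<and> lab (sem point_prog s) t = zeros"
proof -
  let ?C = "mark n ''c'' s"
  let ?f = "Conj (Conj (Conj (inF ''c'' ''x'') (inF ''c'' ''y'')) (ltF (Var ''x'') (Var ''y'')))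
     (Conj (Conj (pcF ''x'' ''y'' ''t'') (inF ''c'' ''s'')) (Conj (tcF ''s'' ''t'') (Neg (pcF ''x'' ''y'' ''s''))))"
  define R where "R t x y r \<longleftrightarrow> x \<in> ?C \<and> y \<in> ?C \<and> x < y \<and> pc x y t \<and> r \<in> ?C \<and> tc r t \<and> \<not> pc x y r" for t x y r
  define F where "F t vs \<longleftrightarrow> R t (vs ! 0) (vs ! 1) (vs ! 2)" for t vs
  have eval: "fval ?f s' = F t vs \<and> (\<forall>s''. frame label_names s' s'' \<longrightarrow>
      nval (Var ''x'') s'' = vs ! 0 \<and> nval (Var ''y'') s'' = vs ! 1 \<and> nval (Var ''s'') s'' = vs ! 2)"
    if a: "t < n" "length vs = length [''x'', ''y'', ''s'']" "set vs \<subseteq> {..<n}" "nats s' ''t'' 0 = t" "map (\<lambda>x. nats s' x 0) [''x'', ''y'', ''s''] = vs"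
      and fr: "frame (set [''t'', ''x'', ''y'', ''s''] \<union> label_names) s s'" for s' t vs
  proof -
    have e': "env s'" by (rule env_frame[OF e fr]) (auto simp: label_names_def)
    have c: "mark n ''c'' s' = ?C" by (rule mark_frame[OF fr]) (auto simp: label_names_def)
    obtain x y r where x: "vs = [x, y, r]" "x < n" "y < n" "r < n" "nats s' ''x'' 0 = x" "nats s' ''y'' 0 = y" "nats s' ''s'' 0 = r" using a by auto
    have "fval ?f s' \<longleftrightarrow> R t x y r"
      using x a e' by (auto simp add: R_def fval_inF c simp del: fval_derived(3))
    moreover have "\<forall>s''. frame label_names s' s'' \<longrightarrow> nval (Var ''x'') s'' = x \<and> nval (Var ''y'') s'' = y \<and> nval (Var ''s'') s'' = r"
      using x by (auto simp: frame_def label_names_def)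
    ultimately show ?thesis using x by (simp add: F_def)
  qed
  note sc = search_correct[where xs = "[''x'', ''y'', ''s'']" and k = 3 and f = ?f and F = F and x = "Var ''x''" and y = "Var ''y''"
      and z = "Var ''s''" and X = "\<lambda>vs. vs ! 0" and Y = "\<lambda>vs. vs ! 1" and Z = "\<lambda>vs. vs ! 2", OF env_n[OF e] _ _ z _ eval t]
  show "lab (sem point_prog s) t = lab s t" if "nats s ''kd'' t \<noteq> 0"
    unfolding point_prog_def by (rule sc(1)) (auto simp: label_names_def that)
  assume kd: "nats s ''kd'' t = 0"
  have "(\<exists>vs. length vs = length [''x'', ''y'', ''s''] \<and> set vs \<subseteq> {..<n} \<and> F t vs \<and>
         lab (sem point_prog s) t = [3, vs ! 0, vs ! 1, vs ! 2, 0, 0, 0, 0]) \<or>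
      (\<forall>vs. length vs = length [''x'', ''y'', ''s''] \<and> set vs \<subseteq> {..<n} \<longrightarrow> \<not> F t vs) \<and> lab (sem point_prog s) t = zeros"
    unfolding point_prog_def by (rule sc(2)) (auto simp: label_names_def kd)
  then show "ok3 ?C t (lab (sem point_prog s) t) \<or>
      (\<forall>x\<in>?C. \<forall>y\<in>?C. \<forall>r\<in>?C. x < y \<and> pc x y t \<and> tc r t \<longrightarrow> pc x y r) \<and> lab (sem point_prog s) t = zeros"
  proof
    assume "\<exists>vs. length vs = length [''x'', ''y'', ''s''] \<and> set vs \<subseteq> {..<n} \<and> F t vs \<and>
         lab (sem point_prog s) t = [3, vs ! 0, vs ! 1, vs ! 2, 0, 0, 0, 0]"
    then show ?thesis unfolding ok3_def F_def R_def by blast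
  next
    assume *: "(\<forall>vs. length vs = length [''x'', ''y'', ''s''] \<and> set vs \<subseteq> {..<n} \<longrightarrow> \<not> F t vs) \<and> lab (sem point_prog s) t = zeros"
    have "\<not> R t x y r" for x y r
    proof
      assume p: "R t x y r"
      then have "x < n" "y < n" "r < n" by (auto simp: R_def mark_def)
      then have "\<not> F t [x, y, r]" using * by simp
      then show False using p by (simp add: F_def)
    qed
    then show ?thesis using * unfolding R_def by blast
  qed
qed

end

lemma lab_nth [simp]: "lab s t ! 0 = nats s ''kd'' t" "lab s t ! Suc 0 = nats s ''lx'' t" "lab s t ! 2 = nats s ''ly'' t"
  "lab s t ! 3 = nats s ''lz'' t"
  by (simp_all add: lab_def eval_nat_numeral)

lemma fval_same_pairF [simp]: "fval same_pairF s \<longleftrightarrow> nats s ''lx'' (nats s ''v'' 0) = nats s ''lx'' (nats s ''t'' 0)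
   \<and> nats s ''ly'' (nats s ''v'' 0) = nats s ''ly'' (nats s ''t'' 0)"
  by (simp add: same_pairF_def)

lemma writes_early:
  "writes private_prog = {''t'', ''s'', ''kd'', ''lx'', ''ly'', ''lz''}" "rwrites private_prog = {}"
  "writes nonplanar_prog = {''t'', ''x'', ''y'', ''kd'', ''lx'', ''ly'', ''lz''}" "rwrites nonplanar_prog = {}"
  "writes matching_prog = {''t'', ''m''}" "rwrites matching_prog = {}"
  "writes side_prog = {''t'', ''v'', ''x'', ''y'', ''lz'', ''h0''}" "rwrites side_prog = {}"
  "writes point_prog = {''t'', ''x'', ''y'', ''s'', ''kd'', ''lx'', ''ly'', ''lz''}" "rwrites point_prog = {}"
  by (auto simp: private_prog_def nonplanar_prog_def matching_prog_def side_prog_def point_prog_def)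

context segments_input
begin

text \<open>A segment that is not chosen was blocked by a chosen one that touches it, and a chosen
  one touches itself; this gives maximality for each pair.\<close>

lemma matching_correct:
  assumes e: "env s" and z: "mark n ''m'' s = {}"
  defines "M \<equiv> mark n ''m'' (sem matching_prog s)"
    and "same \<equiv> (\<lambda>v t. nats s ''lx'' v = nats s ''lx'' t \<and> nats s ''ly'' v = nats s ''ly'' t)"
  shows "\<forall>v\<in>M. nats s ''kd'' v = 2" "\<forall>v\<in>M. \<forall>v'\<in>M. v \<noteq> v' \<and> same v v' \<longrightarrow> \<not> tc v v'"
    "\<forall>t<n. nats s ''kd'' t = 2 \<longrightarrow> (\<exists>v\<in>M. tc v t \<and> same v t)"
proof -
  let ?g = "Conj (Conj (inF ''m'' ''v'') (tcF ''v'' ''t'')) same_pairF"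
  let ?p = "Guard (Conj (eqF (At ''kd'' ''t'') (NConst 2)) (Neg (Ex ''v'' ?g))) (NSet ''m'' (Var ''t'') (NConst 1))"
  define I where "I Q s' \<longleftrightarrow> (let M = mark n ''m'' s' in (\<forall>v\<in>M. nats s ''kd'' v = 2) \<and>
    (\<forall>v\<in>M. \<forall>v'\<in>M. v \<noteq> v' \<and> same v v' \<longrightarrow> \<not> tc v v') \<and>
    (\<forall>t\<in>Q. nats s ''kd'' t = 2 \<longrightarrow> (\<exists>v\<in>M. tc v t \<and> same v t)))" for Q s'
  have "I {..<n} (sem (nest [''t''] ?p) s)"
  proof (rule nest1)
    show "nats s ''n'' 0 = n" using env_n[OF e] .
    show "I {} s" using z by (simp add: I_def)
    show "I Q (nupdate ''t'' 0 v s')" if "I Q s'" for Q s' v using that by (simp add: I_def mark_nupdate)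
    fix Q a s' assume a: "a < n" "a \<notin> Q" and I: "I Q s'" and fr: "frame (insert ''t'' (writes ?p)) s s'" and t: "nats s' ''t'' 0 = a"
    define M' where "M' = mark n ''m'' s'"
    have e': "env s'" by (rule env_frame[OF e fr]) simp
    have arr: "nats s' ''kd'' = nats s ''kd''" "nats s' ''lx'' = nats s ''lx''" "nats s' ''ly'' = nats s ''ly''"
      using fr by (auto simp: frame_def)
    have g: "fval ?g (nupdate ''v'' 0 v s') \<longleftrightarrow> v \<in> M' \<and> tc v a \<and> same v a" if "v < n" for v
      using that a t e' arr by (simp add: fval_inF mark_nupdate M'_def same_def del: fval_derived(3))
    have "fval (Ex ''v'' ?g) s' \<longleftrightarrow> (\<exists>v\<in>M'. tc v a \<and> same v a)"
      unfolding fval.simps(4) env_n[OF e'] using g mark_subset[of n "''m''" s'] unfolding M'_def by blast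
    then have pr: "fval (Conj (eqF (At ''kd'' ''t'') (NConst 2)) (Neg (Ex ''v'' ?g))) s' \<longleftrightarrow>
       nats s ''kd'' a = 2 \<and> \<not> (\<exists>v\<in>M'. tc v a \<and> same v a)"
      using t arr by (simp del: fval.simps(4))
    have sem: "sem ?p s' = (if nats s ''kd'' a = 2 \<and> \<not> (\<exists>v\<in>M'. tc v a \<and> same v a) then nupdate ''m'' a 1 s' else s')"
      unfolding sem.simps(4) pr by (simp only: sem.simps(1) nval.simps t)
    have I': "\<forall>v\<in>M'. nats s ''kd'' v = 2" "\<forall>v\<in>M'. \<forall>v'\<in>M'. v \<noteq> v' \<and> same v v' \<longrightarrow> \<not> tc v v'"
      "\<forall>t\<in>Q. nats s ''kd'' t = 2 \<longrightarrow> (\<exists>v\<in>M'. tc v t \<and> same v t)" using I by (auto simp: I_def M'_def Let_def)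
    show "I (insert a Q) (sem ?p s')"
    proof (cases "nats s ''kd'' a = 2 \<and> \<not> (\<exists>v\<in>M'. tc v a \<and> same v a)")
      case True
      then have m: "mark n ''m'' (sem ?p s') = insert a M'" unfolding sem using a by (simp add: mark_nupdate M'_def)
      have "same a v \<longleftrightarrow> same v a" for v by (auto simp: same_def)
      then show ?thesis unfolding I_def m Let_def using I' True tc_sym tc_refl by (auto simp: same_def)
    next
      case False
      then have m: "mark n ''m'' (sem ?p s') = M'" unfolding sem by (auto simp add: M'_def)
      show ?thesis unfolding I_def m Let_def using I' False by blast
    qed
  qed auto
  then show "\<forall>v\<in>M. nats s ''kd'' v = 2" "\<forall>v\<in>M. \<forall>v'\<in>M. v \<noteq> v' \<and> same v v' \<longrightarrow> \<not> tc v v'"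
    "\<forall>t<n. nats s ''kd'' t = 2 \<longrightarrow> (\<exists>v\<in>M. tc v t \<and> same v t)"
    unfolding I_def M_def matching_prog_def Let_def by blast+
qed

lemma side_correct:
  assumes e: "env s" and C: "indep C" "C \<subseteq> {..<n}"
    and l2: "\<And>t. t < n \<Longrightarrow> nats s ''kd'' t = 2 \<Longrightarrow> \<exists>x y. nonplanar_pair C t x y \<and> lab s t = [2, x, y, 0, 0, 0, 0, 0]"
    and M: "\<forall>v\<in>mark n ''m'' s. nats s ''kd'' v = 2"
    and ex: "\<And>t. t < n \<Longrightarrow> nats s ''kd'' t = 2 \<Longrightarrow>
      \<exists>v\<in>mark n ''m'' s. tc v t \<and> nats s ''lx'' v = nats s ''lx'' t \<and> nats s ''ly'' v = nats s ''ly'' t"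
    and t: "t < n"
  shows "nats s ''kd'' t \<noteq> 2 \<Longrightarrow> lab (sem side_prog s) t = lab s t"
    and "nats s ''kd'' t = 2 \<Longrightarrow> ok2 C (mark n ''m'' s) (lab (sem side_prog s)) t"
proof -
  let ?M = "mark n ''m'' s" and ?kd = "nats s ''kd''" and ?lx = "nats s ''lx''" and ?ly = "nats s ''ly''"
  let ?pred = "Conj (Conj (eqF (At ''kd'' ''t'') (NConst 2)) (inF ''m'' ''v'')) same_pairF"
  let ?px = "Sq (NSet ''lz'' (Var ''t'') (Var ''v'')) (NSet ''h0'' (Var ''t'') (NConst 0))"
  let ?py = "Sq (NSet ''lz'' (Var ''t'') (Var ''v'')) (NSet ''h0'' (Var ''t'') (NConst 1))"
  let ?body = "Sq (NSet ''x'' (NConst 0) (At ''lx'' ''t'')) (Sq (NSet ''y'' (NConst 0) (At ''ly'' ''t''))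
       (Sq (Guard (parF ''x'' ''v'' ''t'') ?px) (Guard (parF ''y'' ''v'' ''t'') ?py)))"
  let ?p = "Guard ?pred ?body"
  define same where "same v t \<longleftrightarrow> v \<in> ?M \<and> ?lx v = ?lx t \<and> ?ly v = ?ly t" for v t
  define px where "px v t \<longleftrightarrow> param G (?lx t) v = param G (?lx t) t" for v t
  define py where "py v t \<longleftrightarrow> param G (?ly t) v = param G (?ly t) t" for v t
  define good where "good t l \<longleftrightarrow> (\<exists>z e. l = [2, ?lx t, ?ly t, z, e, 0, 0, 0] \<and> same z t \<and> (e = 0 \<and> px z t \<or> e = 1 \<and> py z t))" for t l
  define I where "I Q s' \<longleftrightarrow> (\<forall>t<n. (?kd t \<noteq> 2 \<longrightarrow> lab s' t = lab s t) \<and> (?kd t = 2 \<longrightarrow> good t (lab s' t) \<or>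
     lab s' t = lab s t \<and> (\<forall>v. (t, v) \<in> Q \<and> same v t \<longrightarrow> \<not> px v t \<and> \<not> py v t)))" for Q s'
  have pair: "?lx t \<in> C" "?ly t \<in> C" "?lx t < ?ly t" "nonplanar_pair C t (?lx t) (?ly t)" "?lx t < n" "?ly t < n"
    and lab2: "lab s t = [2, ?lx t, ?ly t, 0, 0, 0, 0, 0]" if tt: "t < n" "?kd t = 2" for t
  proof -
    obtain x y where xy: "nonplanar_pair C t x y" "lab s t = [2, x, y, 0, 0, 0, 0, 0]" using l2[OF tt] by blast
    then have "?lx t = x" "?ly t = y" by (auto simp: lab_def)
    then show "?lx t \<in> C" "?ly t \<in> C" "?lx t < ?ly t" "nonplanar_pair C t (?lx t) (?ly t)" "?lx t < n" "?ly t < n"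
      "lab s t = [2, ?lx t, ?ly t, 0, 0, 0, 0, 0]" using xy C by (auto simp: nonplanar_pair_def)
  qed
  have "I ({..<n} \<times> {..<n}) (sem (nest [''t'', ''v''] ?p) s)"
  proof (rule nest2)
    show "nats s ''n'' 0 = n" using env_n[OF e] .
    show "I {} s" by (simp add: I_def)
    show "I Q (nupdate z 0 v s')" if "z \<in> {''t'', ''v''}" "I Q s'" for Q s' z v
    proof -
      have "lab (nupdate z 0 v s') = lab s'" using that(1) by (auto simp: lab_def fun_eq_iff)
      then show ?thesis using that(2) by (simp add: I_def)
    qed
    fix Q a b s' assume ab: "a < n" "b < n" "(a, b) \<notin> Q" and I: "I Q s'"
      and fr: "frame ({''t'', ''v''} \<union> writes ?p) s s'" and v: "nats s' ''t'' 0 = a" "nats s' ''v'' 0 = b"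
    have e': "env s'" by (rule env_frame[OF e fr]) simp
    have arr: "nats s' ''kd'' = ?kd" "nats s' ''lx'' = ?lx" "nats s' ''ly'' = ?ly" "nats s' ''m'' = nats s ''m''"
      using fr by (auto simp: frame_def)
    have pred: "fval ?pred s' \<longleftrightarrow> ?kd a = 2 \<and> same b a"
      using v arr ab by (auto simp: same_def mark_def)
    show "I (insert (a, b) Q) (sem ?p s')"
    proof (cases "?kd a = 2 \<and> same b a")
      case False
      have "sem ?p s' = s'" unfolding sem.simps(4) pred by (rule if_not_P[OF False])
      then show ?thesis using I False unfolding I_def by auto
    next
      case True
      define s2 where "s2 = nupdate ''y'' 0 (?ly a) (nupdate ''x'' 0 (?lx a) s')"
      have e2: "env s2" using e' by (simp add: s2_def)
      have v2: "nats s2 ''t'' 0 = a" "nats s2 ''v'' 0 = b" "nats s2 ''x'' 0 = ?lx a" "nats s2 ''y'' 0 = ?ly a"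
        using v by (simp_all add: s2_def)
      have lt: "?lx a < n" "?ly a < n" using pair ab True by auto
      define s3 where "s3 = (if px b a then nupdate ''h0'' a 0 (nupdate ''lz'' a b s2) else s2)"
      have "sem (Guard (parF ''x'' ''v'' ''t'') ?px) s2 = s3"
        using e2 v2 lt ab by (simp add: s3_def px_def)
      moreover have "sem (Guard (parF ''y'' ''v'' ''t'') ?py) s3 = (if py b a then nupdate ''h0'' a 1 (nupdate ''lz'' a b s3) else s3)"
      proof -
        have "env s3" "nats s3 ''t'' 0 = a" "nats s3 ''v'' 0 = b" "nats s3 ''y'' 0 = ?ly a" using e2 v2 by (simp_all add: s3_def)
        then show ?thesis using lt ab by (simp add: py_def)
      qed
      ultimately have sem: "sem ?p s' = (if py b a then nupdate ''h0'' a 1 (nupdate ''lz'' a b s3) else s3)"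
      proof -
        have "sem (NSet ''x'' (NConst 0) (At ''lx'' ''t'')) s' = nupdate ''x'' 0 (?lx a) s'" by (simp add: v arr)
        moreover have "sem (NSet ''y'' (NConst 0) (At ''ly'' ''t'')) (nupdate ''x'' 0 (?lx a) s') = s2" by (simp add: v arr s2_def)
        moreover assume "sem (Guard (parF ''x'' ''v'' ''t'') ?px) s2 = s3"
          "sem (Guard (parF ''y'' ''v'' ''t'') ?py) s3 = (if py b a then nupdate ''h0'' a 1 (nupdate ''lz'' a b s3) else s3)"
        ultimately have "sem ?body s' = (if py b a then nupdate ''h0'' a 1 (nupdate ''lz'' a b s3) else s3)"
          by (simp only: sem.simps(3))
        then show ?thesis unfolding sem.simps(4) pred if_P[OF True] .
      qed
      have other: "lab (sem ?p s') c = lab s' c" if "c \<noteq> a" for c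
        unfolding sem s3_def s2_def using that by (simp add: lab_def)
      have form: "\<exists>z e. lab s' a = [2, ?lx a, ?ly a, z, e, 0, 0, 0]"
        using I ab True lab2[of a] unfolding I_def good_def by metis
      have here: "good a (lab (sem ?p s') a) \<or> (\<not> px b a \<and> \<not> py b a \<and> lab (sem ?p s') a = lab s' a)"
        using form True unfolding sem s3_def s2_def good_def by (auto simp: lab_def)
      show ?thesis unfolding I_def
      proof (intro allI impI)
        fix c assume c: "c < n"
        show "(?kd c \<noteq> 2 \<longrightarrow> lab (sem ?p s') c = lab s c) \<and> (?kd c = 2 \<longrightarrow> good c (lab (sem ?p s') c) \<or>
           lab (sem ?p s') c = lab s c \<and> (\<forall>v. (c, v) \<in> insert (a, b) Q \<and> same v c \<longrightarrow> \<not> px v c \<and> \<not> py v c))"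
        proof (cases "c = a")
          case True
          then show ?thesis using here I[unfolded I_def, rule_format, OF c] \<open>?kd a = 2 \<and> same b a\<close>
            by (metis insertE prod.inject)
        next
          case False
          then show ?thesis using I[unfolded I_def, rule_format, OF c] unfolding other[OF False] by blast
        qed
      qed
    qed
  qed auto
  then have post: "I ({..<n} \<times> {..<n}) (sem side_prog s)" by (simp only: side_prog_def)
  then show "?kd t \<noteq> 2 \<Longrightarrow> lab (sem side_prog s) t = lab s t" using t by (simp add: I_def)
  assume kd: "?kd t = 2"
  obtain v where v: "v \<in> ?M" "tc v t" "?lx v = ?lx t" "?ly v = ?ly t" using ex[OF t kd] by blast
  have vn: "v < n" using v(1) by (simp add: mark_def)
  have np: "nonplanar_pair C t (?lx t) (?ly t)" "nonplanar_pair C v (?lx t) (?ly t)"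
    using pair[OF t kd] pair[OF vn] M v by auto
  have "\<not> tc (?lx t) (?ly t)" using np C by (auto simp: indep_def nonplanar_pair_def)
  \<comment> \<open>By maximality some chosen \<open>v\<close> with the same pair touches
    \<open>t\<close>. Touching forces a common parameter on one of the two members, so the loop has
    encountered a hit.\<close>
  then have "px v t \<or> py v t" unfolding px_def py_def
    using np v(2) tc_sym unfolding nonplanar_pair_def by (intro par_touch) auto
  then have "good t (lab (sem side_prog s) t)" using post t kd v vn unfolding I_def same_def by blast
  then obtain z e where z: "lab (sem side_prog s) t = [2, ?lx t, ?ly t, z, e, 0, 0, 0]" "same z t" "e = 0 \<and> px z t \<or> e = 1 \<and> py z t"
    by (auto simp: good_def)
  have fr: "frame (writes side_prog) s (sem side_prog s)" by (rule frame_sem) (auto simp: writes_early)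
  then have "nats (sem side_prog s) ''lx'' = ?lx" "nats (sem side_prog s) ''ly'' = ?ly" by (auto simp: frame_def writes_early)
  then show "ok2 C ?M (lab (sem side_prog s)) t" unfolding ok2_def
    using z np(1) unfolding same_def px_def py_def
    by (intro exI[of _ "?lx t"] exI[of _ "?ly t"] exI[of _ z] exI[of _ e]) auto
qed

lemma early_correct:
  assumes e: "env s" and opt: "optimal n (mark n ''c'' s)" and z: "\<And>t. t < n \<Longrightarrow> lab s t = zeros" and m: "mark n ''m'' s = {}"
  defines "C \<equiv> mark n ''c'' s" and "M \<equiv> mark n ''m'' (sem early_prog s)" and "L \<equiv> lab (sem early_prog s)"
  shows "\<forall>t<n. ok1 C t (L t) \<or> ok2 C M L t \<or> ok3 C t (L t) \<or> L t = zeros \<and> residual C t"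
    and "\<forall>v\<in>M. \<forall>v'\<in>M. v \<noteq> v' \<and> L v ! 1 = L v' ! 1 \<and> L v ! 2 = L v' ! 2 \<longrightarrow> \<not> tc v v'"
proof -
  have indep: "indep C" and sub: "C \<subseteq> {..<n}" using opt by (auto simp: optimal_def C_def)
  define s1 where "s1 = sem private_prog s"
  have f1: "frame (writes private_prog) s s1" unfolding s1_def by (rule frame_sem) (auto simp: writes_early)
  have e1: "env s1" using e f1 by (rule env_frame) (simp add: writes_early)
  have c1: "mark n ''c'' s1 = C" unfolding C_def by (rule mark_frame[OF f1]) (simp add: writes_early)
  have m1: "mark n ''m'' s1 = {}" unfolding m[symmetric] by (rule mark_frame[OF f1]) (simp add: writes_early)
  have L1: "ok1 C t (lab s1 t) \<or> lab s1 t = zeros \<and> (\<exists>x\<in>C. \<exists>y\<in>C. x < y \<and> tc x t \<and> tc y t)" if "t < n" for t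
    using private_correct[OF e opt z that] unfolding s1_def C_def .
  define s2 where "s2 = sem nonplanar_prog s1"
  have f2: "frame (writes nonplanar_prog) s1 s2" unfolding s2_def by (rule frame_sem) (auto simp: writes_early)
  have e2: "env s2" using e1 f2 by (rule env_frame) (simp add: writes_early)
  have c2: "mark n ''c'' s2 = C" unfolding c1[symmetric] by (rule mark_frame[OF f2]) (simp add: writes_early)
  have m2: "mark n ''m'' s2 = {}" unfolding m1[symmetric] by (rule mark_frame[OF f2]) (simp add: writes_early)
  have z1: "lab s1 t = zeros" if "t < n" "nats s1 ''kd'' t = 0" for t
    using L1[OF that(1)] that(2) by (auto simp: ok1_def lab_def)
  define two where "two t \<longleftrightarrow> (\<exists>x\<in>C. \<exists>y\<in>C. x < y \<and> tc x t \<and> tc y t)" for t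
  have L2: "ok1 C t (lab s2 t) \<or> (\<exists>x y. nonplanar_pair C t x y \<and> lab s2 t = [2, x, y, 0, 0, 0, 0, 0])
     \<or> lab s2 t = zeros \<and> two t \<and> (\<forall>x y. \<not> nonplanar_pair C t x y)" if t: "t < n" for t
  proof (cases "nats s1 ''kd'' t = 0")
    case True
    then have "two t" using L1[OF t] by (auto simp: two_def ok1_def lab_def)
    then show ?thesis using nonplanar_correct(2)[OF e1 z1 t True] unfolding s2_def[symmetric] c1 by blast
  next
    case False
    then have "ok1 C t (lab s1 t)" using L1[OF t] by (auto simp: lab_def)
    then show ?thesis using nonplanar_correct(1)[OF e1 z1 t False] unfolding s2_def by simp
  qed
  define s3 where "s3 = sem matching_prog s2"
  have f3: "frame (writes matching_prog) s2 s3" unfolding s3_def by (rule frame_sem) (auto simp: writes_early)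
  have e3: "env s3" using e2 f3 by (rule env_frame) (simp add: writes_early)
  have c3: "mark n ''c'' s3 = C" unfolding c2[symmetric] by (rule mark_frame[OF f3]) (simp add: writes_early)
  have arr3: "nats s3 ''kd'' = nats s2 ''kd''" "nats s3 ''lx'' = nats s2 ''lx''" "nats s3 ''ly'' = nats s2 ''ly''"
    using f3 by (auto simp: frame_def writes_early)
  have l3: "lab s3 = lab s2" using lab_frame[OF f3] by (auto simp: writes_early label_names_def fun_eq_iff)
  define M3 where "M3 = mark n ''m'' s3"
  note M3 = matching_correct[OF e2 m2, folded s3_def, folded M3_def arr3]
  have kd2: "\<exists>x y. nonplanar_pair C t x y \<and> lab s3 t = [2, x, y, 0, 0, 0, 0, 0]" if "t < n" "nats s3 ''kd'' t = 2" for t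
    using L2[OF that(1)] that(2) unfolding l3 arr3 by (auto simp: ok1_def lab_def)
  define s4 where "s4 = sem side_prog s3"
  have f4: "frame (writes side_prog) s3 s4" unfolding s4_def by (rule frame_sem) (auto simp: writes_early)
  have e4: "env s4" using e3 f4 by (rule env_frame) (simp add: writes_early)
  have c4: "mark n ''c'' s4 = C" unfolding c3[symmetric] by (rule mark_frame[OF f4]) (simp add: writes_early)
  have m4: "mark n ''m'' s4 = M3" unfolding M3_def by (rule mark_frame[OF f4]) (simp add: writes_early)
  have arr4: "nats s4 ''kd'' = nats s3 ''kd''" "nats s4 ''lx'' = nats s3 ''lx''" "nats s4 ''ly'' = nats s3 ''ly''"
    using f4 by (auto simp: frame_def writes_early)
  have L4: "nats s3 ''kd'' t \<noteq> 2 \<Longrightarrow> lab s4 t = lab s3 t" "nats s3 ''kd'' t = 2 \<Longrightarrow> ok2 C M3 (lab s4) t" if "t < n" for t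
  proof -
    have M3a: "\<forall>v\<in>mark n ''m'' s3. nats s3 ''kd'' v = 2" using M3(1) unfolding M3_def .
    have M3c: "\<exists>v\<in>mark n ''m'' s3. tc v t \<and> nats s3 ''lx'' v = nats s3 ''lx'' t \<and> nats s3 ''ly'' v = nats s3 ''ly'' t"
      if "t < n" "nats s3 ''kd'' t = 2" for t using M3(3) that unfolding M3_def by simp
    show "nats s3 ''kd'' t \<noteq> 2 \<Longrightarrow> lab s4 t = lab s3 t"
      unfolding s4_def by (rule side_correct(1)[OF e3 indep sub kd2 M3a M3c \<open>t < n\<close>])
    show "nats s3 ''kd'' t = 2 \<Longrightarrow> ok2 C M3 (lab s4) t"
      unfolding s4_def M3_def by (rule side_correct(2)[OF e3 indep sub kd2 M3a M3c \<open>t < n\<close>])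
  qed
  have z4: "lab s4 t = zeros" if "t < n" "nats s4 ''kd'' t = 0" for t
  proof -
    have "lab s4 t = lab s2 t" using L4(1)[OF that(1)] that(2) unfolding arr4 l3 by simp
    then show ?thesis using L2[OF that(1)] that(2) by (auto simp: ok1_def lab_def)
  qed
  define s5 where "s5 = sem point_prog s4"
  have f5: "frame (writes point_prog) s4 s5" unfolding s5_def by (rule frame_sem) (auto simp: writes_early)
  have m5: "mark n ''m'' s5 = M3" unfolding m4[symmetric] by (rule mark_frame[OF f5]) (simp add: writes_early)
  have s5: "sem early_prog s = s5" by (simp add: early_prog_def s1_def s2_def s3_def s4_def s5_def)
  have L5: "lab s5 t = lab s4 t" if "t < n" "nats s4 ''kd'' t \<noteq> 0" for t
    using point_correct(1)[OF e4 z4 that] by (simp add: s5_def)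
  \<comment> \<open>Elements of \<open>M\<close> already have kind 2, so the search for crossing
    points does not alter them.\<close>
  have Mlab: "lab s5 v = lab s4 v" if "v \<in> M3" for v
    using that M3(1) arr4 L5[of v] by (auto simp: M3_def mark_def)
  show "\<forall>t<n. ok1 C t (L t) \<or> ok2 C M L t \<or> ok3 C t (L t) \<or> L t = zeros \<and> residual C t"
  proof (intro allI impI)
    fix t assume t: "t < n"
    show "ok1 C t (L t) \<or> ok2 C M L t \<or> ok3 C t (L t) \<or> L t = zeros \<and> residual C t"
    proof (cases "nats s4 ''kd'' t = 0")
      case True
      then have two: "two t" "\<forall>x y. \<not> nonplanar_pair C t x y"
        using L2[OF t] unfolding arr4 arr3 by (auto simp: ok1_def lab_def)
      from point_correct(2)[OF e4 z4 t True]
      have "ok3 C t (lab s5 t) \<or> (\<forall>x\<in>C. \<forall>y\<in>C. \<forall>r\<in>C. x < y \<and> pc x y t \<and> tc r t \<longrightarrow> pc x y r) \<and> lab s5 t = zeros"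
        unfolding c4 s5_def .
      then show ?thesis using two unfolding L_def s5 residual_def two_def nonplanar_pair_def by blast
    next
      case False
      then have l: "L t = lab s4 t" using L5[OF t] by (simp add: L_def s5)
      show ?thesis
      proof (cases "nats s3 ''kd'' t = 2")
        case True
        have "ok2 C M3 (lab s4) t" using L4(2)[OF t True] .
        then obtain x y z e' where "lab s4 t = [2, x, y, z, e', 0, 0, 0]" "nonplanar_pair C t x y" "z \<in> M3" "lab s4 z ! 1 = x" "lab s4 z ! 2 = y"
          "e' = 0 \<and> param G x z = param G x t \<or> e' = 1 \<and> param G y z = param G y t" unfolding ok2_def by blast
        moreover have "M = M3" using m5 by (simp add: M_def s5)
        moreover have "L z = lab s4 z" if "z \<in> M3" for z using Mlab[OF that] by (simp add: L_def s5)
        ultimately have "ok2 C M L t" unfolding ok2_def l by metis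
        then show ?thesis by blast
      next
        case False
        then have "L t = lab s2 t" using L4(1)[OF t False] l l3 by simp
        moreover have "nats s2 ''kd'' t \<noteq> 0" "nats s2 ''kd'' t \<noteq> 2"
          using False \<open>nats s4 ''kd'' t \<noteq> 0\<close> arr3 arr4 by auto
        ultimately show ?thesis using L2[OF t] by (auto simp: lab_def)
      qed
    qed
  qed
  show "\<forall>v\<in>M. \<forall>v'\<in>M. v \<noteq> v' \<and> L v ! 1 = L v' ! 1 \<and> L v ! 2 = L v' ! 2 \<longrightarrow> \<not> tc v v'"
  proof (intro ballI impI)
    fix v v' assume "v \<in> M" "v' \<in> M" and *: "v \<noteq> v' \<and> L v ! 1 = L v' ! 1 \<and> L v ! 2 = L v' ! 2"
    then have v: "v \<in> M3" "v' \<in> M3" using m5 by (auto simp: M_def s5)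
    then have "L v = lab s4 v" "L v' = lab s4 v'" using Mlab by (auto simp: L_def s5)
    then have "nats s3 ''lx'' v = nats s3 ''lx'' v'" "nats s3 ''ly'' v = nats s3 ''ly'' v'" using * unfolding arr4[symmetric] by simp_all
    then show "\<not> tc v v'" using M3(2)[rule_format, of v v'] v * by blast
  qed
qed

end

section \<open>Heights in a finite partial order\<close>

text \<open>Each step removes the minimal elements. For a strict order on a finite set, level
  \<open>r\<close> consists of the elements of height at least \<open>r\<close>.\<close>

primrec level :: "nat set \<Rightarrow> (nat \<Rightarrow> nat \<Rightarrow> bool) \<Rightarrow> nat \<Rightarrow> nat set" where
  "level T R 0 = T"
| "level T R (Suc r) = {t \<in> level T R r. \<exists>u\<in>level T R r. R u t}"

lemma level_antimono: "r \<le> r' \<Longrightarrow> level T R r' \<subseteq> level T R r"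
  by (induction r' rule: dec_induct) auto

text \<open>The height truncated at \<open>r\<close>, which is what \<open>r\<close> sweeps of
  raising can establish.\<close>

definition level_height :: "nat set \<Rightarrow> (nat \<Rightarrow> nat \<Rightarrow> bool) \<Rightarrow> nat \<Rightarrow> (nat \<Rightarrow> nat) \<Rightarrow> bool" where
  "level_height T R r h \<longleftrightarrow> (\<forall>t\<in>T. t \<in> level T R (h t) \<and> h t \<le> r \<and> (h t < r \<longrightarrow> t \<notin> level T R (Suc (h t))))"

lemma level_height_ge: "level_height T R r h \<Longrightarrow> t \<in> T \<Longrightarrow> k \<le> r \<Longrightarrow> k \<le> h t \<longleftrightarrow> t \<in> level T R k"
  unfolding level_height_def using level_antimono[of k "h t" T R] level_antimono[of "Suc (h t)" k T R]
  by (metis Suc_leI le_less_trans not_le subsetD)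

lemma level_chain:
  assumes trans: "\<And>t u v. t \<in> T \<Longrightarrow> u \<in> T \<Longrightarrow> v \<in> T \<Longrightarrow> R t u \<Longrightarrow> R u v \<Longrightarrow> R t v"
    and irrefl: "\<And>t. \<not> R t t" and fin: "finite T"
  shows "t \<in> level T R r \<Longrightarrow> \<exists>A\<subseteq>T. card A = r \<and> (\<forall>a\<in>A. R a t)"
proof (induction r arbitrary: t)
  case 0
  then show ?case by (intro exI[of _ "{}"]) auto
next
  case (Suc r)
  then obtain u where u: "u \<in> level T R r" "R u t" "t \<in> level T R r" by auto
  obtain A where A: "A \<subseteq> T" "card A = r" "\<forall>a\<in>A. R a u" using Suc.IH[OF u(1)] by blast
  have T: "t \<in> T" "u \<in> T" using u level_antimono[of 0 r T R] by auto
  have "u \<notin> A" using A irrefl by blast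
  moreover have "finite A" using A(1) fin finite_subset by blast
  ultimately have "card (insert u A) = Suc r" using A by simp
  moreover have "\<forall>a\<in>insert u A. R a t" using A u T trans by blast
  ultimately show ?case using A T by (intro exI[of _ "insert u A"]) auto
qed

text \<open>An element of level \<open>n\<close> would be the top of a chain of \<open>n + 1\<close>
  indices below \<open>n\<close>.\<close>

lemma level_empty:
  assumes "\<And>t u v. t \<in> T \<Longrightarrow> u \<in> T \<Longrightarrow> v \<in> T \<Longrightarrow> R t u \<Longrightarrow> R u v \<Longrightarrow> R t v"
    and "\<And>t. \<not> R t t" and T: "T \<subseteq> {..<n}"
  shows "level T R n = {}"
proof (rule ccontr)
  assume "level T R n \<noteq> {}"
  then obtain t where t: "t \<in> level T R n" by blast
  have fin: "finite T" using T by (rule finite_subset) simp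
  obtain A where A: "A \<subseteq> T" "card A = n" "\<forall>a\<in>A. R a t" 
    using level_chain[where T = T and R = R and r = n and t = t] assms(1,2) fin t by metis
  have "t \<in> T" using t level_antimono[of 0 n T R] by auto
  moreover have "t \<notin> A" using A assms(2) by blast
  ultimately have "card (insert t A) = Suc n" "insert t A \<subseteq> {..<n}"
    using A T finite_subset[OF A(1) fin] by (simp, blast)
  then show False using card_mono[of "{..<n}" "insert t A"] by simp
qed

text \<open>With level \<open>n\<close> empty the truncation at \<open>n\<close> takes no effect, so
  \<open>h\<close> is the true height. An element at height \<open>v + 1\<close> has a predecessor
  in level \<open>v\<close>, whose height is at least \<open>v\<close> and, by strict monotonicity,
  not larger.\<close>

lemma level_height_final:
  assumes "level_height T R n h" and e: "level T R n = {}"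
  shows "t \<in> T \<Longrightarrow> u \<in> T \<Longrightarrow> R t u \<Longrightarrow> h t < h u"
    and "t \<in> T \<Longrightarrow> 0 < h t \<Longrightarrow> \<exists>u\<in>T. R u t \<and> h t = Suc (h u)"
    and "t \<in> T \<Longrightarrow> h t \<le> n"
proof -
  have le: "h t < n" "t \<in> level T R (h t)" "t \<notin> level T R (Suc (h t))" if "t \<in> T" for t
  proof -
    have h: "t \<in> level T R (h t)" "h t \<le> n" "h t < n \<longrightarrow> t \<notin> level T R (Suc (h t))"
      using assms(1) that by (auto simp: level_height_def)
    then have "h t \<noteq> n" using e by auto
    then show "h t < n" "t \<in> level T R (h t)" "t \<notin> level T R (Suc (h t))" using h by auto
  qed
  show "h t \<le> n" if "t \<in> T" using le[OF that] by simp
  have ge: "k \<le> h t \<longleftrightarrow> t \<in> level T R k" if "t \<in> T" "k \<le> n" for t k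
    using level_height_ge[OF assms(1)] that .
  have less: "h t < h u" if tu: "t \<in> T" "u \<in> T" "R t u" for t u
  proof -
    have lv: "r \<le> Suc (h t) \<Longrightarrow> u \<in> level T R r" for r
    proof (induction r)
      case (Suc r)
      then have "t \<in> level T R r" using le[OF tu(1)] level_antimono[of r "h t" T R] by auto
      then show ?case using Suc tu by auto
    qed (use tu in simp)
    have "Suc (h t) \<le> h u" using ge[OF tu(2), of "Suc (h t)"] lv[of "Suc (h t)"] le(1)[OF tu(1)]
      by (simp del: level.simps)
    then show ?thesis by simp
  qed
  show "t \<in> T \<Longrightarrow> u \<in> T \<Longrightarrow> R t u \<Longrightarrow> h t < h u" by (rule less)
  show "\<exists>u\<in>T. R u t \<and> h t = Suc (h u)" if t: "t \<in> T" "0 < h t"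
  proof -
    obtain v where v: "h t = Suc v" using t by (cases "h t") auto
    then obtain u where u: "u \<in> level T R v" "R u t" using le(2)[OF t(1)] by auto
    have "u \<in> T" using u level_antimono[of 0 v T R] by auto
    moreover have "v \<le> h u" using ge[OF \<open>u \<in> T\<close>, of v] u le(1)[OF t(1)] v by auto
    moreover have "h u < h t" using less[of u t] \<open>u \<in> T\<close> t u by blast
    ultimately show ?thesis using u v by (intro bexI[of _ u]) auto
  qed
qed

section \<open>Heights and a longest chain inside one plane\<close>

definition hname :: "nat \<Rightarrow> vname" where
  "hname i = (if i = 0 then ''h0'' else if i = 1 then ''h1'' else if i = 2 then ''h2'' else ''h3'')"

definition activeF :: "vname \<Rightarrow> fm" where
  "activeF v = Conj (eqF (At ''kd'' v) (NConst 5)) (Conj (eqF (At ''lx'' v) (Var ''x'')) (eqF (At ''ly'' v) (Var ''y'')))"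

definition touch_prog :: prog where
  "touch_prog = search [''u''] (Conj (pcF ''x'' ''y'' ''t'') (Conj (inF ''D'' ''u'') (tcF ''u'' ''t''))) 4 (Var ''x'') (Var ''y'') (Var ''u'')"

definition class_prog :: prog where
  "class_prog = search [] (pcF ''x'' ''y'' ''t'') 5 (Var ''x'') (Var ''y'') (NConst 0)"

text \<open>A predecessor may have been raised already in the current sweep, so its value is
  required to be at least \<open>r\<close> instead of equal to \<open>r\<close>.\<close>

definition raiseF :: "nat \<Rightarrow> fm" where
  "raiseF i = Conj (Conj (activeF ''t'') (eqF (At (hname i) ''t'') (Var ''r'')))
     (Ex ''v'' (Conj (activeF ''v'') (Conj (ordF i ''x'' ''y'' ''v'' ''t'') (Neg (ltF (At (hname i) ''v'') (Var ''r''))))))"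

definition height_prog :: "nat \<Rightarrow> prog" where
  "height_prog i = For ''r'' ''n'' (nest [''t''] (Guard (raiseF i) (NSet (hname i) (Var ''t'') (NPlus (Var ''r'') (NConst 1)))))"

text \<open>The maximum is taken over all four orders at once, since one chain has to bound the
  heights in each of them.\<close>

definition topF :: "nat \<Rightarrow> fm" where
  "topF i = Conj (activeF ''t'') (All ''v'' (Imp (activeF ''v'') (Neg (Disj (Disj (ltF (At (hname i) ''t'') (At ''h0'' ''v''))
     (ltF (At (hname i) ''t'') (At ''h1'' ''v''))) (Disj (ltF (At (hname i) ''t'') (At ''h2'' ''v'')) (ltF (At (hname i) ''t'') (At ''h3'' ''v'')))))))"

definition stepF :: "nat \<Rightarrow> fm" where
  "stepF i = Conj (activeF ''u'') (Conj (ordF i ''x'' ''y'' ''u'' ''cur'') (eqF (At (hname i) ''cur'') (NPlus (At (hname i) ''u'') (NConst 1))))"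

definition descend_prog :: "nat \<Rightarrow> prog" where
  "descend_prog i = For ''r'' ''n'' (nest [''u''] (Guard (stepF i) (Sq (NSet ''D'' (Var ''u'') (NConst 1)) (NSet ''cur'' (NConst 0) (Var ''u'')))))"

text \<open>\<open>on\<close> stops the search after the first success, so a plane contributes a
  single chain although all four orders are tried.\<close>

definition chain_prog :: "nat \<Rightarrow> prog" where
  "chain_prog i = nest [''t''] (Guard (Conj (eqF (Var ''on'') (NConst 0)) (topF i))
     (Sq (NSet ''on'' (NConst 0) (NConst 1)) (Sq (NSet ''D'' (Var ''t'') (NConst 1))
       (Sq (NSet ''cur'' (NConst 0) (Var ''t'')) (descend_prog i)))))"

definition plane_prog :: prog where
  "plane_prog = Sq touch_prog (Sq class_prog (Sq (height_prog 0) (Sq (height_prog 1) (Sq (height_prog 2) (Sq (height_prog 3)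
     (Sq (NSet ''on'' (NConst 0) (NConst 0)) (Sq (chain_prog 0) (Sq (chain_prog 1) (Sq (chain_prog 2) (chain_prog 3))))))))))"

definition planes_prog :: prog where
  "planes_prog = nest [''x'', ''y''] (Guard (Conj (Conj (inF ''c'' ''x'') (inF ''c'' ''y'')) (Conj (ltF (Var ''x'') (Var ''y'')) (pcF ''x'' ''y'' ''x'')))
     plane_prog)"

lemma hname_cases: "hname i \<in> {''h0'', ''h1'', ''h2'', ''h3''}"
  by (simp add: hname_def)

lemma hname_noteq [simp]: "x \<notin> {''h0'', ''h1'', ''h2'', ''h3''} \<Longrightarrow> hname i \<noteq> x" "x \<notin> {''h0'', ''h1'', ''h2'', ''h3''} \<Longrightarrow> x \<noteq> hname i"
  using hname_cases[of i] by auto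

lemma hname_inj: "i < 4 \<Longrightarrow> j < 4 \<Longrightarrow> hname i = hname j \<longleftrightarrow> i = j"
  by (auto simp: hname_def)

lemma writes_height [simp]: "writes (height_prog i) = {''r'', ''t'', hname i}" "rwrites (height_prog i) = {}"
  by (auto simp: height_prog_def)

lemma writes_descend [simp]: "writes (descend_prog i) = {''r'', ''u'', ''D'', ''cur''}" "rwrites (descend_prog i) = {}"
  by (auto simp: descend_prog_def)

lemma writes_chain [simp]: "writes (chain_prog i) = {''t'', ''on'', ''D'', ''cur'', ''r'', ''u''}" "rwrites (chain_prog i) = {}"
  by (auto simp: chain_prog_def)

lemma fval_activeF: "fval (activeF v) s \<longleftrightarrow> nats s ''kd'' (nats s v 0) = 5 \<and> nats s ''lx'' (nats s v 0) = nats s ''x'' 0 \<and> nats s ''ly'' (nats s v 0) = nats s ''y'' 0"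
  by (simp add: activeF_def)

definition members :: "nat \<Rightarrow> state \<Rightarrow> nat set" where
  "members n s = {t. t < n \<and> nats s ''kd'' t = 5 \<and> nats s ''lx'' t = nats s ''x'' 0 \<and> nats s ''ly'' t = nats s ''y'' 0}"

lemma members_frame: "frame W s s' \<Longrightarrow> {''kd'', ''lx'', ''ly'', ''x'', ''y''} \<inter> W = {} \<Longrightarrow> members n s' = members n s"
  by (auto simp: members_def frame_def)

lemma fval_activeF_members: "nats s v 0 < n \<Longrightarrow> fval (activeF v) s \<longleftrightarrow> nats s v 0 \<in> members n s"
  by (simp add: fval_activeF members_def)

lemma members_nupdate: "x \<notin> {''kd'', ''lx'', ''ly'', ''x'', ''y''} \<Longrightarrow> members n (nupdate x i v s) = members n s"
  by (rule members_frame[OF frame_nupdate[of x "{x}"]]) auto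

lemma members_subset: "members n s \<subseteq> {..<n}"
  by (auto simp: members_def)

context segments_input
begin

lemma height_correct:
  assumes e: "env s" and x: "nats s ''x'' 0 = x" "nats s ''y'' 0 = y" "x < n" "y < n"
    and pc: "\<And>t. t \<in> members n s \<Longrightarrow> pc x y t" and z: "\<And>t. t \<in> members n s \<Longrightarrow> nats s (hname i) t = 0"
  defines "h \<equiv> nats (sem (height_prog i) s) (hname i)" and "T \<equiv> members n s"
  shows "t \<in> T \<Longrightarrow> u \<in> T \<Longrightarrow> po i x y t u \<Longrightarrow> h t < h u"
    and "t \<in> T \<Longrightarrow> 0 < h t \<Longrightarrow> \<exists>u\<in>T. po i x y u t \<and> h t = Suc (h u)"
    and "t \<in> T \<Longrightarrow> h t \<le> n"
    and "t \<notin> T \<Longrightarrow> h t = nats s (hname i) t"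
proof -
  let ?R = "po i x y" and ?h = "\<lambda>s :: state. nats s (hname i)"
  let ?p = "Guard (raiseF i) (NSet (hname i) (Var ''t'') (NPlus (Var ''r'') (NConst 1)))"
  have TT: "T \<subseteq> {..<n}" unfolding T_def by (rule members_subset)
  define I where "I r s' \<longleftrightarrow> level_height T ?R r (?h s') \<and> (\<forall>t. t \<notin> T \<longrightarrow> ?h s' t = ?h s t)" for r s'
  have "I (nats s ''n'' 0) (sem (height_prog i) s)" unfolding height_prog_def
  proof (rule sem_For)
    show "I 0 s" using z by (auto simp: I_def level_height_def T_def)
    fix r s1 assume r: "r < nats s ''n'' 0" and I: "I r s1"
      and fr: "\<forall>y. y \<notin> insert ''r'' (writes (nest [''t''] ?p)) \<longrightarrow> nats s1 y = nats s y"
      "\<forall>y. y \<notin> rwrites (nest [''t''] ?p) \<longrightarrow> reals s1 y = reals s y"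
    have fr1: "frame {''r'', ''t'', hname i} s s1" using fr by (auto simp: frame_def)
    define s2 where "s2 = nupdate ''r'' 0 r s1"
    have fr2: "frame {''r'', ''t'', hname i} s s2" using fr1 by (auto simp: frame_def s2_def)
    have e2: "env s2" using env_frame[OF e fr2] by simp
    have h2: "?h s2 = ?h s1" by (simp add: s2_def)
    \<comment> \<open>In the middle of a sweep a height can be \<open>r\<close> or
      \<open>r + 1\<close>; an index already visited and still at \<open>r\<close> is known to lie
      outside the next level.\<close>
    define J where "J Q s' \<longleftrightarrow> (\<forall>t\<in>T. t \<in> level T ?R (?h s' t) \<and> ?h s' t \<le> Suc r \<and> (?h s' t < r \<longrightarrow> t \<notin> level T ?R (Suc (?h s' t)))
      \<and> (?h s' t = r \<and> t \<in> Q \<longrightarrow> t \<notin> level T ?R (Suc r))) \<and> (\<forall>t. t \<notin> T \<longrightarrow> ?h s' t = ?h s t)" for Q s'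
    have "J {..<n} (sem (nest [''t''] ?p) s2)"
    proof (rule nest1) 
      show "nats s2 ''n'' 0 = n" using env_n[OF e2] .
      show "J {} s2" using I by (auto simp: J_def I_def level_height_def h2)
      show "J Q (nupdate ''t'' 0 v s')" if "J Q s'" for Q s' v using that by (simp add: J_def)
      fix Q a s' assume a: "a < n" "a \<notin> Q" and J: "J Q s'" and fr': "frame (insert ''t'' (writes ?p)) s2 s'" and t: "nats s' ''t'' 0 = a"
      have e': "env s'" using env_frame[OF e2 fr'] by simp
      have fr3: "frame {''r'', ''t'', hname i} s s'" by (rule frame_trans[OF fr2 fr']) auto
      have T': "members n s' = T" unfolding T_def by (rule members_frame[OF fr3]) simp
      have v: "nats s' ''r'' 0 = r" "nats s' ''x'' 0 = x" "nats s' ''y'' 0 = y"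
        using fr' fr3 x by (auto simp: frame_def s2_def)
      \<comment> \<open>Both values \<open>r\<close> and \<open>r + 1\<close> witness membership in
        level \<open>r\<close>, so the test does not depend on which predecessors were raised in
        this sweep.\<close>
      have lev: "v \<in> T \<Longrightarrow> \<not> ?h s' v < r \<longleftrightarrow> v \<in> level T ?R r" for v
        using J level_antimono[of r "?h s' v" T ?R] level_antimono[of "Suc (?h s' v)" r T ?R]
        unfolding J_def by (metis Suc_leI not_le subsetD)
      have g: "fval (Conj (activeF ''v'') (Conj (ordF i ''x'' ''y'' ''v'' ''t'') (Neg (ltF (At (hname i) ''v'') (Var ''r''))))) (nupdate ''v'' 0 b s')
         \<longleftrightarrow> b \<in> T \<and> ?R b a \<and> \<not> ?h s' b < r" if "b < n" for b
        using that a v x e' t by (simp add: fval_activeF_members members_nupdate T')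
      have "fval (raiseF i) s' \<longleftrightarrow> a \<in> T \<and> ?h s' a = r \<and> (\<exists>b\<in>T. ?R b a \<and> \<not> ?h s' b < r)"
      proof -
        have "fval (Conj (activeF ''t'') (eqF (At (hname i) ''t'') (Var ''r''))) s' \<longleftrightarrow> a \<in> T \<and> ?h s' a = r"
          using a t v by (simp add: fval_activeF_members T')
        then show ?thesis unfolding raiseF_def fval.simps(3)[of "Conj _ _" "Ex _ _"] fval.simps(4) env_n[OF e'] using g TT by blast
      qed
      also have "\<dots> \<longleftrightarrow> a \<in> T \<and> ?h s' a = r \<and> a \<in> level T ?R (Suc r)"
        using lev J level_antimono[of 0 r T ?R] unfolding J_def by auto
      finally have cond: "fval (raiseF i) s' \<longleftrightarrow> a \<in> T \<and> ?h s' a = r \<and> a \<in> level T ?R (Suc r)" .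
      have upd: "sem (NSet (hname i) (Var ''t'') (NPlus (Var ''r'') (NConst 1))) s' = nupdate (hname i) a (Suc r) s'"
        by (simp add: t v)
      show "J (insert a Q) (sem ?p s')"
      proof (cases "a \<in> T \<and> ?h s' a = r \<and> a \<in> level T ?R (Suc r)")
        case True
        have "sem ?p s' = nupdate (hname i) a (Suc r) s'" unfolding sem.simps(4) cond if_P[OF True] upd ..
        then have "?h (sem ?p s') = (?h s')(a := Suc r)" by simp
        then show ?thesis unfolding J_def using J True unfolding J_def by auto
      next
        case False
        have "sem ?p s' = s'" unfolding sem.simps(4) cond by (rule if_not_P[OF False])
        then show ?thesis using J False unfolding J_def by auto
      qed
    qed auto
    define s3 where "s3 = sem (nest [''t''] ?p) s2"
    have J: "J {..<n} s3" unfolding s3_def by fact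
    have "t \<in> level T ?R (?h s3 t) \<and> ?h s3 t \<le> Suc r \<and> (?h s3 t < Suc r \<longrightarrow> t \<notin> level T ?R (Suc (?h s3 t)))"
      if t: "t \<in> T" for t
    proof -
      have "t \<in> {..<n}" using t TT by blast
      then have *: "t \<in> level T ?R (?h s3 t)" "?h s3 t \<le> Suc r" "?h s3 t < r \<longrightarrow> t \<notin> level T ?R (Suc (?h s3 t))"
         "?h s3 t = r \<longrightarrow> t \<notin> level T ?R (Suc r)" using J t unfolding J_def by blast+
      moreover have "t \<notin> level T ?R (Suc (?h s3 t))" if "?h s3 t < Suc r"
      proof (cases "?h s3 t = r")
        case True
        then show ?thesis using *(4) by metis
      next
        case False
        then show ?thesis using *(3) that by linarith
      qed
      ultimately show ?thesis by blast
    qed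
    then have "I (Suc r) s3" using J unfolding I_def J_def level_height_def by blast
    then show "I (Suc r) (sem (nest [''t''] ?p) (nupdate ''r'' 0 r s1))" by (simp only: s3_def s2_def)
  qed
  then have I: "level_height T ?R n h" "\<forall>t. t \<notin> T \<longrightarrow> h t = nats s (hname i) t"
    using env_n[OF e] by (auto simp: I_def h_def)
  have em: "level T ?R n = {}"
  proof (rule level_empty[OF _ _ TT])
    show "\<not> ?R t t" for t using ord_tc tc_refl by blast
    show "?R t v" if "t \<in> T" "u \<in> T" "v \<in> T" "?R t u" "?R u v" for t u v
      using ord_trans[of x y t u v i] pc that unfolding T_def by blast
  qed
  show "t \<in> T \<Longrightarrow> u \<in> T \<Longrightarrow> po i x y t u \<Longrightarrow> h t < h u" by (rule level_height_final(1)[OF I(1) em])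
  show "t \<in> T \<Longrightarrow> 0 < h t \<Longrightarrow> \<exists>u\<in>T. po i x y u t \<and> h t = Suc (h u)" by (rule level_height_final(2)[OF I(1) em])
  show "t \<in> T \<Longrightarrow> h t \<le> n" by (rule level_height_final(3)[OF I(1) em])
  show "t \<notin> T \<Longrightarrow> h t = nats s (hname i) t" using I by blast
qed

text \<open>\<open>c\<close> is the least element of the chain. The sum \<open>card A + h c\<close>
  stays constant during the descent, so the chain has \<open>k\<close> members when height 0 is
  reached.\<close>

definition chain_inv :: "nat set \<Rightarrow> (nat \<Rightarrow> nat \<Rightarrow> bool) \<Rightarrow> (nat \<Rightarrow> nat) \<Rightarrow> nat \<Rightarrow> nat set \<Rightarrow> nat \<Rightarrow> bool" where
  "chain_inv T R h k A c \<longleftrightarrow> A \<subseteq> T \<and> c \<in> A \<and> (\<forall>a\<in>A. a = c \<or> R c a) \<and> indep A \<and> card A + h c = k"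

lemma chain_inv_step:
  assumes c: "chain_inv T (po i x y) h k A c" and u: "u \<in> T" "po i x y u c" "h c = Suc (h u)"
    and T: "T \<subseteq> {..<n}" "\<And>t. t \<in> T \<Longrightarrow> pc x y t"
  shows "chain_inv T (po i x y) h k (insert u A) u"
proof -
  let ?R = "po i x y"
  have fin: "finite A" using c T(1) finite_subset[of A "{..<n}"] unfolding chain_inv_def by auto
  have cT: "c \<in> T" and AT: "A \<subseteq> T" using c by (auto simp: chain_inv_def)
  have R: "?R u a" if "a \<in> A" for a
  proof (cases "a = c")
    case True then show ?thesis using u by simp
  next
    case False
    then have "?R c a" using c that by (auto simp: chain_inv_def)
    then show ?thesis using ord_trans[of x y u c a i] T(2) u cT AT that by blast
  qed
  have "u \<notin> A" using R ord_tc tc_refl by blast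
  moreover have "indep (insert u A)"
    using c R ord_tc[of i x y u] tc_sym unfolding chain_inv_def indep_def by blast
  ultimately show ?thesis using c R u fin unfolding chain_inv_def by auto
qed

lemma descend_correct:
  assumes e: "env s" and x: "nats s ''x'' 0 = x" "nats s ''y'' 0 = y" "x < n" "y < n"
    and pc: "\<And>t. t \<in> members n s \<Longrightarrow> pc x y t"
    and cur: "nats s ''cur'' 0 = a" "a \<in> members n s" and D: "mark n ''D'' s = insert a D0"
    and pred: "\<And>t. t \<in> members n s \<Longrightarrow> 0 < nats s (hname i) t \<Longrightarrow>
      \<exists>u\<in>members n s. po i x y u t \<and> nats s (hname i) t = Suc (nats s (hname i) u)"
    and bound: "nats s (hname i) a \<le> n"
  shows "\<exists>A\<subseteq>members n s. mark n ''D'' (sem (descend_prog i) s) = D0 \<union> A \<and> indep A \<and> card A = Suc (nats s (hname i) a)"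
proof -
  define T where "T = members n s"
  define h where "h = nats s (hname i)"
  let ?R = "po i x y"
  let ?p = "Guard (stepF i) (Sq (NSet ''D'' (Var ''u'') (NConst 1)) (NSet ''cur'' (NConst 0) (Var ''u'')))"
  have TT: "T \<subseteq> {..<n}" unfolding T_def by (rule members_subset)
  have TP: "\<And>t. t \<in> T \<Longrightarrow> pc x y t" using pc T_def by blast
  define V where "V s' c \<longleftrightarrow> nats s' ''cur'' 0 = c \<and> (\<exists>A. mark n ''D'' s' = D0 \<union> A \<and> chain_inv T ?R h (Suc (h a)) A c)" for s' c
  \<comment> \<open>Every sweep lowers the height of the current element at least once unless it is
    0; several descents within one sweep do no harm.\<close>
  define I where "I r s' \<longleftrightarrow> (\<exists>c. V s' c \<and> (h c = 0 \<or> h c + r \<le> h a))" for r s'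
  have "I (nats s ''n'' 0) (sem (descend_prog i) s)" unfolding descend_prog_def
  proof (rule sem_For)
    have "chain_inv T ?R h (Suc (h a)) {a} a" using cur by (auto simp: chain_inv_def indep_def T_def)
    moreover have "mark n ''D'' s = D0 \<union> {a}" using D by auto
    ultimately have "V s a" using cur unfolding V_def by blast
    then show "I 0 s" unfolding I_def by auto
    fix r s1 assume r: "r < nats s ''n'' 0" and I: "I r s1"
      and fr: "\<forall>y. y \<notin> insert ''r'' (writes (nest [''u''] ?p)) \<longrightarrow> nats s1 y = nats s y"
      "\<forall>y. y \<notin> rwrites (nest [''u''] ?p) \<longrightarrow> reals s1 y = reals s y"
    define W where "W = {''r'', ''u'', ''D'', ''cur''}"
    have fr1: "frame W s s1" using fr by (auto simp: frame_def W_def)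
    define s2 where "s2 = nupdate ''r'' 0 r s1"
    have fr2: "frame W s s2" using fr1 by (auto simp: frame_def s2_def W_def)
    have e2: "env s2" using env_frame[OF e fr2] by (simp add: W_def)
    obtain c0 where c0: "V s2 c0" "h c0 = 0 \<or> h c0 + r \<le> h a"
    proof -
      obtain c where "V s1 c" "h c = 0 \<or> h c + r \<le> h a" using I unfolding I_def by blast
      moreover have "V s2 c = V s1 c" by (simp add: V_def s2_def mark_nupdate)
      ultimately show ?thesis using that by blast
    qed
    \<comment> \<open>Either the current element is unchanged and no visited index fits below it, or
      its height has dropped since the sweep began.\<close>
    define J where "J Q s' \<longleftrightarrow> (V s' c0 \<and> (\<forall>u\<in>Q. \<not> (u \<in> T \<and> ?R u c0 \<and> h c0 = Suc (h u)))) \<or> (\<exists>c. V s' c \<and> h c < h c0)" for Q s'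
    have J: "J {..<n} (sem (nest [''u''] ?p) s2)"
    proof (rule nest1)
      show "nats s2 ''n'' 0 = n" using env_n[OF e2] .
      show "J {} s2" using c0 by (simp add: J_def)
      show "J Q (nupdate ''u'' 0 v s')" if "J Q s'" for Q s' v
      proof -
        have "V (nupdate ''u'' 0 v s') c = V s' c" for c by (simp add: V_def mark_nupdate)
        then show ?thesis using that by (simp add: J_def)
      qed
      fix Q b s' assume b: "b < n" "b \<notin> Q" and J: "J Q s'" and fr': "frame (insert ''u'' (writes ?p)) s2 s'" and u: "nats s' ''u'' 0 = b"
      have fr3: "frame W s s'" by (rule frame_trans[OF fr2 fr']) (auto simp: W_def)
      have e': "env s'" using env_frame[OF e fr3] by (simp add: W_def)
      have T': "members n s' = T" unfolding T_def by (rule members_frame[OF fr3]) (simp add: W_def)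
      have v: "nats s' ''x'' 0 = x" "nats s' ''y'' 0 = y" "nats s' (hname i) = h"
        using fr3 x by (auto simp: frame_def h_def W_def)
      obtain c where c: "V s' c" "c = c0 \<or> h c < h c0" using J unfolding J_def by blast
      have cur': "nats s' ''cur'' 0 = c" "c \<in> T" "c < n" using c(1) TT by (auto simp: V_def chain_inv_def)
      have cond: "fval (stepF i) s' \<longleftrightarrow> b \<in> T \<and> ?R b c \<and> h c = Suc (h b)"
        unfolding stepF_def using b u v x e' cur' by (simp add: fval_activeF_members T')
      show "J (insert b Q) (sem ?p s')"
      proof (cases "b \<in> T \<and> ?R b c \<and> h c = Suc (h b)")
        case True
        have "sem (Sq (NSet ''D'' (Var ''u'') (NConst 1)) (NSet ''cur'' (NConst 0) (Var ''u''))) s' = nupdate ''cur'' 0 b (nupdate ''D'' b 1 s')"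
          by (simp add: u)
        then have sem: "sem ?p s' = nupdate ''cur'' 0 b (nupdate ''D'' b 1 s')"
          unfolding sem.simps(4) cond if_P[OF True] .
        obtain A where A: "mark n ''D'' s' = D0 \<union> A" "chain_inv T ?R h (Suc (h a)) A c" using c(1) unfolding V_def by blast
        have "chain_inv T ?R h (Suc (h a)) (insert b A) b"
          using True by (intro chain_inv_step[OF A(2) _ _ _ TT TP]) auto
        moreover have "mark n ''D'' (sem ?p s') = D0 \<union> insert b A" unfolding sem using b A(1) by (simp add: mark_nupdate)
        ultimately have "V (sem ?p s') b" unfolding V_def sem by auto
        moreover have "h b < h c0" using True c(2) by auto
        ultimately show ?thesis unfolding J_def by blast
      next
        case False
        have "sem ?p s' = s'" unfolding sem.simps(4) cond by (rule if_not_P[OF False])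
        moreover have "J (insert b Q) s'"
        proof (cases "c = c0 \<and> \<not> (\<exists>c. V s' c \<and> h c < h c0)")
          case True
          then have "V s' c0 \<and> (\<forall>u\<in>Q. \<not> (u \<in> T \<and> ?R u c0 \<and> h c0 = Suc (h u)))" using J unfolding J_def by blast
          then show ?thesis using False True unfolding J_def by blast
        next
          case False
          then show ?thesis using c unfolding J_def by blast
        qed
        ultimately show ?thesis by simp
      qed
    qed auto
    define s3 where "s3 = sem (nest [''u''] ?p) s2"
    have "I (Suc r) s3"
    proof (cases "\<exists>c. V s3 c \<and> h c < h c0")
      case True
      then obtain c where "V s3 c" "h c < h c0" by blast
      then show ?thesis using c0(2) unfolding I_def by (intro exI[of _ c]) auto
    next
      case False
      then have 1: "V s3 c0" "\<forall>u<n. \<not> (u \<in> T \<and> ?R u c0 \<and> h c0 = Suc (h u))" using J unfolding J_def s3_def by auto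
      have "c0 \<in> T" using 1(1) by (auto simp: V_def chain_inv_def)
      \<comment> \<open>A positive height would provide a predecessor exactly one lower, and the
        completed sweep would have found it.\<close>
      then have "h c0 = 0" using pred[of c0] 1(2) TT unfolding T_def h_def by blast
      then show ?thesis using 1(1) unfolding I_def by blast
    qed
    then show "I (Suc r) (sem (nest [''u''] ?p) (nupdate ''r'' 0 r s1))" by (simp only: s3_def s2_def)
  qed
  then obtain c where c: "V (sem (descend_prog i) s) c" "h c = 0 \<or> h c + n \<le> h a"
    using env_n[OF e] unfolding I_def by auto
  then have "h c = 0" using bound by (auto simp: h_def)
  then show ?thesis using c(1) unfolding V_def chain_inv_def T_def h_def by auto
qed

end

lemma all_less_4: "(\<forall>j<4. Q j) \<longleftrightarrow> Q 0 \<and> Q 1 \<and> Q 2 \<and> Q (3::nat)"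
  by (simp add: eval_nat_numeral All_less_Suc) blast

lemma writes_plane:
  "writes touch_prog = {''t'', ''u'', ''kd'', ''lx'', ''ly'', ''lz''}" "rwrites touch_prog = {}"
  "writes class_prog = {''t'', ''kd'', ''lx'', ''ly'', ''lz''}" "rwrites class_prog = {}"
  by (auto simp: touch_prog_def class_prog_def)

context segments_input
begin

definition is_top :: "nat set \<Rightarrow> (nat \<Rightarrow> nat \<Rightarrow> nat) \<Rightarrow> nat \<Rightarrow> nat \<Rightarrow> bool" where
  "is_top T h i t \<longleftrightarrow> t \<in> T \<and> (\<forall>v\<in>T. \<forall>j<4. h j v \<le> h i t)"

lemma is_top_exists:
  assumes "finite T" "T \<noteq> {}"
  shows "\<exists>i<4. \<exists>t. is_top T h i t"
proof -
  let ?S = "(\<lambda>(i, t). h i t) ` ({..<4} \<times> T)"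
  have fin: "finite ?S" using assms by simp
  have "(0::nat) \<in> {..<4}" by simp
  then have "?S \<noteq> {}" using assms(2) by blast
  then have "Max ?S \<in> ?S" using fin by (rule Max_in[rotated])
  then obtain i t where it: "i < 4" "t \<in> T" "Max ?S = h i t" by auto
  have "h j v \<le> h i t" if "j < 4" "v \<in> T" for j v
    unfolding it(3)[symmetric] by (rule Max_ge[OF fin]) (use that in auto)
  then show ?thesis using it unfolding is_top_def by blast
qed

text \<open>With all heights below \<open>card A\<close> in each of the four orders, the plane uses
  at most \<open>card A ^ 4\<close> quadruples.\<close>

definition good_chain :: "nat set \<Rightarrow> (nat \<Rightarrow> nat \<Rightarrow> nat) \<Rightarrow> nat set \<Rightarrow> bool" where
  "good_chain T h A \<longleftrightarrow> A \<subseteq> T \<and> indep A \<and> (\<forall>v\<in>T. \<forall>j<4. h j v < card A)"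

definition heights :: "state \<Rightarrow> nat \<Rightarrow> nat \<Rightarrow> nat" where
  "heights s i = nats s (hname i)"

lemma heights_frame: "frame W s s' \<Longrightarrow> {''h0'', ''h1'', ''h2'', ''h3''} \<inter> W = {} \<Longrightarrow> heights s' = heights s"
  using hname_cases unfolding heights_def fun_eq_iff frame_def by blast

lemma fval_topF:
  assumes e: "env s" and t: "nats s ''t'' 0 = t" "t < n" and i: "i < 4"
  shows "fval (topF i) s \<longleftrightarrow> is_top (members n s) (heights s) i t"
proof -
  have v: "fval (Imp (activeF ''v'') (Neg (Disj (Disj (ltF (At (hname i) ''t'') (At ''h0'' ''v''))
     (ltF (At (hname i) ''t'') (At ''h1'' ''v''))) (Disj (ltF (At (hname i) ''t'') (At ''h2'' ''v'')) (ltF (At (hname i) ''t'') (At ''h3'' ''v'')))))) (nupdate ''v'' 0 b s)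
    \<longleftrightarrow> (b \<in> members n s \<longrightarrow> (\<forall>j<4. heights s j b \<le> heights s i t))" if "b < n" for b
    using that t by (simp add: fval_activeF_members members_nupdate all_less_4 heights_def not_less hname_def[of 0] hname_def[of "Suc 0"] hname_def[of 2] hname_def[of 3])
  show ?thesis
    unfolding topF_def fval.simps(3) fval_derived(6) env_n[OF e] is_top_def
    using v t members_subset[of n s] by (auto simp: fval_activeF_members simp del: fval_derived fval.simps)
qed

lemma chain_correct:
  assumes e: "env s" and x: "nats s ''x'' 0 = x" "nats s ''y'' 0 = y" "x < n" "y < n" and i: "i < 4"
    and pc: "\<And>t. t \<in> members n s \<Longrightarrow> pc x y t"
    and pred: "\<And>t. t \<in> members n s \<Longrightarrow> 0 < heights s i t \<Longrightarrow>
      \<exists>u\<in>members n s. po i x y u t \<and> heights s i t = Suc (heights s i u)"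
    and bound: "\<And>t. t \<in> members n s \<Longrightarrow> heights s i t \<le> n"
  defines "s' \<equiv> sem (chain_prog i) s" and "T \<equiv> members n s" and "D0 \<equiv> mark n ''D'' s"
  shows "nats s ''on'' 0 \<noteq> 0 \<Longrightarrow> nats s' ''on'' 0 \<noteq> 0 \<and> mark n ''D'' s' = D0"
    and "nats s ''on'' 0 = 0 \<Longrightarrow> (nats s' ''on'' 0 = 0 \<and> mark n ''D'' s' = D0 \<and> (\<forall>t. \<not> is_top T (heights s) i t)) \<or>
      (nats s' ''on'' 0 \<noteq> 0 \<and> (\<exists>A. mark n ''D'' s' = D0 \<union> A \<and> good_chain T (heights s) A))"
proof -
  let ?b = "Sq (NSet ''on'' (NConst 0) (NConst 1)) (Sq (NSet ''D'' (Var ''t'') (NConst 1))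
       (Sq (NSet ''cur'' (NConst 0) (Var ''t'')) (descend_prog i)))"
  let ?p = "Guard (Conj (eqF (Var ''on'') (NConst 0)) (topF i)) ?b"
  have TT: "T \<subseteq> {..<n}" unfolding T_def by (rule members_subset)
  define I where "I Q s1 \<longleftrightarrow> (nats s ''on'' 0 \<noteq> 0 \<and> nats s1 ''on'' 0 \<noteq> 0 \<and> mark n ''D'' s1 = D0) \<or>
     (nats s ''on'' 0 = 0 \<and> nats s1 ''on'' 0 = 0 \<and> mark n ''D'' s1 = D0 \<and> (\<forall>t\<in>Q. \<not> is_top T (heights s) i t)) \<or>
     (nats s ''on'' 0 = 0 \<and> nats s1 ''on'' 0 \<noteq> 0 \<and> (\<exists>A. mark n ''D'' s1 = D0 \<union> A \<and> good_chain T (heights s) A))" for Q s1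
  define W where "W = {''t'', ''on'', ''D'', ''cur'', ''r'', ''u''}"
  have "I {..<n} (sem (nest [''t''] ?p) s)"
  proof (rule nest1)
    show "nats s ''n'' 0 = n" using env_n[OF e] .
    show "I {} s" by (cases "nats s ''on'' 0 = 0") (simp_all add: I_def D0_def)
    show "I Q (nupdate ''t'' 0 v s1)" if "I Q s1" for Q s1 v using that by (simp add: I_def mark_nupdate)
    fix Q a s1 assume a: "a < n" "a \<notin> Q" and I: "I Q s1" and fr': "frame (insert ''t'' (writes ?p)) s s1" and t: "nats s1 ''t'' 0 = a"
    have fr: "frame W s s1" using fr' by (auto simp: frame_def W_def)
    have e1: "env s1" using env_frame[OF e fr] by (simp add: W_def)
    have T1: "members n s1 = T" unfolding T_def by (rule members_frame[OF fr]) (simp add: W_def)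
    have h1: "heights s1 = heights s" by (rule heights_frame[OF fr]) (simp add: W_def)
    have cond: "fval (Conj (eqF (Var ''on'') (NConst 0)) (topF i)) s1 \<longleftrightarrow> nats s1 ''on'' 0 = 0 \<and> is_top T (heights s) i a"
      using fval_topF[OF e1 t a(1) i] T1 h1 by simp
    show "I (insert a Q) (sem ?p s1)"
    proof (cases "nats s1 ''on'' 0 = 0 \<and> is_top T (heights s) i a")
      case True
      define s2 where "s2 = nupdate ''cur'' 0 a (nupdate ''D'' a 1 (nupdate ''on'' 0 1 s1))"
      have sem: "sem ?p s1 = sem (descend_prog i) s2"
      proof -
        have "sem ?b s1 = sem (descend_prog i) s2" by (simp add: t s2_def)
        then show ?thesis unfolding sem.simps(4) cond if_P[OF True] .
      qed
      have fr2: "frame W s s2" using fr by (auto simp: frame_def s2_def W_def)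
      have e2: "env s2" using env_frame[OF e fr2] by (simp add: W_def)
      have T2: "members n s2 = T" unfolding T_def by (rule members_frame[OF fr2]) (simp add: W_def)
      have h2: "nats s2 (hname i) = heights s i" using heights_frame[OF fr2] by (simp add: W_def heights_def fun_eq_iff)
      have on: "nats s ''on'' 0 = 0" "mark n ''D'' s1 = D0" using I True unfolding I_def by auto
      have aT: "a \<in> T" using True by (simp add: is_top_def)
      have "\<exists>A\<subseteq>members n s2. mark n ''D'' (sem (descend_prog i) s2) = D0 \<union> A \<and> indep A \<and> card A = Suc (nats s2 (hname i) a)"
      proof (rule descend_correct[OF e2 _ _ x(3,4)])
        show "nats s2 ''x'' 0 = x" "nats s2 ''y'' 0 = y" using fr2 x by (auto simp: frame_def W_def)
        show "pc x y t" if "t \<in> members n s2" for t using that pc unfolding T2 T_def by blast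
        show "nats s2 ''cur'' 0 = a" by (simp add: s2_def)
        show "a \<in> members n s2" using aT T2 by simp
        show "mark n ''D'' s2 = insert a D0" using on(2) a(1) by (simp add: s2_def mark_nupdate)
        show "\<exists>u\<in>members n s2. po i x y u t \<and> nats s2 (hname i) t = Suc (nats s2 (hname i) u)"
          if "t \<in> members n s2" "0 < nats s2 (hname i) t" for t
          using that pred unfolding T2 h2 T_def by blast
        show "nats s2 (hname i) a \<le> n" using bound aT unfolding h2 T_def by blast
      qed
      then obtain A where A: "A \<subseteq> T" "mark n ''D'' (sem ?p s1) = D0 \<union> A" "indep A" "card A = Suc (heights s i a)"
        unfolding T2 h2 sem by blast
      \<comment> \<open>The chain below a top has one member more than the top's height, which no
        other height exceeds.\<close>
      have "good_chain T (heights s) A" using A True unfolding good_chain_def is_top_def by (auto simp: less_Suc_eq_le)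
      moreover have "nats (sem ?p s1) ''on'' 0 \<noteq> 0"
        unfolding sem using nats_sem[of "''on''" "descend_prog i" s2] by (simp add: s2_def)
      ultimately show ?thesis using on A(2) unfolding I_def by blast
    next
      case False
      have "sem ?p s1 = s1" unfolding sem.simps(4) cond by (rule if_not_P[OF False])
      moreover have "I (insert a Q) s1" using I False unfolding I_def by blast
      ultimately show ?thesis by simp
    qed
  qed auto
  then have I: "I {..<n} s'" by (simp add: s'_def chain_prog_def)
  show "nats s ''on'' 0 \<noteq> 0 \<Longrightarrow> nats s' ''on'' 0 \<noteq> 0 \<and> mark n ''D'' s' = D0" using I unfolding I_def by simp
  have top: "\<not> is_top T (heights s) i t" if "\<forall>t\<in>{..<n}. \<not> is_top T (heights s) i t" for t
    using that TT unfolding is_top_def by blast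
  assume on: "nats s ''on'' 0 = 0"
  have "(nats s' ''on'' 0 = 0 \<and> mark n ''D'' s' = D0 \<and> (\<forall>t\<in>{..<n}. \<not> is_top T (heights s) i t)) \<or>
      (nats s' ''on'' 0 \<noteq> 0 \<and> (\<exists>A. mark n ''D'' s' = D0 \<union> A \<and> good_chain T (heights s) A))"
    using I on unfolding I_def by simp
  then show "(nats s' ''on'' 0 = 0 \<and> mark n ''D'' s' = D0 \<and> (\<forall>t. \<not> is_top T (heights s) i t)) \<or>
      (nats s' ''on'' 0 \<noteq> 0 \<and> (\<exists>A. mark n ''D'' s' = D0 \<union> A \<and> good_chain T (heights s) A))"
  proof (elim disjE conjE)
    assume "nats s' ''on'' 0 = 0" "mark n ''D'' s' = D0" "\<forall>t\<in>{..<n}. \<not> is_top T (heights s) i t"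
    then show ?thesis using top by (intro disjI1 conjI allI)
  qed (intro disjI2 conjI)
qed

lemma touch_prog_correct:
  assumes e: "env s" and x: "nats s ''x'' 0 = x" "nats s ''y'' 0 = y" "x < n" "y < n"
    and z: "\<And>t. t < n \<Longrightarrow> nats s ''kd'' t = 0 \<Longrightarrow> lab s t = zeros" and t: "t < n"
  shows "nats s ''kd'' t \<noteq> 0 \<Longrightarrow> lab (sem touch_prog s) t = lab s t"
    and "nats s ''kd'' t = 0 \<Longrightarrow> (\<exists>u\<in>mark n ''D'' s. pc x y t \<and> tc u t \<and> lab (sem touch_prog s) t = [4, x, y, u, 0, 0, 0, 0])
      \<or> (pc x y t \<longrightarrow> (\<forall>u\<in>mark n ''D'' s. \<not> tc u t)) \<and> lab (sem touch_prog s) t = zeros"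
proof -
  let ?D = "mark n ''D'' s"
  let ?f = "Conj (pcF ''x'' ''y'' ''t'') (Conj (inF ''D'' ''u'') (tcF ''u'' ''t''))"
  define F where "F t vs \<longleftrightarrow> pc x y t \<and> vs ! 0 \<in> ?D \<and> tc (vs ! 0) t" for t vs
  have eval: "fval ?f s' = F t vs \<and> (\<forall>s''. frame label_names s' s'' \<longrightarrow>
      nval (Var ''x'') s'' = x \<and> nval (Var ''y'') s'' = y \<and> nval (Var ''u'') s'' = vs ! 0)"
    if a: "t < n" "length vs = length [''u'']" "set vs \<subseteq> {..<n}" "nats s' ''t'' 0 = t" "map (\<lambda>x. nats s' x 0) [''u''] = vs"
      and fr: "frame (set [''t'', ''u''] \<union> label_names) s s'" for s' t vs
  proof -
    have e': "env s'" by (rule env_frame[OF e fr]) (auto simp: label_names_def)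
    have D: "mark n ''D'' s' = ?D" by (rule mark_frame[OF fr]) (auto simp: label_names_def)
    obtain u where u: "vs = [u]" "u < n" "nats s' ''u'' 0 = u" using a by auto
    have v: "nats s' ''x'' 0 = x" "nats s' ''y'' 0 = y" using fr x by (auto simp: frame_def label_names_def)
    have "fval ?f s' \<longleftrightarrow> F t vs"
      using u a e' v x by (simp add: F_def fval_inF D del: fval_derived(3))
    moreover have "\<forall>s''. frame label_names s' s'' \<longrightarrow> nval (Var ''x'') s'' = x \<and> nval (Var ''y'') s'' = y \<and> nval (Var ''u'') s'' = u"
      using u v by (auto simp: frame_def label_names_def)
    ultimately show ?thesis using u by simp
  qed
  note sc = search_correct[where xs = "[''u'']" and k = 4 and f = ?f and F = F and x = "Var ''x''" and y = "Var ''y''"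
      and z = "Var ''u''" and X = "\<lambda>_. x" and Y = "\<lambda>_. y" and Z = "\<lambda>vs. vs ! 0", OF env_n[OF e] _ _ z _ eval t]
  show "lab (sem touch_prog s) t = lab s t" if "nats s ''kd'' t \<noteq> 0"
    unfolding touch_prog_def by (rule sc(1)) (auto simp: label_names_def that)
  assume kd: "nats s ''kd'' t = 0"
  have "(\<exists>vs. length vs = length [''u''] \<and> set vs \<subseteq> {..<n} \<and> F t vs \<and>
         lab (sem touch_prog s) t = [4, x, y, vs ! 0, 0, 0, 0, 0]) \<or>
      (\<forall>vs. length vs = length [''u''] \<and> set vs \<subseteq> {..<n} \<longrightarrow> \<not> F t vs) \<and> lab (sem touch_prog s) t = zeros"
    unfolding touch_prog_def by (rule sc(2)) (auto simp: label_names_def kd)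
  then show "(\<exists>u\<in>?D. pc x y t \<and> tc u t \<and> lab (sem touch_prog s) t = [4, x, y, u, 0, 0, 0, 0])
      \<or> (pc x y t \<longrightarrow> (\<forall>u\<in>?D. \<not> tc u t)) \<and> lab (sem touch_prog s) t = zeros"
  proof
    assume *: "(\<forall>vs. length vs = length [''u''] \<and> set vs \<subseteq> {..<n} \<longrightarrow> \<not> F t vs) \<and> lab (sem touch_prog s) t = zeros"
    have "\<not> tc u t" if "pc x y t" "u \<in> ?D" for u
    proof -
      have "u < n" using that(2) by (simp add: mark_def)
      then have "\<not> F t [u]" using * by simp
      then show ?thesis using that by (simp add: F_def)
    qed
    then show ?thesis using * by blast
  qed (auto simp: F_def)
qed

lemma class_prog_correct:
  assumes e: "env s" and x: "nats s ''x'' 0 = x" "nats s ''y'' 0 = y" "x < n" "y < n"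
    and z: "\<And>t. t < n \<Longrightarrow> nats s ''kd'' t = 0 \<Longrightarrow> lab s t = zeros" and t: "t < n"
  shows "lab (sem class_prog s) t = (if nats s ''kd'' t = 0 \<and> pc x y t then [5, x, y, 0, 0, 0, 0, 0] else lab s t)"
proof -
  define F where "F t vs \<longleftrightarrow> pc x y t" for t and vs :: "nat list"
  have eval: "fval (pcF ''x'' ''y'' ''t'') s' = F t vs \<and> (\<forall>s''. frame label_names s' s'' \<longrightarrow>
      nval (Var ''x'') s'' = x \<and> nval (Var ''y'') s'' = y \<and> nval (NConst 0) s'' = 0)"
    if a: "t < n" "length vs = length []" "set vs \<subseteq> {..<n}" "nats s' ''t'' 0 = t" "map (\<lambda>x. nats s' x 0) [] = vs"
      and fr: "frame (set [''t''] \<union> label_names) s s'" for s' t vs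
  proof -
    have e': "env s'" by (rule env_frame[OF e fr]) (auto simp: label_names_def)
    have v: "nats s' ''x'' 0 = x" "nats s' ''y'' 0 = y" using fr x by (auto simp: frame_def label_names_def)
    have "fval (pcF ''x'' ''y'' ''t'') s' \<longleftrightarrow> F t vs" using a e' v x by (simp add: F_def)
    moreover have "\<forall>s''. frame label_names s' s'' \<longrightarrow> nval (Var ''x'') s'' = x \<and> nval (Var ''y'') s'' = y"
      using v by (auto simp: frame_def label_names_def)
    ultimately show ?thesis by simp
  qed
  note sc = search_correct[where xs = "[]" and k = 5 and f = "pcF ''x'' ''y'' ''t''" and F = F and x = "Var ''x''" and y = "Var ''y''"
      and z = "NConst 0" and X = "\<lambda>_. x" and Y = "\<lambda>_. y" and Z = "\<lambda>_. 0", OF env_n[OF e] _ _ z _ eval t]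
  show ?thesis
  proof (cases "nats s ''kd'' t = 0")
    case True
    have "(\<exists>vs. length vs = length ([] :: vname list) \<and> set vs \<subseteq> {..<n} \<and> F t vs \<and> lab (sem class_prog s) t = [5, x, y, 0, 0, 0, 0, 0]) \<or>
      (\<forall>vs. length vs = length ([] :: vname list) \<and> set vs \<subseteq> {..<n} \<longrightarrow> \<not> F t vs) \<and> lab (sem class_prog s) t = zeros"
      unfolding class_prog_def by (rule sc(2)) (auto simp: label_names_def True)
    then show ?thesis using True z[OF t True] by (auto simp: F_def)
  next
    case False
    have "lab (sem class_prog s) t = lab s t"
      unfolding class_prog_def by (rule sc(1)) (auto simp: label_names_def False)
    then show ?thesis using False by simp
  qed
qed

end

context segments_input
begin

definition height_ok :: "nat set \<Rightarrow> nat \<Rightarrow> nat \<Rightarrow> nat \<Rightarrow> (nat \<Rightarrow> nat) \<Rightarrow> bool" where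
  "height_ok T x y i h \<longleftrightarrow> (\<forall>t\<in>T. \<forall>u\<in>T. po i x y t u \<longrightarrow> h t < h u) \<and>
     (\<forall>t\<in>T. 0 < h t \<longrightarrow> (\<exists>u\<in>T. po i x y u t \<and> h t = Suc (h u))) \<and> (\<forall>t\<in>T. h t \<le> n)"

lemma heights_correct:
  assumes e: "env s" and x: "nats s ''x'' 0 = x" "nats s ''y'' 0 = y" "x < n" "y < n"
    and pc: "\<And>t. t \<in> members n s \<Longrightarrow> pc x y t" and z: "\<And>t i. t \<in> members n s \<Longrightarrow> i < 4 \<Longrightarrow> heights s i t = 0"
  defines "W \<equiv> {''r'', ''t'', ''h0'', ''h1'', ''h2'', ''h3''}"
  shows "\<exists>s'. s' = sem (height_prog 3) (sem (height_prog 2) (sem (height_prog 1) (sem (height_prog 0) s))) \<and> frame W s s' \<and>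
    (\<forall>i<4. height_ok (members n s) x y i (heights s' i) \<and> (\<forall>t. t \<notin> members n s \<longrightarrow> heights s' i t = heights s i t))"
proof -
  let ?T = "members n s"
  define st where "st k = fold (\<lambda>i. sem (height_prog i)) [0..<k] s" for k
  have st: "st 0 = s" "st (Suc k) = sem (height_prog k) (st k)" for k by (simp_all add: st_def)
  have "k \<le> 4 \<Longrightarrow> frame W s (st k) \<and> (\<forall>i<k. height_ok ?T x y i (heights (st k) i) \<and> (\<forall>t. t \<notin> ?T \<longrightarrow> heights (st k) i t = heights s i t))
     \<and> (\<forall>i. k \<le> i \<and> i < 4 \<longrightarrow> heights (st k) i = heights s i)" for k
  proof (induction k)
    case 0
    then show ?case by (simp add: st)
  next
    case (Suc k)
    then have IH: "frame W s (st k)" "\<forall>i<k. height_ok ?T x y i (heights (st k) i) \<and> (\<forall>t. t \<notin> ?T \<longrightarrow> heights (st k) i t = heights s i t)"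
      "\<forall>i. k \<le> i \<and> i < 4 \<longrightarrow> heights (st k) i = heights s i" and k: "k < 4" by auto
    have e': "env (st k)" using env_frame[OF e IH(1)] by (simp add: W_def)
    have T': "members n (st k) = ?T" by (rule members_frame[OF IH(1)]) (simp add: W_def)
    have x': "nats (st k) ''x'' 0 = x" "nats (st k) ''y'' 0 = y" using IH(1) x by (auto simp: frame_def W_def)
    have pc': "pc x y t" if "t \<in> members n (st k)" for t using pc that T' by simp
    have z': "nats (st k) (hname k) t = 0" if "t \<in> members n (st k)" for t
      using IH(3) k z that T' by (auto simp: heights_def)
    have h: "height_ok ?T x y k (heights (sem (height_prog k) (st k)) k)"
      "\<And>t. t \<notin> ?T \<Longrightarrow> heights (sem (height_prog k) (st k)) k t = heights (st k) k t"
      unfolding height_ok_def heights_def T'[symmetric]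
      using height_correct[OF e' x' x(3,4)] pc' z' by (blast, blast)
    have fr: "frame {''r'', ''t'', hname k} (st k) (st (Suc k))" unfolding st by (rule frame_sem) auto
    have 1: "frame W s (st (Suc k))"
      by (rule frame_trans[OF IH(1) fr]) (use hname_cases[of k] in \<open>auto simp: W_def\<close>)
    have old: "heights (st (Suc k)) i = heights (st k) i" if "i \<noteq> k" "i < 4" for i
      using fr that k hname_inj[of i k] unfolding heights_def by (intro frame_eq[OF fr]) auto
    have new: "height_ok ?T x y k (heights (st (Suc k)) k)" "t \<notin> ?T \<Longrightarrow> heights (st (Suc k)) k t = heights s k t" for t
    proof -
      show "height_ok ?T x y k (heights (st (Suc k)) k)" unfolding st by (rule h(1))
      show "heights (st (Suc k)) k t = heights s k t" if "t \<notin> ?T" unfolding st using h(2)[OF that] IH(3) k by simp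
    qed
    have "\<forall>i<Suc k. height_ok ?T x y i (heights (st (Suc k)) i) \<and> (\<forall>t. t \<notin> ?T \<longrightarrow> heights (st (Suc k)) i t = heights s i t)"
    proof (intro allI impI)
      fix i assume "i < Suc k"
      then show "height_ok ?T x y i (heights (st (Suc k)) i) \<and> (\<forall>t. t \<notin> ?T \<longrightarrow> heights (st (Suc k)) i t = heights s i t)"
        using new old[of i] IH(2) k by (cases "i = k") auto
    qed
    moreover have "\<forall>i. Suc k \<le> i \<and> i < 4 \<longrightarrow> heights (st (Suc k)) i = heights s i" using old IH(3) by auto
    ultimately show ?case using 1 by blast
  qed
  from this[of 4] show ?thesis by (simp add: st eval_nat_numeral)
qed

lemma chains_correct:
  assumes e: "env s" and x: "nats s ''x'' 0 = x" "nats s ''y'' 0 = y" "x < n" "y < n"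
    and pc: "\<And>t. t \<in> members n s \<Longrightarrow> pc x y t" and ok: "\<And>i. i < 4 \<Longrightarrow> height_ok (members n s) x y i (heights s i)"
    and on: "nats s ''on'' 0 = 0"
  shows "\<exists>s'. s' = sem (chain_prog 3) (sem (chain_prog 2) (sem (chain_prog 1) (sem (chain_prog 0) s))) \<and>
    frame {''t'', ''on'', ''D'', ''cur'', ''r'', ''u''} s s' \<and>
    (\<exists>A. mark n ''D'' s' = mark n ''D'' s \<union> A \<and> good_chain (members n s) (heights s) A)"
proof -
  let ?T = "members n s" and ?W = "{''t'', ''on'', ''D'', ''cur'', ''r'', ''u''}" and ?D0 = "mark n ''D'' s" and ?h = "heights s"
  define st where "st k = fold (\<lambda>i. sem (chain_prog i)) [0..<k] s" for k
  have st: "st 0 = s" "st (Suc k) = sem (chain_prog k) (st k)" for k by (simp_all add: st_def)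
  have "k \<le> 4 \<Longrightarrow> frame ?W s (st k) \<and> ((nats (st k) ''on'' 0 = 0 \<and> mark n ''D'' (st k) = ?D0 \<and> (\<forall>i<k. \<forall>t. \<not> is_top ?T ?h i t))
     \<or> (nats (st k) ''on'' 0 \<noteq> 0 \<and> (\<exists>A. mark n ''D'' (st k) = ?D0 \<union> A \<and> good_chain ?T ?h A)))" for k
  proof (induction k)
    case 0
    then show ?case using on by (simp add: st)
  next
    case (Suc k)
    then have k: "k < 4" and fr: "frame ?W s (st k)" and IH: "(nats (st k) ''on'' 0 = 0 \<and> mark n ''D'' (st k) = ?D0 \<and> (\<forall>i<k. \<forall>t. \<not> is_top ?T ?h i t))
     \<or> (nats (st k) ''on'' 0 \<noteq> 0 \<and> (\<exists>A. mark n ''D'' (st k) = ?D0 \<union> A \<and> good_chain ?T ?h A))" by auto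
    have e': "env (st k)" using env_frame[OF e fr] by simp
    have T': "members n (st k) = ?T" by (rule members_frame[OF fr]) simp
    have h': "heights (st k) = ?h" by (rule heights_frame[OF fr]) simp
    have x': "nats (st k) ''x'' 0 = x" "nats (st k) ''y'' 0 = y" using fr x by (auto simp: frame_def)
    have fr': "frame ?W s (st (Suc k))" unfolding st by (rule frame_trans[OF fr frame_sem[where W = ?W]]) (auto simp: chain_prog_def descend_prog_def)
    have pr: "\<exists>u\<in>?T. po k x y u t \<and> ?h k t = Suc (?h k u)" if "t \<in> ?T" "0 < ?h k t" for t
      using ok[OF k] that unfolding height_ok_def by blast
    have bd: "?h k t \<le> n" if "t \<in> ?T" for t using ok[OF k] that unfolding height_ok_def by blast
    note cc = chain_correct[OF e' x' x(3,4) k, unfolded T' h']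
    have c1: "nats (st k) ''on'' 0 \<noteq> 0 \<Longrightarrow> nats (st (Suc k)) ''on'' 0 \<noteq> 0 \<and> mark n ''D'' (st (Suc k)) = mark n ''D'' (st k)"
      and c2: "nats (st k) ''on'' 0 = 0 \<Longrightarrow> (nats (st (Suc k)) ''on'' 0 = 0 \<and> mark n ''D'' (st (Suc k)) = mark n ''D'' (st k) \<and> (\<forall>t. \<not> is_top ?T ?h k t)) \<or>
      (nats (st (Suc k)) ''on'' 0 \<noteq> 0 \<and> (\<exists>A. mark n ''D'' (st (Suc k)) = mark n ''D'' (st k) \<union> A \<and> good_chain ?T ?h A))"
      unfolding st by (rule cc(1)[OF pc pr bd]; assumption) (rule cc(2)[OF pc pr bd]; assumption)
    show ?case
    proof (cases "nats (st k) ''on'' 0 = 0")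
      case True
      then have *: "mark n ''D'' (st k) = ?D0" "\<forall>i<k. \<forall>t. \<not> is_top ?T ?h i t" using IH by auto
      show ?thesis using c2[OF True] fr' *(2) unfolding *(1) by (auto simp: less_Suc_eq)
    next
      case False
      then have "\<exists>A. mark n ''D'' (st k) = ?D0 \<union> A \<and> good_chain ?T ?h A" using IH by auto
      then show ?thesis using c1[OF False] fr' by simp
    qed
  qed
  from this[of 4] have fr: "frame ?W s (st 4)" and D: "(mark n ''D'' (st 4) = ?D0 \<and> (\<forall>i<4. \<forall>t. \<not> is_top ?T ?h i t))
     \<or> (\<exists>A. mark n ''D'' (st 4) = ?D0 \<union> A \<and> good_chain ?T ?h A)" by auto
  have "\<exists>A. mark n ''D'' (st 4) = ?D0 \<union> A \<and> good_chain ?T ?h A"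
    using D
  proof
    assume *: "mark n ''D'' (st 4) = ?D0 \<and> (\<forall>i<4. \<forall>t. \<not> is_top ?T ?h i t)"
    have "finite ?T" by (rule finite_subset[OF members_subset]) simp
    \<comment> \<open>A nonempty class has a top in some order. So if all four searches fail the
      class is empty, and the empty chain will do.\<close>
    then have "?T = {}" using is_top_exists[of ?T ?h] * by blast
    then have "good_chain ?T ?h {}" by (simp add: good_chain_def indep_def)
    then show ?thesis using * by (intro exI[of _ "{}"]) simp
  qed
  moreover have "st 4 = sem (chain_prog 3) (sem (chain_prog 2) (sem (chain_prog 1) (sem (chain_prog 0) s)))"
    by (simp add: st eval_nat_numeral)
  ultimately show ?thesis using fr by metis
qed

text \<open>Among the unlabelled segments \<open>T0\<close> of the plane, those touching the old
  clique \<open>D0\<close> receive crossing labels and the others, \<open>T\<close>, receive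
  heights. Keeping \<open>T\<close> apart from \<open>D0\<close> is what permits adding its chain to
  the clique.\<close>

lemma plane_correct:
  assumes e: "env s" and x: "nats s ''x'' 0 = x" "nats s ''y'' 0 = y" "x < n" "y < n"
    and z: "\<And>t. t < n \<Longrightarrow> nats s ''kd'' t = 0 \<Longrightarrow> lab s t = zeros"
    and new: "\<And>t. t < n \<Longrightarrow> nats s ''kd'' t = 5 \<Longrightarrow> \<not> (nats s ''lx'' t = x \<and> nats s ''ly'' t = y)"
  defines "T0 \<equiv> {t. t < n \<and> nats s ''kd'' t = 0 \<and> pc x y t}" and "D0 \<equiv> mark n ''D'' s" and "s' \<equiv> sem plane_prog s"
  shows "\<exists>T A. T \<subseteq> T0 \<and> (\<forall>t\<in>T. \<forall>u\<in>D0. \<not> tc u t) \<and> mark n ''D'' s' = D0 \<union> A \<and> good_chain T (heights s') A \<and>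
    (\<forall>t<n. t \<notin> T0 \<longrightarrow> lab s' t = lab s t) \<and>
    (\<forall>t\<in>T0 - T. \<exists>u\<in>D0. tc u t \<and> lab s' t = [4, x, y, u, 0, 0, 0, 0]) \<and>
    (\<forall>t\<in>T. \<exists>a b c d. lab s' t = [5, x, y, 0, a, b, c, d]) \<and>
    (\<forall>i<4. \<forall>t\<in>T. \<forall>u\<in>T. po i x y t u \<longrightarrow> heights s' i t < heights s' i u)"
proof -
  define s1 where "s1 = sem touch_prog s"
  have f1: "frame (writes touch_prog) s s1" unfolding s1_def by (rule frame_sem) (auto simp: writes_plane)
  have e1: "env s1" using env_frame[OF e f1] by (simp add: writes_plane)
  have x1: "nats s1 ''x'' 0 = x" "nats s1 ''y'' 0 = y" using f1 x by (auto simp: frame_def writes_plane)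
  have t1: "nats s ''kd'' t \<noteq> 0 \<Longrightarrow> lab s1 t = lab s t"
    "nats s ''kd'' t = 0 \<Longrightarrow> (\<exists>u\<in>D0. pc x y t \<and> tc u t \<and> lab s1 t = [4, x, y, u, 0, 0, 0, 0])
      \<or> (pc x y t \<longrightarrow> (\<forall>u\<in>D0. \<not> tc u t)) \<and> lab s1 t = zeros" if "t < n" for t
    unfolding s1_def D0_def by (rule touch_prog_correct[OF e x z that]; assumption)+
  have z1: "lab s1 t = zeros" if "t < n" "nats s1 ''kd'' t = 0" for t
  proof (cases "nats s ''kd'' t = 0")
    case True
    have "nats s1 ''kd'' t = lab s1 t ! 0" by simp
    then show ?thesis using t1(2)[OF that(1) True] that(2) by (auto simp: lab_def)
  next
    case False
    have "nats s1 ''kd'' t = lab s1 t ! 0" by simp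
    also have "\<dots> = nats s ''kd'' t" using t1(1)[OF that(1) False] by simp
    finally show ?thesis using False that(2) by simp
  qed
  define T where "T = {t \<in> T0. \<forall>u\<in>D0. \<not> tc u t}"
  have L1a: "lab s1 t = lab s t" if "t < n" "nats s ''kd'' t \<noteq> 0" for t using t1(1)[OF that] .
  have L1b: "\<exists>u\<in>D0. tc u t \<and> lab s1 t = [4, x, y, u, 0, 0, 0, 0]" if t: "t \<in> T0 - T" for t
  proof -
    have t': "t < n" "nats s ''kd'' t = 0" "pc x y t" "\<not> (\<forall>u\<in>D0. \<not> tc u t)" using t by (auto simp: T0_def T_def)
    from t1(2)[OF t'(1,2)] show ?thesis
    proof
      assume "(pc x y t \<longrightarrow> (\<forall>u\<in>D0. \<not> tc u t)) \<and> lab s1 t = zeros"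
      then show ?thesis using t'(3,4) by simp
    qed (elim bexE conjE, intro bexI conjI)
  qed
  have L1c: "lab s1 t = zeros" if t: "t < n" "nats s ''kd'' t = 0" "t \<notin> T0 - T" for t
  proof -
    have t': "pc x y t \<longrightarrow> (\<forall>u\<in>D0. \<not> tc u t)" using t by (auto simp: T0_def T_def)
    from t1(2)[OF t(1,2)] show ?thesis
    proof
      assume "\<exists>u\<in>D0. pc x y t \<and> tc u t \<and> lab s1 t = [4, x, y, u, 0, 0, 0, 0]"
      then show ?thesis using t' by (elim bexE conjE) simp
    qed simp
  qed
  define s2 where "s2 = sem class_prog s1"
  have f2: "frame (writes class_prog) s1 s2" unfolding s2_def by (rule frame_sem) (auto simp: writes_plane)
  have e2: "env s2" using env_frame[OF e1 f2] by (simp add: writes_plane)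
  have x2: "nats s2 ''x'' 0 = x" "nats s2 ''y'' 0 = y" using f2 x1 by (auto simp: frame_def writes_plane)
  have t2: "lab s2 t = (if nats s1 ''kd'' t = 0 \<and> pc x y t then [5, x, y, 0, 0, 0, 0, 0] else lab s1 t)" if "t < n" for t
    unfolding s2_def by (rule class_prog_correct[OF e1 x1 x(3,4) z1 that]; assumption)
  have kd1: "nats s1 ''kd'' t = 0 \<and> pc x y t \<longleftrightarrow> t \<in> T" if "t < n" for t
  proof
    assume *: "nats s1 ''kd'' t = 0 \<and> pc x y t"
    have "nats s ''kd'' t = 0"
    proof (rule ccontr)
      assume "nats s ''kd'' t \<noteq> 0"
      then have "lab s1 t ! 0 = lab s t ! 0" using L1a[OF that] by simp
      then show False using * \<open>nats s ''kd'' t \<noteq> 0\<close> by simp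
    qed
    moreover have "t \<notin> T0 - T"
    proof
      assume "t \<in> T0 - T"
      then obtain u where "lab s1 t = [4, x, y, u, 0, 0, 0, 0]" using L1b by blast
      then show False using * by (simp add: lab_def)
    qed
    ultimately show "t \<in> T" using * that unfolding T0_def by simp
  next
    assume "t \<in> T"
    then have "lab s1 t = zeros" "pc x y t" using L1c[OF that] unfolding T_def T0_def by auto
    then show "nats s1 ''kd'' t = 0 \<and> pc x y t" by (simp add: lab_def)
  qed
  have L2: "lab s2 t = (if t \<in> T then [5, x, y, 0, 0, 0, 0, 0] else lab s1 t)" if "t < n" for t
    using t2[OF that] kd1[OF that] by simp
  have Tn: "t < n" if "t \<in> T" for t using that unfolding T_def T0_def by blast
  \<comment> \<open>By the assumption \<open>new\<close> no segment of kind 5 carried this pair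
    before, so its members are exactly those labelled in this round.\<close>
  have mem2: "members n s2 = T"
  proof -
    have "t \<in> members n s2 \<longleftrightarrow> t \<in> T" if t: "t < n" for t
    proof (cases "t \<in> T")
      case True
      then show ?thesis using L2[OF t] t x2 by (simp add: members_def lab_def)
    next
      case False
      then have l: "lab s2 t = lab s1 t" using L2[OF t] by simp
      have "\<not> (nats s2 ''kd'' t = 5 \<and> nats s2 ''lx'' t = x \<and> nats s2 ''ly'' t = y)"
      proof (cases "nats s ''kd'' t = 0")
        case True
        then have "lab s1 t ! 0 \<noteq> 5"
          using L1b[of t] L1c[OF t True] by (cases "t \<in> T0 - T") (auto simp: lab_def)
        then show ?thesis using l by (auto simp: lab_def)
      next
        case False
        then have "lab s2 t = lab s t" using l L1a[OF t] by simp
        then have "nats s2 ''kd'' t = nats s ''kd'' t" "nats s2 ''lx'' t = nats s ''lx'' t" "nats s2 ''ly'' t = nats s ''ly'' t"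
          by (simp_all add: lab_def)
        then show ?thesis using new[OF t] by simp
      qed
      then show ?thesis using False x2 by (simp add: members_def)
    qed
    then show ?thesis using Tn members_subset[of n s2] by blast
  qed
  have pcT: "pc x y t" if "t \<in> members n s2" for t using that mem2 unfolding T_def T0_def by blast
  have h2: "heights s2 i t = 0" if "t \<in> members n s2" "i < 4" for i t
  proof -
    have "lab s2 t = [5, x, y, 0, 0, 0, 0, 0]" using that L2[OF Tn] mem2 by simp
    then show ?thesis using that(2) by (auto simp: heights_def hname_def lab_def)
  qed
  obtain s3 where s3: "s3 = sem (height_prog 3) (sem (height_prog 2) (sem (height_prog 1) (sem (height_prog 0) s2)))"
    and f3: "frame {''r'', ''t'', ''h0'', ''h1'', ''h2'', ''h3''} s2 s3"
    and h3: "\<forall>i<4. height_ok T x y i (heights s3 i) \<and> (\<forall>t. t \<notin> T \<longrightarrow> heights s3 i t = heights s2 i t)"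
    using heights_correct[OF e2 x2 x(3,4) pcT h2] unfolding mem2 by blast
  define s4 where "s4 = nupdate ''on'' 0 0 s3"
  have f4: "frame {''r'', ''t'', ''h0'', ''h1'', ''h2'', ''h3'', ''on''} s2 s4" using f3 by (auto simp: frame_def s4_def)
  have e4: "env s4" using env_frame[OF e2 f4] by simp
  have x4: "nats s4 ''x'' 0 = x" "nats s4 ''y'' 0 = y" using f4 x2 by (auto simp: frame_def)
  have mem4: "members n s4 = T" unfolding mem2[symmetric] by (rule members_frame[OF f4]) simp
  have h4: "heights s4 = heights s3" by (rule heights_frame[of "{''on''}"]) (auto simp: s4_def frame_def)
  have pc4: "pc x y t" if "t \<in> members n s4" for t using that pcT mem2 mem4 by simp
  have ok4: "height_ok (members n s4) x y i (heights s4 i)" if "i < 4" for i using h3 that unfolding mem4 h4 by blast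
  have on4: "nats s4 ''on'' 0 = 0" by (simp add: s4_def)
  obtain s5 A where s5: "s5 = sem (chain_prog 3) (sem (chain_prog 2) (sem (chain_prog 1) (sem (chain_prog 0) s4)))"
    and f5: "frame {''t'', ''on'', ''D'', ''cur'', ''r'', ''u''} s4 s5"
    and A: "mark n ''D'' s5 = mark n ''D'' s4 \<union> A" "good_chain T (heights s4) A"
    using chains_correct[OF e4 x4 x(3,4) pc4 ok4 on4] unfolding mem4 by blast
  have s': "s' = s5" unfolding s'_def plane_prog_def s5 s4_def s3 s2_def s1_def by simp
  have h5: "heights s5 = heights s3" using heights_frame[OF f5] h4 by simp
  have D4: "mark n ''D'' s4 = D0"
  proof -
    have "mark n ''D'' s4 = mark n ''D'' s2" by (rule mark_frame[OF f4]) simp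
    also have "\<dots> = mark n ''D'' s1" by (rule mark_frame[OF f2]) (simp add: writes_plane)
    also have "\<dots> = D0" unfolding D0_def by (rule mark_frame[OF f1]) (simp add: writes_plane)
    finally show ?thesis .
  qed
  have f25: "frame {''r'', ''t'', ''h0'', ''h1'', ''h2'', ''h3'', ''on'', ''D'', ''cur'', ''u''} s2 s5"
    by (rule frame_trans[OF f4 f5]) auto
  have arr: "nats s5 ''kd'' = nats s2 ''kd''" "nats s5 ''lx'' = nats s2 ''lx''" "nats s5 ''ly'' = nats s2 ''ly''" "nats s5 ''lz'' = nats s2 ''lz''"
    using f25 by (auto simp: frame_def)
  have labh: "lab s t = [nats s ''kd'' t, nats s ''lx'' t, nats s ''ly'' t, nats s ''lz'' t, heights s 0 t, heights s 1 t, heights s 2 t, heights s 3 t]"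
    for s t by (simp add: lab_def heights_def hname_def)
  have out: "lab s5 t = lab s2 t" if "t \<notin> T" for t
    using h3 that unfolding labh arr h5 by simp
  show ?thesis
  proof (rule exI[of _ T], rule exI[of _ A], intro conjI)
    show "T \<subseteq> T0" by (auto simp: T_def)
    show "\<forall>t\<in>T. \<forall>u\<in>D0. \<not> tc u t" by (simp add: T_def)
    show "mark n ''D'' s' = D0 \<union> A" unfolding s' using A(1) D4 by simp
    show "good_chain T (heights s') A" unfolding s' h5 using A(2) h4 by simp
    show "\<forall>t<n. t \<notin> T0 \<longrightarrow> lab s' t = lab s t"
    proof (intro allI impI)
      fix t assume t: "t < n" "t \<notin> T0"
      then have nT: "t \<notin> T" by (simp add: T_def)
      have "lab s5 t = lab s1 t" using out[OF nT] L2[OF t(1)] nT by simp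
      also have "\<dots> = lab s t"
      proof (cases "nats s ''kd'' t = 0")
        case True
        then show ?thesis using L1c[OF t(1) True] t z[OF t(1) True] by simp
      next
        case False
        then show ?thesis using L1a[OF t(1)] by simp
      qed
      finally show "lab s' t = lab s t" by (simp add: s')
    qed
    show "\<forall>t\<in>T0 - T. \<exists>u\<in>D0. tc u t \<and> lab s' t = [4, x, y, u, 0, 0, 0, 0]"
    proof
      fix t assume t: "t \<in> T0 - T"
      then have "t < n" by (simp add: T0_def)
      then have "lab s5 t = lab s1 t" using out[of t] L2[of t] t by simp
      then show "\<exists>u\<in>D0. tc u t \<and> lab s' t = [4, x, y, u, 0, 0, 0, 0]" using L1b[OF t] by (simp add: s')
    qed
    show "\<forall>t\<in>T. \<exists>a b c d. lab s' t = [5, x, y, 0, a, b, c, d]"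
    proof
      fix t assume t: "t \<in> T"
      have "lab s2 t = [5, x, y, 0, 0, 0, 0, 0]" using L2[OF Tn[OF t]] t by simp
      then have "nats s2 ''kd'' t = 5" "nats s2 ''lx'' t = x" "nats s2 ''ly'' t = y" "nats s2 ''lz'' t = 0" by (simp_all add: lab_def)
      then show "\<exists>a b c d. lab s' t = [5, x, y, 0, a, b, c, d]" unfolding s' labh arr by simp
    qed
    show "\<forall>i<4. \<forall>t\<in>T. \<forall>u\<in>T. po i x y t u \<longrightarrow> heights s' i t < heights s' i u"
      unfolding s' h5 using h3 unfolding height_ok_def by blast
  qed
qed

end

section \<open>Joining the planes\<close>

context seg_structure
begin

text \<open>Positions 0 to 3 of a label hold the kind, the pair and the auxiliary index; positions 4
  to 7 hold the heights.\<close>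

definition touch_label :: "(nat \<times> nat) set \<Rightarrow> nat set \<Rightarrow> nat set \<Rightarrow> nat \<Rightarrow> nat list \<Rightarrow> bool" where
  "touch_label Q C D t l \<longleftrightarrow> l ! 0 = 4 \<and> (l ! 1, l ! 2) \<in> Q \<and> l ! 1 \<in> C \<and> l ! 2 \<in> C \<and> l ! 1 < l ! 2 \<and> pc (l ! 1) (l ! 2) t
     \<and> l ! 3 \<in> D \<and> tc (l ! 3) t \<and> \<not> pc (l ! 1) (l ! 2) (l ! 3) \<and> (\<forall>i<4. l ! (4 + i) = 0)"

definition class_label :: "(nat \<times> nat) set \<Rightarrow> nat set \<Rightarrow> nat set \<Rightarrow> (nat \<Rightarrow> nat list) \<Rightarrow> nat \<Rightarrow> nat list \<Rightarrow> bool" where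
  "class_label Q C D L t l \<longleftrightarrow> l ! 0 = 5 \<and> (l ! 1, l ! 2) \<in> Q \<and> l ! 1 \<in> C \<and> l ! 2 \<in> C \<and> l ! 1 < l ! 2 \<and> pc (l ! 1) (l ! 2) t
     \<and> l ! 3 = 0 \<and> (\<forall>i<4. l ! (4 + i) < card {v \<in> D. L v ! 1 = l ! 1 \<and> L v ! 2 = l ! 2})"

text \<open>\<open>U\<close> are the segments left over by the earlier stages and \<open>Q\<close>
  the pairs already visited. Heights may be compared across all of \<open>U\<close>, since segments
  of kind 5 with the same pair were labelled in the same round.\<close>

definition planes_inv :: "nat set \<Rightarrow> nat set \<Rightarrow> (nat \<times> nat) set \<Rightarrow> (nat \<Rightarrow> nat list) \<Rightarrow> nat set \<Rightarrow> bool" where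
  "planes_inv C U Q L D \<longleftrightarrow>
     (\<forall>t\<in>U. (L t ! 0 = 0 \<and> (\<forall>x\<in>C. \<forall>y\<in>C. (x, y) \<in> Q \<and> x < y \<longrightarrow> \<not> pc x y t)) \<or> touch_label Q C D t (L t) \<or> class_label Q C D L t (L t)) \<and>
     D \<subseteq> U \<and> (\<forall>v\<in>D. L v ! 0 = 5) \<and> indep D \<and>
     (\<forall>t\<in>U. \<forall>u\<in>U. \<forall>i<4. L t ! 0 = 5 \<and> L u ! 0 = 5 \<and> L t ! 1 = L u ! 1 \<and> L t ! 2 = L u ! 2 \<and> ord i (L t ! 1) (L t ! 2) t u \<longrightarrow>
        L t ! (4 + i) < L u ! (4 + i))"

lemma touch_label_mono: "touch_label Q C D t l \<Longrightarrow> Q \<subseteq> Q' \<Longrightarrow> D \<subseteq> D' \<Longrightarrow> touch_label Q' C D' t l"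
  unfolding touch_label_def by (elim conjE, intro conjI) (assumption | erule subsetD, assumption)+

lemma class_label_mono:
  assumes l: "class_label Q C D L t l" and Q: "Q \<subseteq> Q'" and D: "D \<subseteq> D'" "finite D'" and L: "\<And>v. v \<in> D \<Longrightarrow> L' v = L v"
  shows "class_label Q' C D' L' t l"
proof -
  have "card {v \<in> D. L v ! 1 = l ! 1 \<and> L v ! 2 = l ! 2} \<le> card {v \<in> D'. L' v ! 1 = l ! 1 \<and> L' v ! 2 = l ! 2}"
    by (rule card_mono) (use D L in auto)
  then show ?thesis using l Q unfolding class_label_def by (meson less_le_trans subsetD)
qed

text \<open>The new chain extends the clique because all of \<open>T\<close> avoids
  \<open>D\<close>. The segments of the plane outside \<open>T\<close> meet \<open>D\<close>, and
  their label is sound only if the member they meet leaves the plane; uniqueness of the plane of a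
  residual segment ensures this.\<close>

lemma planes_step:
  assumes inv: "planes_inv C U Q L D" and ab: "(a, b) \<notin> Q" "a \<in> C" "b \<in> C" "a < b"
    and C: "indep C" and U: "finite U" "\<And>t. t \<in> U \<Longrightarrow> residual C t"
    and T0: "T0 = {t \<in> U. L t ! 0 = 0 \<and> pc a b t}" and T: "T \<subseteq> T0" "\<And>t u. t \<in> T \<Longrightarrow> u \<in> D \<Longrightarrow> \<not> tc u t"
    and A: "A \<subseteq> T" "indep A" "\<And>v i. v \<in> T \<Longrightarrow> i < 4 \<Longrightarrow> L' v ! (4 + i) < card A"
    and old: "\<And>t. t \<in> U \<Longrightarrow> t \<notin> T0 \<Longrightarrow> L' t = L t"
    and touched: "\<And>t. t \<in> T0 - T \<Longrightarrow> \<exists>u\<in>D. tc u t \<and> L' t = [4, a, b, u, 0, 0, 0, 0]"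
    and classed: "\<And>t. t \<in> T \<Longrightarrow> L' t ! 0 = 5 \<and> L' t ! 1 = a \<and> L' t ! 2 = b \<and> L' t ! 3 = 0"
    and mono: "\<And>i t u. i < 4 \<Longrightarrow> t \<in> T \<Longrightarrow> u \<in> T \<Longrightarrow> ord i a b t u \<Longrightarrow> L' t ! (4 + i) < L' u ! (4 + i)"
  shows "planes_inv C U (insert (a, b) Q) L' (D \<union> A)"
proof -
  have cases: "(L t ! 0 = 0 \<and> (\<forall>x\<in>C. \<forall>y\<in>C. (x, y) \<in> Q \<and> x < y \<longrightarrow> \<not> pc x y t)) \<or> touch_label Q C D t (L t) \<or> class_label Q C D L t (L t)"
    if "t \<in> U" for t using inv that unfolding planes_inv_def by blast
  have D: "D \<subseteq> U" "\<And>v. v \<in> D \<Longrightarrow> L v ! 0 = 5" "indep D" using inv unfolding planes_inv_def by blast+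
  have sub: "T0 \<subseteq> U" "A \<subseteq> U" "T \<subseteq> U" using T A T0 by blast+
  have DA: "D \<union> A \<subseteq> U" using D sub by blast
  have finDA: "finite (D \<union> A)" using DA U(1) by (rule finite_subset)
  have DL: "L' v = L v" if "v \<in> D" for v using D(2)[OF that] D(1) that by (intro old) (auto simp: T0)
  \<comment> \<open>The pair is visited for the first time, so heights stored under it stem from the
    present round.\<close>
  have no5: "\<not> (L t ! 1 = a \<and> L t ! 2 = b)" if "t \<in> U" "L t ! 0 = 5" for t
  proof -
    have "class_label Q C D L t (L t)" using cases[OF that(1)] that(2) by (auto simp: touch_label_def)
    then show ?thesis using ab(1) by (auto simp: class_label_def)
  qed
  \<comment> \<open>If the member \<open>u\<close> of \<open>D\<close> lay in this plane, the plane
    under which \<open>u\<close> was labelled would be the same one, and \<open>t\<close> would have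
    been labelled together with it.\<close>
  have out: "\<not> pc a b u" if t: "t \<in> T0 - T" and u: "u \<in> D" for t u
  proof
    assume pcu: "pc a b u"
    have uU: "u \<in> U" using u D by blast
    have "class_label Q C D L u (L u)" using cases[OF uU] D(2)[OF u] by (auto simp: touch_label_def)
    then have l: "(L u ! 1, L u ! 2) \<in> Q" "L u ! 1 \<in> C" "L u ! 2 \<in> C" "L u ! 1 < L u ! 2" "pc (L u ! 1) (L u ! 2) u"
      unfolding class_label_def by blast+
    have "pc (L u ! 1) (L u ! 2) t"
      using residual_plane[OF C U(2)[OF uU] ab(2-4) pcu l(2-5)] t T0 by blast
    moreover have "t \<in> U" "L t ! 0 = 0" using t T0 by blast+
    ultimately show False using cases[of t] l by (auto simp: touch_label_def class_label_def)
  qed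
  have kinds: "L' t ! 0 = 5 \<Longrightarrow> t \<in> T \<or> t \<notin> T0 \<and> L t ! 0 = 5" if "t \<in> U" for t
    using touched[of t] old[OF that] by (cases "t \<in> T0"; cases "t \<in> T") auto
  show ?thesis
    unfolding planes_inv_def
  proof (intro conjI ballI allI impI)
    fix t assume t: "t \<in> U"
    show "(L' t ! 0 = 0 \<and> (\<forall>x\<in>C. \<forall>y\<in>C. (x, y) \<in> insert (a, b) Q \<and> x < y \<longrightarrow> \<not> pc x y t)) \<or>
        touch_label (insert (a, b) Q) C (D \<union> A) t (L' t) \<or> class_label (insert (a, b) Q) C (D \<union> A) L' t (L' t)"
    proof (cases "t \<in> T0")
      case False
      then have l: "L' t = L t" using old[OF t] by blast
      from cases[OF t] show ?thesis
      proof (elim disjE conjE)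
        assume 1: "L t ! 0 = 0" "\<forall>x\<in>C. \<forall>y\<in>C. (x, y) \<in> Q \<and> x < y \<longrightarrow> \<not> pc x y t"
        then have "\<not> pc a b t" using False t T0 by blast
        then show ?thesis using 1 l by auto
      next
        assume "touch_label Q C D t (L t)"
        then have "touch_label (insert (a, b) Q) C (D \<union> A) t (L t)" by (rule touch_label_mono) auto
        then show ?thesis unfolding l by blast
      next
        assume "class_label Q C D L t (L t)"
        then have "class_label (insert (a, b) Q) C (D \<union> A) L' t (L t)" by (rule class_label_mono) (use finDA DL in auto)
        then show ?thesis unfolding l by blast
      qed
    next
      case True
      then have p: "pc a b t" using T0 by blast
      show ?thesis
      proof (cases "t \<in> T")
        case False
        then have m: "t \<in> T0 - T" using True by blast
        obtain u where u: "u \<in> D" "tc u t" "L' t = [4, a, b, u, 0, 0, 0, 0]" using touched[OF m] by blast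
        have "\<forall>i<4. L' t ! (4 + i) = 0" unfolding u(3) by (simp add: all_less_4)
        then have "touch_label (insert (a, b) Q) C (D \<union> A) t (L' t)"
          using u ab p out[OF m u(1)] by (simp add: touch_label_def)
        then show ?thesis by blast
      next
        case t: True
        have "card A \<le> card {v \<in> D \<union> A. L' v ! 1 = a \<and> L' v ! 2 = b}"
          by (rule card_mono) (use finDA A(1) classed in auto)
        then have "\<forall>i<4. L' t ! (4 + i) < card {v \<in> D \<union> A. L' v ! 1 = a \<and> L' v ! 2 = b}" using A(3)[OF t] less_le_trans by blast
        then have "class_label (insert (a, b) Q) C (D \<union> A) L' t (L' t)"
          unfolding class_label_def using classed[OF t] ab p by simp
        then show ?thesis by blast
      qed
    qed
  next
    show "D \<union> A \<subseteq> U" by (rule DA)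
    show "L' v ! 0 = 5" if "v \<in> D \<union> A" for v
      using that
    proof
      show "v \<in> D \<Longrightarrow> L' v ! 0 = 5" using DL D(2) by simp
      show "v \<in> A \<Longrightarrow> L' v ! 0 = 5" using classed A(1) by blast
    qed
    have "\<not> tc t u \<and> \<not> tc u t" if "t \<in> A" "u \<in> D" for t u
      using T(2)[of t u] that A(1) tc_sym by blast
    then show "indep (D \<union> A)" using D(3) A(2) unfolding indep_def by blast
  next
    fix t u i assume tu: "t \<in> U" "u \<in> U" and i: "i < (4::nat)"
      and *: "L' t ! 0 = 5 \<and> L' u ! 0 = 5 \<and> L' t ! 1 = L' u ! 1 \<and> L' t ! 2 = L' u ! 2 \<and> ord i (L' t ! 1) (L' t ! 2) t u"
    consider "t \<in> T" "u \<in> T" | "t \<in> T" "u \<notin> T0" "L u ! 0 = 5" | "t \<notin> T0" "L t ! 0 = 5" "u \<in> T"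
      | "t \<notin> T0" "L t ! 0 = 5" "u \<notin> T0" "L u ! 0 = 5"
      using kinds tu * by blast
    then show "L' t ! (4 + i) < L' u ! (4 + i)"
    proof cases
      case 1
      then show ?thesis using mono[OF i] classed * by metis
    next
      case 2
      then have "L u ! 1 = a" "L u ! 2 = b" using classed[of t] old[OF tu(2)] * by auto
      then show ?thesis using no5[OF tu(2) 2(3)] by blast
    next
      case 3
      then have "L t ! 1 = a" "L t ! 2 = b" using classed[of u] old[OF tu(1)] * by auto
      then show ?thesis using no5[OF tu(1) 3(2)] by blast
    next
      case 4
      then have l: "L' t = L t" "L' u = L u" using old tu by blast+
      show ?thesis unfolding l using inv * i tu unfolding planes_inv_def l by (elim conjE) blast
    qed
  qed
qed

end

lemma writes_plane_prog: "writes plane_prog = {''t'', ''u'', ''kd'', ''lx'', ''ly'', ''lz'', ''r'', ''h0'', ''h1'', ''h2'', ''h3'', ''on'', ''D'', ''cur''}"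
  "rwrites plane_prog = {}"
  by (auto simp: plane_prog_def writes_plane hname_def)

lemma writes_planes: "writes planes_prog = {''x'', ''y'', ''t'', ''u'', ''kd'', ''lx'', ''ly'', ''lz'', ''r'', ''h0'', ''h1'', ''h2'', ''h3'', ''on'', ''D'', ''cur''}"
  "rwrites planes_prog = {}"
  by (auto simp: planes_prog_def writes_plane_prog)

context segments_input
begin

lemma lab_heights: "i < 4 \<Longrightarrow> lab s t ! (4 + i) = heights s i t" for i :: nat
  by (auto simp: lab_def heights_def hname_def eval_nat_numeral less_Suc_eq)

lemma planes_correct:
  assumes e: "env s" and C: "indep (mark n ''c'' s)" and D: "mark n ''D'' s = {}"
    and labels: "\<And>t. t < n \<Longrightarrow> nats s ''kd'' t \<in> {1, 2, 3} \<or> lab s t = zeros \<and> residual (mark n ''c'' s) t"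
  defines "s' \<equiv> sem planes_prog s" and "C \<equiv> mark n ''c'' s"
  shows "\<forall>t<n. nats s ''kd'' t \<noteq> 0 \<longrightarrow> lab s' t = lab s t"
    and "planes_inv C {t. t < n \<and> nats s ''kd'' t = 0} ({..<n} \<times> {..<n}) (lab s') (mark n ''D'' s')"
proof -
  define U where "U = {t. t < n \<and> nats s ''kd'' t = 0}"
  have finU: "finite U" by (rule finite_subset[of _ "{..<n}"]) (auto simp: U_def)
  have resU: "residual C t" and zU: "lab s t = zeros" if "t \<in> U" for t
    using labels[of t] that by (auto simp: U_def C_def)
  have C': "indep C" using C unfolding C_def .
  define I where "I Q s1 \<longleftrightarrow> (\<forall>t<n. nats s ''kd'' t \<noteq> 0 \<longrightarrow> lab s1 t = lab s t) \<and> planes_inv C U Q (lab s1) (mark n ''D'' s1)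
      \<and> (\<forall>t\<in>U. nats s1 ''kd'' t = 0 \<longrightarrow> lab s1 t = zeros)" for Q s1
  let ?f = "Conj (Conj (inF ''c'' ''x'') (inF ''c'' ''y'')) (Conj (ltF (Var ''x'') (Var ''y'')) (pcF ''x'' ''y'' ''x''))"
  let ?p = "Guard ?f plane_prog"
  have "I ({..<n} \<times> {..<n}) (sem (nest [''x'', ''y''] ?p) s)"
  proof (rule nest2)
    show "nats s ''n'' 0 = n" using env_n[OF e] .
    have "lab s t ! 0 = 0" if "t \<in> U" for t unfolding zU[OF that] by simp
    then show "I {} s" unfolding I_def planes_inv_def D using zU by (simp add: indep_def)
    show "I Q (nupdate z 0 v s1)" if z: "z \<in> {''x'', ''y''}" and I: "I Q s1" for Q s1 z v
    proof -
      have fr: "frame {''x'', ''y''} s1 (nupdate z 0 v s1)" by (rule frame_nupdate) (rule z)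
      have l: "lab (nupdate z 0 v s1) = lab s1" by (rule ext, rule lab_frame[OF fr]) (simp add: label_names_def)
      have m: "mark n ''D'' (nupdate z 0 v s1) = mark n ''D'' s1" by (rule mark_frame[OF fr]) simp
      have k: "nats (nupdate z 0 v s1) ''kd'' = nats s1 ''kd''" by (rule frame_eq[OF fr]) simp
      show ?thesis using I unfolding I_def l m k .
    qed
    fix Q a b s1 assume ab: "a < n" "b < n" "(a, b) \<notin> Q" and I: "I Q s1"
      and fr: "frame ({''x'', ''y''} \<union> writes ?p) s s1" and x: "nats s1 ''x'' 0 = a" "nats s1 ''y'' 0 = b"
    have e1: "env s1" by (rule env_frame[OF e fr]) (simp add: writes_plane_prog)
    have c1: "mark n ''c'' s1 = C" unfolding C_def by (rule mark_frame[OF fr]) (simp add: writes_plane_prog)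
    have I1: "lab s1 t = lab s t" if "t < n" "nats s ''kd'' t \<noteq> 0" for t using I that unfolding I_def by blast
    have I2: "planes_inv C U Q (lab s1) (mark n ''D'' s1)" using I unfolding I_def by blast
    have I3: "lab s1 t = zeros" if "t \<in> U" "nats s1 ''kd'' t = 0" for t using I that unfolding I_def by blast
    have cond: "fval ?f s1 \<longleftrightarrow> a \<in> C \<and> b \<in> C \<and> a < b \<and> pc a b a"
      using x ab e1 unfolding fval.simps(3) by (simp add: fval_inF c1 del: fval_derived(3))
    show "I (insert (a, b) Q) (sem ?p s1)"
    proof (cases "a \<in> C \<and> b \<in> C \<and> a < b \<and> pc a b a")
      case False
      have sem: "sem ?p s1 = s1" unfolding sem.simps(4) cond by (rule if_not_P[OF False])
      \<comment> \<open>A pair that fails the test spans no plane, so no segment is overlooked by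
        skipping it.\<close>
      have "\<not> (a \<in> C \<and> b \<in> C \<and> a < b \<and> pc a b t)" for t using False pc_base[of a b t] by blast
      then have ns: "\<not> pc a b t" if "a \<in> C" "b \<in> C" "a < b" for t using that by blast
      have "planes_inv C U (insert (a, b) Q) (lab s1) (mark n ''D'' s1)"
        unfolding planes_inv_def
      proof (intro conjI ballI)
        fix t assume t: "t \<in> U"
        have "(lab s1 t ! 0 = 0 \<and> (\<forall>x\<in>C. \<forall>y\<in>C. (x, y) \<in> Q \<and> x < y \<longrightarrow> \<not> pc x y t)) \<or> touch_label Q C (mark n ''D'' s1) t (lab s1 t)
          \<or> class_label Q C (mark n ''D'' s1) (lab s1) t (lab s1 t)" using I2 t unfolding planes_inv_def by (elim conjE) (erule bspec)
        then show "(lab s1 t ! 0 = 0 \<and> (\<forall>x\<in>C. \<forall>y\<in>C. (x, y) \<in> insert (a, b) Q \<and> x < y \<longrightarrow> \<not> pc x y t)) \<or>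
          touch_label (insert (a, b) Q) C (mark n ''D'' s1) t (lab s1 t) \<or> class_label (insert (a, b) Q) C (mark n ''D'' s1) (lab s1) t (lab s1 t)"
        proof (elim disjE)
          assume "lab s1 t ! 0 = 0 \<and> (\<forall>x\<in>C. \<forall>y\<in>C. (x, y) \<in> Q \<and> x < y \<longrightarrow> \<not> pc x y t)"
          then show ?thesis using ns by (intro disjI1 conjI ballI impI) (simp, auto)
        next
          assume "touch_label Q C (mark n ''D'' s1) t (lab s1 t)"
          then have "touch_label (insert (a, b) Q) C (mark n ''D'' s1) t (lab s1 t)" by (rule touch_label_mono) auto
          then show ?thesis by blast
        next
          assume "class_label Q C (mark n ''D'' s1) (lab s1) t (lab s1 t)"
          then have "class_label (insert (a, b) Q) C (mark n ''D'' s1) (lab s1) t (lab s1 t)" by (rule class_label_mono) auto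
          then show ?thesis by blast
        qed
      qed (use I2 in \<open>unfold planes_inv_def, blast+\<close>)
      then show ?thesis unfolding sem using I unfolding I_def by blast
    next
      case True
      have sem: "sem ?p s1 = sem plane_prog s1" unfolding sem.simps(4) cond by (rule if_P[OF True])
      let ?D = "mark n ''D'' s1" and ?L = "lab s1" and ?s = "sem plane_prog s1"
      let ?T0 = "{t. t < n \<and> nats s1 ''kd'' t = 0 \<and> pc a b t}"
      \<comment> \<open>Labels of the earlier kinds 1, 2 and 3 are never changed here, so kinds 0
        and 5 occur within \<open>U\<close> only.\<close>
      have kdU: "t \<in> U" if "t < n" "nats s1 ''kd'' t = 0 \<or> nats s1 ''kd'' t = 5" for t
      proof (rule ccontr)
        assume "t \<notin> U"
        then have k: "nats s ''kd'' t \<noteq> 0" using that(1) by (simp add: U_def)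
        then have "lab s1 t ! 0 = lab s t ! 0" using I1[OF that(1)] by simp
        then have "nats s1 ''kd'' t = nats s ''kd'' t" by simp
        moreover have "nats s ''kd'' t \<in> {1, 2, 3}" using labels[OF that(1)] k by (auto simp: lab_def)
        ultimately show False using that(2) by auto
      qed
      have z: "lab s1 t = zeros" if "t < n" "nats s1 ''kd'' t = 0" for t by (rule I3[OF kdU]) (use that in auto)
      have new: "\<not> (nats s1 ''lx'' t = a \<and> nats s1 ''ly'' t = b)" if t: "t < n" "nats s1 ''kd'' t = 5" for t
      proof -
        have "t \<in> U" by (rule kdU) (use t in auto)
        then have "class_label Q C ?D ?L t (?L t)" using I2 t(2) unfolding planes_inv_def touch_label_def by auto
        then have "(?L t ! 1, ?L t ! 2) \<in> Q" unfolding class_label_def by blast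
        then show ?thesis using ab(3) by auto
      qed
      obtain T A where T: "T \<subseteq> ?T0" "\<forall>t\<in>T. \<forall>u\<in>?D. \<not> tc u t" and DA: "mark n ''D'' ?s = ?D \<union> A" and gc: "good_chain T (heights ?s) A"
        and old: "\<forall>t<n. t \<notin> ?T0 \<longrightarrow> lab ?s t = lab s1 t"
        and tch: "\<forall>t\<in>?T0 - T. \<exists>u\<in>?D. tc u t \<and> lab ?s t = [4, a, b, u, 0, 0, 0, 0]"
        and cls: "\<forall>t\<in>T. \<exists>h0 h1 h2 h3. lab ?s t = [5, a, b, 0, h0, h1, h2, h3]"
        and mono: "\<forall>i<4. \<forall>t\<in>T. \<forall>u\<in>T. po i a b t u \<longrightarrow> heights ?s i t < heights ?s i u"
        by (rule plane_correct[OF e1 x ab(1,2), THEN exE], rule z, assumption+, rule new, assumption+, elim exE conjE, rule that, assumption+)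
      have T0: "?T0 = {t \<in> U. ?L t ! 0 = 0 \<and> pc a b t}" using kdU by (auto simp: U_def)
      have inv: "planes_inv C U (insert (a, b) Q) (lab ?s) (mark n ''D'' ?s)"
        unfolding DA
      proof (rule planes_step[OF I2 ab(3) _ _ _ C' finU resU T0 T(1)])
        show "a \<in> C" "b \<in> C" "a < b" using True by auto
        show "\<not> tc u t" if "t \<in> T" "u \<in> ?D" for t u using T(2) that by blast
        show "A \<subseteq> T" "indep A" using gc unfolding good_chain_def by auto
        show "lab ?s v ! (4 + i) < card A" if "v \<in> T" "i < 4" for v i
          using gc that unfolding good_chain_def lab_heights[OF that(2)] by blast
        show "lab ?s t = ?L t" if t: "t \<in> U" "t \<notin> ?T0" for t
          using t(1) by (intro old[THEN spec, THEN mp, THEN mp, OF _ t(2)]) (simp add: U_def)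
        show "\<exists>u\<in>?D. tc u t \<and> lab ?s t = [4, a, b, u, 0, 0, 0, 0]" if "t \<in> ?T0 - T" for t
          by (rule bspec[OF tch that])
        show "lab ?s t ! 0 = 5 \<and> lab ?s t ! 1 = a \<and> lab ?s t ! 2 = b \<and> lab ?s t ! 3 = 0" if t: "t \<in> T" for t
        proof -
          obtain h0 h1 h2 h3 where "lab ?s t = [5, a, b, 0, h0, h1, h2, h3]" using cls t by blast
          then show ?thesis by (simp only: nth_Cons_0 nth_Cons_numeral) simp
        qed
        show "lab ?s t ! (4 + i) < lab ?s u ! (4 + i)" if "i < 4" "t \<in> T" "u \<in> T" "po i a b t u" for i t u
          using mono that unfolding lab_heights[OF that(1)] by blast
      qed
      moreover have "lab ?s t = lab s t" if t: "t < n" "nats s ''kd'' t \<noteq> 0" for t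
      proof -
        have "t \<notin> U" using t by (simp add: U_def)
        then have "t \<notin> ?T0" unfolding T0 by simp
        then show ?thesis using old[THEN spec, THEN mp, THEN mp, OF t(1)] I1[OF t] by metis
      qed
      moreover have "lab ?s t = zeros" if t: "t \<in> U" "nats ?s ''kd'' t = 0" for t
      proof -
        have tn: "t < n" using t by (simp add: U_def)
        have "lab ?s t ! 0 = 0" using t by simp
        have "t \<notin> ?T0"
        proof
          assume *: "t \<in> ?T0"
          have "lab ?s t ! 0 \<noteq> 0"
          proof (cases "t \<in> T")
            case True
            show ?thesis using bspec[OF cls True] by (elim exE) (erule ssubst, simp)
          next
            case False
            then have "t \<in> ?T0 - T" using * by (rule DiffI[rotated])
            from bspec[OF tch this] show ?thesis by (elim bexE conjE) (erule ssubst, simp)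
          qed
          then show False using \<open>lab ?s t ! 0 = 0\<close> by simp
        qed
        then have l: "lab ?s t = lab s1 t" by (rule old[THEN spec, THEN mp, THEN mp, OF tn])
        then have "lab s1 t ! 0 = 0" using t(2) by (metis lab_nth(1))
        then show ?thesis unfolding l using I3[OF t(1)] by simp
      qed
      ultimately show ?thesis unfolding sem I_def by blast
    qed
  qed (auto simp: writes_plane_prog)
  then have "I ({..<n} \<times> {..<n}) s'" by (simp only: s'_def planes_prog_def)
  then show "\<forall>t<n. nats s ''kd'' t \<noteq> 0 \<longrightarrow> lab s' t = lab s t" "planes_inv C U ({..<n} \<times> {..<n}) (lab s') (mark n ''D'' s')"
    unfolding I_def by blast+
qed

end

section \<open>Selection of the clique and assignment of colors\<close>

definition count_prog :: "fm \<Rightarrow> prog" where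
  "count_prog f = nest [''v''] (Guard f (NSet ''cnt'' (NConst 0) (NPlus (Var ''cnt'') (NConst 1))))"

definition store_prog :: "fm \<Rightarrow> prog" where
  "store_prog f = nest [''v''] (Sq (NSet ''K'' (Var ''v'') (NConst 0)) (Guard f (NSet ''K'' (Var ''v'') (NConst 1))))"

text \<open>Keeps the largest candidate seen so far in \<open>K\<close> and its size in
  \<open>best\<close>; a candidate is the set of values of \<open>v\<close> satisfying the
  formula.\<close>

definition update_prog :: "fm \<Rightarrow> prog" where
  "update_prog f = Sq (NSet ''cnt'' (NConst 0) (NConst 0)) (Sq (count_prog f)
     (Guard (ltF (Var ''best'') (Var ''cnt'')) (Sq (NSet ''best'' (NConst 0) (Var ''cnt'')) (store_prog f))))"

text \<open>Running over all \<open>t\<close> reaches the clique of every pair that occurs in a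
  label, without enumerating the pairs.\<close>

definition classes_prog :: prog where
  "classes_prog = nest [''t''] (update_prog (Conj (inF ''m'' ''v'') same_pairF))"

definition same_labelF :: "vname \<Rightarrow> vname \<Rightarrow> fm" where
  "same_labelF a b = Conj (Conj (Conj (eqF (At ''kd'' a) (At ''kd'' b)) (eqF (At ''lx'' a) (At ''lx'' b)))
       (Conj (eqF (At ''ly'' a) (At ''ly'' b)) (eqF (At ''lz'' a) (At ''lz'' b))))
     (Conj (Conj (eqF (At ''h0'' a) (At ''h0'' b)) (eqF (At ''h1'' a) (At ''h1'' b)))
       (Conj (eqF (At ''h2'' a) (At ''h2'' b)) (eqF (At ''h3'' a) (At ''h3'' b))))"

text \<open>The least index with the same label serves as the color, so labels of any size become
  indices and the number of colors is the number of labels.\<close>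

definition color_prog :: prog where
  "color_prog = nest [''t'', ''u''] (Guard (Conj (same_labelF ''u'' ''t'') (Neg (Ex ''v'' (Conj (ltF (Var ''v'') (Var ''u'')) (same_labelF ''v'' ''t'')))))
     (NSet ''C'' (Var ''t'') (Var ''u'')))"

definition coloring_prog :: prog where
  "coloring_prog = Sq clique_prog (Sq early_prog (Sq classes_prog (Sq planes_prog
     (Sq (update_prog (inF ''c'' ''v'')) (Sq (update_prog (inF ''D'' ''v'')) color_prog)))))"

lemma fval_same_labelF [simp]: "fval (same_labelF a b) s \<longleftrightarrow> lab s (nats s a 0) = lab s (nats s b 0)"
  by (auto simp: same_labelF_def lab_def)

lemma writes_output:
  "writes (count_prog f) = {''v'', ''cnt''}" "rwrites (count_prog f) = {}"
  "writes (store_prog f) = {''v'', ''K''}" "rwrites (store_prog f) = {}"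
  "writes (update_prog f) = {''v'', ''cnt'', ''best'', ''K''}" "rwrites (update_prog f) = {}"
  "writes classes_prog = {''t'', ''v'', ''cnt'', ''best'', ''K''}" "rwrites classes_prog = {}"
  "writes color_prog = {''t'', ''u'', ''C''}" "rwrites color_prog = {}"
  "writes clique_prog = {''r'', ''t'', ''u'', ''s'', ''c''}" "rwrites clique_prog = {}"
  "writes early_prog = {''t'', ''s'', ''x'', ''y'', ''v'', ''m'', ''kd'', ''lx'', ''ly'', ''lz'', ''h0''}" "rwrites early_prog = {}"
  by (auto simp: count_prog_def store_prog_def update_prog_def classes_prog_def color_prog_def clique_prog_def early_prog_def writes_early)

lemma count_correct:
  assumes n: "nats s ''n'' 0 = n" and S: "S \<subseteq> {..<n}" and cnt: "nats s ''cnt'' 0 = 0"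
    and f: "\<And>s'. frame {''v'', ''cnt''} s s' \<Longrightarrow> nats s' ''v'' 0 < n \<Longrightarrow> fval f s' \<longleftrightarrow> nats s' ''v'' 0 \<in> S"
  shows "nats (sem (count_prog f) s) ''cnt'' 0 = card S"
proof -
  define I where "I Q s' \<longleftrightarrow> nats s' ''cnt'' 0 = card (S \<inter> Q)" for Q and s' :: state
  have fin: "finite S" using S by (rule finite_subset) simp
  have "I {..<n} (sem (nest [''v''] (Guard f (NSet ''cnt'' (NConst 0) (NPlus (Var ''cnt'') (NConst 1))))) s)"
  proof (rule nest1[OF n])
    show "I {} s" by (simp add: I_def cnt)
    show "I Q (nupdate ''v'' 0 v s')" if "I Q s'" for Q s' v using that by (simp add: I_def)
    fix Q a s' assume a: "a < n" "a \<notin> Q" and I: "I Q s'" and v: "nats s' ''v'' 0 = a"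
      and fr: "frame (insert ''v'' (writes (Guard f (NSet ''cnt'' (NConst 0) (NPlus (Var ''cnt'') (NConst 1)))))) s s'"
    have "fval f s' \<longleftrightarrow> a \<in> S" using f[of s'] fr v a(1) by simp
    moreover have "S \<inter> insert a Q = (if a \<in> S then insert a (S \<inter> Q) else S \<inter> Q)" by auto
    ultimately show "I (insert a Q) (sem (Guard f (NSet ''cnt'' (NConst 0) (NPlus (Var ''cnt'') (NConst 1)))) s')"
      using I a fin by (auto simp: I_def)
  qed auto
  moreover have "S \<inter> {..<n} = S" using S by blast
  ultimately show ?thesis by (simp add: I_def count_prog_def)
qed

lemma store_correct:
  assumes n: "nats s ''n'' 0 = n" and S: "S \<subseteq> {..<n}"
    and f: "\<And>s'. frame {''v'', ''K''} s s' \<Longrightarrow> nats s' ''v'' 0 < n \<Longrightarrow> fval f s' \<longleftrightarrow> nats s' ''v'' 0 \<in> S"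
  shows "mark n ''K'' (sem (store_prog f) s) = S"
proof -
  let ?p = "Sq (NSet ''K'' (Var ''v'') (NConst 0)) (Guard f (NSet ''K'' (Var ''v'') (NConst 1)))"
  define I where "I Q s' \<longleftrightarrow> (\<forall>a\<in>Q. nats s' ''K'' a \<noteq> 0 \<longleftrightarrow> a \<in> S)" for Q and s' :: state
  have "I {..<n} (sem (nest [''v''] ?p) s)"
  proof (rule nest1[OF n])
    show "I {} s" by (simp add: I_def)
    show "I Q (nupdate ''v'' 0 v s')" if "I Q s'" for Q s' v using that by (simp add: I_def)
    fix Q a s' assume a: "a < n" "a \<notin> Q" and I: "I Q s'" and v: "nats s' ''v'' 0 = a"
      and fr: "frame (insert ''v'' (writes ?p)) s s'"
    define s1 where "s1 = nupdate ''K'' a 0 s'"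
    have "frame {''v'', ''K''} s s1" using fr by (auto simp: frame_def s1_def)
    then have "fval f s1 \<longleftrightarrow> a \<in> S" using f[of s1] v a(1) by (simp add: s1_def)
    moreover have "sem ?p s' = sem (Guard f (NSet ''K'' (Var ''v'') (NConst 1))) s1" by (simp add: s1_def v)
    ultimately show "I (insert a Q) (sem ?p s')" using I a v by (auto simp: I_def s1_def)
  qed auto
  then show ?thesis using S by (auto simp: I_def store_prog_def mark_def)
qed

context segments_input
begin

definition tracks :: "state \<Rightarrow> bool" where
  "tracks s \<longleftrightarrow> indep (mark n ''K'' s) \<and> nats s ''best'' 0 = card (mark n ''K'' s)"

lemma update_correct:
  assumes n: "nats s ''n'' 0 = n" and S: "S \<subseteq> {..<n}" "indep S" and tr: "tracks s"
    and f: "\<And>s'. frame {''v'', ''cnt'', ''best'', ''K''} s s' \<Longrightarrow> nats s' ''v'' 0 < n \<Longrightarrow> fval f s' \<longleftrightarrow> nats s' ''v'' 0 \<in> S"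
  defines "s' \<equiv> sem (update_prog f) s"
  shows "tracks s' \<and> nats s ''best'' 0 \<le> nats s' ''best'' 0 \<and> card S \<le> nats s' ''best'' 0"
proof -
  define s1 where "s1 = sem (count_prog f) (nupdate ''cnt'' 0 0 s)"
  have f0: "frame {''v'', ''cnt''} s (nupdate ''cnt'' 0 0 s)" by (rule frame_nupdate) simp
  have "frame {''v'', ''cnt''} (nupdate ''cnt'' 0 0 s) s1" unfolding s1_def by (rule frame_sem) (auto simp: writes_output)
  then have f1: "frame {''v'', ''cnt''} s s1" using frame_trans[OF f0] by blast
  have c: "nats s1 ''cnt'' 0 = card S"
    unfolding s1_def
  proof (rule count_correct[OF _ S(1)])
    show "fval f s'' \<longleftrightarrow> nats s'' ''v'' 0 \<in> S" if "frame {''v'', ''cnt''} (nupdate ''cnt'' 0 0 s) s''" "nats s'' ''v'' 0 < n" for s''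
      by (rule f[OF frame_trans[OF f0 that(1)] that(2)]) auto
  qed (simp_all add: n)
  have b: "nats s1 ''best'' = nats s ''best''" "nats s1 ''K'' = nats s ''K''" "nats s1 ''n'' 0 = n" using f1 n by (auto simp: frame_def)
  have K1: "mark n ''K'' s1 = mark n ''K'' s" by (simp add: mark_def b)
  have s': "s' = (if nats s ''best'' 0 < card S then sem (store_prog f) (nupdate ''best'' 0 (card S) s1) else s1)"
    unfolding s'_def update_prog_def by (simp add: s1_def[symmetric] c b)
  show ?thesis
  proof (cases "nats s ''best'' 0 < card S")
    case True
    define s2 where "s2 = nupdate ''best'' 0 (card S) s1"
    have f2: "frame {''v'', ''cnt'', ''best'', ''K''} s s2" using f1 by (auto simp: frame_def s2_def)
    have "mark n ''K'' (sem (store_prog f) s2) = S"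
    proof (rule store_correct[OF _ S(1)])
      show "nats s2 ''n'' 0 = n" by (simp add: s2_def b)
      show "fval f s'' \<longleftrightarrow> nats s'' ''v'' 0 \<in> S" if "frame {''v'', ''K''} s2 s''" "nats s'' ''v'' 0 < n" for s''
        by (rule f[OF frame_trans[OF f2 that(1)] that(2)]) auto
    qed
    moreover have "nats (sem (store_prog f) s2) ''best'' 0 = card S" using nats_sem[of "''best''" "store_prog f" s2] by (simp add: writes_output s2_def)
    ultimately show ?thesis using True S(2) unfolding s' by (simp add: tracks_def s2_def[symmetric])
  next
    case False
    then show ?thesis using tr unfolding s' tracks_def by (simp add: K1 b)
  qed
qed

lemma classes_correct:
  assumes e: "env s" and tr: "tracks s"
    and indep: "\<And>t. t < n \<Longrightarrow> indep {v \<in> mark n ''m'' s. lab s v ! 1 = lab s t ! 1 \<and> lab s v ! 2 = lab s t ! 2}"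
  defines "s' \<equiv> sem classes_prog s"
  shows "tracks s'" and "t < n \<Longrightarrow> card {v \<in> mark n ''m'' s. lab s v ! 1 = lab s t ! 1 \<and> lab s v ! 2 = lab s t ! 2} \<le> nats s' ''best'' 0"
proof -
  let ?S = "\<lambda>t. {v \<in> mark n ''m'' s. lab s v ! 1 = lab s t ! 1 \<and> lab s v ! 2 = lab s t ! 2}"
  let ?p = "update_prog (Conj (inF ''m'' ''v'') same_pairF)"
  define I where "I Q s' \<longleftrightarrow> tracks s' \<and> (\<forall>t\<in>Q. card (?S t) \<le> nats s' ''best'' 0)" for Q and s' :: state
  have "I {..<n} (sem (nest [''t''] ?p) s)"
  proof (rule nest1)
    show "nats s ''n'' 0 = n" using env_n[OF e] .
    show "I {} s" using tr by (simp add: I_def)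
    show "I Q (nupdate ''t'' 0 v s')" if "I Q s'" for Q s' v
    proof -
      have "tracks (nupdate ''t'' 0 v s') = tracks s'" by (simp add: tracks_def mark_nupdate)
      then show ?thesis using that by (simp add: I_def)
    qed
    fix Q a s1 assume a: "a < n" "a \<notin> Q" and I: "I Q s1" and fr: "frame (insert ''t'' (writes ?p)) s s1" and t: "nats s1 ''t'' 0 = a"
    have "tracks (sem ?p s1) \<and> nats s1 ''best'' 0 \<le> nats (sem ?p s1) ''best'' 0 \<and> card (?S a) \<le> nats (sem ?p s1) ''best'' 0"
    proof (rule update_correct)
      show "nats s1 ''n'' 0 = n" using fr env_n[OF e] by (auto simp: frame_def writes_output)
      show "?S a \<subseteq> {..<n}" by (auto simp: mark_def)
      show "indep (?S a)" by (rule indep[OF a(1)])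
      show "tracks s1" using I by (simp add: I_def)
      fix s2 assume fr2: "frame {''v'', ''cnt'', ''best'', ''K''} s1 s2" and v: "nats s2 ''v'' 0 < n"
      have f: "frame {''t'', ''v'', ''cnt'', ''best'', ''K''} s s2" by (rule frame_trans[OF fr fr2]) (auto simp: writes_output)
      have "nats s2 ''t'' 0 = a" using fr2 t by (simp add: frame_def)
      moreover have "nats s2 ''lx'' = nats s ''lx''" "nats s2 ''ly'' = nats s ''ly''" "nats s2 ''m'' = nats s ''m''" using f by (auto simp: frame_def)
      ultimately show "fval (Conj (inF ''m'' ''v'') same_pairF) s2 \<longleftrightarrow> nats s2 ''v'' 0 \<in> ?S a"
        using v by (simp add: mark_def)
    qed
    then show "I (insert a Q) (sem ?p s1)" using I by (auto simp: I_def)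
  qed (auto simp: writes_output)
  then have I: "I {..<n} s'" by (simp only: s'_def classes_prog_def)
  then show "tracks s'" by (simp add: I_def)
  show "t < n \<Longrightarrow> card (?S t) \<le> nats s' ''best'' 0" using I by (simp add: I_def)
qed

lemma color_correct:
  assumes e: "env s" and t: "t < n"
  shows "nats (sem color_prog s) ''C'' t = (LEAST u. lab s u = lab s t)"
proof -
  let ?f = "Conj (same_labelF ''u'' ''t'') (Neg (Ex ''v'' (Conj (ltF (Var ''v'') (Var ''u'')) (same_labelF ''v'' ''t''))))"
  let ?p = "Guard ?f (NSet ''C'' (Var ''t'') (Var ''u''))"
  let ?L = "\<lambda>t. LEAST u. lab s u = lab s t"
  define I where "I Q s' \<longleftrightarrow> (\<forall>t u. (t, u) \<in> Q \<and> u = ?L t \<longrightarrow> nats s' ''C'' t = u)" for Q and s' :: state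
  have "I ({..<n} \<times> {..<n}) (sem (nest [''t'', ''u''] ?p) s)"
  proof (rule nest2)
    show "nats s ''n'' 0 = n" using env_n[OF e] .
    show "I {} s" by (simp add: I_def)
    show "I Q (nupdate z 0 v s')" if "z \<in> {''t'', ''u''}" "I Q s'" for Q s' z v using that by (auto simp: I_def)
    fix Q a b s' assume ab: "a < n" "b < n" "(a, b) \<notin> Q" and I: "I Q s'" and fr: "frame ({''t'', ''u''} \<union> writes ?p) s s'"
      and tu: "nats s' ''t'' 0 = a" "nats s' ''u'' 0 = b"
    have n': "nats s' ''n'' 0 = n" using fr env_n[OF e] by (auto simp: frame_def)
    have l: "lab s' = lab s" by (rule ext, rule lab_frame[OF fr]) (simp add: label_names_def)
    have l': "lab (nupdate ''v'' 0 i s') = lab s" for i unfolding l[symmetric]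
      by (rule ext, rule lab_frame[OF frame_nupdate[of _ "{''v''}"]]) (simp_all add: label_names_def)
    have "fval ?f s' \<longleftrightarrow> lab s b = lab s a \<and> (\<forall>v<n. v < b \<longrightarrow> lab s v \<noteq> lab s a)" by (simp add: tu n' l l') blast
    also have "\<dots> \<longleftrightarrow> b = ?L a"
    proof
      assume *: "lab s b = lab s a \<and> (\<forall>v<n. v < b \<longrightarrow> lab s v \<noteq> lab s a)"
      show "b = ?L a"
      proof (rule Least_equality[symmetric])
        show "lab s b = lab s a" using * by blast
        fix y assume y: "lab s y = lab s a"
        show "b \<le> y"
        proof (rule ccontr)
          assume "\<not> b \<le> y"
          then have "y < b" "y < n" using ab by simp_all
          then show False using * y by blast
        qed
      qed
    next
      assume b: "b = ?L a"
      have "lab s (?L a) = lab s a" by (rule LeastI[of "\<lambda>u. lab s u = lab s a"]) simp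
      then show "lab s b = lab s a \<and> (\<forall>v<n. v < b \<longrightarrow> lab s v \<noteq> lab s a)"
        unfolding b using not_less_Least[of _ "\<lambda>u. lab s u = lab s a"] by blast
    qed
    finally have "sem ?p s' = (if b = ?L a then nupdate ''C'' a b s' else s')" unfolding sem.simps(4) by (simp add: tu)
    then show "I (insert (a, b) Q) (sem ?p s')" using I by (auto simp: I_def)
  qed auto
  \<comment> \<open>The least index is taken over all natural numbers, but \<open>t\<close> itself
    is a candidate below \<open>n\<close>.\<close>
  moreover have "?L t < n" using Least_le[of "\<lambda>u. lab s u = lab s t" t] t by simp
  ultimately show ?thesis using t by (simp add: I_def color_prog_def)
qed

end

context segments_input
begin

text \<open>A residual segment lies in the plane of some pair from \<open>C\<close>, and all pairs
  have been visited, so it cannot have remained without a label.\<close>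

lemma planes_inv_final:
  assumes inv: "planes_inv C U ({..<n} \<times> {..<n}) L D" and C: "indep C" "C \<subseteq> {..<n}" and t: "t \<in> U" "residual C t"
  shows "touch_label ({..<n} \<times> {..<n}) C D t (L t) \<or> class_label ({..<n} \<times> {..<n}) C D L t (L t)"
proof -
  obtain x y where xy: "x \<in> C" "y \<in> C" "x < y" "pc x y t" using residual_exists[OF C(1) t(2)] by blast
  then have "(x, y) \<in> {..<n} \<times> {..<n}" using C(2) by blast
  moreover have "(L t ! 0 = 0 \<and> (\<forall>x\<in>C. \<forall>y\<in>C. (x, y) \<in> {..<n} \<times> {..<n} \<and> x < y \<longrightarrow> \<not> pc x y t)) \<or>
    touch_label ({..<n} \<times> {..<n}) C D t (L t) \<or> class_label ({..<n} \<times> {..<n}) C D L t (L t)"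
    using inv t(1) unfolding planes_inv_def by (elim conjE) (erule bspec)
  ultimately show ?thesis using xy by blast
qed

lemma coloring_correct:
  assumes e: "env s" and z: "\<And>t. t < n \<Longrightarrow> lab s t = zeros" and best: "nats s ''best'' 0 = 0"
    and marks: "mark n ''c'' s = {}" "mark n ''m'' s = {}" "mark n ''D'' s = {}" "mark n ''K'' s = {}"
  defines "s' \<equiv> sem coloring_prog s"
  shows "indep (mark n ''K'' s')"
    and "\<And>t u. t < n \<Longrightarrow> u < n \<Longrightarrow> t \<noteq> u \<Longrightarrow> \<not> tc t u \<Longrightarrow> nats s' ''C'' t \<noteq> nats s' ''C'' u"
    and "card (nats s' ''C'' ` {..<n}) \<le> card (mark n ''K'' s') ^ 4 + card (mark n ''K'' s') ^ 3"
proof -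
  define s1 where "s1 = sem clique_prog s"
  define s2 where "s2 = sem early_prog s1"
  define s3 where "s3 = sem classes_prog s2"
  define s4 where "s4 = sem planes_prog s3"
  define s5 where "s5 = sem (update_prog (inF ''c'' ''v'')) s4"
  define s6 where "s6 = sem (update_prog (inF ''D'' ''v'')) s5"
  have s': "s' = sem color_prog s6" by (simp add: s'_def coloring_prog_def s1_def s2_def s3_def s4_def s5_def s6_def)
  have f1: "frame {''r'', ''t'', ''u'', ''s'', ''c''} s s1" unfolding s1_def by (rule frame_sem) (simp_all add: writes_output)
  have f2: "frame {''t'', ''s'', ''x'', ''y'', ''v'', ''m'', ''kd'', ''lx'', ''ly'', ''lz'', ''h0''} s1 s2" unfolding s2_def by (rule frame_sem) (simp_all add: writes_output)
  have f3: "frame {''t'', ''v'', ''cnt'', ''best'', ''K''} s2 s3" unfolding s3_def by (rule frame_sem) (simp_all add: writes_output)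
  have f4: "frame {''x'', ''y'', ''t'', ''u'', ''kd'', ''lx'', ''ly'', ''lz'', ''r'', ''h0'', ''h1'', ''h2'', ''h3'', ''on'', ''D'', ''cur''} s3 s4"
    unfolding s4_def by (rule frame_sem) (simp_all add: writes_planes)
  have f5: "frame {''v'', ''cnt'', ''best'', ''K''} s4 s5" unfolding s5_def by (rule frame_sem) (simp_all add: writes_output)
  have f6: "frame {''v'', ''cnt'', ''best'', ''K''} s5 s6" unfolding s6_def by (rule frame_sem) (simp_all add: writes_output)
  have f7: "frame {''t'', ''u'', ''C''} s6 s'" unfolding s' by (rule frame_sem) (simp_all add: writes_output)
  have e1: "env s1" using env_frame[OF e f1] by simp
  have e2: "env s2" using env_frame[OF e1 f2] by simp
  have e3: "env s3" using env_frame[OF e2 f3] by simp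
  have e4: "env s4" using env_frame[OF e3 f4] by simp
  have e5: "env s5" using env_frame[OF e4 f5] by simp
  have e6: "env s6" using env_frame[OF e5 f6] by simp
  define C where "C = mark n ''c'' s1"
  have opt: "optimal n C" unfolding C_def s1_def by (rule clique_prog_correct[OF e marks(1)])
  then have C: "indep C" "C \<subseteq> {..<n}" by (auto simp: optimal_def)
  have m1: "mark n ''m'' s1 = {}" using mark_frame[OF f1, of "''m''" n] marks(2) by simp
  have z1: "lab s1 t = zeros" if "t < n" for t using lab_frame[OF f1, of t] z[OF that] by (simp add: label_names_def)
  define M where "M = mark n ''m'' s2"
  let ?L0 = "lab s2"
  have early: "ok1 C t (?L0 t) \<or> ok2 C M ?L0 t \<or> ok3 C t (?L0 t) \<or> ?L0 t = zeros \<and> residual C t" if "t < n" for t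
    using early_correct(1)[OF e1 opt[unfolded C_def] z1 m1] that unfolding s2_def C_def M_def by blast
  have Mindep: "\<not> tc v v'" if "v \<in> M" "v' \<in> M" "v \<noteq> v'" "?L0 v ! 1 = ?L0 v' ! 1" "?L0 v ! 2 = ?L0 v' ! 2" for v v'
    using early_correct(2)[OF e1 opt[unfolded C_def] z1 m1] that unfolding s2_def M_def by blast
  have c2: "mark n ''c'' s2 = C" unfolding C_def by (rule mark_frame[OF f2]) simp
  have c3: "mark n ''c'' s3 = C" unfolding c2[symmetric] by (rule mark_frame[OF f3]) simp
  have c4: "mark n ''c'' s4 = C" unfolding c3[symmetric] by (rule mark_frame[OF f4]) simp
  have D3: "mark n ''D'' s3 = {}"
    using mark_frame[OF f1, of "''D''" n] mark_frame[OF f2, of "''D''" n] mark_frame[OF f3, of "''D''" n] marks(3) by simp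
  have K2: "mark n ''K'' s2 = {}" "nats s2 ''best'' 0 = 0"
    using mark_frame[OF f1, of "''K''" n] mark_frame[OF f2, of "''K''" n] marks(4) best f1 f2 by (simp_all add: frame_def)
  have tr2: "tracks s2" using K2 by (simp add: tracks_def indep_def)
  define B where "B t = {v \<in> M. ?L0 v ! 1 = ?L0 t ! 1 \<and> ?L0 v ! 2 = ?L0 t ! 2}" for t
  have Bi: "indep (B t)" for t unfolding indep_def B_def by (intro ballI impI Mindep) auto
  have tr3: "tracks s3" unfolding s3_def by (rule classes_correct(1)[OF e2 tr2]) (rule Bi[unfolded B_def M_def])
  have B3: "card (B t) \<le> nats s3 ''best'' 0" if "t < n" for t
    unfolding s3_def B_def M_def by (rule classes_correct(2)[OF e2 tr2 _ that]) (rule Bi[unfolded B_def M_def])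
  have l3: "lab s3 = ?L0" by (rule ext, rule lab_frame[OF f3]) (simp add: label_names_def)
  have kd3: "nats s3 ''kd'' = nats s2 ''kd''" using f3 by (simp add: frame_def)
  define L where "L = lab s4"
  define D where "D = mark n ''D'' s4"
  define U where "U = {t. t < n \<and> nats s2 ''kd'' t = 0}"
  have kinds0: "nats s2 ''kd'' t \<in> {1, 2, 3} \<or> ?L0 t = zeros \<and> residual C t" if "t < n" for t
    using early[OF that] by (auto simp: ok1_def ok2_def ok3_def lab_def)
  have pl: "\<forall>t<n. nats s2 ''kd'' t \<noteq> 0 \<longrightarrow> L t = ?L0 t" "planes_inv C U ({..<n} \<times> {..<n}) L D"
  proof -
    have k: "nats s3 ''kd'' t \<in> {1, 2, 3} \<or> lab s3 t = zeros \<and> residual (mark n ''c'' s3) t" if "t < n" for t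
      using kinds0[OF that] unfolding l3 kd3 c3 .
    have C3: "indep (mark n ''c'' s3)" unfolding c3 by (rule C(1))
    show "\<forall>t<n. nats s2 ''kd'' t \<noteq> 0 \<longrightarrow> L t = ?L0 t"
      using planes_correct(1)[OF e3 C3 D3 k] unfolding L_def s4_def l3 kd3 by blast
    show "planes_inv C U ({..<n} \<times> {..<n}) L D"
      using planes_correct(2)[OF e3 C3 D3 k] unfolding L_def D_def U_def s4_def kd3 c3 by blast
  qed
  \<comment> \<open>Only labels of nonzero kind are known to survive the plane stage. Every element
    of \<open>M\<close> that a label of kind 2 refers to is of this sort.\<close>
  define M' where "M' = {v \<in> M. nats s2 ''kd'' v \<noteq> 0}"
  have M'n: "v < n" if "v \<in> M'" for v using that by (simp add: M'_def M_def mark_def)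
  have LM: "L v = ?L0 v" if "v \<in> M'" for v using pl(1) M'n[OF that] that by (simp add: M'_def)
  have Lkeep: "L t = ?L0 t" if "t < n" "nats s2 ''kd'' t \<noteq> 0" for t using pl(1) that by blast
  have fin: "ok1 C t (L t) \<or> ok2 C M' L t \<or> ok3 C t (L t) \<or>
      t \<in> U \<and> (touch_label ({..<n} \<times> {..<n}) C D t (L t) \<or> class_label ({..<n} \<times> {..<n}) C D L t (L t))" if t: "t < n" for t
  proof (cases "nats s2 ''kd'' t = 0")
    case True
    then have "residual C t" using kinds0[OF t] by auto
    moreover have "t \<in> U" using t True by (simp add: U_def)
    ultimately show ?thesis using planes_inv_final[OF pl(2) C] by blast
  next
    case False
    have l: "L t = ?L0 t" by (rule Lkeep[OF t False])
    have "?L0 t \<noteq> zeros" using False by (auto simp: lab_def)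
    then consider "ok1 C t (?L0 t)" | "ok2 C M ?L0 t" | "ok3 C t (?L0 t)" using early[OF t] by (elim disjE conjE) simp_all
    then show ?thesis
    proof cases
      case 2
      then obtain x y v d where o: "?L0 t = [2, x, y, v, d, 0, 0, 0]" "nonplanar_pair C t x y" "v \<in> M" "?L0 v ! 1 = x" "?L0 v ! 2 = y"
        "d = 0 \<and> param G x v = param G x t \<or> d = 1 \<and> param G y v = param G y t" unfolding ok2_def by (elim exE conjE) (rule that)
      \<comment> \<open>As \<open>x < y\<close>, the entry \<open>y\<close> is positive, and so the
        label of \<open>v\<close> cannot consist of zeros.\<close>
      have "0 < y" using o(2) by (auto simp: nonplanar_pair_def)
      then have "?L0 v \<noteq> zeros" using o(5) by (auto simp: lab_def)
      moreover have vn: "v < n" using o(3) by (simp add: M_def mark_def)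
      ultimately have "nats s2 ''kd'' v \<noteq> 0" using kinds0[OF vn] by auto
      then have v: "v \<in> M'" using o(3) by (simp add: M'_def)
      have "ok2 C M' L t" unfolding ok2_def l LM[OF v]
      proof (intro exI conjI)
        show "L v ! 1 = x" "L v ! 2 = y" using o(4,5) LM[OF v] by simp_all
      qed (fact o v)+
      then show ?thesis by blast
    qed (simp_all only: l, blast+)
  qed
  have tr4: "tracks s4" using tr3 mark_frame[OF f4, of "''K''" n] f4 by (simp add: tracks_def frame_def)
  have b4: "nats s4 ''best'' 0 = nats s3 ''best'' 0" using f4 by (simp add: frame_def)
  have D: "D \<subseteq> U" "indep D" "\<And>v. v \<in> D \<Longrightarrow> L v ! 0 = 5" using pl(2) unfolding planes_inv_def by blast+
  have u5: "tracks s5 \<and> nats s4 ''best'' 0 \<le> nats s5 ''best'' 0 \<and> card C \<le> nats s5 ''best'' 0"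
    unfolding s5_def
  proof (rule update_correct[OF env_n[OF e4] C(2,1) tr4])
    fix q assume q: "frame {''v'', ''cnt'', ''best'', ''K''} s4 q" "nats q ''v'' 0 < n"
    have "mark n ''c'' q = C" unfolding c4[symmetric] by (rule mark_frame[OF q(1)]) simp
    then show "fval (inF ''c'' ''v'') q \<longleftrightarrow> nats q ''v'' 0 \<in> C" using fval_inF[OF q(2), of "''c''"] by simp
  qed
  have D5: "mark n ''D'' s5 = D" unfolding D_def by (rule mark_frame[OF f5]) simp
  have u6: "tracks s6 \<and> nats s5 ''best'' 0 \<le> nats s6 ''best'' 0 \<and> card D \<le> nats s6 ''best'' 0"
    unfolding s6_def
  proof (rule update_correct[OF env_n[OF e5] _ D(2)])
    show "D \<subseteq> {..<n}" unfolding D_def by (rule mark_subset)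
    show "tracks s5" using u5 by blast
    fix q assume q: "frame {''v'', ''cnt'', ''best'', ''K''} s5 q" "nats q ''v'' 0 < n"
    have "mark n ''D'' q = D" unfolding D5[symmetric] by (rule mark_frame[OF q(1)]) simp
    then show "fval (inF ''D'' ''v'') q \<longleftrightarrow> nats q ''v'' 0 \<in> D" using fval_inF[OF q(2), of "''D''"] by simp
  qed
  have K: "mark n ''K'' s' = mark n ''K'' s6" by (rule mark_frame[OF f7]) simp
  have kc: "card (mark n ''K'' s') = nats s6 ''best'' 0" using u6 K by (simp add: tracks_def)
  show "indep (mark n ''K'' s')" using u6 K by (simp add: tracks_def)
  have l6: "lab s6 = L"
  proof
    fix t show "lab s6 t = L t"
      using lab_frame[OF f5, of t] lab_frame[OF f6, of t] by (simp add: L_def label_names_def)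
  qed
  have Lh: "L t ! (4 + i) = heights s4 i t" if "i < 4" for i t unfolding L_def by (rule lab_heights[OF that])
  have Ln: "L t ! 0 = nats s4 ''kd'' t" "L t ! 1 = nats s4 ''lx'' t" "L t ! 2 = nats s4 ''ly'' t" "L t ! 3 = nats s4 ''lz'' t" for t
    by (simp_all add: L_def)
  have lst: "L t = [nats s4 ''kd'' t, nats s4 ''lx'' t, nats s4 ''ly'' t, nats s4 ''lz'' t, heights s4 0 t, heights s4 1 t, heights s4 2 t, heights s4 3 t]" for t
    by (simp add: L_def lab_def heights_def hname_def)
  have not5: "nats s4 ''kd'' t = 5 \<Longrightarrow> t \<in> U" if "t < n" for t
    using fin[OF that] by (auto simp: ok1_def ok2_def ok3_def lst)
  have mono: "\<And>t u i. t \<in> U \<Longrightarrow> u \<in> U \<Longrightarrow> i < 4 \<Longrightarrow> L t ! 0 = 5 \<and> L u ! 0 = 5 \<and> L t ! 1 = L u ! 1 \<and> L t ! 2 = L u ! 2 \<and> po i (L t ! 1) (L t ! 2) t u \<Longrightarrow>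
        L t ! (4 + i) < L u ! (4 + i)" using pl(2) unfolding planes_inv_def by (elim conjE) blast
  interpret labelling tc pc "param G" po n C M' D "mark n ''K'' s'" "nats s4 ''kd''" "nats s4 ''lx''" "nats s4 ''ly''" "nats s4 ''lz''" "heights s4"
  proof
    show "optimal n C" by (rule opt)
    show "M' \<subseteq> {..<n}" using M'n by blast
    show "\<not> tc m m'" if m: "m \<in> M'" "m' \<in> M'" "m \<noteq> m'" "nats s4 ''lx'' m = nats s4 ''lx'' m'" "nats s4 ''ly'' m = nats s4 ''ly'' m'" for m m'
      by (rule Mindep) (use m LM[OF m(1)] LM[OF m(2)] in \<open>simp_all add: M'_def L_def lab_def\<close>)
    show "D \<subseteq> {..<n}" unfolding D_def by (rule mark_subset)
    show "indep D" by (rule D(2))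
    show "card C \<le> card (mark n ''K'' s')" "card D \<le> card (mark n ''K'' s')" using u5 u6 unfolding kc by linarith+
    show "card {m \<in> M'. nats s4 ''lx'' m = x \<and> nats s4 ''ly'' m = y} \<le> card (mark n ''K'' s')" for x y
    proof (cases "{m \<in> M'. nats s4 ''lx'' m = x \<and> nats s4 ''ly'' m = y} = {}")
      case False
      then obtain m where m: "m \<in> M'" "nats s4 ''lx'' m = x" "nats s4 ''ly'' m = y" by blast
      \<comment> \<open>A nonempty class lies in the class \<open>B m\<close> of any of its elements
        \<open>m\<close>, and that clique was compared with \<open>best\<close>.\<close>
      have "{m \<in> M'. nats s4 ''lx'' m = x \<and> nats s4 ''ly'' m = y} \<subseteq> B m"
      proof
        fix v assume v: "v \<in> {m \<in> M'. nats s4 ''lx'' m = x \<and> nats s4 ''ly'' m = y}"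
        then have l: "L v ! 1 = L m ! 1" "L v ! 2 = L m ! 2" using m by (simp_all only: Ln mem_Collect_eq)
        have vM: "v \<in> M'" using v by blast
        show "v \<in> B m" using l vM unfolding LM[OF vM] LM[OF m(1)] B_def M'_def by blast
      qed
      moreover have "finite (B m)" by (rule finite_subset[of _ M]) (auto simp: B_def M_def)
      ultimately have "card {m \<in> M'. nats s4 ''lx'' m = x \<and> nats s4 ''ly'' m = y} \<le> card (B m)" by (rule card_mono[rotated])
      then show ?thesis using B3[OF M'n[OF m(1)]] b4 u5 u6 unfolding kc by linarith
    next
      case True
      show ?thesis unfolding True by simp
    qed
    show "nats s4 ''kd'' t \<in> {1, 2, 3, 4, 5}" if "t < n" for t
      using fin[OF that] by (auto simp: ok1_def ok2_def ok3_def touch_label_def class_label_def lst)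
    show "nats s4 ''lx'' t \<in> C \<and> (\<forall>s\<in>C. tc s t \<longrightarrow> s = nats s4 ''lx'' t) \<and> nats s4 ''ly'' t = 0 \<and> nats s4 ''lz'' t = 0 \<and> (\<forall>i<4. heights s4 i t = 0)"
      if "t < n" "nats s4 ''kd'' t = 1" for t
    proof -
      have "ok1 C t (L t)" using fin[OF that(1)] that(2) by (auto simp: ok2_def ok3_def touch_label_def class_label_def lst)
      then show ?thesis unfolding ok1_def lst all_less_4 by auto
    qed
    show "nats s4 ''lx'' t \<in> C \<and> nats s4 ''ly'' t \<in> C \<and> nats s4 ''lx'' t < nats s4 ''ly'' t \<and> \<not> pc (nats s4 ''lx'' t) (nats s4 ''ly'' t) (nats s4 ''lx'' t)
      \<and> tc (nats s4 ''lx'' t) t \<and> tc (nats s4 ''ly'' t) t \<and> nats s4 ''lz'' t \<in> M' \<and> nats s4 ''lx'' (nats s4 ''lz'' t) = nats s4 ''lx'' t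
      \<and> nats s4 ''ly'' (nats s4 ''lz'' t) = nats s4 ''ly'' t
      \<and> (heights s4 0 t = 0 \<and> param G (nats s4 ''lx'' t) (nats s4 ''lz'' t) = param G (nats s4 ''lx'' t) t
        \<or> heights s4 0 t = 1 \<and> param G (nats s4 ''ly'' t) (nats s4 ''lz'' t) = param G (nats s4 ''ly'' t) t)
      \<and> heights s4 1 t = 0 \<and> heights s4 2 t = 0 \<and> heights s4 3 t = 0"
      if "t < n" "nats s4 ''kd'' t = 2" for t
    proof -
      have "ok2 C M' L t" using fin[OF that(1)] that(2) by (auto simp: ok1_def ok3_def touch_label_def class_label_def lst)
      then show ?thesis unfolding ok2_def nonplanar_pair_def Ln by (elim exE conjE) (simp add: lst)
    qed
    show "nats s4 ''lx'' t \<in> C \<and> nats s4 ''ly'' t \<in> C \<and> nats s4 ''lx'' t < nats s4 ''ly'' t \<and> pc (nats s4 ''lx'' t) (nats s4 ''ly'' t) t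
      \<and> nats s4 ''lz'' t \<in> C \<and> tc (nats s4 ''lz'' t) t \<and> \<not> pc (nats s4 ''lx'' t) (nats s4 ''ly'' t) (nats s4 ''lz'' t) \<and> (\<forall>i<4. heights s4 i t = 0)"
      if "t < n" "nats s4 ''kd'' t = 3" for t
    proof -
      have "ok3 C t (L t)" using fin[OF that(1)] that(2) by (auto simp: ok1_def ok2_def touch_label_def class_label_def lst)
      then show ?thesis unfolding ok3_def all_less_4 by (elim exE conjE) (simp add: lst)
    qed
    show "nats s4 ''lx'' t \<in> C \<and> nats s4 ''ly'' t \<in> C \<and> nats s4 ''lx'' t < nats s4 ''ly'' t \<and> pc (nats s4 ''lx'' t) (nats s4 ''ly'' t) t
      \<and> nats s4 ''lz'' t \<in> D \<and> tc (nats s4 ''lz'' t) t \<and> \<not> pc (nats s4 ''lx'' t) (nats s4 ''ly'' t) (nats s4 ''lz'' t) \<and> (\<forall>i<4. heights s4 i t = 0)"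
      if "t < n" "nats s4 ''kd'' t = 4" for t
    proof -
      have "touch_label ({..<n} \<times> {..<n}) C D t (L t)"
        using fin[OF that(1)] that(2) by (auto simp: ok1_def ok2_def ok3_def class_label_def lst)
      then show ?thesis using Lh unfolding touch_label_def Ln by auto
    qed
    show "nats s4 ''lx'' t \<in> C \<and> nats s4 ''ly'' t \<in> C \<and> nats s4 ''lx'' t < nats s4 ''ly'' t \<and> pc (nats s4 ''lx'' t) (nats s4 ''ly'' t) t
      \<and> nats s4 ''lz'' t = 0 \<and> (\<forall>i<4. heights s4 i t < card {d \<in> D. nats s4 ''lx'' d = nats s4 ''lx'' t \<and> nats s4 ''ly'' d = nats s4 ''ly'' t})"
      if "t < n" "nats s4 ''kd'' t = 5" for t
    proof -
      have "class_label ({..<n} \<times> {..<n}) C D L t (L t)"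
        using fin[OF that(1)] that(2) by (auto simp: ok1_def ok2_def ok3_def touch_label_def lst)
      then show ?thesis using Lh unfolding class_label_def Ln by auto
    qed
    show "heights s4 i t < heights s4 i u" if "t < n" "u < n" "nats s4 ''kd'' t = 5" "nats s4 ''kd'' u = 5"
      "nats s4 ''lx'' t = nats s4 ''lx'' u" "nats s4 ''ly'' t = nats s4 ''ly'' u" "i < 4" "po i (nats s4 ''lx'' t) (nats s4 ''ly'' t) t u" for i t u
      using mono[OF not5[OF that(1,3)] not5[OF that(2,4)] that(7)] that unfolding Ln Lh[OF that(7)] by blast
  qed
  have lbl: "label t = L t" for t by (simp add: label_def lst)
  have col: "nats s' ''C'' t = (LEAST u. L u = L t)" if "t < n" for t
    using color_correct[OF e6 that] unfolding s' l6 .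
  show "nats s' ''C'' t \<noteq> nats s' ''C'' u" if tu: "t < n" "u < n" "t \<noteq> u" "\<not> tc t u" for t u
  proof
    assume "nats s' ''C'' t = nats s' ''C'' u"
    then have eq: "(LEAST w. L w = L t) = (LEAST w. L w = L u)" using col tu by simp
    have least: "L (LEAST w. L w = L v) = L v" for v by (rule LeastI[of "\<lambda>w. L w = L v" v]) simp
    have "L t = L (LEAST w. L w = L t)" by (rule least[symmetric])
    also have "\<dots> = L (LEAST w. L w = L u)" by (rule arg_cong[OF eq])
    also have "\<dots> = L u" by (rule least)
    finally have "L t = L u" .
    then show False using label_proper[OF tu] lbl by simp
  qed
  have im: "nats s' ''C'' ` {..<n} = (\<lambda>l. LEAST u. L u = l) ` (label ` {..<n})"
    unfolding image_image by (rule image_cong) (simp_all only: col lbl lessThan_iff)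
  have "card (nats s' ''C'' ` {..<n}) \<le> card (label ` {..<n})" unfolding im by (rule card_image_le) simp
  also have "\<dots> \<le> card (mark n ''K'' s') ^ 4 + card (mark n ''K'' s') ^ 3" by (rule card_labels)
  finally show "card (nats s' ''C'' ` {..<n}) \<le> card (mark n ''K'' s') ^ 4 + card (mark n ''K'' s') ^ 3" .
qed

end

section \<open>One inner product space for all dimensions\<close>

text \<open>The dimension is a variable of the statement, so no type of fixed dimension fits.
  Finitely supported sequences, represented as polynomials, contain the points of all dimensions at
  once; the new type carries the Euclidean inner product of the coefficients.\<close>

typedef fvec = "UNIV :: real poly set" by blast

setup_lifting type_definition_fvec

instantiation fvec :: real_inner
begin

lift_definition zero_fvec :: fvec is 0 .
lift_definition plus_fvec :: "fvec \<Rightarrow> fvec \<Rightarrow> fvec" is "(+)" .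
lift_definition minus_fvec :: "fvec \<Rightarrow> fvec \<Rightarrow> fvec" is "(-)" .
lift_definition uminus_fvec :: "fvec \<Rightarrow> fvec" is uminus .
lift_definition scaleR_fvec :: "real \<Rightarrow> fvec \<Rightarrow> fvec" is smult .
lift_definition inner_fvec :: "fvec \<Rightarrow> fvec \<Rightarrow> real" is "\<lambda>p q. \<Sum>i\<le>degree p. coeff p i * coeff q i" .
definition norm_fvec :: "fvec \<Rightarrow> real" where "norm_fvec x = sqrt (inner x x)"
definition sgn_fvec :: "fvec \<Rightarrow> fvec" where "sgn_fvec x = scaleR (inverse (norm x)) x"
definition dist_fvec :: "fvec \<Rightarrow> fvec \<Rightarrow> real" where "dist_fvec x y = norm (x - y)"
definition uniformity_fvec :: "(fvec \<times> fvec) filter" where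
  "uniformity_fvec = (INF e\<in>{0<..}. principal {(x, y). dist x y < e})"
definition open_fvec :: "fvec set \<Rightarrow> bool" where
  "open_fvec U \<longleftrightarrow> (\<forall>x\<in>U. eventually (\<lambda>(x', y). x' = x \<longrightarrow> y \<in> U) uniformity)"

lemma sum_coeff_upto: "degree p \<le> N \<Longrightarrow> (\<Sum>i\<le>degree p. coeff p i * c i) = (\<Sum>i\<le>N. coeff p i * (c i :: real))"
  by (rule sum.mono_neutral_left) (auto simp: coeff_eq_0)

instance
proof
  fix x y z :: fvec and a b :: real
  show "x + y + z = x + (y + z)" by transfer (rule add.assoc)
  show "x + y = y + x" by transfer (rule add.commute)
  show "0 + x = x" by transfer simp
  show "- x + x = 0" by transfer simp
  show "x - y = x + - y" by transfer simp
  show "a *\<^sub>R (x + y) = a *\<^sub>R x + a *\<^sub>R y" by transfer (rule smult_add_right)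
  show "(a + b) *\<^sub>R x = a *\<^sub>R x + b *\<^sub>R x" by transfer (rule smult_add_left)
  show "a *\<^sub>R b *\<^sub>R x = (a * b) *\<^sub>R x" by transfer simp
  show "1 *\<^sub>R x = x" by transfer simp
  show "dist x y = norm (x - y)" by (rule dist_fvec_def)
  show "sgn x = inverse (norm x) *\<^sub>R x" by (rule sgn_fvec_def)
  show "norm x = sqrt (inner x x)" by (rule norm_fvec_def)
  show "(uniformity :: (fvec \<times> fvec) filter) = (INF e\<in>{0<..}. principal {(x, y). dist x y < e})" by (rule uniformity_fvec_def)
  show "open U \<longleftrightarrow> (\<forall>x\<in>U. eventually (\<lambda>(x', y). x' = x \<longrightarrow> y \<in> U) uniformity)" for U :: "fvec set" by (rule open_fvec_def)
  show "inner x y = inner y x"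
  proof transfer
    fix p q :: "real poly"
    have "(\<Sum>i\<le>degree p. coeff p i * coeff q i) = (\<Sum>i\<le>max (degree p) (degree q). coeff p i * coeff q i)"
      by (rule sum_coeff_upto) simp
    moreover have "(\<Sum>i\<le>degree q. coeff q i * coeff p i) = (\<Sum>i\<le>max (degree p) (degree q). coeff q i * coeff p i)"
      by (rule sum_coeff_upto) simp
    ultimately show "(\<Sum>i\<le>degree p. coeff p i * coeff q i) = (\<Sum>i\<le>degree q. coeff q i * coeff p i)" by (simp add: mult.commute)
  qed
  show "inner (x + y) z = inner x z + inner y z"
  proof transfer
    fix p q r :: "real poly"
    let ?N = "max (degree p) (degree q)"
    have "degree (p + q) \<le> ?N" by (rule degree_add_le) simp_all
    then show "(\<Sum>i\<le>degree (p + q). coeff (p + q) i * coeff r i) = (\<Sum>i\<le>degree p. coeff p i * coeff r i) + (\<Sum>i\<le>degree q. coeff q i * coeff r i)"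
      by (simp add: sum_coeff_upto[of _ ?N] distrib_right sum.distrib del: coeff_add) (simp add: distrib_right sum.distrib)
  qed
  show "inner (a *\<^sub>R x) y = a * inner x y"
  proof transfer
    fix a :: real and p q :: "real poly"
    have "degree (smult a p) \<le> degree p" by (rule degree_smult_le)
    from sum_coeff_upto[OF this, of "coeff q"]
    show "(\<Sum>i\<le>degree (smult a p). coeff (smult a p) i * coeff q i) = a * (\<Sum>i\<le>degree p. coeff p i * coeff q i)"
      by (simp add: sum_distrib_left mult.assoc)
  qed
  show "0 \<le> inner x x" by transfer (simp add: sum_nonneg)
  show "inner x x = 0 \<longleftrightarrow> x = 0"
  proof transfer
    fix p :: "real poly"
    have "(\<Sum>i\<le>degree p. coeff p i * coeff p i) = 0 \<longleftrightarrow> (\<forall>i\<in>{..degree p}. coeff p i * coeff p i = 0)"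
      by (rule sum_nonneg_eq_0_iff) auto
    also have "\<dots> \<longleftrightarrow> p = 0"
    proof
      assume "\<forall>i\<in>{..degree p}. coeff p i * coeff p i = 0"
      then have "lead_coeff p * lead_coeff p = 0" by blast
      then show "p = 0" by simp
    qed simp
    finally show "(\<Sum>i\<le>degree p. coeff p i * coeff p i) = 0 \<longleftrightarrow> p = 0" .
  qed
qed

end

text \<open>Cuts off after the first \<open>d\<close> coordinates, which loses nothing for points
  that vanish from index \<open>d\<close> on.\<close>

lift_definition vec :: "nat \<Rightarrow> (nat \<Rightarrow> real) \<Rightarrow> fvec" is "\<lambda>d f. \<Sum>i<d. monom (f i) i" .

lemma coeff_vec: "coeff (\<Sum>i<d. monom (f i) i) j = (if j < d then f j else (0::real))"
  by (simp add: coeff_sum)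

lemma inner_vec: "inner (vec d f) (vec d g) = (\<Sum>i<d. f i * g i)"
proof transfer
  fix d and f g :: "nat \<Rightarrow> real"
  let ?p = "\<Sum>i<d. monom (f i) i" and ?q = "\<Sum>i<d. monom (g i) i"
  have "(\<Sum>i\<le>degree ?p. coeff ?p i * coeff ?q i) = (\<Sum>i\<le>max d (degree ?p). coeff ?p i * coeff ?q i)"
    by (rule sum_coeff_upto) simp
  also have "\<dots> = (\<Sum>i<d. coeff ?p i * coeff ?q i)" by (rule sum.mono_neutral_right) (auto simp: coeff_vec)
  also have "\<dots> = (\<Sum>i<d. f i * g i)" by (simp add: coeff_vec)
  finally show "(\<Sum>i\<le>degree ?p. coeff ?p i * coeff ?q i) = (\<Sum>i<d. f i * g i)" .
qed

lemma vec_convex: "(1 - u) *\<^sub>R vec d f + u *\<^sub>R vec d g = vec d (\<lambda>j. (1 - u) * f j + u * g j)"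
  by transfer (rule poly_eqI, simp add: coeff_vec)

lemma vec_eqD: "vec d f = vec d g \<Longrightarrow> j < d \<Longrightarrow> f j = g j"
proof (transfer)
  fix d j and f g :: "nat \<Rightarrow> real" assume "(\<Sum>i<d. monom (f i) i) = (\<Sum>i<d. monom (g i) i)" "j < d"
  then have "coeff (\<Sum>i<d. monom (f i) i) j = coeff (\<Sum>i<d. monom (g i) i) j" by simp
  then show "f j = g j" using \<open>j < d\<close> unfolding coeff_vec by simp
qed

lemma closed_segment_vec: "closed_segment (vec d a) (vec d b) = vec d ` segment (a, b)"
  unfolding closed_segment_def segment_def by (auto simp: vec_convex image_def)

section \<open>Filling the table of inner products\<close>

definition cname :: "bool \<Rightarrow> vname" where "cname b = (if b then ''B'' else ''A'')"

definition entry_prog :: "bool \<Rightarrow> bool \<Rightarrow> prog" where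
  "entry_prog b c = For ''k'' ''d'' (RSet (gname b c) (NPlus (At ''row'' ''i'') (Var ''j'')) (RPlus (RCell (gname b c) (NPlus (At ''row'' ''i'') (Var ''j'')))
     (RTimes (RCell (cname b) (NPlus (At ''rd'' ''i'') (Var ''k''))) (RCell (cname c) (NPlus (At ''rd'' ''j'') (Var ''k''))))))"

text \<open>Multiples of \<open>n\<close> and \<open>d\<close> by repeated addition, since the
  machine has no multiplication of addresses.\<close>

definition rows_prog :: prog where
  "rows_prog = For ''i'' ''n'' (Sq (NSet ''row'' (NPlus (Var ''i'') (NConst 1)) (NPlus (At ''row'' ''i'') (Var ''n'')))
     (NSet ''rd'' (NPlus (Var ''i'') (NConst 1)) (NPlus (At ''rd'' ''i'') (Var ''d''))))"

definition gram_prog :: "bool \<Rightarrow> bool \<Rightarrow> prog" where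
  "gram_prog b c = For ''i'' ''n'' (For ''j'' ''n'' (entry_prog b c))"

definition prepare_prog :: prog where
  "prepare_prog = Sq rows_prog (Sq (gram_prog False False) (Sq (gram_prog False True) (Sq (gram_prog True False) (gram_prog True True))))"

lemma gname_cname: "gname b c \<noteq> cname b'" "cname b' \<noteq> gname b c" "gname b c = gname b' c' \<longleftrightarrow> b = b' \<and> c = c'"
  by (auto simp: gname_def cname_def)

lemma writes_gram: "writes (gram_prog b c) = {''i'', ''j'', ''k''}" "rwrites (gram_prog b c) = {gname b c}"
  "writes rows_prog = {''i'', ''row'', ''rd''}" "rwrites rows_prog = {}"
  by (auto simp: gram_prog_def entry_prog_def rows_prog_def)

lemma rows_correct:
  assumes "nats s ''n'' 0 = n" "nats s ''d'' 0 = d" "nats s ''row'' 0 = 0" "nats s ''rd'' 0 = 0" "i \<le> n"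
  shows "nats (sem rows_prog s) ''row'' i = i * n \<and> nats (sem rows_prog s) ''rd'' i = i * d"
proof -
  define I where "I m s' \<longleftrightarrow> (\<forall>i\<le>m. nats s' ''row'' i = i * n \<and> nats s' ''rd'' i = i * d) \<and> nats s' ''n'' 0 = n \<and> nats s' ''d'' 0 = d" for m and s' :: state
  have "I (nats s ''n'' 0) (sem rows_prog s)" unfolding rows_prog_def
  proof (rule sem_For)
    show "I 0 s" using assms by (simp add: I_def)
    fix m s' assume Im: "I m s'"
    then have r: "nats s' ''row'' m = m * n" "nats s' ''rd'' m = m * d" by (simp_all add: I_def)
    show "I (Suc m) (sem (Sq (NSet ''row'' (NPlus (Var ''i'') (NConst 1)) (NPlus (At ''row'' ''i'') (Var ''n'')))
     (NSet ''rd'' (NPlus (Var ''i'') (NConst 1)) (NPlus (At ''rd'' ''i'') (Var ''d'')))) (nupdate ''i'' 0 m s'))"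
      using Im r by (simp add: I_def le_Suc_eq)
  qed
  then show ?thesis using assms by (simp add: I_def)
qed

lemma entry_correct:
  assumes "nats s ''row'' (nats s ''i'' 0) = r" "nats s ''j'' 0 = j" "nats s ''rd'' (nats s ''i'' 0) = p" "nats s ''rd'' j = q" "nats s ''d'' 0 = d"
  shows "reals (sem (entry_prog b c) s) (gname b c) = (reals s (gname b c))
    (r + j := reals s (gname b c) (r + j) + (\<Sum>k<d. reals s (cname b) (p + k) * reals s (cname c) (q + k)))"
proof -
  let ?g = "gname b c"
  define I where "I m s' \<longleftrightarrow> reals s' ?g = (reals s ?g)(r + j := reals s ?g (r + j) + (\<Sum>k<m. reals s (cname b) (p + k) * reals s (cname c) (q + k)))" for m and s' :: state
  have "I (nats s ''d'' 0) (sem (entry_prog b c) s)" unfolding entry_prog_def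
  proof (rule sem_For)
    let ?p = "RSet ?g (NPlus (At ''row'' ''i'') (Var ''j'')) (RPlus (RCell ?g (NPlus (At ''row'' ''i'') (Var ''j'')))
      (RTimes (RCell (cname b) (NPlus (At ''rd'' ''i'') (Var ''k''))) (RCell (cname c) (NPlus (At ''rd'' ''j'') (Var ''k'')))))"
    show "I 0 s" by (simp add: I_def)
    fix k s' assume Ik: "I k s'" and fr: "\<forall>y. y \<notin> insert ''k'' (writes ?p) \<longrightarrow> nats s' y = nats s y" "\<forall>y. y \<notin> rwrites ?p \<longrightarrow> reals s' y = reals s y"
    have ny: "nats s' ''row'' = nats s ''row''" "nats s' ''i'' = nats s ''i''" "nats s' ''j'' = nats s ''j''" "nats s' ''rd'' = nats s ''rd''"
      using fr(1) by simp_all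
    have ry: "reals s' (cname e) = reals s (cname e)" for e using fr(2) by (simp add: gname_cname)
    have ig: "reals s' ?g = (reals s ?g)(r + j := reals s ?g (r + j) + (\<Sum>k<k. reals s (cname b) (p + k) * reals s (cname c) (q + k)))"
      using Ik unfolding I_def .
    show "I (Suc k) (sem ?p (nupdate ''k'' 0 k s'))"
      unfolding I_def by (simp add: rupdate_def ny ry ig assms add.assoc)
  qed
  then show ?thesis using assms by (simp add: I_def)
qed

text \<open>The table is filled in the order of addresses, so the progress of both loops is
  described by the length of the completed part. The cells beyond it are still 0, as the
  accumulation in \<open>entry_prog\<close> requires.\<close>

lemma gram_correct:
  assumes n: "nats s ''n'' 0 = n" and d: "nats s ''d'' 0 = d"
    and rows: "\<And>i. i < n \<Longrightarrow> nats s ''row'' i = i * n \<and> nats s ''rd'' i = i * d"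
    and zero: "\<And>i. reals s (gname b c) i = 0" and ij: "i < n" "j < n"
  shows "reals (sem (gram_prog b c) s) (gname b c) (i * n + j) = (\<Sum>k<d. reals s (cname b) (i * d + k) * reals s (cname c) (j * d + k))"
proof -
  let ?g = "gname b c"
  define F where "F i j = (\<Sum>k<d. reals s (cname b) (i * d + k) * reals s (cname c) (j * d + k))" for i j
  define I where "I m s' \<longleftrightarrow> (\<forall>q. reals s' ?g q = (if q < m * n then F (q div n) (q mod n) else 0))" for m and s' :: state
  have "I (nats s ''n'' 0) (sem (gram_prog b c) s)"
    unfolding gram_prog_def
  proof (rule sem_For)
    show "I 0 s" by (simp add: I_def zero)
    fix i s1 assume i: "i < nats s ''n'' 0" and I: "I i s1"
      and fr: "\<forall>y. y \<notin> insert ''i'' (writes (For ''j'' ''n'' (entry_prog b c))) \<longrightarrow> nats s1 y = nats s y"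
        "\<forall>y. y \<notin> rwrites (For ''j'' ''n'' (entry_prog b c)) \<longrightarrow> reals s1 y = reals s y"
    define s2 where "s2 = nupdate ''i'' 0 i s1"
    have n2: "nats s2 ''n'' 0 = n" "nats s2 ''d'' 0 = d" "nats s2 ''i'' 0 = i" "nats s2 ''row'' = nats s ''row''" "nats s2 ''rd'' = nats s ''rd''"
      using fr n d by (auto simp: s2_def entry_prog_def)
    have c2: "reals s2 (cname e) = reals s (cname e)" for e using fr by (simp add: s2_def entry_prog_def gname_cname)
    define J where "J m s' \<longleftrightarrow> (\<forall>q. reals s' ?g q = (if q < i * n then F (q div n) (q mod n) else if q < i * n + m then F i (q - i * n) else 0))" for m and s' :: state
    have "J (nats s2 ''n'' 0) (sem (For ''j'' ''n'' (entry_prog b c)) s2)"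
    proof (rule sem_For)
      show "J 0 s2" using I by (simp add: I_def J_def s2_def)
      fix j s3 assume j: "j < nats s2 ''n'' 0" and J: "J j s3"
        and fr3: "\<forall>y. y \<notin> insert ''j'' (writes (entry_prog b c)) \<longrightarrow> nats s3 y = nats s2 y"
        "\<forall>y. y \<notin> rwrites (entry_prog b c) \<longrightarrow> reals s3 y = reals s2 y"
      define s4 where "s4 = nupdate ''j'' 0 j s3"
      have n4: "nats s4 ''d'' 0 = d" "nats s4 ''i'' 0 = i" "nats s4 ''j'' 0 = j" "nats s4 ''row'' = nats s ''row''" "nats s4 ''rd'' = nats s ''rd''"
        using fr3 n2 by (auto simp: s4_def entry_prog_def)
      have c4: "reals s4 (cname e) = reals s (cname e)" for e using fr3 c2 by (simp add: s4_def entry_prog_def gname_cname)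
      have g4: "reals s4 ?g = reals s3 ?g" by (simp add: s4_def)
      have lt: "i < n" "j < n" using i j n n2 by auto
      have g: "reals (sem (entry_prog b c) s4) ?g = (reals s3 ?g)(i * n + j := reals s3 ?g (i * n + j) + F i j)"
        using entry_correct[of s4 "i * n" j "i * d" "j * d" d b c] n4 rows lt by (simp add: c4 g4 F_def)
      show "J (Suc j) (sem (entry_prog b c) (nupdate ''j'' 0 j s3))"
        unfolding J_def s4_def[symmetric] g
      proof
        have Jq: "reals s3 ?g q = (if q < i * n then F (q div n) (q mod n) else if q < i * n + j then F i (q - i * n) else 0)" for q
          using J unfolding J_def by (rule spec)
        fix q show "((reals s3 ?g)(i * n + j := reals s3 ?g (i * n + j) + F i j)) q =
          (if q < i * n then F (q div n) (q mod n) else if q < i * n + Suc j then F i (q - i * n) else 0)"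
          by (cases "q = i * n + j") (simp_all add: Jq less_Suc_eq)
      qed
    qed
    then have J: "\<forall>q. reals (sem (For ''j'' ''n'' (entry_prog b c)) s2) ?g q = (if q < i * n then F (q div n) (q mod n) else if q < i * n + n then F i (q - i * n) else 0)"
      unfolding J_def n2(1) .
    have st: "\<forall>q. reals (sem (For ''j'' ''n'' (entry_prog b c)) s2) ?g q = (if q < Suc i * n then F (q div n) (q mod n) else 0)"
    proof
      fix q
      have m: "Suc i * n = i * n + n" by simp
      show "reals (sem (For ''j'' ''n'' (entry_prog b c)) s2) ?g q = (if q < Suc i * n then F (q div n) (q mod n) else 0)"
      proof (cases "q < i * n")
        case True
        then have lt: "q < i * n + n" by simp
        show ?thesis unfolding J[THEN spec] m if_P[OF True] if_P[OF lt] by (rule refl)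
      next
        case False
        show ?thesis
        proof (cases "q < i * n + n")
          case True
          obtain r where r: "q = i * n + r" using False le_Suc_ex[of "i * n" q] by (auto simp: not_less)
          then have "r < n" "n \<noteq> 0" using True by simp_all
          then have dm: "q div n = i" "q mod n = q - i * n" by (simp_all add: r)
          show ?thesis unfolding J[THEN spec] m if_not_P[OF False] if_P[OF True] dm by (rule refl)
        next
          case F: False
          show ?thesis unfolding J[THEN spec] m if_not_P[OF False] if_not_P[OF F] by (rule refl)
        qed
      qed
    qed
    then show "I (Suc i) (sem (For ''j'' ''n'' (entry_prog b c)) (nupdate ''i'' 0 i s1))" unfolding I_def s2_def[symmetric] .
  qed
  then have In: "\<forall>q. reals (sem (gram_prog b c) s) ?g q = (if q < n * n then F (q div n) (q mod n) else 0)" unfolding I_def n .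
  have "i * n + j < Suc i * n" using ij by simp
  also have "Suc i * n \<le> n * n" using ij by (intro mult_le_mono1) simp
  finally have lt: "i * n + j < n * n" .
  have "n \<noteq> 0" using ij by simp
  then have dm: "(i * n + j) div n = i" "(i * n + j) mod n = j" using ij(2) by simp_all
  show ?thesis unfolding In[THEN spec] if_P[OF lt] dm F_def by (rule refl)
qed

lemma prepare_correct:
  assumes n: "nats s ''n'' 0 = n" and d: "nats s ''d'' 0 = d" and z: "nats s ''row'' 0 = 0" "nats s ''rd'' 0 = 0"
    and g: "\<And>b c i. reals s (gname b c) i = 0" and ij: "i < n" "j < n"
  shows "gram (sem prepare_prog s) (b, i) (c, j) = (\<Sum>k<d. reals s (cname b) (i * d + k) * reals s (cname c) (j * d + k))"
proof -
  define s0 where "s0 = sem rows_prog s"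
  define s1 where "s1 = sem (gram_prog False False) s0"
  define s2 where "s2 = sem (gram_prog False True) s1"
  define s3 where "s3 = sem (gram_prog True False) s2"
  define s4 where "s4 = sem (gram_prog True True) s3"
  have p: "sem prepare_prog s = s4" by (simp add: prepare_prog_def s0_def s1_def s2_def s3_def s4_def)
  have rows: "nats s0 ''row'' i = i * n \<and> nats s0 ''rd'' i = i * d" if "i < n" for i
    using rows_correct[OF n d z, of i] that by (simp add: s0_def)
  have n0: "nats s0 ''n'' 0 = n" "nats s0 ''d'' 0 = d" using n d by (simp_all add: s0_def nats_sem writes_gram)
  have nat: "nats s1 x = nats s0 x" "nats s2 x = nats s0 x" "nats s3 x = nats s0 x" "nats s4 x = nats s0 x" if "x \<notin> {''i'', ''j'', ''k''}" for x
    using that by (simp_all add: s1_def s2_def s3_def s4_def nats_sem writes_gram)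
  have re: "reals s0 = reals s" by (rule ext) (simp add: s0_def reals_sem writes_gram)
  have r1: "reals s1 x = reals s x" if "x \<noteq> gname False False" for x using that by (simp add: s1_def reals_sem writes_gram re)
  have r2: "reals s2 x = reals s1 x" if "x \<noteq> gname False True" for x using that by (simp add: s2_def reals_sem writes_gram)
  have r3: "reals s3 x = reals s2 x" if "x \<noteq> gname True False" for x using that by (simp add: s3_def reals_sem writes_gram)
  have r4: "reals s4 x = reals s3 x" if "x \<noteq> gname True True" for x using that by (simp add: s4_def reals_sem writes_gram)
  have z0: "reals s0 (gname b c) k = 0" for b c k by (simp add: re g)
  have z1: "reals s1 (gname False True) k = 0" "reals s1 (gname True c) k = 0" for c k by (simp_all add: r1 gname_cname g)
  have z2: "reals s2 (gname True c) k = 0" for c k by (simp add: r2 gname_cname z1)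
  have z3: "reals s3 (gname True True) k = 0" for k by (simp add: r3 gname_cname z2)
  have c0: "reals s0 (cname e) = reals s (cname e)" for e by (simp add: re)
  have c1: "reals s1 (cname e) = reals s (cname e)" for e by (simp add: r1 gname_cname)
  have c2: "reals s2 (cname e) = reals s (cname e)" for e by (simp add: r2 gname_cname c1)
  have c3: "reals s3 (cname e) = reals s (cname e)" for e by (simp add: r3 gname_cname c2)
  let ?S = "\<lambda>q b c. \<Sum>k<d. reals q (cname b) (i * d + k) * reals q (cname c) (j * d + k)"
  have g1: "reals s1 (gname False False) (i * n + j) = ?S s0 False False"
    unfolding s1_def by (rule gram_correct[OF n0 rows z0 ij])
  have g2: "reals s2 (gname False True) (i * n + j) = ?S s1 False True"
    unfolding s2_def by (rule gram_correct[OF _ _ _ z1(1) ij]) (use n0 rows in \<open>simp_all add: nat\<close>)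
  have g3: "reals s3 (gname True False) (i * n + j) = ?S s2 True False"
    unfolding s3_def by (rule gram_correct[OF _ _ _ z2 ij]) (use n0 rows in \<open>simp_all add: nat\<close>)
  have g4: "reals s4 (gname True True) (i * n + j) = ?S s3 True True"
    unfolding s4_def by (rule gram_correct[OF _ _ _ z3 ij]) (use n0 rows in \<open>simp_all add: nat\<close>)
  have e: "reals s4 (gname False False) = reals s1 (gname False False)" "reals s4 (gname False True) = reals s2 (gname False True)"
    "reals s4 (gname True False) = reals s3 (gname True False)" by (simp_all add: r4 r3 r2 gname_cname)
  have "reals s4 (gname b c) (i * n + j) = ?S s b c"
    by (cases b; cases c) (simp_all only: e g1 g2 g3 g4 c0 c1 c2 c3)
  moreover have "gram s4 (b, i) (c, j) = reals s4 (gname b c) (i * n + j)" using rows[OF ij(1)] by (simp add: gram_def nat)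
  ultimately show ?thesis unfolding p by simp
qed

section \<open>The machine program and its correctness\<close>

definition main_prog :: prog where "main_prog = Sq prepare_prog coloring_prog"

text \<open>For the empty list the input size is 0 and does not bound \<open>d\<close>; the outer
  test disposes of this case.\<close>

definition main_com :: com where
  "main_com = Cond (NLess (NConst 0) (Var ''n'')) (compile main_prog 0) Skip"

lemma wfp_main: "wfp main_prog"
  by (simp add: main_prog_def prepare_prog_def rows_prog_def gram_prog_def entry_prog_def coloring_prog_def clique_prog_def improveF_def exchange_def
      early_prog_def private_prog_def nonplanar_prog_def matching_prog_def side_prog_def point_prog_def search_def set_label_def same_pairF_def
      classes_prog_def update_prog_def count_prog_def store_prog_def planes_prog_def plane_prog_def touch_prog_def class_prog_def height_prog_def
      raiseF_def activeF_def chain_prog_def topF_def descend_prog_def stepF_def color_prog_def same_labelF_def hname_def)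

lemma segment_vanishes:
  assumes "p \<in> endpoint_pairs d" "x \<in> segment p" "d \<le> j"
  shows "x j = 0"
  using assms by (auto simp: endpoint_pairs_def segment_def topspace_Euclidean_space)

lemma endpoint_pairs_coordinate:
  assumes "p \<in> endpoint_pairs d"
  obtains j where "j < d" "fst p j \<noteq> snd p j"
proof -
  obtain j where j: "fst p j \<noteq> snd p j" using assms by (auto simp: endpoint_pairs_def fun_eq_iff)
  have "j < d"
  proof (rule ccontr)
    assume "\<not> j < d"
    then have "fst p j = 0" "snd p j = 0" using assms by (auto simp: endpoint_pairs_def topspace_Euclidean_space)
    then show False using j by simp
  qed
  then show thesis using j that by blast
qed

text \<open>Indices beyond the list get the unit segment on the first axis, since
  \<open>seg_geometry\<close> asks for a proper segment at every index.\<close>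

definition endpoint :: "nat \<Rightarrow> segment_list \<Rightarrow> bool \<times> nat \<Rightarrow> fvec" where
  "endpoint d ps = (\<lambda>(b, i). if i < length ps then vec d ((if b then snd else fst) (ps ! i)) else vec 1 (\<lambda>_. if b then 1 else 0))"

lemma endpoint_nondegenerate:
  assumes "set ps \<subseteq> endpoint_pairs d"
  shows "endpoint d ps (False, i) \<noteq> endpoint d ps (True, i)"
proof (cases "i < length ps")
  case True
  then have "ps ! i \<in> endpoint_pairs d" using assms nth_mem by blast
  then obtain j where "j < d" "fst (ps ! i) j \<noteq> snd (ps ! i) j" by (rule endpoint_pairs_coordinate)
  then show ?thesis using True vec_eqD[of d "fst (ps ! i)" "snd (ps ! i)" j] by (auto simp: endpoint_def)
next
  case False
  then show ?thesis using vec_eqD[of 1 "\<lambda>_. 0" "\<lambda>_. 1" 0] by (auto simp: endpoint_def)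
qed

lemma input_coordinate:
  assumes "i < length ps" "k < d"
  shows "reals (input_state d ps) (cname b) (i * d + k) = (if b then snd else fst) (ps ! i) k"
proof -
  have "i * d + k < Suc i * d" using assms by simp
  also have "\<dots> \<le> length ps * d" using assms by (intro mult_le_mono1) simp
  finally show ?thesis using assms by (auto simp: input_state_def cname_def)
qed

lemma main_correct:
  assumes ps: "set ps \<subseteq> endpoint_pairs d"
  defines "n \<equiv> length ps" and "s \<equiv> sem main_prog (input_state d ps)"
  shows "i < n \<Longrightarrow> j < n \<Longrightarrow> nats s ''K'' i \<noteq> 0 \<Longrightarrow> nats s ''K'' j \<noteq> 0 \<Longrightarrow> i \<noteq> j \<Longrightarrow> segment (ps ! i) \<inter> segment (ps ! j) = {}"
    and "i < n \<Longrightarrow> j < n \<Longrightarrow> i \<noteq> j \<Longrightarrow> segment (ps ! i) \<inter> segment (ps ! j) = {} \<Longrightarrow> nats s ''C'' i \<noteq> nats s ''C'' j"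
    and "card (nats s ''C'' ` {..<n}) \<le> card {i. i < n \<and> nats s ''K'' i \<noteq> 0} ^ 4 + card {i. i < n \<and> nats s ''K'' i \<noteq> 0} ^ 3"
proof -
  interpret segments_input "endpoint d ps" n
    by unfold_locales (rule endpoint_nondegenerate[OF ps])
  have sg: "sg i = vec d ` segment (ps ! i)" if "i < n" for i
  proof -
    have "endpoint d ps (False, i) = vec d (fst (ps ! i))" "endpoint d ps (True, i) = vec d (snd (ps ! i))"
      using that by (simp_all add: endpoint_def n_def)
    then show ?thesis unfolding sg_def using closed_segment_vec[of d "fst (ps ! i)" "snd (ps ! i)"] by simp
  qed
  have touch: "tc i j \<longleftrightarrow> segment (ps ! i) \<inter> segment (ps ! j) \<noteq> {}" if ij: "i < n" "j < n" for i j
  proof -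
    have p: "ps ! i \<in> endpoint_pairs d" "ps ! j \<in> endpoint_pairs d" using ij ps nth_mem unfolding n_def by blast+
    \<comment> \<open>\<open>vec d\<close> is injective on points vanishing from index
      \<open>d\<close> on, so no intersection is created by passing to vectors.\<close>
    have "x = y" if xy: "x \<in> segment (ps ! i)" "y \<in> segment (ps ! j)" "vec d x = vec d y" for x y
    proof
      fix k show "x k = y k"
        using vec_eqD[OF xy(3), of k] segment_vanishes[OF p(1) xy(1), of k] segment_vanishes[OF p(2) xy(2), of k] by (cases "k < d") auto
    qed
    then show ?thesis unfolding touches_iff sg[OF ij(1)] sg[OF ij(2)] by blast
  qed
  let ?s0 = "input_state d ps"
  define s1 where "s1 = sem prepare_prog ?s0"
  have n0: "nats ?s0 x k = (if k = 0 \<and> x = ''n'' then n else if k = 0 \<and> x = ''d'' then d else 0)" for x k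
    by (simp add: input_state_def n_def)
  have n1: "nats s1 x = nats ?s0 x" if "x \<notin> {''i'', ''j'', ''k'', ''row'', ''rd''}" for x
    using that by (simp add: s1_def prepare_prog_def nats_sem writes_gram)
  have z: "nats s1 x k = 0" if "x \<notin> {''i'', ''j'', ''k'', ''row'', ''rd'', ''n'', ''d''}" for x k using that n1[of x] n0[of x k] by simp
  have g0: "reals ?s0 (gname e e') k = 0" for e e' k by (simp add: input_state_def gname_def)
  have "agree n (gram s1) G"
    unfolding agree_def
  proof (intro allI impI)
    fix a b :: "bool \<times> nat" assume ab: "snd a < n" "snd b < n"
    have "gram s1 (fst a, snd a) (fst b, snd b) =
        (\<Sum>k<d. reals ?s0 (cname (fst a)) (snd a * d + k) * reals ?s0 (cname (fst b)) (snd b * d + k))"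
      unfolding s1_def by (rule prepare_correct[OF _ _ _ _ g0 ab]) (simp_all add: n0)
    then have "gram s1 a b = (\<Sum>k<d. reals ?s0 (cname (fst a)) (snd a * d + k) * reals ?s0 (cname (fst b)) (snd b * d + k))"
      unfolding prod.collapse .
    also have "\<dots> = inner (endpoint d ps a) (endpoint d ps b)"
      using ab by (cases a; cases b) (simp add: endpoint_def inner_vec input_coordinate n_def)
    also have "\<dots> = G a b" by (simp only: G_def)
    finally show "gram s1 a b = G a b" .
  qed
  then have e: "env s1" using n1[of "''n''"] n0 by (simp add: env_def)
  have l: "lab s1 t = zeros" for t by (simp add: lab_def z)
  have m: "mark n ''c'' s1 = {}" "mark n ''m'' s1 = {}" "mark n ''D'' s1 = {}" "mark n ''K'' s1 = {}" by (simp_all add: mark_def z)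
  have s: "s = sem coloring_prog s1" by (simp add: s_def main_prog_def s1_def)
  have b: "nats s1 ''best'' 0 = 0" by (simp add: z)
  note cc = coloring_correct[OF e l b m, folded s]
  show "segment (ps ! i) \<inter> segment (ps ! j) = {}" if ij: "i < n" "j < n" "nats s ''K'' i \<noteq> 0" "nats s ''K'' j \<noteq> 0" "i \<noteq> j"
  proof -
    have "i \<in> mark n ''K'' s" "j \<in> mark n ''K'' s" using ij unfolding mark_def by blast+
    then have "\<not> tc i j" using cc(1) ij(5) unfolding indep_def by blast
    then show ?thesis using touch[OF ij(1,2)] by blast
  qed
  show "nats s ''C'' i \<noteq> nats s ''C'' j" if ij: "i < n" "j < n" "i \<noteq> j" "segment (ps ! i) \<inter> segment (ps ! j) = {}"
    using cc(2)[OF ij(1-3)] ij(4) touch[OF ij(1,2)] by blast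
  show "card (nats s ''C'' ` {..<n}) \<le> card {i. i < n \<and> nats s ''K'' i \<noteq> 0} ^ 4 + card {i. i < n \<and> nats s ''K'' i \<noteq> 0} ^ 3"
    using cc(3) unfolding mark_def .
qed

text \<open>The input size bounds \<open>n\<close> because \<open>d\<close> is positive, and bounds
  \<open>d\<close> because the list is nonempty. The constant 2 pays for the outer test and, on the
  empty list, for \<open>Skip\<close>.\<close>

lemma main_com_correct:
  assumes d: "d \<ge> 2" and ps: "set ps \<subseteq> endpoint_pairs d"
  shows "\<exists>t s. exec main_com (input_state d ps) t s \<and> t \<le> poly (cost main_prog + [:2:]) (input_size d ps) \<and>
    nats s ''K'' = nats (sem main_prog (input_state d ps)) ''K'' \<and> nats s ''C'' = nats (sem main_prog (input_state d ps)) ''C''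
    \<or> ps = [] \<and> exec main_com (input_state d ps) t s \<and> t \<le> poly (cost main_prog + [:2:]) (input_size d ps)"
proof (cases "ps = []")
  case True
  have "exec main_com (input_state d ps) (Suc 1) (input_state d ps)"
    unfolding main_com_def by (rule exec.CondFalse[OF _ exec.Skip]) (simp add: input_state_def True)
  then show ?thesis using True by (intro exI disjI2 conjI) (assumption | simp)+
next
  case False
  let ?s = "input_state d ps" and ?N = "input_size d ps"
  have l: "1 \<le> length ps" using False by (cases ps) auto
  have "length ps * 1 \<le> length ps * (2 * d)" using d by (intro mult_le_mono2) simp
  then have 1: "nats ?s ''n'' 0 \<le> ?N" by (simp add: input_state_def input_size_def)
  have "1 * d \<le> (2 * length ps) * d" using l by (intro mult_le_mono1) simp
  then have 2: "nats ?s ''d'' 0 \<le> ?N" by (simp add: input_state_def input_size_def)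
  obtain t s' where t: "exec (compile main_prog 0) ?s t s'" "eqv s' (sem main_prog ?s)" "t \<le> poly (cost main_prog) ?N"
    using exec_compile[OF wfp_main 1 2, of 0] by blast
  have "exec main_com ?s (Suc t) s'"
    unfolding main_com_def by (rule exec.CondTrue[OF _ t(1)]) (use False in \<open>simp add: input_state_def\<close>)
  moreover have "nats s' ''K'' = nats (sem main_prog ?s) ''K''" "nats s' ''C'' = nats (sem main_prog ?s) ''C''" using t(2) by (simp_all add: eqv_def)
  moreover have "Suc t \<le> poly (cost main_prog + [:2:]) ?N" using t(3) by simp
  ultimately show ?thesis by blast
qed

lemma wf_disjointness_graph: "wf_digraph (disjointness_graph S)"
  by unfold_locales (auto simp: disjointness_graph_def)

lemma algorithm_correct:
  assumes d: "d \<ge> 2" and L: "lists_segments d S ps"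
  shows "\<exists>t s. exec main_com (input_state d ps) t s \<and> t \<le> poly (cost main_prog + [:2:]) (input_size d ps) \<and>
    (\<exists>K c. output_clique ps s K \<and> output_coloring ps s c \<and> subgraph K (disjointness_graph S) \<and> complete_digraph (card (verts K)) K \<and>
      proper_coloring (disjointness_graph S) c \<and> card (c ` verts (disjointness_graph S)) \<le> card (verts K) ^ 4 + card (verts K) ^ 3)"
proof -
  have ps: "set ps \<subseteq> endpoint_pairs d" and dist: "distinct (map segment ps)" and S: "S = segment ` set ps"
    using L by (auto simp: lists_segments_def)
  let ?n = "length ps" and ?m = "sem main_prog (input_state d ps)"
  obtain t s where ex: "exec main_com (input_state d ps) t s" "t \<le> poly (cost main_prog + [:2:]) (input_size d ps)"
    and eq: "ps = [] \<or> nats s ''K'' = nats ?m ''K'' \<and> nats s ''C'' = nats ?m ''C''" using main_com_correct[OF d ps] by blast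
  let ?seg = "\<lambda>i. segment (ps ! i)"
  define A where "A = {i. i < ?n \<and> nats s ''K'' i \<noteq> 0}"
  have K: "?seg i \<inter> ?seg j = {}" if "i \<in> A" "j \<in> A" "i \<noteq> j" for i j
    using that eq main_correct(1)[OF ps, of i j] by (auto simp: A_def)
  have C: "nats s ''C'' i \<noteq> nats s ''C'' j" if "i < ?n" "j < ?n" "i \<noteq> j" "?seg i \<inter> ?seg j = {}" for i j
    using that eq main_correct(2)[OF ps, of i j] by auto
  have num: "card (nats s ''C'' ` {..<?n}) \<le> card A ^ 4 + card A ^ 3"
    using eq
  proof
    assume "nats s ''K'' = nats ?m ''K'' \<and> nats s ''C'' = nats ?m ''C''"
    then show ?thesis using main_correct(3)[OF ps] by (simp add: A_def)
  qed simp
  have inj: "inj_on ?seg {..<?n}" using dist by (auto simp: inj_on_def distinct_conv_nth)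
  have Sn: "S = ?seg ` {..<?n}" unfolding S by (auto simp: set_conv_nth)
  define V where "V = ?seg ` A"
  have An: "A \<subseteq> {..<?n}" by (auto simp: A_def)
  then have cV: "card V = card A" unfolding V_def using inj by (intro card_image) (rule inj_on_subset)
  have VS: "V \<subseteq> S" unfolding V_def Sn using An by blast
  have finV: "finite V" unfolding V_def using An finite_subset by blast
  let ?K = "with_proj \<lparr> pverts = V, parcs = {(u, v). (u, v) \<in> V \<times> V \<and> u \<noteq> v} \<rparr>"
  \<comment> \<open>Each segment is listed once, so its index is well defined and its color can be
    looked up in the output array.\<close>
  define c where "c = (\<lambda>u. nats s ''C'' (inv_into {..<?n} ?seg u))"
  have cseg: "c (?seg i) = nats s ''C'' i" if "i < ?n" for i
  proof -
    have inv: "inv_into {..<?n} ?seg (?seg i) = i" by (rule inv_into_f_f[OF inj]) (use that in simp)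
    show ?thesis unfolding c_def by (rule arg_cong[OF inv])
  qed
  have "output_clique ps s ?K" unfolding output_clique_def by (auto simp: V_def A_def)
  moreover have "output_coloring ps s c" by (simp add: output_coloring_def cseg)
  moreover have "subgraph ?K (disjointness_graph S)"
    unfolding subgraph_def
  proof (intro conjI)
    show "verts ?K \<subseteq> verts (disjointness_graph S)" using VS by (simp add: disjointness_graph_def)
    show "arcs ?K \<subseteq> arcs (disjointness_graph S)"
    proof
      fix e assume "e \<in> arcs ?K"
      then obtain i j where "e = (?seg i, ?seg j)" "i \<in> A" "j \<in> A" "?seg i \<noteq> ?seg j" by (auto simp: V_def)
      moreover from this have "?seg i \<inter> ?seg j = {}" using K[of i j] by blast
      ultimately show "e \<in> arcs (disjointness_graph S)" using VS by (auto simp: disjointness_graph_def V_def)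
    qed
    show "wf_digraph (disjointness_graph S)" by (rule wf_disjointness_graph)
    show "wf_digraph ?K" by unfold_locales auto
    show "compatible (disjointness_graph S) ?K" by (simp add: compatible_def disjointness_graph_def)
  qed
  moreover have "complete_digraph (card (verts ?K)) ?K" unfolding complete_digraph_pair_def using finV by simp
  moreover have "proper_coloring (disjointness_graph S) c"
    unfolding proper_coloring_def
  proof (intro ballI, clarify)
    fix u v assume uv: "(u, v) \<in> arcs_ends (disjointness_graph S)" and eq: "c u = c v"
    then have *: "u \<in> S" "v \<in> S" "u \<noteq> v" "u \<inter> v = {}" by (simp_all add: disjointness_graph_def)
    then obtain i j where ij: "i < ?n" "j < ?n" "u = ?seg i" "v = ?seg j" unfolding Sn by blast
    then show False using C[of i j] * eq cseg by auto
  qed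
  moreover have "c ` S = nats s ''C'' ` {..<?n}" unfolding Sn image_image by (rule image_cong) (simp_all add: cseg)
  then have "card (c ` verts (disjointness_graph S)) \<le> card (verts ?K) ^ 4 + card (verts ?K) ^ 3"
    using num by (simp add: disjointness_graph_def cV)
  ultimately show ?thesis using ex by blast
qed

lemma segments_listed:
  assumes "finite S" "S \<subseteq> segments d"
  obtains ps where "lists_segments d S ps"
proof -
  obtain xs where xs: "set xs = S" "distinct xs" using finite_distinct_list[OF assms(1)] by blast
  have "\<forall>x\<in>S. \<exists>p. p \<in> endpoint_pairs d \<and> segment p = x"
  proof
    fix x assume "x \<in> S"
    then have "x \<in> segment ` endpoint_pairs d" using assms(2) unfolding segments_def by blast
    then show "\<exists>p. p \<in> endpoint_pairs d \<and> segment p = x" by blast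
  qed
  then obtain f where f: "\<forall>x\<in>S. f x \<in> endpoint_pairs d \<and> segment (f x) = x" by metis
  have "map segment (map f xs) = xs" unfolding map_map by (rule map_idI) (use f xs in simp)
  then have "lists_segments d S (map f xs)" using f xs unfolding lists_segments_def by auto
  then show thesis by (rule that)
qed

text \<open>The chromatic number is defined with an initial interval of colors, so the colors in use
  are first renumbered by a bijection.\<close>

lemma chromatic_number_le:
  assumes "proper_coloring G c" "finite (verts G)" and wf: "wf_digraph G"
  shows "chromatic_number G \<le> card (c ` verts G)"
proof -
  obtain h where h: "bij_betw h (c ` verts G) {0..<card (c ` verts G)}" using ex_bij_betw_finite_nat[of "c ` verts G"] assms(2) by blast
  have "proper_coloring G (h \<circ> c)"
    unfolding proper_coloring_def
  proof (intro ballI, clarify)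
    fix u v assume uv: "(u, v) \<in> arcs_ends G" and eq: "(h \<circ> c) u = (h \<circ> c) v"
    then have "u \<in> verts G" "v \<in> verts G" using wf by (auto simp: arcs_ends_conv wf_digraph_def)
    then have "c u = c v" using h eq by (auto simp: bij_betw_def inj_on_def)
    then show False using assms(1) uv by (auto simp: proper_coloring_def)
  qed
  moreover have "(h \<circ> c) ` verts G \<subseteq> {..<card (c ` verts G)}" using h by (auto simp: bij_betw_def image_comp[symmetric] atLeast0LessThan)
  ultimately show ?thesis unfolding chromatic_number_def by (intro Least_le) blast
qed

text \<open>\<open>Max\<close> dominates its members only for finite sets; here complete subgraphs
  have at most as many vertices as the graph.\<close>

lemma clique_number_ge:
  assumes "subgraph K G" "complete_digraph k K" "finite (verts G)"
  shows "k \<le> clique_number G"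
  unfolding clique_number_def
proof (rule Max_ge)
  have "{k. \<exists>K. subgraph K G \<and> complete_digraph k K} \<subseteq> {..card (verts G)}"
    using assms(3) by (auto simp: subgraph_def complete_digraph_def intro: card_mono)
  then show "finite {k. \<exists>K. subgraph K G \<and> complete_digraph k K}" by (rule finite_subset) simp
qed (use assms in blast)

theorem theorem1:
  shows "(\<forall>d \<ge> 2. \<forall>S. finite S \<and> S \<subseteq> segments d \<longrightarrow>
            chromatic_number (disjointness_graph S)
              \<le> clique_number (disjointness_graph S) ^ 4 + clique_number (disjointness_graph S) ^ 3)
       \<and> (\<exists>(program :: com) (p :: nat poly).
            \<forall>d \<ge> 2. \<forall>S ps. finite S \<and> S \<subseteq> segments d \<and> lists_segments d S ps \<longrightarrow>
              (\<exists>t s. exec program (input_state d ps) t s \<and> t \<le> poly p (input_size d ps) \<and>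
                (\<exists>K c. output_clique ps s K \<and> output_coloring ps s c \<and>
                  subgraph K (disjointness_graph S) \<and> complete_digraph (card (verts K)) K \<and>
                  proper_coloring (disjointness_graph S) c \<and>
                  card (c ` verts (disjointness_graph S)) \<le> card (verts K) ^ 4 + card (verts K) ^ 3)))"
proof (intro conjI allI impI)
  fix d :: nat and S assume d: "d \<ge> 2" and S: "finite S \<and> S \<subseteq> segments d"
  let ?G = "disjointness_graph S"
  obtain ps where "lists_segments d S ps" using S segments_listed by blast
  \<comment> \<open>The clique and the coloring returned for some listing of \<open>S\<close>
    certify the inequality.\<close>
  from algorithm_correct[OF d this]
  obtain K c where K: "subgraph K ?G" "complete_digraph (card (verts K)) K" and c: "proper_coloring ?G c"
    "card (c ` verts ?G) \<le> card (verts K) ^ 4 + card (verts K) ^ 3" by blast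
  have fin: "finite (verts ?G)" using S by (simp add: disjointness_graph_def)
  have "chromatic_number ?G \<le> card (c ` verts ?G)" by (rule chromatic_number_le[OF c(1) fin wf_disjointness_graph])
  also have "\<dots> \<le> card (verts K) ^ 4 + card (verts K) ^ 3" by (rule c(2))
  also have "\<dots> \<le> clique_number ?G ^ 4 + clique_number ?G ^ 3"
    using clique_number_ge[OF K fin] by (intro add_mono power_mono) simp_all
  finally show "chromatic_number ?G \<le> clique_number ?G ^ 4 + clique_number ?G ^ 3" .
next
  show "\<exists>(program :: com) (p :: nat poly).
            \<forall>d \<ge> 2. \<forall>S ps. finite S \<and> S \<subseteq> segments d \<and> lists_segments d S ps \<longrightarrow>
              (\<exists>t s. exec program (input_state d ps) t s \<and> t \<le> poly p (input_size d ps) \<and>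
                (\<exists>K c. output_clique ps s K \<and> output_coloring ps s c \<and>
                  subgraph K (disjointness_graph S) \<and> complete_digraph (card (verts K)) K \<and>
                  proper_coloring (disjointness_graph S) c \<and>
                  card (c ` verts (disjointness_graph S)) \<le> card (verts K) ^ 4 + card (verts K) ^ 3))"
    by (intro exI[of _ main_com] exI[of _ "cost main_prog + [:2:]"] allI impI algorithm_correct) auto
qed

end
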